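(* Let $\Sigma$ be a compact hyperelliptic Riemann surface of genus $g\ge2$ with its hyperbolic metric of curvature $-1$. The $2g+2$ Weierstrass points of $\Sigma$ yield steady states for any system with at most $2g+2$ vortices, independently of the assigned intensities: for every $1\le m\le 2g+2$, every choice of $m$ distinct Weierstrass points $s_1,\dots,s_m$ and every choice of strengths $\Gamma_1,\dots,\Gamma_m$, the configuration $(s_1,\dots,s_m)$ is an equilibrium of the $m$-vortex system.
   Context: A hyperelliptic surface is a Riemann surface that is a two-sheeted branched covering of the Riemann sphere; the sheet exchange is the hyperelliptic involution, whose $2g+2$ fixed points are exactly the Weierstrass points. Let $\mu$ be the area form, $V$ the total area, $\Delta$ the positive Laplace–Beltrami operator. The Green function $G$ is determined by $\Delta_sG(s,r)=\delta_r(s)-V^{-1}$, $\int_\Sigma G(s,r)\mu(s)=0$, $G(s,r)=G(r,s)$; the Robin function is $R(s_0)=\lim_{s\to s_0}[G(s,s_0)+\frac1{2\pi}\log\ell(s,s_0)]$, $\ell$ the Riemannian distance. An equilibrium (steady state) of the $m$-vortex system is a critical point (with pairwise distinct $s_j$) of $$H_{\rm vort}(s_1,\dots,s_m)=\sum_{j=1}^m\frac{\Gamma_j^2}{2}R(s_j)+\sum_{j=1}^m\sum_{k\ne j}\frac{\Gamma_j\Gamma_k}{2}G(s_j,s_k)$$ (then the vortices, together with vanishing harmonic component of the flow, are at rest). *)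

theory Defs
  imports "HOL-Complex_Analysis.Complex_Analysis" "HOL-Homology.Homology"
begin

section \<open>Riemann surfaces\<close>

type_synonym 'a chart = "'a set \<times> ('a \<Rightarrow> complex)"

abbreviation chart_dom :: "'a chart \<Rightarrow> 'a set"
  where "chart_dom c \<equiv> fst c"

abbreviation chart_img :: "'a chart \<Rightarrow> complex set"
  where "chart_img c \<equiv> snd c ` fst c"

abbreviation chart_inv :: "'a chart \<Rightarrow> complex \<Rightarrow> 'a"
  where "chart_inv c \<equiv> inv_into (fst c) (snd c)"

definition complex_chart :: "'a topology \<Rightarrow> 'a chart \<Rightarrow> bool" where
  "complex_chart X c \<longleftrightarrow>
     openin X (chart_dom c) \<and> open (chart_img c) \<and>
     homeomorphic_map (subtopology X (chart_dom c)) (top_of_set (chart_img c)) (snd c)"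

definition transition :: "'a chart \<Rightarrow> 'a chart \<Rightarrow> complex \<Rightarrow> complex" where
  "transition c d = snd d \<circ> chart_inv c"

definition riemann_surface :: "'a topology \<Rightarrow> 'a chart set \<Rightarrow> bool" where
  "riemann_surface X \<A> \<longleftrightarrow>
     topspace X \<noteq> {} \<and> connected_space X \<and> Hausdorff_space X \<and>
     (\<forall>c\<in>\<A>. complex_chart X c) \<and>
     (\<Union>c\<in>\<A>. chart_dom c) = topspace X \<and>
     (\<forall>c\<in>\<A>. \<forall>d\<in>\<A>.
        transition c d holomorphic_on snd c ` (chart_dom c \<inter> chart_dom d))"

text \<open>
  The topological genus of a closed orientable surface: its first integral homology
  is free of rank \<open>2g\<close>.
\<close>

definition has_genus :: "'a topology \<Rightarrow> nat \<Rightarrow> bool" where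
  "has_genus X g \<longleftrightarrow> homology_group 1 X \<cong> free_Abelian_group {..<2 * g}"

definition holomorphic_between ::
  "'a topology \<Rightarrow> 'a chart set \<Rightarrow> 'b topology \<Rightarrow> 'b chart set \<Rightarrow> ('a \<Rightarrow> 'b) \<Rightarrow> bool" where
  "holomorphic_between X \<A> Y \<B> f \<longleftrightarrow>
     continuous_map X Y f \<and>
     (\<forall>c\<in>\<A>. \<forall>d\<in>\<B>.
        (snd d \<circ> f \<circ> chart_inv c) holomorphic_on snd c ` {x \<in> chart_dom c. f x \<in> chart_dom d})"

text \<open>The Riemann sphere; \<open>None\<close> is the point at infinity.\<close>

definition riemann_sphere :: "complex option topology" where
  "riemann_sphere = Alexandroff_compactification euclidean"

definition riemann_sphere_atlas :: "complex option chart set" where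
  "riemann_sphere_atlas =
     {(range Some, the),
      (UNIV - {Some 0}, \<lambda>w. case w of None \<Rightarrow> 0 | Some z \<Rightarrow> inverse z)}"


section \<open>Hyperelliptic surfaces\<close>

text \<open>
  A branched covering is a holomorphic map which is a covering outside finitely many branch
  values; here every evenly covered open set has two sheets above it.
\<close>

definition two_sheeted_branched_covering ::
  "'a topology \<Rightarrow> 'a chart set \<Rightarrow> 'b topology \<Rightarrow> 'b chart set \<Rightarrow> ('a \<Rightarrow> 'b) \<Rightarrow> bool" where
  "two_sheeted_branched_covering X \<A> Y \<B> f \<longleftrightarrow>
     holomorphic_between X \<A> Y \<B> f \<and>
     (\<exists>S. finite S \<and> S \<subseteq> topspace Y \<and>
       (\<forall>y\<in>topspace Y - S. \<exists>W U V. openin Y W \<and> y \<in> W \<and>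
          openin X U \<and> openin X V \<and> U \<inter> V = {} \<and> {x \<in> topspace X. f x \<in> W} = U \<union> V \<and>
          homeomorphic_map (subtopology X U) (subtopology Y W) f \<and>
          homeomorphic_map (subtopology X V) (subtopology Y W) f))"

definition hyperelliptic_surface ::
  "'a topology \<Rightarrow> 'a chart set \<Rightarrow> ('a \<Rightarrow> complex option) \<Rightarrow> bool" where
  "hyperelliptic_surface X \<A> \<pi> \<longleftrightarrow>
     riemann_surface X \<A> \<and> compact_space X \<and>
     two_sheeted_branched_covering X \<A> riemann_sphere riemann_sphere_atlas \<pi>"

text \<open>
  The sheet exchange moves a point to the other point of its fibre, and fixes it if it is alone
  in its fibre.
\<close>

definition hyperelliptic_involution :: "'a topology \<Rightarrow> ('a \<Rightarrow> complex option) \<Rightarrow> 'a \<Rightarrow> 'a" where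
  "hyperelliptic_involution X \<pi> p =
     (if \<exists>q\<in>topspace X. q \<noteq> p \<and> \<pi> q = \<pi> p
      then (THE q. q \<in> topspace X \<and> q \<noteq> p \<and> \<pi> q = \<pi> p) else p)"

definition weierstrass_points :: "'a topology \<Rightarrow> ('a \<Rightarrow> complex option) \<Rightarrow> 'a set" where
  "weierstrass_points X \<pi> = {p \<in> topspace X. hyperelliptic_involution X \<pi> p = p}"


section \<open>Differentiable functions and the flat Laplacian\<close>

definition partial_x :: "(complex \<Rightarrow> real) \<Rightarrow> complex \<Rightarrow> real" where
  "partial_x u z = deriv (\<lambda>t::real. u (z + of_real t)) 0"

definition partial_y :: "(complex \<Rightarrow> real) \<Rightarrow> complex \<Rightarrow> real" where
  "partial_y u z = deriv (\<lambda>t::real. u (z + \<i> * of_real t)) 0"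

primrec C_k_on :: "nat \<Rightarrow> (complex \<Rightarrow> real) \<Rightarrow> complex set \<Rightarrow> bool" where
  "C_k_on 0 u S \<longleftrightarrow> continuous_on S u"
| "C_k_on (Suc k) u S \<longleftrightarrow>
     u differentiable_on S \<and> C_k_on k (partial_x u) S \<and> C_k_on k (partial_y u) S"

definition flat_laplacian :: "(complex \<Rightarrow> real) \<Rightarrow> complex \<Rightarrow> real" where
  "flat_laplacian u z = partial_x (partial_x u) z + partial_y (partial_y u) z"

definition surface_C_k_on :: "'a chart set \<Rightarrow> nat \<Rightarrow> 'a set \<Rightarrow> ('a \<Rightarrow> real) \<Rightarrow> bool" where
  "surface_C_k_on \<A> k W f \<longleftrightarrow>
     (\<forall>c\<in>\<A>. C_k_on k (f \<circ> chart_inv c) (snd c ` (chart_dom c \<inter> W)))"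

text \<open>
  An arbitrary chart around \<open>p\<close>, used to evaluate expressions that do not depend on the
  chart.
\<close>

definition chart_at :: "'a chart set \<Rightarrow> 'a \<Rightarrow> 'a chart" where
  "chart_at \<A> p = (SOME c. c \<in> \<A> \<and> p \<in> chart_dom c)"


section \<open>Conformal metrics\<close>

text \<open>
  A Riemannian metric compatible with the complex structure is given by its densities: in the
  chart \<open>c\<close> it is \<open>(\<rho> c z)\<^sup>2 |dz|\<^sup>2\<close>.
\<close>

definition conformal_metric :: "'a chart set \<Rightarrow> ('a chart \<Rightarrow> complex \<Rightarrow> real) \<Rightarrow> bool" where
  "conformal_metric \<A> \<rho> \<longleftrightarrow>
     (\<forall>c\<in>\<A>. (\<forall>z\<in>chart_img c. \<rho> c z > 0) \<and> (\<forall>k. C_k_on k (\<rho> c) (chart_img c))) \<and>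
     (\<forall>c\<in>\<A>. \<forall>d\<in>\<A>. \<forall>z\<in>snd c ` (chart_dom c \<inter> chart_dom d).
        \<rho> c z = \<rho> d (transition c d z) * norm (deriv (transition c d) z))"

definition gaussian_curvature :: "('a chart \<Rightarrow> complex \<Rightarrow> real) \<Rightarrow> 'a chart \<Rightarrow> complex \<Rightarrow> real" where
  "gaussian_curvature \<rho> c z = - flat_laplacian (\<lambda>w. ln (\<rho> c w)) z / (\<rho> c z)\<^sup>2"

definition hyperbolic_metric :: "'a chart set \<Rightarrow> ('a chart \<Rightarrow> complex \<Rightarrow> real) \<Rightarrow> bool" where
  "hyperbolic_metric \<A> \<rho> \<longleftrightarrow>
     conformal_metric \<A> \<rho> \<and> (\<forall>c\<in>\<A>. \<forall>z\<in>chart_img c. gaussian_curvature \<rho> c z = -1)"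

text \<open>The area form as a Borel measure: \<open>\<mu> = (\<rho> c z)\<^sup>2 dx dy\<close> in each chart.\<close>

definition area_measure ::
  "'a topology \<Rightarrow> 'a chart set \<Rightarrow> ('a chart \<Rightarrow> complex \<Rightarrow> real) \<Rightarrow> 'a measure \<Rightarrow> bool" where
  "area_measure X \<A> \<rho> \<mu> \<longleftrightarrow>
     space \<mu> = topspace X \<and> sets \<mu> = sigma_sets (topspace X) {U. openin X U} \<and>
     (\<forall>c\<in>\<A>. \<forall>E\<in>sets \<mu>. E \<subseteq> chart_dom c \<longrightarrow>
        emeasure \<mu> E = (\<integral>\<^sup>+z\<in>snd c ` E. ennreal ((\<rho> c z)\<^sup>2) \<partial>lborel))"

text \<open>The positive Laplace--Beltrami operator.\<close>

definition laplace_beltrami ::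
  "'a chart set \<Rightarrow> ('a chart \<Rightarrow> complex \<Rightarrow> real) \<Rightarrow> ('a \<Rightarrow> real) \<Rightarrow> 'a \<Rightarrow> real" where
  "laplace_beltrami \<A> \<rho> f p =
     (let c = chart_at \<A> p; z = snd c p
      in - flat_laplacian (f \<circ> chart_inv c) z / (\<rho> c z)\<^sup>2)"

definition piecewise_C1_curve :: "'a topology \<Rightarrow> 'a chart set \<Rightarrow> (real \<Rightarrow> 'a) \<Rightarrow> bool" where
  "piecewise_C1_curve X \<A> \<gamma> \<longleftrightarrow>
     pathin X \<gamma> \<and>
     (\<forall>c\<in>\<A>. \<forall>a b. 0 \<le> a \<and> a \<le> b \<and> b \<le> 1 \<and> \<gamma> ` {a..b} \<subseteq> chart_dom c \<longrightarrow>
        (snd c \<circ> \<gamma>) piecewise_C1_differentiable_on {a..b})"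

definition curve_speed ::
  "'a chart set \<Rightarrow> ('a chart \<Rightarrow> complex \<Rightarrow> real) \<Rightarrow> (real \<Rightarrow> 'a) \<Rightarrow> real \<Rightarrow> real" where
  "curve_speed \<A> \<rho> \<gamma> t =
     (let c = chart_at \<A> (\<gamma> t)
      in \<rho> c (snd c (\<gamma> t)) * norm (vector_derivative (snd c \<circ> \<gamma>) (at t)))"

definition curve_length ::
  "'a chart set \<Rightarrow> ('a chart \<Rightarrow> complex \<Rightarrow> real) \<Rightarrow> (real \<Rightarrow> 'a) \<Rightarrow> ennreal" where
  "curve_length \<A> \<rho> \<gamma> = (\<integral>\<^sup>+t\<in>{0..1}. ennreal (curve_speed \<A> \<rho> \<gamma> t) \<partial>lborel)"

definition riemannian_dist ::
  "'a topology \<Rightarrow> 'a chart set \<Rightarrow> ('a chart \<Rightarrow> complex \<Rightarrow> real) \<Rightarrow> 'a \<Rightarrow> 'a \<Rightarrow> real" where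
  "riemannian_dist X \<A> \<rho> p q =
     enn2real (INF \<gamma>\<in>{\<gamma>. piecewise_C1_curve X \<A> \<gamma> \<and> \<gamma> 0 = p \<and> \<gamma> 1 = q}. curve_length \<A> \<rho> \<gamma>)"


section \<open>Green and Robin functions\<close>

text \<open>
  The equation \<open>\<Delta>\<^sub>s G(s, r) = \<delta>\<^sub>r(s) - 1/V\<close> is meant in the sense of distributions, that is,
  after pairing with smooth test functions; away from \<open>r\<close> the function \<open>G(\<cdot>, r)\<close> is
  twice continuously differentiable. The values \<open>G r r\<close> are irrelevant.
\<close>

definition green_function ::
  "'a topology \<Rightarrow> 'a chart set \<Rightarrow> ('a chart \<Rightarrow> complex \<Rightarrow> real) \<Rightarrow> 'a measure \<Rightarrow>
   ('a \<Rightarrow> 'a \<Rightarrow> real) \<Rightarrow> bool" where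
  "green_function X \<A> \<rho> \<mu> G \<longleftrightarrow>
     (\<forall>r\<in>topspace X.
        surface_C_k_on \<A> 2 (topspace X - {r}) (\<lambda>s. G s r) \<and>
        integrable \<mu> (\<lambda>s. G s r) \<and>
        (\<forall>f. (\<forall>k. surface_C_k_on \<A> k (topspace X) f) \<longrightarrow>
           (\<integral>s. G s r * laplace_beltrami \<A> \<rho> f s \<partial>\<mu>)
             = f r - (\<integral>s. f s \<partial>\<mu>) / measure \<mu> (space \<mu>)) \<and>
        (\<integral>s. G s r \<partial>\<mu>) = 0) \<and>
     (\<forall>s\<in>topspace X. \<forall>r\<in>topspace X. G s r = G r s)"

definition robin_function ::
  "'a topology \<Rightarrow> 'a chart set \<Rightarrow> ('a chart \<Rightarrow> complex \<Rightarrow> real) \<Rightarrow> ('a \<Rightarrow> 'a \<Rightarrow> real) \<Rightarrow>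
   'a \<Rightarrow> real" where
  "robin_function X \<A> \<rho> G s\<^sub>0 =
     Lim (atin X s\<^sub>0) (\<lambda>s. G s s\<^sub>0 + 1 / (2 * pi) * ln (riemannian_dist X \<A> \<rho> s s\<^sub>0))"


section \<open>Vortices\<close>

definition vortex_hamiltonian ::
  "('a \<Rightarrow> 'a \<Rightarrow> real) \<Rightarrow> ('a \<Rightarrow> real) \<Rightarrow> ('m::finite \<Rightarrow> real) \<Rightarrow> ('m \<Rightarrow> 'a) \<Rightarrow> real" where
  "vortex_hamiltonian G R \<Gamma> s =
     (\<Sum>j\<in>UNIV. (\<Gamma> j)\<^sup>2 / 2 * R (s j)) +
     (\<Sum>j\<in>UNIV. \<Sum>k\<in>UNIV - {j}. \<Gamma> j * \<Gamma> k / 2 * G (s j) (s k))"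

text \<open>
  A configuration of distinct points at which the differential of the Hamiltonian vanishes, the
  Hamiltonian being read in product charts of the \<open>m\<close>-fold product of the surface.
\<close>

definition vortex_equilibrium ::
  "'a topology \<Rightarrow> 'a chart set \<Rightarrow> ('a \<Rightarrow> 'a \<Rightarrow> real) \<Rightarrow> ('a \<Rightarrow> real) \<Rightarrow> ('m::finite \<Rightarrow> real) \<Rightarrow>
   ('m \<Rightarrow> 'a) \<Rightarrow> bool" where
  "vortex_equilibrium X \<A> G R \<Gamma> s \<longleftrightarrow>
     range s \<subseteq> topspace X \<and> inj s \<and>
     (\<forall>c. (\<forall>j. c j \<in> \<A> \<and> s j \<in> chart_dom (c j)) \<longrightarrow>
        ((\<lambda>z::complex^'m. vortex_hamiltonian G R \<Gamma> (\<lambda>j. chart_inv (c j) (z $ j)))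
           has_derivative (\<lambda>_. 0)) (at (\<chi> j. snd (c j) (s j))))"

end

theory Submission imports Defs
begin

text \<open>
  The hyperelliptic involution \<open>\<tau>\<close> is biholomorphic, hence an isometry of the hyperbolic metric by the
  Ahlfors--Schwarz argument. Therefore \<open>G(\<tau> s, \<tau> r) - G(s, r)\<close> is harmonic in \<open>s\<close>, also across the pole,
  so it is a constant, which vanishes because it is symmetric in \<open>s, r\<close> and odd under \<open>\<tau>\<close>. Comparing the
  finite parts at the pole, the Robin function is \<open>\<tau>\<close>-invariant too. At a Weierstrass point \<open>\<tau>\<close> has
  differential \<open>-1\<close>, and so the differential of every \<open>\<tau>\<close>-invariant function vanishes there; this applies
  to each term of the Hamiltonian in each variable. Differentiability of the Robin function and joint
  differentiability of \<open>G\<close> follow from the bound \<open>O(|z - z\<^sub>0| |w - w\<^sub>0|)\<close> for mixed second differences of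
  functions that are harmonic in each of two variables.
\<close>

section \<open>Differential calculus in the plane\<close>

text \<open>The obstacle is how little is given about \<open>G\<close>: each \<open>G(., r)\<close>
  is twice differentiable off \<open>r\<close>, and the equation at the pole holds only against test
  functions. Neither the shape of the pole nor continuity in both variables together is known.
  Harmonicity is therefore handled through area means: radial test functions turn the distributional
  equation into equality of means over concentric discs, and Harnack and Lipschitz bounds and the
  removal of the pole all follow from means. Curvature -1 enters twice: in the isometry, and as the
  equation \<open>Laplacian of ln \<rho> = \<rho>\<^sup>2\<close>, by which \<open>G\<close> minus
  \<open>ln \<rho>\<close> divided by the total area is exactly harmonic in a chart. The mixed
  difference bound requires control of \<open>G\<close> uniform in the pole. Chains of Harnack
  inequalities over the compact surface give it up to additive constants, and these cancel in mixed
  differences.\<close>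

lemma partials_of_derivative:
  assumes "(u has_derivative D) (at z)"
  shows "((\<lambda>t. u (z + of_real t)) has_real_derivative D 1) (at 0)"
    and "((\<lambda>t. u (z + \<i> * of_real t)) has_real_derivative D \<i>) (at 0)"
    and "partial_x u z = D 1" and "partial_y u z = D \<i>"
proof -
  have lin: "linear D" using assms has_derivative_linear by blast
  have 1: "((\<lambda>t. u (z + of_real t)) has_derivative (\<lambda>t. D (of_real t))) (at 0)"
    by (rule has_derivative_compose[where f="\<lambda>t::real. z + of_real t" and s=UNIV, simplified])
      (use assms in \<open>auto intro!: derivative_eq_intros\<close>)
  have 2: "((\<lambda>t. u (z + \<i> * of_real t)) has_derivative (\<lambda>t. D (\<i> * of_real t))) (at 0)"
    by (rule has_derivative_compose[where f="\<lambda>t::real. z + \<i> * of_real t" and s=UNIV, simplified])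
      (use assms in \<open>auto intro!: derivative_eq_intros\<close>)
  have "D (of_real t) = D 1 * t" "D (\<i> * of_real t) = D \<i> * t" for t
    using linear_scale[OF lin, of t 1] linear_scale[OF lin, of t \<i>]
    by (simp_all add: scaleR_conv_of_real mult.commute)
  then show x: "((\<lambda>t. u (z + of_real t)) has_real_derivative D 1) (at 0)"
    and y: "((\<lambda>t. u (z + \<i> * of_real t)) has_real_derivative D \<i>) (at 0)"
    using 1 2 by (simp_all add: has_field_derivative_def)
  show "partial_x u z = D 1" "partial_y u z = D \<i>"
    unfolding partial_x_def partial_y_def using x y by (auto intro: DERIV_imp_deriv)
qed

lemma has_derivative_partials:
  assumes "u differentiable (at z)"
  shows "(u has_derivative (\<lambda>v. Re v * partial_x u z + Im v * partial_y u z)) (at z)"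
proof -
  obtain D where D: "(u has_derivative D) (at z)" using assms differentiable_def by blast
  have lin: "linear D" using D has_derivative_linear by blast
  have "D v = Re v * D 1 + Im v * D \<i>" for v
  proof -
    have "v = Re v *\<^sub>R 1 + Im v *\<^sub>R \<i>" by (simp add: complex_eq_iff)
    then have "D v = D (Re v *\<^sub>R 1 + Im v *\<^sub>R \<i>)" by simp
    also have "\<dots> = Re v * D 1 + Im v * D \<i>"
      by (simp only: linear_add[OF lin] linear_scale[OF lin] real_scaleR_def)
    finally show ?thesis .
  qed
  then have "D = (\<lambda>v. Re v * D 1 + Im v * D \<i>)" by blast
  with D partials_of_derivative[OF D] show ?thesis by simp
qed

lemma differentiable_on_open_iff:
  "open S \<Longrightarrow> u differentiable_on S \<longleftrightarrow> (\<forall>z\<in>S. u differentiable (at z))"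
  by (simp add: differentiable_on_def at_within_open_NO_MATCH)

lemma partial_cong:
  assumes "open S" "z \<in> S" "\<And>w. w \<in> S \<Longrightarrow> u w = v w"
  shows "partial_x u z = partial_x v z" "partial_y u z = partial_y v z"
proof -
  have "open ((\<lambda>t::real. z + of_real t) -` S)" "open ((\<lambda>t::real. z + \<i> * of_real t) -` S)"
    by (intro open_vimage assms continuous_intros)+
  then have "\<forall>\<^sub>F t in nhds (0::real). z + of_real t \<in> S" "\<forall>\<^sub>F t in nhds (0::real). z + \<i> * of_real t \<in> S"
    using eventually_nhds_in_open[of "(\<lambda>t::real. z + of_real t) -` S" 0]
      eventually_nhds_in_open[of "(\<lambda>t::real. z + \<i> * of_real t) -` S" 0] assms(2) by simp_all
  then have "\<forall>\<^sub>F t in nhds 0. u (z + of_real t) = v (z + of_real t)"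
    "\<forall>\<^sub>F t in nhds 0. u (z + \<i> * of_real t) = v (z + \<i> * of_real t)"
    using assms(3) by (blast intro: eventually_mono)+
  from deriv_cong_ev[OF this(1) refl] deriv_cong_ev[OF this(2) refl]
  show "partial_x u z = partial_x v z" "partial_y u z = partial_y v z"
    unfolding partial_x_def partial_y_def .
qed

lemma C_k_on_cong_imp:
  assumes "open S" "\<And>w. w \<in> S \<Longrightarrow> u w = v w" "C_k_on k u S"
  shows "C_k_on k v S"
  using assms(2,3)
proof (induction k arbitrary: u v)
  case 0 then show ?case using continuous_on_cong[OF refl, of S u v] by auto
next
  case (Suc k)
  have "v differentiable_on S"
    unfolding differentiable_on_def
  proof
    fix x assume "x \<in> S"
    then show "v differentiable at x within S"
      using Suc.prems differentiable_transform_within[of u x S 1 v] by (auto simp: differentiable_on_def)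
  qed
  moreover have "C_k_on k (partial_x v) S"
    by (rule Suc.IH[of "partial_x u"]) (use Suc.prems in \<open>auto intro: partial_cong[OF assms(1)]\<close>)
  moreover have "C_k_on k (partial_y v) S"
    by (rule Suc.IH[of "partial_y u"]) (use Suc.prems in \<open>auto intro: partial_cong[OF assms(1)]\<close>)
  ultimately show ?case by simp
qed

lemma flat_laplacian_cong:
  assumes "open S" "z \<in> S" "\<And>w. w \<in> S \<Longrightarrow> u w = v w"
  shows "flat_laplacian u z = flat_laplacian v z"
proof -
  have "partial_x (partial_x u) z = partial_x (partial_x v) z"
    "partial_y (partial_y u) z = partial_y (partial_y v) z"
    by (rule partial_cong[OF assms(1,2)], rule partial_cong[OF assms(1)], assumption, rule assms(3), assumption)+
  then show ?thesis by (simp add: flat_laplacian_def)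
qed

lemma C_k_on_subset: "C_k_on k u S \<Longrightarrow> T \<subseteq> S \<Longrightarrow> C_k_on k u T"
proof (induction k arbitrary: u)
  case 0 then show ?case using continuous_on_subset by simp blast
next
  case (Suc k) then show ?case using differentiable_on_subset[of u S T] by simp
qed

lemma C_k_on_local:
  "(\<And>z. z \<in> S \<Longrightarrow> \<exists>T. open T \<and> z \<in> T \<and> C_k_on k u T) \<Longrightarrow> C_k_on k u S"
proof (induction k arbitrary: u)
  case 0
  show ?case
    unfolding C_k_on.simps continuous_on_eq_continuous_within
  proof
    fix z assume "z \<in> S"
    then obtain T where "open T" "z \<in> T" "continuous_on T u" using 0[OF \<open>z \<in> S\<close>] by auto
    then show "continuous (at z within S) u"
      by (metis continuous_at_imp_continuous_within continuous_on_eq_continuous_at)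
  qed
next
  case (Suc k)
  have "u differentiable_on S"
    unfolding differentiable_on_def
  proof
    fix z assume "z \<in> S"
    then obtain T where "open T" "z \<in> T" "u differentiable_on T" using Suc.prems[OF \<open>z \<in> S\<close>] by auto
    then show "u differentiable at z within S"
      by (metis differentiable_on_open_iff differentiable_at_withinI)
  qed
  moreover have "C_k_on k (partial_x u) S" "C_k_on k (partial_y u) S"
    by (rule Suc.IH, drule Suc.prems, auto)+
  ultimately show ?case by simp
qed

lemma C_k_on_SucD: "C_k_on (Suc k) u S \<Longrightarrow> C_k_on k u S"
proof (induction k arbitrary: u)
  case 0 then show ?case using differentiable_imp_continuous_on[of u S] by simp
next
  case (Suc k) then show ?case unfolding C_k_on.simps(2)[of "Suc k"] C_k_on.simps(2)[of k u] by blast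
qed

lemma C_k_on_le: "C_k_on k u S \<Longrightarrow> j \<le> k \<Longrightarrow> C_k_on j u S"
proof (induction k)
  case (Suc k)
  show ?case
  proof (cases "j = Suc k")
    case True then show ?thesis using Suc.prems(1) by (simp only:)
  next
    case False then show ?thesis using Suc.IH[OF C_k_on_SucD[OF Suc.prems(1)]] Suc.prems(2) by linarith
  qed
qed simp

lemma C_k_on_continuous: "C_k_on k u S \<Longrightarrow> continuous_on S u"
  using C_k_on_le[of k u S 0] by simp

lemma C_k_on_const: "C_k_on k (\<lambda>_. c) S"
proof (induction k arbitrary: c)
  case (Suc k)
  have "partial_x (\<lambda>_. c) = (\<lambda>_. 0)" "partial_y (\<lambda>_. c) = (\<lambda>_. 0)"
    by (auto simp: partial_x_def partial_y_def fun_eq_iff)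
  with Suc show ?case by (simp add: differentiable_on_def)
qed auto

lemma partial_add:
  assumes "u differentiable (at z)" "v differentiable (at z)"
  shows "partial_x (\<lambda>w. u w + v w) z = partial_x u z + partial_x v z"
    "partial_y (\<lambda>w. u w + v w) z = partial_y u z + partial_y v z"
  using partials_of_derivative(3,4)[OF has_derivative_add[OF assms[THEN has_derivative_partials]]] by simp_all

lemma partial_mult:
  assumes "u differentiable (at z)" "v differentiable (at z)"
  shows "partial_x (\<lambda>w. u w * v w) z = u z * partial_x v z + partial_x u z * v z"
    "partial_y (\<lambda>w. u w * v w) z = u z * partial_y v z + partial_y u z * v z"
  using partials_of_derivative(3,4)[OF has_derivative_mult[OF assms[THEN has_derivative_partials]]] by simp_all

lemma C_k_on_add:
  assumes "open S"
  shows "C_k_on k u S \<Longrightarrow> C_k_on k v S \<Longrightarrow> C_k_on k (\<lambda>w. u w + v w) S"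
proof (induction k arbitrary: u v)
  case (Suc k)
  have d: "z \<in> S \<Longrightarrow> u differentiable (at z)" "z \<in> S \<Longrightarrow> v differentiable (at z)" for z
    using Suc.prems assms by (auto simp: differentiable_on_open_iff)
  have "C_k_on k (partial_x (\<lambda>w. u w + v w)) S"
    by (rule C_k_on_cong_imp[OF assms, of "\<lambda>w. partial_x u w + partial_x v w"])
      (use d Suc in \<open>auto simp: partial_add\<close>)
  moreover have "C_k_on k (partial_y (\<lambda>w. u w + v w)) S"
    by (rule C_k_on_cong_imp[OF assms, of "\<lambda>w. partial_y u w + partial_y v w"])
      (use d Suc in \<open>auto simp: partial_add\<close>)
  ultimately show ?case using Suc.prems by (auto intro: differentiable_on_add)
qed (auto intro: continuous_intros)

lemma C_k_on_mult:
  assumes "open S"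
  shows "C_k_on k u S \<Longrightarrow> C_k_on k v S \<Longrightarrow> C_k_on k (\<lambda>w. u w * v w) S"
proof (induction k arbitrary: u v)
  case (Suc k)
  have d: "z \<in> S \<Longrightarrow> u differentiable (at z)" "z \<in> S \<Longrightarrow> v differentiable (at z)" for z
    using Suc.prems assms by (auto simp: differentiable_on_open_iff)
  have uv: "C_k_on k u S" "C_k_on k v S" using Suc.prems C_k_on_SucD by blast+
  have "C_k_on k (partial_x (\<lambda>w. u w * v w)) S"
    by (rule C_k_on_cong_imp[OF assms, of "\<lambda>w. u w * partial_x v w + partial_x u w * v w"])
      (use d Suc uv in \<open>auto simp: partial_mult intro!: C_k_on_add[OF assms]\<close>)
  moreover have "C_k_on k (partial_y (\<lambda>w. u w * v w)) S"
    by (rule C_k_on_cong_imp[OF assms, of "\<lambda>w. u w * partial_y v w + partial_y u w * v w"])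
      (use d Suc uv in \<open>auto simp: partial_mult intro!: C_k_on_add[OF assms]\<close>)
  moreover have "(\<lambda>w. u w * v w) differentiable_on S"
    using d assms by (auto simp: differentiable_on_open_iff intro: differentiable_mult)
  ultimately show ?case by simp
qed (auto intro: continuous_intros)

lemma C_k_on_cmult: "open S \<Longrightarrow> C_k_on k u S \<Longrightarrow> C_k_on k (\<lambda>w. c * u w) S"
  by (intro C_k_on_mult C_k_on_const)

lemma C_k_on_diff: "open S \<Longrightarrow> C_k_on k u S \<Longrightarrow> C_k_on k v S \<Longrightarrow> C_k_on k (\<lambda>w. u w - v w) S"
  using C_k_on_add[of S k u "\<lambda>w. - 1 * v w"] C_k_on_cmult[of S k v "-1"] by simp

section \<open>Holomorphic functions and the conformal behaviour of the Laplacian\<close>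

lemma has_derivative_Re_holomorphic:
  assumes "\<phi> holomorphic_on S" "open S" "z \<in> S"
  shows "(\<phi> has_derivative (\<lambda>v. deriv \<phi> z * v)) (at z)"
  using assms holomorphic_derivI[of \<phi> S z] by (auto simp: has_field_derivative_def)

lemma partial_Re:
  assumes "\<phi> holomorphic_on S" "open S" "z \<in> S"
  shows "(\<lambda>w. Re (\<phi> w)) differentiable (at z)"
    "partial_x (\<lambda>w. Re (\<phi> w)) z = Re (deriv \<phi> z)"
    "partial_y (\<lambda>w. Re (\<phi> w)) z = - Im (deriv \<phi> z)"
proof -
  have 1: "((\<lambda>w. Re (\<phi> w)) has_derivative (\<lambda>v. Re (deriv \<phi> z * v))) (at z)"
    using has_derivative_Re_holomorphic[OF assms] by (rule has_derivative_Re)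
  then show "(\<lambda>w. Re (\<phi> w)) differentiable (at z)" by (auto simp: differentiable_def)
  show "partial_x (\<lambda>w. Re (\<phi> w)) z = Re (deriv \<phi> z)" "partial_y (\<lambda>w. Re (\<phi> w)) z = - Im (deriv \<phi> z)"
    using partials_of_derivative(3,4)[OF 1] by simp_all
qed

text \<open>The partial derivatives of \<open>Re \<phi>\<close> are the real parts of
  \<open>deriv \<phi>\<close> and of \<open>\<i> * deriv \<phi>\<close>, so real parts of
  holomorphic functions form a class closed under differentiation. The induction runs over the whole
  class.\<close>

lemma C_k_on_Re_holomorphic:
  assumes "open S"
  shows "\<phi> holomorphic_on S \<Longrightarrow> C_k_on k (\<lambda>w. Re (\<phi> w)) S"
proof (induction k arbitrary: \<phi>)
  case 0 then show ?case by (auto intro!: continuous_intros holomorphic_on_imp_continuous_on)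
next
  case (Suc k)
  have "C_k_on k (partial_x (\<lambda>w. Re (\<phi> w))) S"
    by (rule C_k_on_cong_imp[OF assms _ Suc.IH[of "deriv \<phi>"]])
      (use Suc.prems assms in \<open>auto simp: partial_Re intro: holomorphic_deriv\<close>)
  moreover have "C_k_on k (partial_y (\<lambda>w. Re (\<phi> w))) S"
    by (rule C_k_on_cong_imp[OF assms _ Suc.IH[of "\<lambda>w. \<i> * deriv \<phi> w"]])
      (use Suc.prems assms in \<open>auto simp: partial_Re intro!: holomorphic_deriv holomorphic_intros\<close>)
  moreover have "(\<lambda>w. Re (\<phi> w)) differentiable_on S"
    using partial_Re(1)[OF Suc.prems assms] assms by (auto simp: differentiable_on_open_iff)
  ultimately show ?case by simp
qed

lemma C_k_on_Im_holomorphic: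
  assumes "open S" "\<phi> holomorphic_on S"
  shows "C_k_on k (\<lambda>w. Im (\<phi> w)) S"
proof -
  have "(\<lambda>w. - \<i> * \<phi> w) holomorphic_on S" by (intro holomorphic_intros assms)
  from C_k_on_Re_holomorphic[OF assms(1) this] show ?thesis by simp
qed

lemma partial_compose_holomorphic:
  assumes "\<phi> holomorphic_on S" "open S" "z \<in> S" "u differentiable (at (\<phi> z))"
  shows "(u \<circ> \<phi>) differentiable (at z)"
    "partial_x (u \<circ> \<phi>) z = partial_x u (\<phi> z) * Re (deriv \<phi> z) + partial_y u (\<phi> z) * Im (deriv \<phi> z)"
    "partial_y (u \<circ> \<phi>) z = partial_y u (\<phi> z) * Re (deriv \<phi> z) - partial_x u (\<phi> z) * Im (deriv \<phi> z)"
proof -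
  have D: "(u \<circ> \<phi> has_derivative (\<lambda>v. Re v * partial_x u (\<phi> z) + Im v * partial_y u (\<phi> z)) \<circ> (\<lambda>v. deriv \<phi> z * v)) (at z)"
    by (rule diff_chain_at[OF has_derivative_Re_holomorphic[OF assms(1-3)] has_derivative_partials[OF assms(4)]])
  then show "(u \<circ> \<phi>) differentiable (at z)" by (auto simp: differentiable_def)
  show "partial_x (u \<circ> \<phi>) z = partial_x u (\<phi> z) * Re (deriv \<phi> z) + partial_y u (\<phi> z) * Im (deriv \<phi> z)"
    "partial_y (u \<circ> \<phi>) z = partial_y u (\<phi> z) * Re (deriv \<phi> z) - partial_x u (\<phi> z) * Im (deriv \<phi> z)"
    using partials_of_derivative(3,4)[OF D] by (simp_all add: algebra_simps)
qed

lemma C_k_on_compose_holomorphic: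
  assumes "\<phi> holomorphic_on S" "open S" "open T" "\<phi> ` S \<subseteq> T"
  shows "C_k_on k u T \<Longrightarrow> C_k_on k (u \<circ> \<phi>) S"
proof (induction k arbitrary: u)
  case 0
  have "continuous_on (\<phi> ` S) u" using 0 assms(4) by (auto intro: continuous_on_subset)
  then have "continuous_on S (u \<circ> \<phi>)" using holomorphic_on_imp_continuous_on[OF assms(1)]
    by (rule continuous_on_compose[rotated])
  then show ?case by simp
next
  case (Suc k)
  have d: "z \<in> S \<Longrightarrow> u differentiable (at (\<phi> z))" for z
    using Suc.prems assms by (auto simp: differentiable_on_open_iff)
  have RI: "C_k_on k (\<lambda>z. Re (deriv \<phi> z)) S" "C_k_on k (\<lambda>z. Im (deriv \<phi> z)) S"
    using assms by (auto intro!: C_k_on_Re_holomorphic C_k_on_Im_holomorphic holomorphic_deriv)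
  have IH: "C_k_on k (partial_x u \<circ> \<phi>) S" "C_k_on k (partial_y u \<circ> \<phi>) S"
    using Suc.IH[of "partial_x u"] Suc.IH[of "partial_y u"] Suc.prems by (simp_all only: C_k_on.simps)
  have "C_k_on k (partial_x (u \<circ> \<phi>)) S"
    by (rule C_k_on_cong_imp[OF assms(2), of "\<lambda>z. (partial_x u \<circ> \<phi>) z * Re (deriv \<phi> z) + (partial_y u \<circ> \<phi>) z * Im (deriv \<phi> z)"])
      (use d assms IH[unfolded o_def] RI in \<open>auto simp: partial_compose_holomorphic intro!: C_k_on_add C_k_on_mult\<close>)
  moreover have "C_k_on k (partial_y (u \<circ> \<phi>)) S"
    by (rule C_k_on_cong_imp[OF assms(2), of "\<lambda>z. (partial_y u \<circ> \<phi>) z * Re (deriv \<phi> z) - (partial_x u \<circ> \<phi>) z * Im (deriv \<phi> z)"])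
      (use d assms IH[unfolded o_def] RI in \<open>auto simp: partial_compose_holomorphic intro!: C_k_on_diff C_k_on_mult\<close>)
  moreover have "(u \<circ> \<phi>) differentiable_on S"
    using partial_compose_holomorphic(1)[OF assms(1,2)] d assms(2) by (simp add: differentiable_on_open_iff)
  ultimately show ?case unfolding C_k_on.simps by blast
qed

lemma partial_diff_cmult:
  assumes "u differentiable (at z)" "v differentiable (at z)"
  shows "partial_x (\<lambda>w. u w + c * v w) z = partial_x u z + c * partial_x v z"
    "partial_y (\<lambda>w. u w + c * v w) z = partial_y u z + c * partial_y v z"
  using partials_of_derivative(3,4)[OF has_derivative_add[OF assms(1)[THEN has_derivative_partials]
      has_derivative_mult_right[OF assms(2)[THEN has_derivative_partials], of c]]] by simp_all

lemma C2_differentiable: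
  assumes "C_k_on 2 u S" "open S" "z \<in> S"
  shows "u differentiable (at z)" "partial_x u differentiable (at z)" "partial_y u differentiable (at z)"
  using assms by (auto simp: eval_nat_numeral differentiable_on_open_iff)

lemma flat_laplacian_add_cmult:
  assumes "C_k_on 2 u S" "C_k_on 2 v S" "open S" "z \<in> S"
  shows "flat_laplacian (\<lambda>w. u w + c * v w) z = flat_laplacian u z + c * flat_laplacian v z"
proof -
  note d = C2_differentiable[OF assms(1,3)] C2_differentiable[OF assms(2,3)]
  have "partial_x (partial_x (\<lambda>w. u w + c * v w)) z = partial_x (\<lambda>w. partial_x u w + c * partial_x v w) z"
    "partial_y (partial_y (\<lambda>w. u w + c * v w)) z = partial_y (\<lambda>w. partial_y u w + c * partial_y v w) z"
    using d by (auto intro!: partial_cong[OF assms(3,4)] simp: partial_diff_cmult)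
  then show ?thesis
    using d assms(4) by (simp add: partial_diff_cmult flat_laplacian_def algebra_simps)
qed

text \<open>By the Cauchy-Riemann equations the terms with the second derivative of \<phi> cancel
  between the two unmixed derivatives. Each of the two orders of mixed differentiation occurs twice
  with opposite signs. What remains is the Laplacian of \<open>u\<close> times the sum of the
  squared real and imaginary parts of \<open>deriv \<phi>\<close>.\<close>

lemma flat_laplacian_compose_holomorphic:
  assumes \<phi>: "\<phi> holomorphic_on S" and S: "open S" "z \<in> S" and T: "open T" "\<phi> ` S \<subseteq> T" and u: "C_k_on 2 u T"
  shows "flat_laplacian (u \<circ> \<phi>) z = flat_laplacian u (\<phi> z) * (norm (deriv \<phi> z))\<^sup>2"
proof -
  have d: "u differentiable (at (\<phi> w))" "partial_x u differentiable (at (\<phi> w))"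
    "partial_y u differentiable (at (\<phi> w))" if "w \<in> S" for w
    using C2_differentiable[OF u T(1)] T(2) that by auto
  let ?a = "\<lambda>w. Re (deriv \<phi> w)" and ?b = "\<lambda>w. Im (deriv \<phi> w)"
  define ux uy where uxy: "ux = partial_x u \<circ> \<phi>" "uy = partial_y u \<circ> \<phi>"
  have hd: "deriv \<phi> holomorphic_on S" using \<phi> S by (auto intro: holomorphic_deriv)
  have hd': "(\<lambda>w. - \<i> * deriv \<phi> w) holomorphic_on S"
    by (rule holomorphic_on_mult[OF holomorphic_on_const hd])
  have dd: "(\<lambda>w. - \<i> * deriv \<phi> w) = (\<lambda>w. (-\<i>) * deriv \<phi> w)" by simp
  have d': "deriv (\<lambda>w. - \<i> * deriv \<phi> w) z = - \<i> * deriv (deriv \<phi>) z"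
    by (rule DERIV_imp_deriv, rule DERIV_cmult, rule holomorphic_derivI[OF hd S])
  note R = partial_Re[OF hd S]
  have I: "?b differentiable (at z)" "partial_x ?b z = Im (deriv (deriv \<phi>) z)" "partial_y ?b z = Re (deriv (deriv \<phi>) z)"
    using partial_Re[OF hd' S] unfolding d' by simp_all
  note c = partial_compose_holomorphic[OF \<phi> S(1)]
  note cx = c[of z "partial_x u", OF S(2) d(2)[OF S(2)], folded uxy]
  note cy = c[of z "partial_y u", OF S(2) d(3)[OF S(2)], folded uxy]
  have "partial_x (partial_x (u \<circ> \<phi>)) z = partial_x (\<lambda>w. ux w * ?a w + uy w * ?b w) z"
    by (rule partial_cong[OF S]) (simp add: c d uxy)
  also have "\<dots> = ux z * Re (deriv (deriv \<phi>) z) + (partial_x (partial_x u) (\<phi> z) * ?a z + partial_y (partial_x u) (\<phi> z) * ?b z) * ?a z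
      + (uy z * Im (deriv (deriv \<phi>) z) + (partial_x (partial_y u) (\<phi> z) * ?a z + partial_y (partial_y u) (\<phi> z) * ?b z) * ?b z)"
    using R I cx cy by (simp add: partial_add partial_mult)
  finally have 1: "partial_x (partial_x (u \<circ> \<phi>)) z = \<dots>" .
  have "partial_y (partial_y (u \<circ> \<phi>)) z = partial_y (\<lambda>w. uy w * ?a w + (-1) * (ux w * ?b w)) z"
    by (rule partial_cong[OF S]) (simp add: c d uxy)
  also have "\<dots> = uy z * - Im (deriv (deriv \<phi>) z) + (partial_y (partial_y u) (\<phi> z) * ?a z - partial_x (partial_y u) (\<phi> z) * ?b z) * ?a z
      + (-1) * (ux z * Re (deriv (deriv \<phi>) z) + (partial_y (partial_x u) (\<phi> z) * ?a z - partial_x (partial_x u) (\<phi> z) * ?b z) * ?b z)"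
    using R I cx cy by (subst partial_diff_cmult) (simp_all add: partial_mult)
  finally have 2: "partial_y (partial_y (u \<circ> \<phi>)) z = \<dots>" .
  show ?thesis
    unfolding flat_laplacian_def 1 2 cmod_power2 by (simp add: uxy algebra_simps power2_eq_square)
qed

lemma flat_laplacian_Re_holomorphic:
  assumes "\<phi> holomorphic_on S" "open S" "z \<in> S"
  shows "flat_laplacian (\<lambda>w. Re (\<phi> w)) z = 0"
proof -
  have 0: "flat_laplacian Re w = 0" for w
  proof -
    have "partial_x Re = (\<lambda>_. 1)" "partial_y Re = (\<lambda>_. 0)"
      using partial_Re(2,3)[of "\<lambda>w. w" UNIV] by (auto simp: fun_eq_iff)
    then show ?thesis by (simp add: flat_laplacian_def partial_x_def partial_y_def)
  qed
  have "C_k_on 2 Re UNIV" using C_k_on_Re_holomorphic[of UNIV "\<lambda>w. w"] by simp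
  then show ?thesis
    using flat_laplacian_compose_holomorphic[OF assms, of UNIV Re] 0 by (simp add: o_def)
qed

text \<open>Near a point \<open>z \<noteq> 0\<close> the function \<open>ln |w|\<close> is the real part of \<open>Ln (w / z)\<close> up to a constant.\<close>

lemma ln_norm_local:
  assumes "z \<noteq> 0"
  obtains \<phi> r where "r > 0" "0 \<notin> ball z r" "\<phi> holomorphic_on ball z r" "\<And>w. w \<in> ball z r \<Longrightarrow> ln (norm w) = Re (\<phi> w)"
proof
  let ?\<phi> = "\<lambda>w. Ln (w / z) + of_real (ln (norm z))"
  show "norm z > 0" using assms by simp
  show n0: "0 \<notin> ball z (norm z)" by simp
  \<comment> \<open>The disc about \<open>z\<close> of radius |z| misses the ray opposite to
    \<open>z\<close>: a point t z with t \<le> 0 has distance (1 - t) |z| \<ge> |z| from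
    \<open>z\<close>. So the principal branch is available on the whole disc.\<close>
  have pos: "w / z \<notin> \<real>\<^sub>\<le>\<^sub>0" if "w \<in> ball z (norm z)" for w
  proof
    assume "w / z \<in> \<real>\<^sub>\<le>\<^sub>0"
    then obtain t where t: "w / z = of_real t" "t \<le> 0" by (auto simp: nonpos_Reals_def)
    then have "w = of_real t * z" using assms by (simp add: field_simps)
    have "z - w = of_real (1 - t) * z" using \<open>w = _\<close> by (simp add: algebra_simps)
    then have "norm (z - w) = (1 - t) * norm z"
      using t(2) by (simp add: norm_mult del: of_real_diff)
    also have "\<dots> \<ge> norm z" using t(2) by (simp add: algebra_simps mult_nonpos_nonneg)
    finally show False using that by (simp add: dist_norm)
  qed
  show "?\<phi> holomorphic_on ball z (norm z)"
    using pos assms by (intro holomorphic_intros) auto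
  show "ln (norm w) = Re (?\<phi> w)" if "w \<in> ball z (norm z)" for w
  proof -
    have "w \<noteq> 0" using that n0 by blast
    then show ?thesis using assms by (simp add: norm_divide ln_div)
  qed
qed

lemma ln_norm_C_k: "C_k_on k (\<lambda>w. ln (norm w)) (- {0::complex})"
proof (rule C_k_on_local)
  fix z :: complex assume "z \<in> - {0}"
  then obtain \<phi> r where *: "r > 0" "\<phi> holomorphic_on ball z r" "\<And>w. w \<in> ball z r \<Longrightarrow> ln (norm w) = Re (\<phi> w)"
    using ln_norm_local[of z] by blast
  have "C_k_on k (\<lambda>w. ln (norm w)) (ball z r)"
    by (rule C_k_on_cong_imp[OF open_ball _ C_k_on_Re_holomorphic[OF open_ball *(2)]]) (simp add: *(3))
  then show "\<exists>T. open T \<and> z \<in> T \<and> C_k_on k (\<lambda>w. ln (norm w)) T" using *(1) by (intro exI[of _ "ball z r"]) simp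
qed

lemma flat_laplacian_ln_norm: "z \<noteq> 0 \<Longrightarrow> flat_laplacian (\<lambda>w. ln (norm w)) z = 0"
proof -
  assume "z \<noteq> 0"
  then obtain \<phi> r where *: "r > 0" "\<phi> holomorphic_on ball z r" "\<And>w. w \<in> ball z r \<Longrightarrow> ln (norm w) = Re (\<phi> w)"
    using ln_norm_local[of z] by blast
  have "flat_laplacian (\<lambda>w. ln (norm w)) z = flat_laplacian (\<lambda>w. Re (\<phi> w)) z"
    by (rule flat_laplacian_cong[OF open_ball, of _ z r]) (use * in auto)
  then show ?thesis using flat_laplacian_Re_holomorphic[OF *(2) open_ball] *(1) by simp
qed

section \<open>Smooth functions of one real variable and radial functions\<close>

primrec D_k_on :: "nat \<Rightarrow> (real \<Rightarrow> real) \<Rightarrow> real set \<Rightarrow> bool" where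
  "D_k_on 0 F I \<longleftrightarrow> continuous_on I F"
| "D_k_on (Suc k) F I \<longleftrightarrow> (\<exists>F'. (\<forall>x\<in>I. (F has_real_derivative F' x) (at x)) \<and> D_k_on k F' I)"

lemma D_k_on_SucD: "D_k_on (Suc k) F I \<Longrightarrow> D_k_on k F I"
proof (induction k arbitrary: F)
  case 0
  then obtain F' where "\<And>x. x \<in> I \<Longrightarrow> (F has_real_derivative F' x) (at x)" by auto
  then show ?case using DERIV_continuous_on[of I F F'] has_field_derivative_at_within by fastforce
next
  case (Suc k) then show ?case by (metis D_k_on.simps(2))
qed

lemma partial_compose_real:
  assumes "u differentiable (at z)" "(F has_real_derivative F') (at (u z))"
  shows "(\<lambda>w. F (u w)) differentiable (at z)"
    "partial_x (\<lambda>w. F (u w)) z = F' * partial_x u z" "partial_y (\<lambda>w. F (u w)) z = F' * partial_y u z"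
proof -
  have D: "((\<lambda>w. F (u w)) has_derivative (\<lambda>v. F' * (Re v * partial_x u z + Im v * partial_y u z))) (at z)"
    using diff_chain_at[OF has_derivative_partials[OF assms(1)] assms(2)[unfolded has_field_derivative_def]]
    by (simp add: o_def)
  then show "(\<lambda>w. F (u w)) differentiable (at z)" by (auto simp: differentiable_def)
  show "partial_x (\<lambda>w. F (u w)) z = F' * partial_x u z" "partial_y (\<lambda>w. F (u w)) z = F' * partial_y u z"
    using partials_of_derivative(3,4)[OF D] by simp_all
qed

lemma C_k_on_compose_real:
  assumes "open S" "u ` S \<subseteq> I"
  shows "D_k_on k F I \<Longrightarrow> C_k_on k u S \<Longrightarrow> C_k_on k (\<lambda>w. F (u w)) S"
proof (induction k arbitrary: F)
  case 0 then show ?case using assms(2) by (auto intro: continuous_on_compose2)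
next
  case (Suc k)
  obtain F' where F': "\<And>x. x \<in> I \<Longrightarrow> (F has_real_derivative F' x) (at x)" "D_k_on k F' I" using Suc.prems by auto
  have d: "z \<in> S \<Longrightarrow> u differentiable (at z)" for z
    using Suc.prems assms by (auto simp: differentiable_on_open_iff)
  have u: "C_k_on k (partial_x u) S" "C_k_on k (partial_y u) S" using Suc.prems by auto
  have F'u: "z \<in> S \<Longrightarrow> (F has_real_derivative F' (u z)) (at (u z))" for z using F' assms(2) by auto
  have IH: "C_k_on k (\<lambda>w. F' (u w)) S" using Suc F'(2) C_k_on_SucD by blast
  have "C_k_on k (partial_x (\<lambda>w. F (u w))) S"
    by (rule C_k_on_cong_imp[OF assms(1), of "\<lambda>w. F' (u w) * partial_x u w"])
      (use d F'u IH u assms in \<open>auto simp: partial_compose_real(2,3)[OF d F'u] intro!: C_k_on_mult\<close>)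
  moreover have "C_k_on k (partial_y (\<lambda>w. F (u w))) S"
    by (rule C_k_on_cong_imp[OF assms(1), of "\<lambda>w. F' (u w) * partial_y u w"])
      (use d F'u IH u assms in \<open>auto simp: partial_compose_real(2,3)[OF d F'u] intro!: C_k_on_mult\<close>)
  moreover have "(\<lambda>w. F (u w)) differentiable_on S"
    using partial_compose_real(1)[OF d F'u] assms(1) by (auto simp: differentiable_on_open_iff)
  ultimately show ?case by simp
qed

text \<open>The functions \<open>c / x ^ n\<close> form a family closed under differentiation, hence
  the induction for all \<open>c\<close> and \<open>n\<close> at once. The logarithm enters this
  family after one derivative.\<close>

lemma D_k_on_inverse_power: "D_k_on k (\<lambda>x. c / x ^ n) {0<..}"
proof (induction k arbitrary: c n)
  case (Suc k)
  have "((\<lambda>x. c / x ^ n) has_real_derivative (- c * real n) / x ^ Suc n) (at x)" if "x > 0" for x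
  proof (cases n)
    case (Suc m)
    have "((\<lambda>x. x ^ n) has_real_derivative real n * x ^ m) (at x)"
      using DERIV_pow[of n x] Suc by simp
    from DERIV_divide[OF DERIV_const this, of c]
    have "((\<lambda>x. c / x ^ n) has_real_derivative - (c * (real n * x ^ m)) / (x ^ n * x ^ n)) (at x)"
      using that by simp
    moreover have "- (c * (real n * x ^ m)) / (x ^ n * x ^ n) = (- c * real n) / x ^ Suc n"
      using that Suc by (simp add: divide_simps)
    ultimately show ?thesis by simp
  qed auto
  then show ?case using Suc.IH[of "- c * real n" "Suc n"] by (auto intro!: exI[of _ "\<lambda>x. (- c * real n) / x ^ Suc n"])
qed (auto intro!: continuous_intros)

lemma D_k_on_ln: "D_k_on k ln {0<..}"
proof (cases k)
  case (Suc j)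
  have "(ln has_real_derivative 1 / x ^ 1) (at x)" if "x > 0" for x
    using that DERIV_ln[of x] by (simp add: inverse_eq_divide)
  then show ?thesis using Suc D_k_on_inverse_power[of j 1 1] by (auto intro!: exI[of _ "\<lambda>x. 1 / x ^ 1"])
qed (auto intro!: continuous_intros)

lemma C_k_on_norm_power2: "C_k_on k (\<lambda>z. (norm (z - a))\<^sup>2) S"
proof -
  have "C_k_on k (\<lambda>z. Re (z - a) * Re (z - a) + Im (z - a) * Im (z - a)) UNIV"
    by (intro C_k_on_add C_k_on_mult C_k_on_Re_holomorphic C_k_on_Im_holomorphic holomorphic_intros open_UNIV)
  then have "C_k_on k (\<lambda>z. (norm (z - a))\<^sup>2) UNIV" by (simp add: cmod_power2) (simp add: power2_eq_square)
  then show ?thesis by (rule C_k_on_subset) simp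
qed

text \<open>The profile is a function of the squared distance, which is a polynomial in the
  coordinates, so no singularity arises at the centre.\<close>

lemma C_k_on_radial:
  assumes "D_k_on k F I" "{0..} \<subseteq> I"
  shows "C_k_on k (\<lambda>z. F ((norm (z - a))\<^sup>2)) UNIV"
  by (rule C_k_on_compose_real[OF open_UNIV _ assms(1) C_k_on_norm_power2]) (use assms(2) in auto)

lemma partial_norm_power2:
  "(\<lambda>z. (norm (z - a))\<^sup>2) differentiable (at z)"
  "partial_x (\<lambda>z. (norm (z - a))\<^sup>2) z = 2 * Re (z - a)"
  "partial_y (\<lambda>z. (norm (z - a))\<^sup>2) z = 2 * Im (z - a)"
proof -
  have D: "((\<lambda>z. (norm (z - a))\<^sup>2) has_derivative (\<lambda>v. 2 * Re (z - a) * Re v + 2 * Im (z - a) * Im v)) (at z)"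
    unfolding cmod_power2 by (auto intro!: derivative_eq_intros simp: fun_eq_iff algebra_simps)
  then show "(\<lambda>z. (norm (z - a))\<^sup>2) differentiable (at z)" by (auto simp: differentiable_def)
  show "partial_x (\<lambda>z. (norm (z - a))\<^sup>2) z = 2 * Re (z - a)"
    "partial_y (\<lambda>z. (norm (z - a))\<^sup>2) z = 2 * Im (z - a)"
    using partials_of_derivative(3,4)[OF D] by simp_all
qed

text \<open>With t = |z - a|^2 the right-hand side is four times the derivative of t F'(t). A radial
  Poisson equation is thus solved by two successive integrations, as is done in
  \<open>radial_test_bump_exists\<close>.\<close>

lemma flat_laplacian_radial:
  assumes F: "\<And>t. t \<ge> 0 \<Longrightarrow> (F has_real_derivative F' t) (at t)"
    and F': "\<And>t. t \<ge> 0 \<Longrightarrow> (F' has_real_derivative F'' t) (at t)"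
  shows "flat_laplacian (\<lambda>z. F ((norm (z - a))\<^sup>2)) z
    = 4 * (F' ((norm (z - a))\<^sup>2) + (norm (z - a))\<^sup>2 * F'' ((norm (z - a))\<^sup>2))"
proof -
  let ?t = "\<lambda>z. (norm (z - a))\<^sup>2"
  have "partial_x (\<lambda>z. F (?t z)) = (\<lambda>z. F' (?t z) * (2 * Re (z - a)))"
    "partial_y (\<lambda>z. F (?t z)) = (\<lambda>z. F' (?t z) * (2 * Im (z - a)))"
    using partial_compose_real[OF partial_norm_power2(1) F] by (auto simp: fun_eq_iff partial_norm_power2)
  moreover have dF: "(\<lambda>z. F' (?t z)) differentiable (at z)"
    "partial_x (\<lambda>z. F' (?t z)) z = F'' (?t z) * (2 * Re (z - a))"
    "partial_y (\<lambda>z. F' (?t z)) z = F'' (?t z) * (2 * Im (z - a))"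
    using partial_compose_real[OF partial_norm_power2(1) F'] by (auto simp: partial_norm_power2)
  moreover have R: "((\<lambda>z. 2 * Re (z - a)) has_derivative (\<lambda>v. 2 * Re v)) (at z)"
    "((\<lambda>z. 2 * Im (z - a)) has_derivative (\<lambda>v. 2 * Im v)) (at z)"
    by (auto intro!: derivative_eq_intros)
  moreover have "(\<lambda>z. 2 * Re (z - a)) differentiable (at z)" "(\<lambda>z. 2 * Im (z - a)) differentiable (at z)"
    using R by (auto simp: differentiable_def)
  ultimately show ?thesis
    using partials_of_derivative(3)[OF R(1)] partials_of_derivative(4)[OF R(2)]
    unfolding flat_laplacian_def
    by (simp only: partial_mult dF) (simp only: cmod_power2, simp add: algebra_simps power2_eq_square)
qed

section \<open>Weakly harmonic functions\<close>

lemma lborel_translate: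
  fixes f :: "'a::euclidean_space \<Rightarrow> real"
  assumes "integrable lborel f"
  shows "integrable lborel (\<lambda>z. f (z + c))" "(\<integral>z. f (z + c) \<partial>lborel) = (\<integral>z. f z \<partial>lborel)"
proof -
  have m: "(+) c \<in> borel_measurable lborel" by simp
  have f: "f \<in> borel_measurable borel" using borel_measurable_integrable[OF assms] by simp
  have "integrable (distr lborel borel ((+) c)) f" using assms by (simp add: lborel_distr_plus)
  then show "integrable lborel (\<lambda>z. f (z + c))"
    by (subst (asm) integrable_distr_eq[OF m f]) (simp add: add.commute)
  show "(\<integral>z. f (z + c) \<partial>lborel) = (\<integral>z. f z \<partial>lborel)"
    using integral_distr[OF m f] by (simp add: lborel_distr_plus add.commute)
qed

text \<open>Taylor's formula with Lagrange remainder is taken from \<open>z\<close> in the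
  directions \<open>e\<close> and \<open>- e\<close>, and the first-order terms cancel. The
  remainders are values of \<open>g2\<close> at unspecified points, which suffices for bounds and,
  where \<open>g2\<close> is continuous, for limits.\<close>

lemma second_difference:
  fixes g g1 g2 :: "complex \<Rightarrow> real"
  assumes t: "t > 0"
    and \<Omega>: "\<And>s. \<bar>s\<bar> \<le> t \<Longrightarrow> z + of_real s * e \<in> \<Omega>"
    and g: "\<And>z. z \<in> \<Omega> \<Longrightarrow> ((\<lambda>s. g (z + of_real s * e)) has_real_derivative g1 z) (at 0)"
    and g1: "\<And>z. z \<in> \<Omega> \<Longrightarrow> ((\<lambda>s. g1 (z + of_real s * e)) has_real_derivative g2 z) (at 0)"
  obtains \<alpha> \<beta> where "\<bar>\<alpha>\<bar> \<le> t" "\<bar>\<beta>\<bar> \<le> t"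
    "g (z + of_real t * e) + g (z - of_real t * e) - 2 * g z = t\<^sup>2 * (g2 (z + of_real \<alpha> * e) + g2 (z + of_real \<beta> * e)) / 2"
proof -
  have shift: "((\<lambda>s. h (z + of_real s * e)) has_real_derivative h' (z + of_real s0 * e)) (at s0)"
    if "\<And>z. z \<in> \<Omega> \<Longrightarrow> ((\<lambda>s. h (z + of_real s * e)) has_real_derivative h' z) (at 0)" "\<bar>s0\<bar> \<le> t" for h h' s0
  proof -
    have "((\<lambda>s. h ((z + of_real s0 * e) + of_real s * e)) has_real_derivative h' (z + of_real s0 * e)) (at 0)"
      by (rule that(1)[OF \<Omega>[OF that(2)]])
    then have "((\<lambda>s. h (z + of_real (s + s0) * e)) has_real_derivative h' (z + of_real s0 * e)) (at 0)"
      by (simp add: algebra_simps)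
    then show ?thesis using DERIV_shift[of "\<lambda>s. h (z + of_real s * e)" _ 0 s0] by simp
  qed
  have key: "\<exists>\<xi>. \<bar>\<xi>\<bar> \<le> t \<and> g (z + of_real (\<sigma> * t) * e) = g z + \<sigma> * g1 z * t + g2 (z + of_real \<xi> * e) / 2 * t\<^sup>2"
    if \<sigma>: "\<sigma> = 1 \<or> \<sigma> = -1" for \<sigma> :: real
  proof -
    \<comment> \<open>\<open>d\<close> lists the function along \<sigma> e and its first two
      derivatives. The second one carries no sign because \<sigma>^2 = 1.\<close>
    define d where "d = (\<lambda>m::nat. if m = 0 then (\<lambda>s. g (z + of_real (\<sigma> * s) * e))
      else if m = 1 then (\<lambda>s. \<sigma> * g1 (z + of_real (\<sigma> * s) * e)) else (\<lambda>s. g2 (z + of_real (\<sigma> * s) * e)))"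
    have D: "((\<lambda>s. h (z + of_real (\<sigma> * s) * e)) has_real_derivative \<sigma> * h' (z + of_real (\<sigma> * s0) * e)) (at s0)"
      if "\<And>z. z \<in> \<Omega> \<Longrightarrow> ((\<lambda>s. h (z + of_real s * e)) has_real_derivative h' z) (at 0)" "\<bar>s0\<bar> \<le> t" for h h' s0
    proof -
      have "((\<lambda>s. h (z + of_real s * e)) has_real_derivative h' (z + of_real (\<sigma> * s0) * e)) (at (\<sigma> * s0))"
        by (rule shift[OF that(1)]) (use that(2) \<sigma> in \<open>auto simp: abs_mult\<close>)
      from DERIV_chain2[OF this DERIV_cmult_Id[of \<sigma> s0]]
      show ?thesis by (simp only: mult.commute[of \<sigma> "h' _"])
    qed
    have "\<exists>\<xi>. 0 < \<xi> \<and> \<xi> < t \<and> d 0 t = (\<Sum>m<2. d m 0 / fact m * t ^ m) + d 2 \<xi> / fact 2 * t ^ 2"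
    proof (rule Maclaurin[OF t])
      show "\<forall>m s. m < 2 \<and> 0 \<le> s \<and> s \<le> t \<longrightarrow> (d m has_real_derivative d (Suc m) s) (at s)"
      proof (intro allI impI)
        fix m :: nat and s assume *: "m < 2 \<and> 0 \<le> s \<and> s \<le> t"
        then consider "m = 0" | "m = 1" by linarith
        then show "(d m has_real_derivative d (Suc m) s) (at s)"
        proof cases
          case 1 then show ?thesis using D[of g g1 s, OF g] * by (simp add: d_def)
        next
          case 2
          have "((\<lambda>s. \<sigma> * g1 (z + of_real (\<sigma> * s) * e)) has_real_derivative \<sigma> * (\<sigma> * g2 (z + of_real (\<sigma> * s) * e))) (at s)"
            by (rule DERIV_cmult[OF D[of g1 g2 s, OF g1]]) (use * in auto)
          then show ?thesis using 2 \<sigma> by (auto simp: d_def)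
        qed
      qed
    qed auto
    then obtain \<xi> where "0 < \<xi>" "\<xi> < t" "d 0 t = (\<Sum>m<2. d m 0 / fact m * t ^ m) + d 2 \<xi> / fact 2 * t ^ 2" by blast
    then show ?thesis
      using \<sigma> by (intro exI[of _ "\<sigma> * \<xi>"]) (auto simp: d_def numeral_2_eq_2 power2_eq_square)
  qed
  obtain \<alpha> \<beta> where "\<bar>\<alpha>\<bar> \<le> t" "\<bar>\<beta>\<bar> \<le> t"
    "g (z + of_real t * e) = g z + g1 z * t + g2 (z + of_real \<alpha> * e) / 2 * t\<^sup>2"
    "g (z - of_real t * e) = g z - g1 z * t + g2 (z + of_real \<beta> * e) / 2 * t\<^sup>2"
    using key[of 1] key[of "-1"] by auto
  then show ?thesis by (intro that[of \<alpha> \<beta>]) (auto simp: algebra_simps)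
qed

text \<open>
  Green's identity in one direction: the discrete analogue with second differences is the
  translation invariance of the Lebesgue measure, and one passes to the limit.
\<close>

lemma green_direction:
  fixes g g1 g2 \<psi> \<psi>1 \<psi>2 :: "complex \<Rightarrow> real"
  assumes e: "norm e = 1" and R: "0 < R1" "R1 < R" and \<Omega>: "cball a R \<subseteq> \<Omega>"
    and g: "\<And>z. z \<in> \<Omega> \<Longrightarrow> ((\<lambda>s. g (z + of_real s * e)) has_real_derivative g1 z) (at 0)"
    and g1: "\<And>z. z \<in> \<Omega> \<Longrightarrow> ((\<lambda>s. g1 (z + of_real s * e)) has_real_derivative g2 z) (at 0)"
    and \<psi>: "\<And>z. ((\<lambda>s. \<psi> (z + of_real s * e)) has_real_derivative \<psi>1 z) (at 0)"
    and \<psi>1: "\<And>z. ((\<lambda>s. \<psi>1 (z + of_real s * e)) has_real_derivative \<psi>2 z) (at 0)"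
    and cont: "continuous_on (cball a R) g" "continuous_on (cball a R) g2" "continuous_on UNIV \<psi>" "continuous_on UNIV \<psi>2"
    and supp: "\<And>z. R1 \<le> dist a z \<Longrightarrow> \<psi> z = 0"
  shows "(\<integral>z. indicator (cball a R) z * (g z * \<psi>2 z) \<partial>lborel) = (\<integral>z. indicator (cball a R) z * (\<psi> z * g2 z) \<partial>lborel)"
proof -
  define B where "B = cball a R"
  define g0 where "g0 = (\<lambda>z. indicator B z * g z)"
  \<comment> \<open>The steps stay below \<open>R - R1\<close>. From a point where \<psi> may be
    nonzero, at distance less than \<open>R1\<close>, both shifted points remain in the ball on
    which \<open>g\<close> is controlled.\<close>
  define t where "t = (\<lambda>n::nat. (R - R1) / (real n + 2))"
  have t: "t n > 0" "t n < R - R1" for n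
  proof -
    have "(R - R1) * 1 < (R - R1) * (real n + 2)" by (rule mult_strict_left_mono) (use R in auto)
    then show "t n > 0" "t n < R - R1" using R by (simp_all add: t_def divide_less_eq)
  qed
  have t0: "t \<longlonglongrightarrow> 0" unfolding t_def by real_asymp
  have te: "norm (of_real s * e) = \<bar>s\<bar>" for s :: real using e by (simp add: norm_mult)
  have out: "\<psi>1 z = 0" "\<psi>2 z = 0" if "R1 < dist a z" for z
  proof -
    have loc: "h' w = 0" if h: "\<And>z. ((\<lambda>s. h (z + of_real s * e)) has_real_derivative h' z) (at 0)"
      and z: "\<And>z. R1 < dist a z \<Longrightarrow> h z = 0" and w: "R1 < dist a w" for h h' :: "complex \<Rightarrow> real" and w
    proof -
      have "\<forall>\<^sub>F s in nhds (0::real). h (w + of_real s * e) = 0"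
      proof -
        have "\<forall>\<^sub>F s in nhds (0::real). s \<in> ball 0 (dist a w - R1)"
          using w by (intro eventually_nhds_in_open) auto
        then show ?thesis
        proof eventually_elim
          case (elim s)
          have "dist a w \<le> dist a (w + of_real s * e) + \<bar>s\<bar>"
            using dist_triangle[of a w "w + of_real s * e"] te[of s] by (simp add: dist_norm norm_minus_commute)
          then show ?case using elim by (intro z) (simp add: dist_norm)
        qed
      qed
      then have "((\<lambda>s. h (w + of_real s * e)) has_real_derivative 0) (at 0)"
        by (subst DERIV_cong_ev[OF refl _ refl]) auto
      then show ?thesis using h[of w] DERIV_unique by blast
    qed
    have 1: "\<psi>1 z = 0" if "R1 < dist a z" for z using loc[of \<psi> \<psi>1, OF \<psi>] supp that by (meson less_imp_le)
    show "\<psi>1 z = 0" "\<psi>2 z = 0" using 1 loc[of \<psi>1 \<psi>2, OF \<psi>1] that by blast+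
  qed
  obtain K where K: "\<And>z. z \<in> B \<Longrightarrow> \<bar>\<psi>2 z\<bar> \<le> K" "\<And>z. z \<in> B \<Longrightarrow> \<bar>g2 z\<bar> \<le> K" "K \<ge> 0"
  proof -
    have "compact ((\<lambda>z. \<bar>\<psi>2 z\<bar> + \<bar>g2 z\<bar>) ` B)" unfolding B_def
      by (rule compact_continuous_image) (auto intro!: continuous_intros cont continuous_on_subset[OF cont(4)])
    then obtain K where "\<And>x. x \<in> (\<lambda>z. \<bar>\<psi>2 z\<bar> + \<bar>g2 z\<bar>) ` B \<Longrightarrow> norm x \<le> K"
      by (meson bounded_iff compact_imp_bounded)
    then have "\<And>z. z \<in> B \<Longrightarrow> \<bar>\<psi>2 z\<bar> + \<bar>g2 z\<bar> \<le> max K 0" by fastforce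
    then show ?thesis by (intro that[of "max K 0"]) fastforce+
  qed
  have K\<psi>: "\<bar>\<psi>2 z\<bar> \<le> K" for z
  proof (cases "z \<in> B")
    case False
    then have "R1 < dist a z" using R by (auto simp: B_def)
    then show ?thesis using out(2) K(3) by simp
  qed (use K in auto)
  have cB: "compact B" by (simp add: B_def)
  have ic: "integrable lborel (\<lambda>z. indicator B z * f z)" if "continuous_on B f" for f :: "complex \<Rightarrow> real"
    using borel_integrable_compact[OF cB that] by simp
  have m\<psi>: "\<psi> \<in> borel_measurable borel" "\<psi>2 \<in> borel_measurable borel"
    using cont by (auto intro: borel_measurable_continuous_onI)
  have mg0: "g0 \<in> borel_measurable borel"
    using borel_measurable_integrable[OF ic[OF cont(1)[folded B_def]]] by (simp add: g0_def)
  have mg2: "(\<lambda>z. indicator B z * g2 z) \<in> borel_measurable borel"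
    using borel_measurable_integrable[OF ic[OF cont(2)[folded B_def]]] by simp
  have sh: "(\<lambda>z. z + c) \<in> borel_measurable borel" for c :: complex by simp
  have ig: "integrable lborel (\<lambda>z. g0 z * \<psi> (z + c))" for c
  proof -
    have "continuous_on B (\<lambda>z. \<psi> (z + c))"
      by (rule continuous_on_compose2[OF cont(3)]) (auto intro!: continuous_intros)
    then have "continuous_on B (\<lambda>z. g z * \<psi> (z + c))" using cont(1) by (intro continuous_on_mult) (simp_all add: B_def)
    from ic[OF this] show ?thesis by (simp add: g0_def mult.assoc)
  qed
  have ig': "integrable lborel (\<lambda>z. \<psi> z * g0 (z + c))" "(\<integral>z. g0 z * \<psi> (z + c) \<partial>lborel) = (\<integral>z. \<psi> z * g0 (z + - c) \<partial>lborel)" for c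
    using lborel_translate(1)[OF ig[of "-c"], of c] lborel_translate(2)[OF ig[of c], of "-c"] by (simp_all add: mult.commute)
  define A where "A = (\<lambda>n z. (\<psi> (z + of_real (t n) * e) + \<psi> (z - of_real (t n) * e) - 2 * \<psi> z) / (t n)\<^sup>2)"
  define C where "C = (\<lambda>n z. (g0 (z + of_real (t n) * e) + g0 (z - of_real (t n) * e) - 2 * g0 z) / (t n)\<^sup>2)"
  \<comment> \<open>Summation by parts: a shift of \<psi> becomes the opposite shift of
    \<open>g0\<close> by translating the variable. Near the edge of the ball the cut-off spoils the
    difference quotient of \<open>g0\<close>, but \<psi> vanishes there.\<close>
  have eq: "(\<integral>z. g0 z * A n z \<partial>lborel) = (\<integral>z. \<psi> z * C n z \<partial>lborel)" for n
  proof -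
    let ?c = "of_real (t n) * e"
    have "(\<integral>z. g0 z * A n z \<partial>lborel) = (\<integral>z. (g0 z * \<psi> (z + ?c) + g0 z * \<psi> (z + - ?c) - 2 * (g0 z * \<psi> (z + 0))) / (t n)\<^sup>2 \<partial>lborel)"
      by (simp add: A_def algebra_simps)
    also have "\<dots> = ((\<integral>z. g0 z * \<psi> (z + ?c) \<partial>lborel) + (\<integral>z. g0 z * \<psi> (z + - ?c) \<partial>lborel) - 2 * (\<integral>z. g0 z * \<psi> (z + 0) \<partial>lborel)) / (t n)\<^sup>2"
      using ig[of ?c] ig[of "- ?c"] ig[of 0] by simp
    also have "\<dots> = ((\<integral>z. \<psi> z * g0 (z + - ?c) \<partial>lborel) + (\<integral>z. \<psi> z * g0 (z + ?c) \<partial>lborel) - 2 * (\<integral>z. \<psi> z * g0 (z + 0) \<partial>lborel)) / (t n)\<^sup>2"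
      unfolding ig'(2) by simp
    also have "\<dots> = (\<integral>z. (\<psi> z * g0 (z + - ?c) + \<psi> z * g0 (z + ?c) - 2 * (\<psi> z * g0 (z + 0))) / (t n)\<^sup>2 \<partial>lborel)"
      using ig'(1)[of ?c] ig'(1)[of "- ?c"] ig'(1)[of 0] by simp
    also have "\<dots> = (\<integral>z. \<psi> z * C n z \<partial>lborel)"
      by (simp add: C_def algebra_simps)
    finally show ?thesis .
  qed
  have lim: "(\<lambda>n. (h (z + of_real (t n) * e) + h (z - of_real (t n) * e) - 2 * h z) / (t n)\<^sup>2) \<longlonglongrightarrow> h2 z"
    if d: "\<And>n. \<exists>\<alpha> \<beta>. \<bar>\<alpha>\<bar> \<le> t n \<and> \<bar>\<beta>\<bar> \<le> t n \<and>
      h (z + of_real (t n) * e) + h (z - of_real (t n) * e) - 2 * h z = (t n)\<^sup>2 * (h2 (z + of_real \<alpha> * e) + h2 (z + of_real \<beta> * e)) / 2"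
      and c: "isCont h2 z" for h h2 :: "complex \<Rightarrow> real" and z
  proof -
    obtain \<alpha> \<beta> where ab: "\<And>n. \<bar>\<alpha> n\<bar> \<le> t n" "\<And>n. \<bar>\<beta> n\<bar> \<le> t n"
      "\<And>n. h (z + of_real (t n) * e) + h (z - of_real (t n) * e) - 2 * h z = (t n)\<^sup>2 * (h2 (z + of_real (\<alpha> n) * e) + h2 (z + of_real (\<beta> n) * e)) / 2"
      using d by metis
    have "\<alpha> \<longlonglongrightarrow> 0" "\<beta> \<longlonglongrightarrow> 0"
      using ab(1,2) by (auto intro!: Lim_null_comparison[OF _ t0])
    moreover have "(\<lambda>n. z + of_real (\<gamma> n) * e) \<longlonglongrightarrow> z + of_real 0 * e" if "\<gamma> \<longlonglongrightarrow> 0" for \<gamma> :: "nat \<Rightarrow> real"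
      using that by (intro tendsto_intros)
    ultimately have "(\<lambda>n. (h2 (z + of_real (\<alpha> n) * e) + h2 (z + of_real (\<beta> n) * e)) / 2) \<longlonglongrightarrow> (h2 z + h2 z) / 2"
      using c by (intro tendsto_intros isCont_tendsto_compose[OF c]) simp_all
    moreover have "(t n)\<^sup>2 \<noteq> 0" for n using t(1)[of n] by simp
    ultimately show ?thesis by (simp add: ab(3))
  qed
  have sd\<psi>: "\<exists>\<alpha> \<beta>. \<bar>\<alpha>\<bar> \<le> t n \<and> \<bar>\<beta>\<bar> \<le> t n \<and>
      \<psi> (z + of_real (t n) * e) + \<psi> (z - of_real (t n) * e) - 2 * \<psi> z = (t n)\<^sup>2 * (\<psi>2 (z + of_real \<alpha> * e) + \<psi>2 (z + of_real \<beta> * e)) / 2" for n z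
    by (rule second_difference[of "t n" z e UNIV \<psi> \<psi>1 \<psi>2]) (use t(1) \<psi> \<psi>1 in auto)
  have inB: "z + of_real s * e \<in> B" if "dist a z < R1" "\<bar>s\<bar> \<le> t n" for s n z
  proof -
    have "dist a (z + of_real s * e) \<le> dist a z + \<bar>s\<bar>"
      using dist_triangle[of a "z + of_real s * e" z] te[of s] by (simp add: dist_norm)
    then show ?thesis using that t(2)[of n] by (simp add: B_def)
  qed
  have g0B: "g0 z = g z" if "z \<in> B" for z using that by (simp add: g0_def)
  have sdg: "\<exists>\<alpha> \<beta>. \<bar>\<alpha>\<bar> \<le> t n \<and> \<bar>\<beta>\<bar> \<le> t n \<and>
      g0 (z + of_real (t n) * e) + g0 (z - of_real (t n) * e) - 2 * g0 z = (t n)\<^sup>2 * (g2 (z + of_real \<alpha> * e) + g2 (z + of_real \<beta> * e)) / 2" if z: "dist a z < R1" for n z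
  proof -
    have "g0 (z + of_real (t n) * e) = g (z + of_real (t n) * e)" "g0 (z - of_real (t n) * e) = g (z - of_real (t n) * e)" "g0 z = g z"
      using inB[OF z, of "t n" n] inB[OF z, of "- t n" n] inB[OF z, of 0 n] t(1)[of n] by (auto intro!: g0B)
    moreover have *: "z + of_real s * e \<in> \<Omega>" if "\<bar>s\<bar> \<le> t n" for s
      using inB[OF z that] \<Omega> by (auto simp: B_def)
    obtain \<alpha> \<beta> where "\<bar>\<alpha>\<bar> \<le> t n" "\<bar>\<beta>\<bar> \<le> t n"
      "g (z + of_real (t n) * e) + g (z - of_real (t n) * e) - 2 * g z = (t n)\<^sup>2 * (g2 (z + of_real \<alpha> * e) + g2 (z + of_real \<beta> * e)) / 2"
      by (rule second_difference[of "t n" z e \<Omega> g g1 g2, OF t(1) * g g1])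
    ultimately show ?thesis by (intro exI[of _ \<alpha>] exI[of _ \<beta>]) simp
  qed
  have ci: "isCont g2 z" if "dist a z < R1" for z
    using cont(2) that R by (intro continuous_on_interior[OF cont(2)]) auto
  have "(\<lambda>n. \<integral>z. g0 z * A n z \<partial>lborel) \<longlonglongrightarrow> (\<integral>z. g0 z * \<psi>2 z \<partial>lborel)"
  proof (rule integral_dominated_convergence[where w="\<lambda>z. indicator B z * (\<bar>g z\<bar> * K)"])
    show "integrable lborel (\<lambda>z. indicator B z * (\<bar>g z\<bar> * K))"
      using cont(1) by (intro ic continuous_intros) (simp add: B_def)
    show "AE z in lborel. (\<lambda>n. g0 z * A n z) \<longlonglongrightarrow> g0 z * \<psi>2 z"
    proof (intro AE_I2 tendsto_mult tendsto_const)
      fix z :: complex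
      show "(\<lambda>n. A n z) \<longlonglongrightarrow> \<psi>2 z" unfolding A_def
        by (rule lim[OF sd\<psi>]) (use cont(4) in \<open>auto simp: continuous_on_eq_continuous_at\<close>)
    qed
    fix n
    have "\<bar>A n z\<bar> \<le> K" for z
    proof -
      obtain \<alpha> \<beta> where "\<psi> (z + of_real (t n) * e) + \<psi> (z - of_real (t n) * e) - 2 * \<psi> z = (t n)\<^sup>2 * (\<psi>2 (z + of_real \<alpha> * e) + \<psi>2 (z + of_real \<beta> * e)) / 2"
        using sd\<psi> by blast
      then have "A n z = (\<psi>2 (z + of_real \<alpha> * e) + \<psi>2 (z + of_real \<beta> * e)) / 2"
        using t(1)[of n] by (simp add: A_def)
      then show ?thesis using K\<psi>[of "z + of_real \<alpha> * e"] K\<psi>[of "z + of_real \<beta> * e"] by (simp add: abs_le_iff)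
    qed
    then show "AE z in lborel. norm (g0 z * A n z) \<le> indicator B z * (\<bar>g z\<bar> * K)"
      by (intro AE_I2) (auto simp: g0_def abs_mult indicator_def intro!: mult_left_mono)
    show "(\<lambda>z. g0 z * A n z) \<in> borel_measurable lborel" unfolding A_def using mg0 m\<psi> by simp
  qed (use mg0 m\<psi> in simp)
  moreover have "(\<lambda>n. \<integral>z. \<psi> z * C n z \<partial>lborel) \<longlonglongrightarrow> (\<integral>z. \<psi> z * (indicator B z * g2 z) \<partial>lborel)"
  proof (rule integral_dominated_convergence[where w="\<lambda>z. indicator B z * (\<bar>\<psi> z\<bar> * K)"])
    show "integrable lborel (\<lambda>z. indicator B z * (\<bar>\<psi> z\<bar> * K))"
      by (intro ic continuous_intros continuous_on_subset[OF cont(3)]) simp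
    show "AE z in lborel. (\<lambda>n. \<psi> z * C n z) \<longlonglongrightarrow> \<psi> z * (indicator B z * g2 z)"
    proof (intro AE_I2)
      fix z :: complex
      show "(\<lambda>n. \<psi> z * C n z) \<longlonglongrightarrow> \<psi> z * (indicator B z * g2 z)"
      proof (cases "dist a z < R1")
        case True
        have "(\<lambda>n. C n z) \<longlonglongrightarrow> g2 z" unfolding C_def by (rule lim[OF sdg[OF True] ci[OF True]])
        moreover have "z \<in> B" using True R by (simp add: B_def)
        ultimately show ?thesis by (auto intro!: tendsto_intros)
      qed (use supp in simp)
    qed
    fix n
    show "AE z in lborel. norm (\<psi> z * C n z) \<le> indicator B z * (\<bar>\<psi> z\<bar> * K)"
    proof (intro AE_I2)
      fix z :: complex
      show "norm (\<psi> z * C n z) \<le> indicator B z * (\<bar>\<psi> z\<bar> * K)"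
      proof (cases "dist a z < R1")
        case True
        then obtain \<alpha> \<beta> where *: "\<bar>\<alpha>\<bar> \<le> t n" "\<bar>\<beta>\<bar> \<le> t n"
          "g0 (z + of_real (t n) * e) + g0 (z - of_real (t n) * e) - 2 * g0 z = (t n)\<^sup>2 * (g2 (z + of_real \<alpha> * e) + g2 (z + of_real \<beta> * e)) / 2"
          using sdg by blast
        then have "C n z = (g2 (z + of_real \<alpha> * e) + g2 (z + of_real \<beta> * e)) / 2"
          using t(1)[of n] by (simp add: C_def)
        moreover have "\<bar>g2 (z + of_real \<alpha> * e)\<bar> \<le> K" "\<bar>g2 (z + of_real \<beta> * e)\<bar> \<le> K"
          using inB[OF True] * by (auto intro!: K)
        ultimately have "\<bar>C n z\<bar> \<le> K" by (simp add: abs_le_iff)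
        moreover have "z \<in> B" using True R by (simp add: B_def)
        ultimately show ?thesis by (auto simp: abs_mult intro!: mult_left_mono)
      qed (use supp in simp)
    qed
    show "(\<lambda>z. \<psi> z * C n z) \<in> borel_measurable lborel" unfolding C_def using mg0 m\<psi> by simp
  qed (use mg2 m\<psi> in simp)
  ultimately have "(\<integral>z. g0 z * \<psi>2 z \<partial>lborel) = (\<integral>z. \<psi> z * (indicator B z * g2 z) \<partial>lborel)"
    unfolding eq by (rule LIMSEQ_unique)
  then show ?thesis by (simp add: g0_def B_def mult_ac)
qed

lemma C2_partials:
  assumes "C_k_on 2 u S" "open S" "z \<in> S"
  shows "((\<lambda>t. u (z + of_real t * 1)) has_real_derivative partial_x u z) (at 0)"
    "((\<lambda>t. u (z + of_real t * \<i>)) has_real_derivative partial_y u z) (at 0)"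
    "((\<lambda>t. partial_x u (z + of_real t * 1)) has_real_derivative partial_x (partial_x u) z) (at 0)"
    "((\<lambda>t. partial_y u (z + of_real t * \<i>)) has_real_derivative partial_y (partial_y u) z) (at 0)"
proof -
  note d = C2_differentiable[OF assms]
  show "((\<lambda>t. u (z + of_real t * 1)) has_real_derivative partial_x u z) (at 0)"
    "((\<lambda>t. u (z + of_real t * \<i>)) has_real_derivative partial_y u z) (at 0)"
    "((\<lambda>t. partial_x u (z + of_real t * 1)) has_real_derivative partial_x (partial_x u) z) (at 0)"
    "((\<lambda>t. partial_y u (z + of_real t * \<i>)) has_real_derivative partial_y (partial_y u) z) (at 0)"
    using partials_of_derivative(1,2)[OF has_derivative_partials[OF d(1)]]
      partials_of_derivative(1)[OF has_derivative_partials[OF d(2)]]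
      partials_of_derivative(2)[OF has_derivative_partials[OF d(3)]]
    by (simp_all add: mult.commute)
qed

lemma C2_continuous:
  assumes "C_k_on 2 u S"
  shows "continuous_on S u" "continuous_on S (partial_x (partial_x u))" "continuous_on S (partial_y (partial_y u))"
    "continuous_on S (flat_laplacian u)"
proof -
  show "continuous_on S u" using assms C_k_on_continuous by blast
  show "continuous_on S (partial_x (partial_x u))" "continuous_on S (partial_y (partial_y u))"
    using assms by (simp_all add: numeral_2_eq_2)
  then show "continuous_on S (flat_laplacian u)"
    unfolding flat_laplacian_def by (intro continuous_intros)
qed

lemma green_identity:
  assumes g: "C_k_on 2 g \<Omega>" "open \<Omega>" "cball a R \<subseteq> \<Omega>" and R: "0 < R1" "R1 < R"
    and \<psi>: "C_k_on 2 \<psi> UNIV" and supp: "\<And>z. R1 \<le> dist a z \<Longrightarrow> \<psi> z = 0"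
  shows "(LINT z:cball a R|lborel. g z * flat_laplacian \<psi> z) = (LINT z:cball a R|lborel. \<psi> z * flat_laplacian g z)"
proof -
  let ?B = "cball a R"
  note cg = C2_continuous[OF g(1), THEN continuous_on_subset, OF g(3)]
  note c\<psi> = C2_continuous[OF \<psi>]
  note c\<psi>B = c\<psi>[THEN continuous_on_subset, OF subset_UNIV[of ?B]]
  have ic: "set_integrable lborel ?B f" if "continuous_on ?B f" for f :: "complex \<Rightarrow> real"
    using borel_integrable_compact[OF compact_cball that] unfolding set_integrable_def by simp
  have "(LINT z:?B|lborel. g z * partial_x (partial_x \<psi>) z) = (LINT z:?B|lborel. \<psi> z * partial_x (partial_x g) z)"
    using green_direction[OF _ R g(3) C2_partials(1,3)[OF g(1,2)] C2_partials(1,3)[OF \<psi> open_UNIV UNIV_I] cg(1,2) c\<psi>(1,2) supp]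
    by (simp add: set_lebesgue_integral_def)
  moreover have "(LINT z:?B|lborel. g z * partial_y (partial_y \<psi>) z) = (LINT z:?B|lborel. \<psi> z * partial_y (partial_y g) z)"
    using green_direction[OF _ R g(3) C2_partials(2,4)[OF g(1,2)] C2_partials(2,4)[OF \<psi> open_UNIV UNIV_I] cg(1,3) c\<psi>(1,3) supp]
    by (simp add: set_lebesgue_integral_def)
  moreover have "set_integrable lborel ?B (\<lambda>z. g z * partial_x (partial_x \<psi>) z)" "set_integrable lborel ?B (\<lambda>z. g z * partial_y (partial_y \<psi>) z)"
    "set_integrable lborel ?B (\<lambda>z. \<psi> z * partial_x (partial_x g) z)" "set_integrable lborel ?B (\<lambda>z. \<psi> z * partial_y (partial_y g) z)"
    by (intro ic continuous_intros cg c\<psi>B)+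
  ultimately show ?thesis by (simp add: flat_laplacian_def distrib_left set_integral_add)
qed

lemma D_k_on_2I:
  assumes "\<And>t. t \<in> I \<Longrightarrow> (F has_real_derivative F' t) (at t)"
    "\<And>t. t \<in> I \<Longrightarrow> (F' has_real_derivative F'' t) (at t)" "continuous_on I F''"
  shows "D_k_on 2 F I"
  unfolding numeral_2_eq_2 D_k_on.simps using assms by blast

section \<open>Radial integrals and the logarithmic potential\<close>

lemma borel_measurable_indicator_scaleR:
  fixes f :: "'a::euclidean_space \<Rightarrow> real"
  assumes "S \<in> sets borel" "f \<in> borel_measurable borel"
  shows "(\<lambda>x. indicator S x *\<^sub>R f x) \<in> borel_measurable lborel"
  using assms by (intro borel_measurable_scaleR borel_measurable_indicator) auto

text \<open>The disc |z|^2 \<le> a has area pi a, which is linear in a, and the half-lines generate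
  the Borel sets. This is integration in polar coordinates for radial integrands.\<close>

lemma distr_norm_power2:
  "distr lborel borel (\<lambda>z::complex. (norm z)\<^sup>2) = density lborel (\<lambda>t. ennreal pi * indicator {0..} t)"
  (is "?M = ?N")
proof (rule measure_eqI_generator_eq[where E="range (\<lambda>a::real. {..a})" and A="\<lambda>n. {..real n}" and \<Omega>=UNIV])
  have eq: "emeasure ?M {..a} = (if a < 0 then 0 else ennreal (pi * a))" "emeasure ?N {..a} = (if a < 0 then 0 else ennreal (pi * a))" for a
  proof -
    have *: "(\<lambda>z::complex. (norm z)\<^sup>2) -` {..a} = (if a < 0 then {} else cball 0 (sqrt a))"
      by (auto simp: real_le_rsqrt not_less) (smt (verit) zero_le_power2 real_sqrt_le_iff real_sqrt_abs abs_norm_cancel)+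
    have "emeasure ?M {..a} = emeasure lborel ((\<lambda>z::complex. (norm z)\<^sup>2) -` {..a} \<inter> space lborel)"
      by (rule emeasure_distr) auto
    also have "\<dots> = (if a < 0 then 0 else ennreal (pi * a))"
      unfolding * by (simp add: emeasure_cball unit_ball_vol_2)
    finally show "emeasure ?M {..a} = (if a < 0 then 0 else ennreal (pi * a))" .
    have "emeasure ?N {..a} = (\<integral>\<^sup>+t. ennreal pi * indicator {0..a} t \<partial>lborel)"
      by (subst emeasure_density) (auto intro!: nn_integral_cong simp: indicator_def)
    also have "\<dots> = (if a < 0 then 0 else ennreal (pi * a))"
      by (auto simp: nn_integral_cmult ennreal_mult)
    finally show "emeasure ?N {..a} = (if a < 0 then 0 else ennreal (pi * a))" .
  qed
  show "X \<in> range (\<lambda>a. {..a}) \<Longrightarrow> emeasure ?M X = emeasure ?N X" for X by (auto simp: eq)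
  show "emeasure ?M {..real i} \<noteq> \<infinity>" for i by (simp add: eq)
  show "Int_stable (range (\<lambda>a::real. {..a}))" by (auto simp: Int_stable_def)
  have "sets (borel :: real measure) = sigma_sets UNIV (range (\<lambda>a. {..a}))"
    by (subst borel_eq_atMost) (rule sets_measure_of, simp)
  then show "sets ?M = sigma_sets UNIV (range (\<lambda>a. {..a}))" "sets ?N = sigma_sets UNIV (range (\<lambda>a. {..a}))"
    by simp_all
  show "(\<Union>i. {..real i}) = UNIV" using real_arch_simple by auto
qed auto

lemma nn_integral_radial:
  assumes [measurable]: "q \<in> borel_measurable borel"
  shows "(\<integral>\<^sup>+(z::complex). q ((norm z)\<^sup>2) \<partial>lborel) = ennreal pi * (\<integral>\<^sup>+t. q t * indicator {0..} t \<partial>lborel)"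
proof -
  have "(\<integral>\<^sup>+(z::complex). q ((norm z)\<^sup>2) \<partial>lborel) = (\<integral>\<^sup>+t. q t \<partial>distr lborel borel (\<lambda>z::complex. (norm z)\<^sup>2))"
    by (subst nn_integral_distr) auto
  also have "\<dots> = (\<integral>\<^sup>+t. (ennreal pi * indicator {0..} t) * q t \<partial>lborel)"
    unfolding distr_norm_power2 by (subst nn_integral_density) auto
  also have "\<dots> = ennreal pi * (\<integral>\<^sup>+t. q t * indicator {0..} t \<partial>lborel)"
    by (subst nn_integral_cmult[symmetric]) (auto intro!: nn_integral_cong simp: mult_ac)
  finally show ?thesis .
qed

text \<open>In the variable t = |z|^2 the integrand has the antiderivative -2 / (1 + t). This
  density is the rescaled Laplacian of the regularised logarithm, and its mass is the factor 2 pi in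
  \<open>laplacian_ln_norm\<close>.\<close>

lemma integral_fubini_study:
  "integrable lborel (\<lambda>z::complex. 2 / (1 + (norm z)\<^sup>2)\<^sup>2)" "(\<integral>(z::complex). 2 / (1 + (norm z)\<^sup>2)\<^sup>2 \<partial>lborel) = 2 * pi"
proof -
  have "(\<integral>\<^sup>+t. ennreal (2 / (1 + t)\<^sup>2) * indicator {0..} t \<partial>lborel) = ennreal (0 - (- 2 / (1 + 0)))"
  proof (rule nn_integral_FTC_atLeast)
    show "((\<lambda>t. - 2 / (1 + t)) has_real_derivative 2 / (1 + x)\<^sup>2) (at x)" if "0 \<le> x" for x :: real
      using that by (auto intro!: derivative_eq_intros simp: power2_eq_square)
    show "((\<lambda>t::real. - 2 / (1 + t)) \<longlongrightarrow> 0) at_top" by real_asymp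
  qed auto
  then have "(\<integral>\<^sup>+(z::complex). ennreal (2 / (1 + (norm z)\<^sup>2)\<^sup>2) \<partial>lborel) = ennreal pi * 2"
    using nn_integral_radial[of "\<lambda>t. ennreal (2 / (1 + t)\<^sup>2)"] by simp
  also have "\<dots> = ennreal (2 * pi)" by (simp add: ennreal_mult' mult.commute)
  finally have *: "(\<integral>\<^sup>+(z::complex). ennreal (2 / (1 + (norm z)\<^sup>2)\<^sup>2) \<partial>lborel) = ennreal (2 * pi)" .
  have "has_bochner_integral lborel (\<lambda>z::complex. 2 / (1 + (norm z)\<^sup>2)\<^sup>2) (2 * pi)"
    by (rule has_bochner_integral_nn_integral[OF _ _ _ *]) auto
  then show "integrable lborel (\<lambda>z::complex. 2 / (1 + (norm z)\<^sup>2)\<^sup>2)" "(\<integral>(z::complex). 2 / (1 + (norm z)\<^sup>2)\<^sup>2 \<partial>lborel) = 2 * pi"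
    by (auto simp: has_bochner_integral_iff)
qed

text \<open>In t = |z|^2 the singularity becomes t to the power -1/2, which is integrable at 0.
  Through \<open>abs_ln_le\<close> this function dominates the logarithm near its pole.\<close>

lemma set_integrable_inverse_norm: "set_integrable lborel (cball a r) (\<lambda>z::complex. inverse (norm (z - b)))"
proof -
  \<comment> \<open>A disc of this radius about the singularity \<open>b\<close> contains the given
    disc about \<open>a\<close>.\<close>
  define s where "s = r + norm (a - b)"
  have fin: "(\<integral>\<^sup>+(z::complex). ennreal (indicator {0..s\<^sup>2} ((norm z)\<^sup>2) * ((norm z)\<^sup>2) powr (-1/2)) \<partial>lborel) < \<infinity>"
  proof -
    have "((\<lambda>x::real. x powr (-1/2)) has_integral (s\<^sup>2 powr (-1/2+1) / (-1/2+1))) {0..s\<^sup>2}"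
      by (rule has_integral_powr_from_0) auto
    then have "((\<lambda>x::real. indicator {0..s\<^sup>2} x * x powr (-1/2)) has_integral (s\<^sup>2 powr (-1/2+1) / (-1/2+1))) UNIV"
    proof -
      have "(\<lambda>x::real. indicator {0..s\<^sup>2} x * x powr (-1/2)) = (\<lambda>x. if x \<in> {0..s\<^sup>2} then x powr (-1/2) else 0)"
        by (auto simp: indicator_def)
      then show ?thesis using \<open>(_ has_integral _) _\<close> by (simp only: has_integral_restrict_UNIV)
    qed
    then have "(\<integral>\<^sup>+x. ennreal (indicator {0..s\<^sup>2} x * x powr (-1/2)) \<partial>lborel) = ennreal (s\<^sup>2 powr (-1/2+1) / (-1/2+1))"
      by (intro nn_integral_has_integral_lborel) (auto simp: indicator_def)
    moreover have "(\<integral>\<^sup>+x. ennreal (indicator {0..s\<^sup>2} x * x powr (-1/2)) * indicator {0..} x \<partial>lborel) = (\<integral>\<^sup>+x. ennreal (indicator {0..s\<^sup>2} x * x powr (-1/2)) \<partial>lborel)"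
      by (rule nn_integral_cong) (auto simp: indicator_def)
    ultimately show ?thesis
      by (subst nn_integral_radial) (auto simp: ennreal_mult_less_top)
  qed
  have fin': "(\<integral>\<^sup>+(z::complex). ennreal (indicator (cball 0 s) z * inverse (norm z)) \<partial>lborel) < \<infinity>"
  proof (rule le_less_trans[OF nn_integral_mono fin])
    fix z :: complex
    show "ennreal (indicator (cball 0 s) z * inverse (norm z)) \<le> ennreal (indicator {0..s\<^sup>2} ((norm z)\<^sup>2) * ((norm z)\<^sup>2) powr (-1/2))"
    proof (cases "z \<in> cball 0 s \<and> z \<noteq> 0")
      case True
      then have "((norm z)\<^sup>2) powr (-1/2) = inverse (norm z)"
        by (simp add: powr_minus powr_half_sqrt)
      moreover have "(norm z)\<^sup>2 \<le> s\<^sup>2" using True by (intro power_mono) auto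
      ultimately show ?thesis by (auto simp: indicator_def)
    qed (auto simp: indicator_def)
  qed
  have int0: "integrable lborel (\<lambda>z::complex. indicator (cball 0 s) z * inverse (norm z))"
  proof (rule integrableI_nonneg)
    show "(\<lambda>z::complex. indicator (cball 0 s) z * inverse (norm z) :: real) \<in> borel_measurable lborel"
      by (intro borel_measurable_times borel_measurable_indicator) auto
  qed (use fin' in auto)
  have "integrable lborel (\<lambda>z::complex. indicator (cball 0 s) (z - b) * inverse (norm (z - b)))"
    using lborel_translate(1)[OF int0, of "- b"] by simp
  then have *: "set_integrable lborel (cball b s) (\<lambda>z::complex. inverse (norm (z - b)))"
    unfolding set_integrable_def by (rule back_subst[of "integrable lborel"]) (auto simp: indicator_def dist_norm norm_minus_commute)
  have "cball a r \<subseteq> cball b s"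
    by (auto simp: s_def dist_norm) (metis add.commute add_mono_thms_linordered_semiring(1) dist_commute dist_norm dist_triangle order_trans order_refl)
  from set_integrable_subset[OF * _ this] show ?thesis by simp
qed

lemma abs_ln_le: "0 < x \<Longrightarrow> \<bar>ln x\<bar> \<le> x + inverse (x::real)"
  using ln_bound[of x] ln_bound[of "inverse x"] by (auto simp: ln_inverse abs_le_iff intro: order_trans add_increasing add_increasing2)

lemma set_integrable_ln_norm: "set_integrable lborel (cball a r) (\<lambda>z::complex. ln (norm (z - b)))"
proof (rule set_integrable_bound[where f="\<lambda>z. norm (z - b) + inverse (norm (z - b))"])
  show "set_integrable lborel (cball a r) (\<lambda>z. norm (z - b) + inverse (norm (z - b)))"
    by (intro set_integral_add(1) set_integrable_inverse_norm)
      (unfold set_integrable_def, rule borel_integrable_compact, auto intro!: continuous_intros)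
  show "set_borel_measurable lborel (cball a r) (\<lambda>z. ln (norm (z - b)))"
  proof -
    have "(\<lambda>z. ln (norm (z - b))) \<in> borel_measurable borel" by measurable
    then show ?thesis unfolding set_borel_measurable_def
      by (intro borel_measurable_scaleR borel_measurable_indicator) auto
  qed
  show "AE z in lborel. z \<in> cball a r \<longrightarrow> norm (ln (norm (z - b))) \<le> norm (norm (z - b) + inverse (norm (z - b)))"
  proof (intro AE_I2 impI)
    fix z show "norm (ln (norm (z - b))) \<le> norm (norm (z - b) + inverse (norm (z - b)))"
      using abs_ln_le[of "norm (z - b)"] by (cases "z = b") auto
  qed
qed

lemma integral_dilation:
  fixes f :: "complex \<Rightarrow> real"
  assumes [measurable]: "f \<in> borel_measurable borel" and "\<epsilon> > 0"
  shows "(\<integral>z. f z \<partial>lborel) = (\<integral>z. \<epsilon>\<^sup>2 * f (a + \<epsilon> *\<^sub>R z) \<partial>lborel)"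
proof -
  have "(\<integral>z. f z \<partial>lborel) = (\<integral>z. f z \<partial>density (distr lborel borel (\<lambda>x. a + \<epsilon> *\<^sub>R x)) (\<lambda>_. ennreal (\<epsilon>\<^sup>2)))"
    using assms(2) by (subst lborel_affine[of \<epsilon> a]) (auto simp: power2_eq_square)
  also have "\<dots> = (\<integral>z. \<epsilon>\<^sup>2 * f z \<partial>distr lborel borel (\<lambda>x. a + \<epsilon> *\<^sub>R x))"
    by (subst integral_density) auto
  also have "\<dots> = (\<integral>z. \<epsilon>\<^sup>2 * f (a + \<epsilon> *\<^sub>R z) \<partial>lborel)"
    by (subst integral_distr) auto
  finally show ?thesis .
qed

text \<open>\<open>ln |z - b| / (2\<pi>)\<close> is the fundamental solution; it is regularised as \<open>ln (|z - b|\<^sup>2 + \<epsilon>\<^sup>2) / 2\<close>.\<close>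

lemma laplacian_ln_norm:
  assumes R: "0 < R1" "R1 < R" and \<psi>: "C_k_on 2 \<psi> UNIV" and supp: "\<And>z. R1 \<le> dist a z \<Longrightarrow> \<psi> z = 0"
  shows "(LINT z:cball a R|lborel. ln (norm (z - b)) * flat_laplacian \<psi> z) = 2 * pi * \<psi> b"
proof -
  define \<epsilon> where "\<epsilon> = (\<lambda>n. inverse (real (Suc n)))"
  have \<epsilon>: "\<epsilon> n > 0" "\<epsilon> n \<le> 1" for n by (auto simp: \<epsilon>_def field_simps)
  have \<epsilon>0: "\<epsilon> \<longlonglongrightarrow> 0" unfolding \<epsilon>_def by (rule LIMSEQ_inverse_real_of_nat)
  define F where "F = (\<lambda>n t. ln (t + (\<epsilon> n)\<^sup>2) / 2)"
  have c\<psi>: "continuous_on UNIV \<psi>" "continuous_on UNIV (flat_laplacian \<psi>)" using C2_continuous[OF \<psi>] by auto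
  have m\<psi>[measurable]: "\<psi> \<in> borel_measurable borel" "flat_laplacian \<psi> \<in> borel_measurable borel"
    using c\<psi> by (auto intro: borel_measurable_continuous_onI)
  have F: "C_k_on 2 (\<lambda>z. F n ((norm (z - b))\<^sup>2)) UNIV"
    "flat_laplacian (\<lambda>z. F n ((norm (z - b))\<^sup>2)) z = 2 * (\<epsilon> n)\<^sup>2 / ((norm (z - b))\<^sup>2 + (\<epsilon> n)\<^sup>2)\<^sup>2" for n z
  proof -
    let ?I = "{- (\<epsilon> n)\<^sup>2<..}" and ?e = "(\<epsilon> n)\<^sup>2"
    have e: "?e > 0" using \<epsilon>[of n] by simp
    have d1: "(F n has_real_derivative 1 / 2 * inverse (t + ?e)) (at t)" if "t > - ?e" for t
    proof -
      have "((\<lambda>t. ln (t + ?e)) has_real_derivative inverse (t + ?e) * 1) (at t)"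
        by (rule DERIV_chain2[OF DERIV_ln]) (use that in \<open>auto intro!: derivative_eq_intros\<close>)
      from DERIV_cmult[OF this, of "1/2"] show ?thesis by (simp add: F_def)
    qed
    have d2: "((\<lambda>t. 1 / 2 * inverse (t + ?e)) has_real_derivative 1 / 2 * - (inverse (t + ?e) * 1 * inverse (t + ?e))) (at t)" if "t > - ?e" for t
      by (rule DERIV_cmult, rule DERIV_inverse') (use that in \<open>auto intro!: derivative_eq_intros\<close>)
    have "continuous_on ?I (\<lambda>t. 1 / 2 * - (inverse (t + ?e) * 1 * inverse (t + ?e)))" by (intro continuous_intros) auto
    then have "D_k_on 2 (F n) ?I" by (intro D_k_on_2I[OF d1 d2]) auto
    then show "C_k_on 2 (\<lambda>z. F n ((norm (z - b))\<^sup>2)) UNIV"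
      by (rule C_k_on_radial) (use e in \<open>auto intro: less_le_trans[of _ 0]\<close>)
    have "flat_laplacian (\<lambda>z. F n ((norm (z - b))\<^sup>2)) z
      = 4 * (1 / 2 * inverse ((norm (z - b))\<^sup>2 + ?e) + (norm (z - b))\<^sup>2 * (1 / 2 * - (inverse ((norm (z - b))\<^sup>2 + ?e) * 1 * inverse ((norm (z - b))\<^sup>2 + ?e))))"
      by (rule flat_laplacian_radial[OF d1 d2]) (use e in linarith)+
    also have "\<dots> = 2 * ?e / ((norm (z - b))\<^sup>2 + ?e)\<^sup>2"
    proof -
      define T where "T = (norm (z - b))\<^sup>2"
      have "T + ?e > 0" using e by (simp add: T_def add_nonneg_pos)
      then have "4 * (1 / 2 * inverse (T + ?e) + T * (1 / 2 * - (inverse (T + ?e) * 1 * inverse (T + ?e)))) = 2 * ?e / (T + ?e)\<^sup>2"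
        by (simp add: divide_simps power2_eq_square) (simp add: algebra_simps)
      then show ?thesis by (simp only: T_def)
    qed
    finally show "flat_laplacian (\<lambda>z. F n ((norm (z - b))\<^sup>2)) z = 2 * ?e / ((norm (z - b))\<^sup>2 + ?e)\<^sup>2" .
  qed
  define B where "B = cball a R"
  have zero: "\<psi> z = 0" if "z \<notin> B" for z using that R supp by (auto simp: B_def)
  \<comment> \<open>The Laplacian of the regularised logarithm concentrates at \<open>b\<close> at
    scale \<open>\<epsilon> n\<close>. The substitution z = b + \<epsilon> \<zeta> moves all
    dependence on \<open>n\<close> into the argument of \<psi>, against a fixed integrable
    density.\<close>
  have gi: "(LINT z:B|lborel. F n ((norm (z - b))\<^sup>2) * flat_laplacian \<psi> z) = (\<integral>\<zeta>. \<psi> (b + \<epsilon> n *\<^sub>R \<zeta>) * (2 / (1 + (norm \<zeta>)\<^sup>2)\<^sup>2) \<partial>lborel)" for n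
  proof -
    let ?f = "\<lambda>z. \<psi> z * (2 * (\<epsilon> n)\<^sup>2 / ((norm (z - b))\<^sup>2 + (\<epsilon> n)\<^sup>2)\<^sup>2)"
    have "(LINT z:B|lborel. F n ((norm (z - b))\<^sup>2) * flat_laplacian \<psi> z) = (LINT z:B|lborel. ?f z)"
      unfolding B_def using green_identity[OF F(1) open_UNIV _ R \<psi> supp] by (simp add: F(2))
    also have "\<dots> = (\<integral>z. ?f z \<partial>lborel)"
      unfolding set_lebesgue_integral_def by (rule Bochner_Integration.integral_cong) (use zero in \<open>auto simp: indicator_def\<close>)
    also have "\<dots> = (\<integral>\<zeta>. (\<epsilon> n)\<^sup>2 * ?f (b + \<epsilon> n *\<^sub>R \<zeta>) \<partial>lborel)"
      by (rule integral_dilation) (use \<epsilon> in auto)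
    also have "\<dots> = (\<integral>\<zeta>. \<psi> (b + \<epsilon> n *\<^sub>R \<zeta>) * (2 / (1 + (norm \<zeta>)\<^sup>2)\<^sup>2) \<partial>lborel)"
    proof (rule Bochner_Integration.integral_cong[OF refl])
      fix \<zeta> :: complex
      define e T where "e = (\<epsilon> n)\<^sup>2" and "T = 1 + (norm \<zeta>)\<^sup>2"
      have e: "e > 0" "T > 0" using \<epsilon>[of n] by (auto simp: e_def T_def add_pos_nonneg)
      have "(norm (b + \<epsilon> n *\<^sub>R \<zeta> - b))\<^sup>2 + (\<epsilon> n)\<^sup>2 = e * T"
        using \<epsilon>[of n] by (simp add: e_def T_def power_mult_distrib algebra_simps)
      moreover have "e * (2 * e / (e * T)\<^sup>2) = 2 / T\<^sup>2" using e by (simp add: divide_simps power2_eq_square)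
      ultimately show "(\<epsilon> n)\<^sup>2 * ?f (b + \<epsilon> n *\<^sub>R \<zeta>) = \<psi> (b + \<epsilon> n *\<^sub>R \<zeta>) * (2 / (1 + (norm \<zeta>)\<^sup>2)\<^sup>2)"
        by (simp only: e_def[symmetric] T_def[symmetric] mult.left_commute[of e])
    qed
    finally show ?thesis .
  qed
  obtain K where K: "\<And>z. \<bar>\<psi> z\<bar> \<le> K" "\<And>z. z \<in> B \<Longrightarrow> \<bar>flat_laplacian \<psi> z\<bar> \<le> K" "K \<ge> 0"
  proof -
    have "compact ((\<lambda>z. \<bar>\<psi> z\<bar> + \<bar>flat_laplacian \<psi> z\<bar>) ` B)" unfolding B_def
      by (rule compact_continuous_image) (auto intro!: continuous_intros intro: c\<psi>[THEN continuous_on_subset])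
    then obtain K where "\<And>x. x \<in> (\<lambda>z. \<bar>\<psi> z\<bar> + \<bar>flat_laplacian \<psi> z\<bar>) ` B \<Longrightarrow> norm x \<le> K"
      by (meson bounded_iff compact_imp_bounded)
    then have "\<And>z. z \<in> B \<Longrightarrow> \<bar>\<psi> z\<bar> + \<bar>flat_laplacian \<psi> z\<bar> \<le> max K 0" by fastforce
    then have *: "\<And>z. z \<in> B \<Longrightarrow> \<bar>\<psi> z\<bar> \<le> max K 0" "\<And>z. z \<in> B \<Longrightarrow> \<bar>flat_laplacian \<psi> z\<bar> \<le> max K 0" by fastforce+
    moreover have "\<bar>\<psi> z\<bar> \<le> max K 0" for z using *(1) zero by (cases "z \<in> B") auto
    ultimately show ?thesis by (intro that[of "max K 0"]) auto
  qed
  have "(\<lambda>n. \<integral>\<zeta>. \<psi> (b + \<epsilon> n *\<^sub>R \<zeta>) * (2 / (1 + (norm \<zeta>)\<^sup>2)\<^sup>2) \<partial>lborel) \<longlonglongrightarrow> (\<integral>(\<zeta>::complex). \<psi> b * (2 / (1 + (norm \<zeta>)\<^sup>2)\<^sup>2) \<partial>lborel)"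
  proof (rule integral_dominated_convergence[where w="\<lambda>\<zeta>::complex. K * (2 / (1 + (norm \<zeta>)\<^sup>2)\<^sup>2)"])
    show "integrable lborel (\<lambda>\<zeta>::complex. K * (2 / (1 + (norm \<zeta>)\<^sup>2)\<^sup>2))" by (intro integrable_mult_right integral_fubini_study)
    show "AE \<zeta> in lborel. (\<lambda>n. \<psi> (b + \<epsilon> n *\<^sub>R \<zeta>) * (2 / (1 + (norm \<zeta>)\<^sup>2)\<^sup>2)) \<longlonglongrightarrow> \<psi> b * (2 / (1 + (norm \<zeta>)\<^sup>2)\<^sup>2)"
    proof (intro AE_I2 tendsto_mult tendsto_const)
      fix \<zeta> :: complex
      have "(\<lambda>n. b + \<epsilon> n *\<^sub>R \<zeta>) \<longlonglongrightarrow> b + 0 *\<^sub>R \<zeta>" by (intro tendsto_intros \<epsilon>0)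
      then have *: "(\<lambda>n. b + \<epsilon> n *\<^sub>R \<zeta>) \<longlonglongrightarrow> b" by simp
      have "isCont \<psi> b" using c\<psi>(1) by (auto simp: continuous_on_eq_continuous_at)
      from isCont_tendsto_compose[OF this *] show "(\<lambda>n. \<psi> (b + \<epsilon> n *\<^sub>R \<zeta>)) \<longlonglongrightarrow> \<psi> b" .
    qed
    show "AE \<zeta> in lborel. norm (\<psi> (b + \<epsilon> n *\<^sub>R \<zeta>) * (2 / (1 + (norm \<zeta>)\<^sup>2)\<^sup>2)) \<le> K * (2 / (1 + (norm \<zeta>)\<^sup>2)\<^sup>2)" for n
      unfolding norm_mult by (intro AE_I2 mult_mono) (use K in auto)
  qed auto
  then have L1: "(\<lambda>n. LINT z:B|lborel. F n ((norm (z - b))\<^sup>2) * flat_laplacian \<psi> z) \<longlonglongrightarrow> 2 * pi * \<psi> b"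
    unfolding gi by (simp only: integral_mult_right_zero integral_fubini_study(2) mult.commute)
  have "(\<lambda>n. LINT z:B|lborel. F n ((norm (z - b))\<^sup>2) * flat_laplacian \<psi> z) \<longlonglongrightarrow> (LINT z:B|lborel. ln (norm (z - b)) * flat_laplacian \<psi> z)"
    unfolding set_lebesgue_integral_def
  \<comment> \<open>The majorant: the regularised logarithm is at least the exact one, as its
    argument is larger, and it is at most |z - b|^2 + 1, by ln x \<le> x and \<epsilon> \<le>
    1.\<close>
  proof (rule integral_dominated_convergence[where w="\<lambda>z. indicator B z * ((\<bar>ln (norm (z - b))\<bar> + (norm (z - b))\<^sup>2 + 1) * K)"])
    have "set_integrable lborel B (\<lambda>z. \<bar>ln (norm (z - b))\<bar>)"
      using set_integrable_abs[OF set_integrable_ln_norm[of a R b]] by (simp add: B_def)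
    moreover have "set_integrable lborel B (\<lambda>z. (norm (z - b))\<^sup>2 + 1)"
      unfolding set_integrable_def B_def by (rule borel_integrable_compact) (auto intro!: continuous_intros)
    ultimately have "set_integrable lborel B (\<lambda>z. (\<bar>ln (norm (z - b))\<bar> + ((norm (z - b))\<^sup>2 + 1)) * K)"
      by - (rule set_integrable_mult_left, rule set_integral_add(1))
    then show "integrable lborel (\<lambda>z. indicator B z * ((\<bar>ln (norm (z - b))\<bar> + (norm (z - b))\<^sup>2 + 1) * K))"
      by (simp add: set_integrable_def add.assoc)
    have "AE z in lborel. z \<noteq> b" by (simp add: AE_lborel_singleton)
    then show "AE z in lborel. (\<lambda>n. indicator B z *\<^sub>R (F n ((norm (z - b))\<^sup>2) * flat_laplacian \<psi> z)) \<longlonglongrightarrow> indicator B z *\<^sub>R (ln (norm (z - b)) * flat_laplacian \<psi> z)"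
    proof eventually_elim
      case (elim z)
      have "(\<lambda>n. F n ((norm (z - b))\<^sup>2)) \<longlonglongrightarrow> ln ((norm (z - b))\<^sup>2 + 0\<^sup>2) / 2"
        unfolding F_def by (intro tendsto_intros \<epsilon>0) (use elim in auto)
      then have "(\<lambda>n. F n ((norm (z - b))\<^sup>2)) \<longlonglongrightarrow> ln (norm (z - b))"
        using elim by (simp add: ln_realpow)
      then show ?case by (intro tendsto_intros)
    qed
    fix n
    from \<open>AE z in lborel. z \<noteq> b\<close> show "AE z in lborel. norm (indicator B z *\<^sub>R (F n ((norm (z - b))\<^sup>2) * flat_laplacian \<psi> z)) \<le> indicator B z * ((\<bar>ln (norm (z - b))\<bar> + (norm (z - b))\<^sup>2 + 1) * K)"
    proof eventually_elim
      case (elim z)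
      define T where "T = (norm (z - b))\<^sup>2"
      have T: "T > 0" "ln T = 2 * ln (norm (z - b))" using elim by (auto simp: T_def ln_realpow)
      have e: "(\<epsilon> n)\<^sup>2 > 0" "(\<epsilon> n)\<^sup>2 \<le> 1" using \<epsilon>[of n] by (auto simp: power_le_one)
      have "ln T \<le> ln (T + (\<epsilon> n)\<^sup>2)" by (rule ln_mono) (use T(1) e in linarith)+
      moreover have "ln (T + (\<epsilon> n)\<^sup>2) \<le> T + 1" using ln_bound[of "T + (\<epsilon> n)\<^sup>2"] T e by linarith
      ultimately have "\<bar>F n T\<bar> \<le> \<bar>ln (norm (z - b))\<bar> + T + 1"
        using T unfolding F_def by linarith
      then have "\<bar>F n T\<bar> * \<bar>flat_laplacian \<psi> z\<bar> \<le> (\<bar>ln (norm (z - b))\<bar> + T + 1) * K" if "z \<in> B"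
        using that K by (intro mult_mono) auto
      then show ?case by (auto simp: T_def indicator_def abs_mult)
    qed
    show "(\<lambda>z. indicator B z *\<^sub>R (F n ((norm (z - b))\<^sup>2) * flat_laplacian \<psi> z)) \<in> borel_measurable lborel"
      unfolding F_def B_def by (rule borel_measurable_indicator_scaleR) auto
    show "(\<lambda>z. indicator B z *\<^sub>R (ln (norm (z - b)) * flat_laplacian \<psi> z)) \<in> borel_measurable lborel"
      unfolding B_def by (rule borel_measurable_indicator_scaleR) auto
  qed
  from LIMSEQ_unique[OF this L1] show ?thesis by (simp add: B_def)
qed

subsection \<open>Smooth bump functions on the line\<close>

lemma D_k_on_add: "D_k_on k F I \<Longrightarrow> D_k_on k G I \<Longrightarrow> D_k_on k (\<lambda>x. F x + G x) I"
proof (induction k arbitrary: F G)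
  case (Suc k)
  obtain F' G' where "\<forall>x\<in>I. (F has_real_derivative F' x) (at x)" "D_k_on k F' I"
    "\<forall>x\<in>I. (G has_real_derivative G' x) (at x)" "D_k_on k G' I" using Suc.prems by auto
  then show ?case unfolding D_k_on.simps
    by (intro exI[of _ "\<lambda>x. F' x + G' x"] conjI ballI DERIV_add Suc.IH) auto
qed (auto intro: continuous_intros)

lemma D_k_on_const: "D_k_on k (\<lambda>_. c) I"
proof (induction k arbitrary: c)
  case (Suc k) then show ?case by (auto intro!: exI[of _ "\<lambda>_. 0"])
qed auto

lemma D_k_on_mult: "D_k_on k F I \<Longrightarrow> D_k_on k G I \<Longrightarrow> D_k_on k (\<lambda>x. F x * G x) I"
proof (induction k arbitrary: F G)
  case (Suc k)
  obtain F' G' where *: "\<forall>x\<in>I. (F has_real_derivative F' x) (at x)" "D_k_on k F' I"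
    "\<forall>x\<in>I. (G has_real_derivative G' x) (at x)" "D_k_on k G' I" using Suc.prems by auto
  have "D_k_on k (\<lambda>x. F' x * G x + G' x * F x) I"
    by (intro D_k_on_add Suc.IH * Suc.prems[THEN D_k_on_SucD])
  then show ?case unfolding D_k_on.simps
    by (intro exI[of _ "\<lambda>x. F' x * G x + G' x * F x"] conjI ballI DERIV_mult) (use * in auto)
qed (auto intro: continuous_intros)

lemma D_k_on_affine: "D_k_on k F UNIV \<Longrightarrow> D_k_on k (\<lambda>x. F (a * x + b)) UNIV"
proof (induction k arbitrary: F)
  case 0 then show ?case by (auto intro!: continuous_intros intro: continuous_on_compose2[where g=F and t=UNIV])
next
  case (Suc k)
  obtain F' where *: "\<And>x. (F has_real_derivative F' x) (at x)" "D_k_on k F' UNIV" using Suc.prems by auto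
  have "((\<lambda>x. F (a * x + b)) has_real_derivative F' (a * x + b) * a) (at x)" for x
    by (rule DERIV_chain2[OF *(1)]) (auto intro!: derivative_eq_intros)
  then show ?case
    using D_k_on_mult[OF Suc.IH[OF *(2)] D_k_on_const[of k a]]
    by (auto intro!: exI[of _ "\<lambda>x. F' (a * x + b) * a"])
qed

text \<open>The powers in the denominator close the family under differentiation, see
  \<open>flat_exp_DERIV\<close>. The case \<open>n = 0\<close> is the classical smooth function that
  is flat at 0.\<close>

definition flat_exp :: "nat \<Rightarrow> real \<Rightarrow> real" where
  "flat_exp n x = (if x > 0 then exp (- 1 / x) / x ^ n else 0)"

lemma flat_exp_DERIV: "(flat_exp n has_real_derivative (- real n * flat_exp (Suc n) x + flat_exp (Suc (Suc n)) x)) (at x)"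
proof -
  have tz: "(flat_exp m \<longlongrightarrow> 0) (at_right 0)" for m
  proof -
    have "((\<lambda>x. (inverse x) ^ m / exp (inverse x)) \<longlongrightarrow> 0) (at_right (0::real))"
      by (rule filterlim_compose[OF tendsto_power_div_exp_0 filterlim_inverse_at_top_right])
    moreover have "\<forall>\<^sub>F x in at_right 0. (inverse x) ^ m / exp (inverse x) = flat_exp m x"
      by (auto simp: eventually_at_right_field flat_exp_def exp_minus field_simps intro!: exI[of _ 1])
    ultimately show ?thesis by (rule Lim_transform_eventually)
  qed
  consider "x < 0" | "x = 0" | "x > 0" by linarith
  then show ?thesis
  proof cases
    case 1
    have "(flat_exp n has_real_derivative 0) (at x)"
    proof (subst DERIV_cong_ev[OF refl _ refl])
      show "\<forall>\<^sub>F y in nhds x. flat_exp n y = 0"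
        using eventually_nhds_in_open[of "{..<0}" x] 1 by (auto elim!: eventually_mono simp: flat_exp_def)
    qed auto
    then show ?thesis using 1 by (simp add: flat_exp_def)
  next
    case 2
    have "((\<lambda>y. (flat_exp n y - flat_exp n 0) / (y - 0)) \<longlongrightarrow> 0) (at_left 0)"
      by (rule tendsto_eventually) (auto simp: eventually_at_filter flat_exp_def)
    \<comment> \<open>To the right of 0 the difference quotient of \<open>flat_exp n\<close> at 0 is
      \<open>flat_exp (Suc n)\<close>, which tends to 0.\<close>
    moreover have "((\<lambda>y. (flat_exp n y - flat_exp n 0) / (y - 0)) \<longlongrightarrow> 0) (at_right 0)"
      by (rule Lim_transform_eventually[OF tz[of "Suc n"]]) (auto simp: eventually_at_filter flat_exp_def)
    ultimately have "((\<lambda>y. (flat_exp n y - flat_exp n 0) / (y - 0)) \<longlongrightarrow> 0) (at 0)"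
      by (simp add: filterlim_at_split)
    then show ?thesis using 2 by (simp add: has_field_derivative_iff flat_exp_def)
  next
    case 3
    have e: "((\<lambda>y. exp (- 1 / y)) has_real_derivative exp (- 1 / x) / x\<^sup>2) (at x)"
      using 3 by (auto intro!: derivative_eq_intros simp: power2_eq_square)
    have p: "((\<lambda>y. inverse (y ^ n)) has_real_derivative - real n * inverse (x ^ Suc n)) (at x)"
    proof -
      have "((\<lambda>y. inverse (y ^ n)) has_real_derivative - (inverse (x ^ n) * (real n * x ^ (n - Suc 0)) * inverse (x ^ n))) (at x)"
        by (rule DERIV_inverse'[OF DERIV_pow]) (use 3 in simp)
      moreover have "inverse (x ^ n) * (real n * x ^ (n - Suc 0)) * inverse (x ^ n) = real n * inverse (x ^ Suc n)"
        using 3 by (cases n) (auto simp: field_simps)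
      ultimately show ?thesis by simp
    qed
    have "((\<lambda>y. exp (- 1 / y) * inverse (y ^ n)) has_real_derivative
        exp (- 1 / x) / x\<^sup>2 * inverse (x ^ n) + - real n * inverse (x ^ Suc n) * exp (- 1 / x)) (at x)"
      by (rule DERIV_mult[OF e p])
    moreover have "exp (- 1 / x) / x\<^sup>2 * inverse (x ^ n) + - real n * inverse (x ^ Suc n) * exp (- 1 / x)
        = - real n * flat_exp (Suc n) x + flat_exp (Suc (Suc n)) x"
      using 3 by (simp add: flat_exp_def field_simps power2_eq_square)
    ultimately have *: "((\<lambda>y. exp (- 1 / y) * inverse (y ^ n)) has_real_derivative
        - real n * flat_exp (Suc n) x + flat_exp (Suc (Suc n)) x) (at x)" by simp
    show ?thesis
    proof (subst DERIV_cong_ev[OF refl _ refl])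
      show "\<forall>\<^sub>F y in nhds x. flat_exp n y = exp (- 1 / y) * inverse (y ^ n)"
        using eventually_nhds_in_open[of "{0<..}" x] 3
        by (auto elim!: eventually_mono simp: flat_exp_def field_simps)
    qed (rule *)
  qed
qed

lemma D_k_on_flat_exp: "D_k_on k (flat_exp n) UNIV"
proof (induction k arbitrary: n)
  case 0
  show ?case using DERIV_isCont[OF flat_exp_DERIV] by (simp add: continuous_at_imp_continuous_on)
next
  case (Suc k)
  have "D_k_on k (\<lambda>x. - real n * flat_exp (Suc n) x + flat_exp (Suc (Suc n)) x) UNIV"
    by (intro D_k_on_add D_k_on_mult D_k_on_const Suc.IH)
  then show ?case using flat_exp_DERIV[of n]
    by (auto intro!: exI[of _ "\<lambda>x. - real n * flat_exp (Suc n) x + flat_exp (Suc (Suc n)) x"])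
qed

text \<open>For \<open>n > 0\<close> this is positive exactly between \<open>1 / n\<close> and
  \<open>b\<close>, and on the half-line t \<ge> 0 it tends to the indicator of the interval from 0
  to \<open>b\<close>. The gap next to 0 is deliberate: solving the radial equation involves a
  division by t.\<close>

definition bump :: "real \<Rightarrow> nat \<Rightarrow> real \<Rightarrow> real" where
  "bump b n t = flat_exp 0 (real n * t - 1) * flat_exp 0 (real n * (b - t))"

lemma flat_exp_0: "0 \<le> flat_exp 0 x" "flat_exp 0 x \<le> 1" "x \<le> 0 \<Longrightarrow> flat_exp 0 x = 0" "0 < x \<Longrightarrow> 0 < flat_exp 0 x"
  by (auto simp: flat_exp_def)

lemma bump_bounds: "0 \<le> bump b n t" "bump b n t \<le> 1"
  using mult_mono[of "flat_exp 0 (real n * t - 1)" 1 "flat_exp 0 (real n * (b - t))" 1] flat_exp_0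
  by (auto simp: bump_def)

lemma bump_zero: "real n * t \<le> 1 \<Longrightarrow> bump b n t = 0" "b \<le> t \<Longrightarrow> bump b n t = 0"
  by (auto simp: bump_def flat_exp_0(3) mult_nonneg_nonpos)

lemma bump_pos: "1 < real n * t \<Longrightarrow> t < b \<Longrightarrow> 0 < bump b n t"
proof -
  assume "1 < real n * t" "t < b"
  moreover from this have "real n > 0" by (cases n) auto
  ultimately show ?thesis by (simp add: bump_def flat_exp_0(4))
qed

lemma D_k_on_bump: "D_k_on k (bump b n) UNIV"
proof -
  have "D_k_on k (\<lambda>t. flat_exp 0 (real n * t + - 1) * flat_exp 0 (- real n * t + real n * b)) UNIV"
    by (intro D_k_on_mult D_k_on_affine D_k_on_flat_exp)
  moreover have "(\<lambda>t. flat_exp 0 (real n * t + - 1) * flat_exp 0 (- real n * t + real n * b)) = bump b n"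
    by (simp add: bump_def fun_eq_iff algebra_simps)
  ultimately show ?thesis by simp
qed

lemma continuous_on_bump: "continuous_on S (bump b n)"
  using D_k_on_bump[of 0 b n] by (auto intro: continuous_on_subset)

lemma bump_tendsto:
  assumes "0 \<le> t"
  shows "(\<lambda>n. bump b n t) \<longlonglongrightarrow> indicator {0<..<b} t"
proof (cases "t \<in> {0<..<b}")
  case True
  have *: "(\<lambda>n. flat_exp 0 (x n)) \<longlonglongrightarrow> 1" if "filterlim x at_top sequentially" for x :: "nat \<Rightarrow> real"
  proof -
    have "((\<lambda>x::real. exp (- 1 / x)) \<longlongrightarrow> 1) at_top" by real_asymp
    moreover have "\<forall>\<^sub>F x in at_top. exp (- 1 / x) = flat_exp 0 x"
      using eventually_gt_at_top[of 0] by eventually_elim (simp add: flat_exp_def)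
    ultimately have "(flat_exp 0 \<longlongrightarrow> 1) at_top" by (rule Lim_transform_eventually)
    then show ?thesis using that by (rule filterlim_compose)
  qed
  have "filterlim (\<lambda>n. real n * t - 1) at_top sequentially" "filterlim (\<lambda>n. real n * (b - t)) at_top sequentially"
    using True by real_asymp+
  from tendsto_mult[OF this[THEN *]] show ?thesis using True by (simp add: bump_def)
next
  case False
  then have "bump b n t = 0" for n
    using assms bump_zero(1)[where n=n and t=t and b=b] bump_zero(2)[where n=n and t=t and b=b] by (cases "t = 0") auto
  then show ?thesis using False by simp
qed

text \<open>To the left of \<open>a\<close> the integral over an empty interval is 0, in accordance
  with the vanishing of \<open>f\<close>, so the formula holds there as well. Starting the integral
  at an earlier point \<open>c\<close> changes nothing and makes \<open>t\<close> an interior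
  point.\<close>

lemma antiderivative_of_vanishing:
  fixes f :: "real \<Rightarrow> real"
  assumes f: "continuous_on UNIV f" "\<And>t. t \<le> a \<Longrightarrow> f t = 0"
  shows "((\<lambda>t. integral {a..t} f) has_real_derivative f t) (at t)"
proof -
  define c where "c = min a t - 1"
  have ci: "f integrable_on {x..y}" for x y
    using f(1) by (intro integrable_continuous_real continuous_on_subset[OF f(1)]) auto
  have eq: "integral {a..s} f = integral {c..s} f" if "c \<le> s" for s
  proof -
    have z: "integral {x..y} f = 0" if "y \<le> a" for x y
      using integral_cong[of "{x..y}" f "\<lambda>_. 0"] f(2) that by auto
    show ?thesis
    proof (cases "s \<le> a")
      case True
      then show ?thesis using z[of s c] z[of s a] by (cases "s = a") auto
    next
      case False
      then have "integral {c..a} f + integral {a..s} f = integral {c..s} f"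
        by (intro Henstock_Kurzweil_Integration.integral_combine ci) (auto simp: c_def)
      then show ?thesis using z[of a c] by simp
    qed
  qed
  have "((\<lambda>s. integral {c..s} f) has_real_derivative f t) (at t within {c..t+1})"
    by (rule integral_has_real_derivative) (auto simp: c_def intro: continuous_on_subset[OF f(1)])
  then have "((\<lambda>s. integral {c..s} f) has_real_derivative f t) (at t)"
    by (subst (asm) at_within_interior) (auto simp: c_def)
  then show ?thesis
  proof (subst DERIV_cong_ev[OF refl _ refl])
    show "\<forall>\<^sub>F s in nhds t. integral {a..s} f = integral {c..s} f"
    proof -
      have "\<forall>\<^sub>F s in nhds t. s \<in> {c<..}" by (rule eventually_nhds_in_open) (auto simp: c_def)
      then show ?thesis by eventually_elim (use eq in auto)
    qed
  qed
qed

lemma D_k_on_antiderivative: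
  assumes "\<And>t. (F has_real_derivative f t) (at t)" "\<And>k. D_k_on k f UNIV"
  shows "D_k_on k F UNIV"
proof (cases k)
  case 0
  show ?thesis using DERIV_isCont[OF assms(1)] 0 by (simp add: continuous_at_imp_continuous_on)
next
  case (Suc j) then show ?thesis unfolding Suc D_k_on.simps using assms by blast
qed

text \<open>The quotient is identically 0 before \<open>a\<close>, hence around 0, and beyond that
  the denominator is positive. The exponent is arbitrary because differentiation raises it.\<close>

lemma D_k_on_divide_power:
  assumes "0 < a" "\<And>t. t < a \<Longrightarrow> Q t = 0" "D_k_on k Q UNIV"
  shows "D_k_on k (\<lambda>t. Q t / t ^ n) UNIV"
  using assms(2,3)
proof (induction k arbitrary: Q n)
  case 0
  have "isCont (\<lambda>t. Q t / t ^ n) t" for t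
  proof (cases "t < a")
    case True
    have "\<forall>\<^sub>F s in nhds t. Q s / s ^ n = 0"
      using eventually_nhds_in_open[of "{..<a}" t] True 0 by (auto elim!: eventually_mono)
    then show ?thesis by (subst isCont_cong[where g="\<lambda>_. 0"]) auto
  next
    case False
    then show ?thesis using 0 \<open>0 < a\<close> by (auto intro!: continuous_intros simp: continuous_on_eq_continuous_at)
  qed
  then show ?case by (simp add: continuous_at_imp_continuous_on)
next
  case (Suc k)
  obtain Q' where Q': "\<And>t. (Q has_real_derivative Q' t) (at t)" "D_k_on k Q' UNIV" using Suc.prems by auto
  have loc: "\<forall>\<^sub>F s in nhds t. Q s = 0" if "t < a" for t
    using eventually_nhds_in_open[of "{..<a}" t] that Suc.prems by (auto elim!: eventually_mono)
  have Q'0: "Q' t = 0" if "t < a" for t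
  proof -
    have "(Q has_real_derivative 0) (at t)" by (subst DERIV_cong_ev[OF refl loc[OF that] refl]) auto
    then show ?thesis using Q'(1) DERIV_unique by blast
  qed
  have D: "((\<lambda>t. Q t / t ^ n) has_real_derivative (Q' t / t ^ n + - real n * (Q t / t ^ Suc n))) (at t)" for t
  proof (cases "t < a")
    case True
    have ev: "\<forall>\<^sub>F s in nhds t. Q s / s ^ n = 0" using loc[OF True] by eventually_elim simp
    have "((\<lambda>t. Q t / t ^ n) has_real_derivative 0) (at t)" by (subst DERIV_cong_ev[OF refl ev refl]) simp
    then show ?thesis using Q'0[OF True] Suc.prems(1)[OF True] by simp
  next
    case False
    then have t: "t > 0" using \<open>0 < a\<close> by simp
    have "((\<lambda>t. Q t / t ^ n) has_real_derivative (Q' t * t ^ n - Q t * (real n * t ^ (n - Suc 0))) / (t ^ n * t ^ n)) (at t)"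
      by (rule DERIV_divide[OF Q'(1) DERIV_pow]) (use t in simp)
    moreover have "(Q' t * t ^ n - Q t * (real n * t ^ (n - Suc 0))) / (t ^ n * t ^ n) = Q' t / t ^ n + - real n * (Q t / t ^ Suc n)"
      using t by (cases n) (auto simp: field_simps)
    ultimately show ?thesis by simp
  qed
  have "D_k_on k (\<lambda>t. Q' t / t ^ n + - real n * (Q t / t ^ Suc n)) UNIV"
    by (intro D_k_on_add D_k_on_mult D_k_on_const Suc.IH Q' Q'0 Suc.prems(2)[THEN D_k_on_SucD] Suc.prems(1))
  then show ?case using D
    by (auto intro!: exI[of _ "\<lambda>t. Q' t / t ^ n + - real n * (Q t / t ^ Suc n)"])
qed

subsection \<open>The mean value property\<close>

text \<open>\<open>F\<close> is a profile in the squared distance from a centre. The strict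
  inequality \<open>R1 < R\<close> keeps the support away from the bounding circle, as in
  \<open>green_identity\<close>.\<close>

definition radial_test :: "real \<Rightarrow> (real \<Rightarrow> real) \<Rightarrow> bool" where
  "radial_test R F \<longleftrightarrow> (\<forall>k. D_k_on k F UNIV) \<and> (\<exists>R1. 0 < R1 \<and> R1 < R \<and> (\<forall>t\<ge>R1\<^sup>2. F t = 0))"

text \<open>Only functions radial about the centre serve as tests, since only the means over discs
  about this centre are to be compared. The condition is blind to null sets, so a wrong value at a
  single point remains possible.\<close>

definition weakly_harmonic_at :: "(complex \<Rightarrow> real) \<Rightarrow> complex \<Rightarrow> real \<Rightarrow> bool" where
  "weakly_harmonic_at h a R \<longleftrightarrow> set_integrable lborel (cball a R) h \<and>
     (\<forall>F. radial_test R F \<longrightarrow> (LINT z:cball a R|lborel. h z * flat_laplacian (\<lambda>z. F ((norm (z - a))\<^sup>2)) z) = 0)"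

text \<open>By \<open>flat_laplacian_radial\<close> the product Q = t F' must have the derivative
  \<open>q\<close>, a difference of two bumps. The weights \<open>I b2\<close> and
  \<open>I b1\<close> make the integral of \<open>q\<close> vanish, so Q is 0 beyond
  \<open>R2\<^sup>2\<close> and \<open>F\<close> is constant there. Subtracting this constant gives
  compact support.\<close>

lemma radial_test_bump_exists:
  assumes b: "0 < b1" "b1 \<le> R2\<^sup>2" "0 < b2" "b2 \<le> R2\<^sup>2" "0 < R2" "R2 < R" and n: "0 < n"
  defines "I \<equiv> \<lambda>b. integral {0..R2\<^sup>2} (bump b n)"
  obtains F where "radial_test R F"
    "\<And>a z. flat_laplacian (\<lambda>z. F ((norm (z - a))\<^sup>2)) z
       = 4 * (I b2 * bump b1 n ((norm (z - a))\<^sup>2) - I b1 * bump b2 n ((norm (z - a))\<^sup>2))"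
proof -
  define \<alpha> where "\<alpha> = 1 / real n"
  have \<alpha>: "\<alpha> > 0" using n by (simp add: \<alpha>_def)
  define q where "q = (\<lambda>t. I b2 * bump b1 n t - I b1 * bump b2 n t)"
  have qD: "D_k_on k q UNIV" for k
  proof -
    have "D_k_on k (\<lambda>t. I b2 * bump b1 n t + - I b1 * bump b2 n t) UNIV"
      by (intro D_k_on_add D_k_on_mult D_k_on_const D_k_on_bump)
    then show ?thesis by (simp add: q_def)
  qed
  have q0: "q t = 0" if "t \<le> \<alpha>" for t using that n by (simp add: q_def \<alpha>_def bump_zero field_simps)
  have q1: "q t = 0" if "R2\<^sup>2 \<le> t" for t using that b by (simp add: q_def bump_zero)
  have qc: "continuous_on S q" for S using qD[of 0] by (auto intro: continuous_on_subset)
  have qi: "q integrable_on {x..y}" for x y by (intro integrable_continuous_real qc)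
  define Q where "Q = (\<lambda>t. integral {\<alpha>..t} q)"
  have QD: "(Q has_real_derivative q t) (at t)" for t
    unfolding Q_def by (rule antiderivative_of_vanishing[OF qc q0])
  have Q0: "Q t = 0" if "t \<le> \<alpha>" for t using that by (cases "t = \<alpha>") (auto simp: Q_def)
  have Q1: "Q t = 0" if t: "R2\<^sup>2 \<le> t" for t
  proof (cases "\<alpha> \<le> t")
    case True
    have "integral {0..\<alpha>} q = 0" using integral_cong[of "{0..\<alpha>}" q "\<lambda>_. 0"] q0 by auto
    then have "Q t = integral {0..t} q"
      using Henstock_Kurzweil_Integration.integral_combine[of 0 \<alpha> t q] qi \<alpha> True by (simp add: Q_def)
    also have "\<dots> = integral {0..R2\<^sup>2} q + integral {R2\<^sup>2..t} q"
      using Henstock_Kurzweil_Integration.integral_combine[of 0 "R2\<^sup>2" t q] qi t by simp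
    also have "integral {R2\<^sup>2..t} q = 0" using integral_cong[of "{R2\<^sup>2..t}" q "\<lambda>_. 0"] q1 by auto
    also have "integral {0..R2\<^sup>2} q = I b2 * I b1 - I b1 * I b2"
      unfolding q_def I_def
      by (subst Henstock_Kurzweil_Integration.integral_diff)
        (auto intro!: integrable_continuous_real continuous_intros continuous_on_bump)
    finally show ?thesis by simp
  qed (use Q0 in auto)
  define P where "P = (\<lambda>t. Q t / t ^ 1)"
  have PD: "D_k_on k P UNIV" for k
    unfolding P_def by (rule D_k_on_divide_power[OF \<alpha>]) (use Q0 D_k_on_antiderivative[OF QD qD] in auto)
  have P0: "P t = 0" if "t \<le> \<alpha>" for t using Q0[OF that] by (simp add: P_def)
  have Pc: "continuous_on S P" for S using PD[of 0] by (auto intro: continuous_on_subset)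
  define F where "F = (\<lambda>t. integral {\<alpha>..t} P - integral {\<alpha>..R2\<^sup>2} P)"
  have FD: "(F has_real_derivative P t) (at t)" for t
  proof -
    have "((\<lambda>t. integral {\<alpha>..t} P) has_real_derivative P t) (at t)"
      by (rule antiderivative_of_vanishing[OF Pc P0])
    from DERIV_diff[OF this DERIV_const] show ?thesis by (simp add: F_def)
  qed
  have F1: "F t = 0" if t: "R2\<^sup>2 \<le> t" for t
  proof -
    have "\<exists>c. \<forall>s\<in>{R2\<^sup>2..}. F s = c"
      by (rule has_field_derivative_zero_constant)
        (use FD Q1 in \<open>auto simp: P_def intro: has_field_derivative_at_within\<close>,
         metis (no_types) FD Q1 P_def div_0 has_field_derivative_at_within)
    then have "F t = F (R2\<^sup>2)" using t by auto
    then show ?thesis by (simp add: F_def)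
  qed
  have "radial_test R F" unfolding radial_test_def
    using D_k_on_antiderivative[OF FD PD] F1 b by blast
  moreover have "flat_laplacian (\<lambda>z. F ((norm (z - a))\<^sup>2)) z = 4 * q ((norm (z - a))\<^sup>2)" for a z
  proof -
    have P': "(P has_real_derivative (q t / t - Q t / t\<^sup>2)) (at t)" for t
    proof (cases "t < \<alpha>")
      case True
      have "\<forall>\<^sub>F s in nhds t. P s = 0"
        using eventually_nhds_in_open[of "{..<\<alpha>}" t] True P0 by (auto elim!: eventually_mono)
      then have "(P has_real_derivative 0) (at t)" by (subst DERIV_cong_ev[OF refl _ refl]) auto
      then show ?thesis using q0[of t] Q0[of t] True by simp
    next
      case False
      then have t: "t > 0" using \<alpha> by simp
      have "(P has_real_derivative (q t * t - Q t * 1) / (t * t)) (at t)"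
        unfolding P_def power_one_right by (rule DERIV_divide[OF QD DERIV_ident]) (use t in simp)
      moreover have "(q t * t - Q t * 1) / (t * t) = q t / t - Q t / t\<^sup>2"
        using t by (simp add: field_simps power2_eq_square)
      ultimately show ?thesis by simp
    qed
    define T where "T = (norm (z - a))\<^sup>2"
    have "flat_laplacian (\<lambda>z. F ((norm (z - a))\<^sup>2)) z = 4 * (P T + T * (q T / T - Q T / T\<^sup>2))"
      unfolding T_def by (rule flat_laplacian_radial[OF FD P'])
    also have "\<dots> = 4 * q T"
      using q0[of 0] \<alpha> by (cases "T = 0") (auto simp: P_def field_simps power2_eq_square)
    finally show ?thesis by (simp add: T_def)
  qed
  ultimately show ?thesis using that unfolding q_def by blast
qed

lemma integral_bump_tendsto:
  assumes "0 < b" "b \<le> c"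
  shows "(\<lambda>n. integral {0..c} (bump b n)) \<longlonglongrightarrow> b"
proof -
  have "(\<lambda>n. LINT t:{0..c}|lborel. bump b n t) \<longlonglongrightarrow> (LINT t:{0..c}|lborel. indicator {0<..<b} t)"
    unfolding set_lebesgue_integral_def
  proof (rule integral_dominated_convergence[where w="indicator {0..c}"])
    show "AE t in lborel. (\<lambda>n. indicator {0..c} t *\<^sub>R bump b n t) \<longlonglongrightarrow> indicator {0..c} t *\<^sub>R indicator {0<..<b} t"
    proof (intro AE_I2)
      fix t show "(\<lambda>n. indicator {0..c} t *\<^sub>R bump b n t) \<longlonglongrightarrow> indicator {0..c} t *\<^sub>R (indicator {0<..<b} t :: real)"
        by (cases "t \<in> {0..c}") (auto intro!: tendsto_scaleR tendsto_const bump_tendsto simp del: real_scaleR_def)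
    qed
    show "AE t in lborel. norm (indicator {0..c} t *\<^sub>R bump b n t) \<le> indicator {0..c} t" for n
      using bump_bounds by (intro AE_I2) (auto simp: indicator_def)
    show "(\<lambda>t. indicator {0..c} t *\<^sub>R bump b n t) \<in> borel_measurable lborel" for n
      using borel_measurable_continuous_onI[OF continuous_on_bump[of UNIV b n]] by simp
    show "integrable lborel (indicator {0..c} :: real \<Rightarrow> real)" by (rule integrable_real_indicator) (auto simp: emeasure_lborel_Icc_eq)
  qed auto
  moreover have "(LINT t:{0..c}|lborel. indicator {0<..<b} t) = b"
  proof -
    have "(LINT t:{0..c}|lborel. (indicator {0<..<b} t :: real)) = (\<integral>t. indicator {0<..<b} t \<partial>lborel)"
      unfolding set_lebesgue_integral_def by (rule Bochner_Integration.integral_cong) (use assms in \<open>auto simp: indicator_def\<close>)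
    then show ?thesis using assms by simp
  qed
  moreover have "(LINT t:{0..c}|lborel. bump b n t) = integral {0..c} (bump b n)" for n
    by (rule set_borel_integral_eq_integral(2)) (intro borel_integrable_atLeastAtMost' continuous_on_bump)
  ultimately show ?thesis by simp
qed

lemma set_integral_bump_tendsto:
  fixes h :: "complex \<Rightarrow> real"
  assumes h: "set_integrable lborel (cball a R) h" and r: "0 < r" "r \<le> R"
  shows "(\<lambda>n. LINT z:cball a R|lborel. h z * bump (r\<^sup>2) n ((norm (z - a))\<^sup>2)) \<longlonglongrightarrow> (LINT z:ball a r|lborel. h z)"
proof -
  have hm[measurable]: "(\<lambda>z. indicator (cball a R) z *\<^sub>R h z) \<in> borel_measurable borel"
    using borel_measurable_integrable[OF h[unfolded set_integrable_def]] by simp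
  have bm[measurable]: "(\<lambda>z. bump (r\<^sup>2) n ((norm (z - a))\<^sup>2)) \<in> borel_measurable borel" for n
    by (intro borel_measurable_continuous_onI continuous_on_compose2[OF continuous_on_bump[of UNIV]] continuous_intros) auto
  have "(\<lambda>n. \<integral>z. (indicator (cball a R) z *\<^sub>R h z) * bump (r\<^sup>2) n ((norm (z - a))\<^sup>2) \<partial>lborel) \<longlonglongrightarrow> (\<integral>z. indicator (ball a r) z *\<^sub>R (indicator (cball a R) z *\<^sub>R h z) \<partial>lborel)"
  proof (rule integral_dominated_convergence[where w="\<lambda>z. norm (indicator (cball a R) z *\<^sub>R h z)"])
    show "integrable lborel (\<lambda>z. norm (indicator (cball a R) z *\<^sub>R h z))"
      using h unfolding set_integrable_def by (rule integrable_norm)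
    \<comment> \<open>At the centre every bump is 0, so the limit there is not the indicator of the
      disc.\<close>
    have "AE z in lborel. z \<noteq> a" by (simp add: AE_lborel_singleton)
    then show "AE z in lborel. (\<lambda>n. (indicator (cball a R) z *\<^sub>R h z) * bump (r\<^sup>2) n ((norm (z - a))\<^sup>2)) \<longlonglongrightarrow> indicator (ball a r) z *\<^sub>R (indicator (cball a R) z *\<^sub>R h z)"
    proof eventually_elim
      case (elim z)
      have "(\<lambda>n. (indicator (cball a R) z *\<^sub>R h z) * bump (r\<^sup>2) n ((norm (z - a))\<^sup>2)) \<longlonglongrightarrow> (indicator (cball a R) z *\<^sub>R h z) * indicator {0<..<r\<^sup>2} ((norm (z - a))\<^sup>2)"
        by (intro tendsto_intros bump_tendsto) auto
      moreover have "indicator {0<..<r\<^sup>2} ((norm (z - a))\<^sup>2) = (indicator (ball a r) z :: real)"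
        using elim r power_strict_mono[of "norm (z - a)" r 2] power_less_imp_less_base[of "norm (z - a)" 2 r]
        by (auto simp: indicator_def dist_norm norm_minus_commute)
      ultimately show ?case by (simp add: mult.commute)
    qed
    show "AE z in lborel. norm ((indicator (cball a R) z *\<^sub>R h z) * bump (r\<^sup>2) n ((norm (z - a))\<^sup>2)) \<le> norm (indicator (cball a R) z *\<^sub>R h z)" for n
      using bump_bounds by (intro AE_I2) (auto simp: abs_mult indicator_def intro!: mult_left_le)
    show "(\<lambda>z. indicator (ball a r) z *\<^sub>R (indicator (cball a R) z *\<^sub>R h z)) \<in> borel_measurable lborel"
      by (rule borel_measurable_indicator_scaleR[OF _ hm]) simp
    show "(\<lambda>z. (indicator (cball a R) z *\<^sub>R h z) * bump (r\<^sup>2) n ((norm (z - a))\<^sup>2)) \<in> borel_measurable lborel" for n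
      by (intro borel_measurable_times) (use hm bm in auto)
  qed
  moreover have "(\<integral>z. indicator (ball a r) z *\<^sub>R (indicator (cball a R) z *\<^sub>R h z) \<partial>lborel) = (LINT z:ball a r|lborel. h z)"
    unfolding set_lebesgue_integral_def by (rule Bochner_Integration.integral_cong) (use r in \<open>auto simp: indicator_def\<close>)
  ultimately show ?thesis by (simp add: set_lebesgue_integral_def mult.assoc)
qed

text \<open>Testing against the profile from \<open>radial_test_bump_exists\<close> compares two
  bump-weighted integrals. As \<open>n\<close> grows the bumps become the indicators of the two
  discs and the weights become \<open>r2\<^sup>2\<close> and \<open>r1\<^sup>2\<close>. The result
  is the equality of the two area means, cross-multiplied.\<close>

lemma weakly_harmonic_area_means:
  assumes h: "weakly_harmonic_at h a R" and r: "0 < r1" "r1 \<le> r2" "r2 < R"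
  shows "r2\<^sup>2 * (LINT z:ball a r1|lborel. h z) = r1\<^sup>2 * (LINT z:ball a r2|lborel. h z)"
proof -
  have hi: "set_integrable lborel (cball a R) h" using h by (simp add: weakly_harmonic_at_def)
  define I where "I = (\<lambda>b n. integral {0..r2\<^sup>2} (bump b n))"
  define J where "J = (\<lambda>r n. LINT z:cball a R|lborel. h z * bump (r\<^sup>2) n ((norm (z - a))\<^sup>2))"
  have r': "0 < r1\<^sup>2" "r1\<^sup>2 \<le> r2\<^sup>2" "0 < r2\<^sup>2" using r by (auto intro: power_mono)
  have int: "set_integrable lborel (cball a R) (\<lambda>z. h z * bump (r\<^sup>2) n ((norm (z - a))\<^sup>2))" for r n
  proof (rule set_integrable_bound[OF hi])
    have "(\<lambda>z. bump (r\<^sup>2) n ((norm (z - a))\<^sup>2)) \<in> borel_measurable borel"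
      by (intro borel_measurable_continuous_onI continuous_on_compose2[OF continuous_on_bump[of UNIV]] continuous_intros) auto
    then have "(\<lambda>z. (indicator (cball a R) z *\<^sub>R h z) * bump (r\<^sup>2) n ((norm (z - a))\<^sup>2)) \<in> borel_measurable lborel"
      using borel_measurable_integrable[OF hi[unfolded set_integrable_def]] by (intro borel_measurable_times) auto
    then show "set_borel_measurable lborel (cball a R) (\<lambda>z. h z * bump (r\<^sup>2) n ((norm (z - a))\<^sup>2))"
      by (simp add: set_borel_measurable_def mult.assoc)
    show "AE z in lborel. z \<in> cball a R \<longrightarrow> norm (h z * bump (r\<^sup>2) n ((norm (z - a))\<^sup>2)) \<le> norm (h z)"
      using bump_bounds by (intro AE_I2) (auto simp: abs_mult intro!: mult_left_le)
  qed
  have eq: "I (r2\<^sup>2) n * J r1 n = I (r1\<^sup>2) n * J r2 n" if n: "n > 0" for n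
  proof -
    obtain F where F: "radial_test R F" "\<And>a z. flat_laplacian (\<lambda>z. F ((norm (z - a))\<^sup>2)) z
       = 4 * (I (r2\<^sup>2) n * bump (r1\<^sup>2) n ((norm (z - a))\<^sup>2) - I (r1\<^sup>2) n * bump (r2\<^sup>2) n ((norm (z - a))\<^sup>2))"
      by (rule radial_test_bump_exists[of "r1\<^sup>2" r2 "r2\<^sup>2" R n]) (use r r' n in \<open>auto simp: I_def\<close>)
    have "0 = (LINT z:cball a R|lborel. h z * (4 * (I (r2\<^sup>2) n * bump (r1\<^sup>2) n ((norm (z - a))\<^sup>2) - I (r1\<^sup>2) n * bump (r2\<^sup>2) n ((norm (z - a))\<^sup>2))))"
    proof -
      have "(LINT z:cball a R|lborel. h z * flat_laplacian (\<lambda>z. F ((norm (z - a))\<^sup>2)) z) = 0"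
        using h F(1) unfolding weakly_harmonic_at_def by blast
      then show ?thesis unfolding F(2) by (rule sym)
    qed
    also have "\<dots> = (LINT z:cball a R|lborel. 4 * I (r2\<^sup>2) n * (h z * bump (r1\<^sup>2) n ((norm (z - a))\<^sup>2)) - 4 * I (r1\<^sup>2) n * (h z * bump (r2\<^sup>2) n ((norm (z - a))\<^sup>2)))"
      by (simp add: algebra_simps)
    also have "\<dots> = 4 * I (r2\<^sup>2) n * J r1 n - 4 * I (r1\<^sup>2) n * J r2 n"
      unfolding J_def by (subst set_integral_diff(2)) (auto intro!: set_integrable_mult_right int)
    finally show ?thesis by simp
  qed
  have "(\<lambda>n. I (r2\<^sup>2) n * J r1 n) \<longlonglongrightarrow> r2\<^sup>2 * (LINT z:ball a r1|lborel. h z)"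
    "(\<lambda>n. I (r1\<^sup>2) n * J r2 n) \<longlonglongrightarrow> r1\<^sup>2 * (LINT z:ball a r2|lborel. h z)"
    unfolding I_def J_def
    by (rule tendsto_mult[OF integral_bump_tendsto set_integral_bump_tendsto[OF hi]], use r r' in auto)+
  note lims = this
  have "\<forall>\<^sub>F n in sequentially. I (r2\<^sup>2) n * J r1 n = I (r1\<^sup>2) n * J r2 n"
    using eventually_gt_at_top[of 0] by eventually_elim (rule eq)
  from LIMSEQ_unique[OF Lim_transform_eventually[OF lims(1) this] lims(2)] show ?thesis .
qed

text \<open>
  Harmonic functions are encoded by their area means: these make sense without derivatives, so they
  also apply to the Green function with its pole removed, about which only the distributional
  equation is known.
\<close>

definition area_harmonic_on :: "(complex \<Rightarrow> real) \<Rightarrow> complex set \<Rightarrow> bool" where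
  "area_harmonic_on h \<Omega> \<longleftrightarrow> continuous_on \<Omega> h \<and>
     (\<forall>z r. 0 < r \<longrightarrow> cball z (2 * r) \<subseteq> \<Omega> \<longrightarrow> (LINT w:ball z r|lborel. h w) = pi * r\<^sup>2 * h z)"

section \<open>Consequences of the area mean property\<close>

lemma ball_mono_dist: "dist x y + s \<le> r \<Longrightarrow> ball y s \<subseteq> ball x r" "dist x y + s \<le> r \<Longrightarrow> cball y s \<subseteq> cball x r"
  "dist x y + s < r \<Longrightarrow> cball y s \<subseteq> ball x r" for x y :: "'a::metric_space"
  by (auto, metis add_le_cancel_left dist_triangle le_less_trans less_le_not_le linorder_not_less add_less_cancel_left less_le_trans,
      metis add_le_cancel_left dist_triangle order_trans,
      metis add_le_cancel_left dist_triangle le_less_trans order_trans)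

lemma measure_ball_complex: "0 \<le> r \<Longrightarrow> measure lborel (ball z r :: complex set) = pi * r\<^sup>2"
  using content_ball[of r z] by (simp add: unit_ball_vol_2)

lemma integrable_indicator_ball: "integrable lborel (indicator (ball z r) :: complex \<Rightarrow> real)"
proof (rule integrable_real_indicator)
  show "emeasure lborel (ball z r :: complex set) < \<infinity>"
    using emeasure_bounded_finite[of "ball z r"] by simp
qed simp

lemma set_integrable_continuous_cball:
  fixes h :: "complex \<Rightarrow> real"
  assumes "continuous_on (cball z r) h" shows "set_integrable lborel (cball z r) h"
  unfolding set_integrable_def by (rule borel_integrable_compact[OF compact_cball assms])

lemma set_integrable_ball_subset_cball:
  "set_integrable lborel (cball z r) h \<Longrightarrow> s \<le> r \<Longrightarrow> set_integrable lborel (ball z s) h" for h :: "complex \<Rightarrow> real"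
  by (rule set_integrable_subset) auto

lemma area_harmonic_mean:
  "area_harmonic_on h \<Omega> \<Longrightarrow> 0 < r \<Longrightarrow> cball z (2 * r) \<subseteq> \<Omega> \<Longrightarrow> (LINT w:ball z r|lborel. h w) = pi * r\<^sup>2 * h z"
  by (simp add: area_harmonic_on_def)

lemma area_harmonic_integrable:
  assumes "area_harmonic_on h \<Omega>" "cball z r \<subseteq> \<Omega>"
  shows "set_integrable lborel (ball z r) h"
  using assms by (intro set_integrable_ball_subset_cball[OF set_integrable_continuous_cball])
    (auto simp: area_harmonic_on_def intro: continuous_on_subset)

lemma area_harmonic_subset: "area_harmonic_on h \<Omega> \<Longrightarrow> \<Omega>' \<subseteq> \<Omega> \<Longrightarrow> area_harmonic_on h \<Omega>'"
  unfolding area_harmonic_on_def using continuous_on_subset subset_trans by blast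

lemma area_harmonic_cong:
  assumes "\<And>z. z \<in> \<Omega> \<Longrightarrow> h z = k z" "area_harmonic_on h \<Omega>" shows "area_harmonic_on k \<Omega>"
  unfolding area_harmonic_on_def
proof (intro conjI allI impI)
  show "continuous_on \<Omega> k" using assms continuous_on_cong[OF refl assms(1)] by (auto simp: area_harmonic_on_def)
  fix z r assume r: "0 < (r::real)" "cball z (2 * r) \<subseteq> \<Omega>"
  then have sub: "ball z r \<subseteq> \<Omega>" by (auto simp: subset_iff)
  have "(LINT w:ball z r|lborel. k w) = (LINT w:ball z r|lborel. h w)"
    by (rule set_lebesgue_integral_cong) (use sub assms(1) in auto)
  moreover have "z \<in> \<Omega>" using r by auto
  ultimately show "(LINT w:ball z r|lborel. k w) = pi * r\<^sup>2 * k z"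
    using area_harmonic_mean[OF assms(2) r] assms(1) by simp
qed

lemma area_harmonic_lincomb:
  assumes "area_harmonic_on h \<Omega>" "area_harmonic_on k \<Omega>"
  shows "area_harmonic_on (\<lambda>z. a * h z + b * k z + c) \<Omega>"
  unfolding area_harmonic_on_def
proof (intro conjI allI impI)
  show "continuous_on \<Omega> (\<lambda>z. a * h z + b * k z + c)"
    using assms by (auto simp: area_harmonic_on_def intro!: continuous_intros)
  fix z r assume r: "0 < (r::real)" "cball z (2 * r) \<subseteq> \<Omega>"
  have sub: "cball z r \<subseteq> \<Omega>" using r by (auto simp: subset_iff)
  note i = area_harmonic_integrable[OF assms(1) sub] area_harmonic_integrable[OF assms(2) sub]
  have i3: "set_integrable lborel (ball z r) (\<lambda>_. c)" "(LINT w:ball z r|lborel. c) = pi * r\<^sup>2 * c"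
    using integrable_indicator_ball[of z r] r measure_ball_complex[of r z] by (auto simp: set_integrable_def set_lebesgue_integral_def)
  have "(LINT w:ball z r|lborel. a * h w + b * k w + c) = a * (LINT w:ball z r|lborel. h w) + b * (LINT w:ball z r|lborel. k w) + pi * r\<^sup>2 * c"
    using i i3 by (subst set_integral_add(2)) (auto intro!: set_integral_add(1) simp: set_integral_add(2))
  then show "(LINT w:ball z r|lborel. a * h w + b * k w + c) = pi * r\<^sup>2 * (a * h z + b * k z + c)"
    using area_harmonic_mean[OF assms(1) r] area_harmonic_mean[OF assms(2) r] by (simp add: algebra_simps)
qed

lemma area_harmonic_diff:
  "area_harmonic_on h \<Omega> \<Longrightarrow> area_harmonic_on k \<Omega> \<Longrightarrow> area_harmonic_on (\<lambda>z. h z - k z + c) \<Omega>"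
  using area_harmonic_lincomb[of h \<Omega> k 1 "-1" c] by simp

lemma area_harmonic_reflect: "area_harmonic_on h \<Omega> \<Longrightarrow> area_harmonic_on (\<lambda>z. c - h z) \<Omega>"
  using area_harmonic_lincomb[of h \<Omega> h "-1" 0 c] by simp

lemma area_harmonic_translate:
  assumes "area_harmonic_on h (ball a R)" shows "area_harmonic_on (\<lambda>z. h (z + c)) (ball (a - c) R)"
  unfolding area_harmonic_on_def
proof (intro conjI allI impI)
  have tr: "z \<in> cball x r \<longleftrightarrow> z + c \<in> cball (x + c) r" "z \<in> ball x r \<longleftrightarrow> z + c \<in> ball (x + c) r" for x z :: complex and r
    by (auto simp: dist_norm)
  show "continuous_on (ball (a - c) R) (\<lambda>z. h (z + c))"
    by (rule continuous_on_compose2[of "ball a R" h])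
      (use assms tr(2)[of _ "a - c"] in \<open>auto simp: area_harmonic_on_def intro!: continuous_intros\<close>)
  fix z r assume r: "0 < (r::real)" "cball z (2 * r) \<subseteq> ball (a - c) R"
  have sub: "cball (z + c) (2 * r) \<subseteq> ball a R"
  proof
    fix w assume "w \<in> cball (z + c) (2 * r)"
    then have "w - c \<in> cball z (2 * r)" using tr(1)[of "w - c" z "2 * r"] by simp
    then have "w - c \<in> ball (a - c) R" using r(2) by blast
    then show "w \<in> ball a R" using tr(2)[of "w - c" "a - c"] by simp
  qed
  then have "cball (z + c) r \<subseteq> ball a R" using r by (auto simp: subset_iff)
  from area_harmonic_integrable[OF assms this]
  have "(\<integral>w. indicator (ball (z + c) r) (w + c) *\<^sub>R h (w + c) \<partial>lborel) = (LINT w:ball (z + c) r|lborel. h w)"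
    unfolding set_integrable_def set_lebesgue_integral_def by (rule lborel_translate(2))
  moreover have "indicator (ball (z + c) r) (w + c) = (indicator (ball z r) w :: real)" for w
    using tr(2)[of w z r] by (simp add: indicator_def)
  ultimately have "(LINT w:ball z r|lborel. h (w + c)) = (LINT w:ball (z + c) r|lborel. h w)"
    by (simp only: set_lebesgue_integral_def)
  then show "(LINT w:ball z r|lborel. h (w + c)) = pi * r\<^sup>2 * h (z + c)"
    using area_harmonic_mean[OF assms r(1) sub] by simp
qed

text \<open>All concentric means agree, so the mean over the disc of radius \<open>r\<close> is the
  mean over an arbitrarily small disc, and there continuity at the centre brings it close to
  \<open>h z\<close>.\<close>

lemma weakly_harmonic_mean:
  assumes h: "weakly_harmonic_at h z R" "isCont h z" and r: "0 < r" "r < R"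
  shows "(LINT w:ball z r|lborel. h w) = pi * r\<^sup>2 * h z"
proof -
  have hi: "set_integrable lborel (cball z R) h" using h by (simp add: weakly_harmonic_at_def)
  have "\<bar>(LINT w:ball z r|lborel. h w) - pi * r\<^sup>2 * h z\<bar> \<le> e" if "e > 0" for e
  proof -
    define e' where "e' = e / (pi * r\<^sup>2)"
    have "e' > 0" using that r by (simp add: e'_def)
    then obtain d where d: "d > 0" "\<And>w. dist w z < d \<Longrightarrow> \<bar>h w - h z\<bar> < e'"
      using h(2) unfolding continuous_at_eps_delta by (metis dist_real_def)
    define s where "s = min d r"
    have s: "0 < s" "s \<le> d" "s \<le> r" using d r by (auto simp: s_def)
    have i: "set_integrable lborel (ball z s) h" by (rule set_integrable_ball_subset_cball[OF hi]) (use s r in auto)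
    have ic: "set_integrable lborel (ball z s) (\<lambda>_. c)" "(LINT w:ball z s|lborel. c) = pi * s\<^sup>2 * c" for c :: real
      using integrable_indicator_ball[of z s] s measure_ball_complex[of s z] by (auto simp: set_integrable_def set_lebesgue_integral_def)
    have "(LINT w:ball z s|lborel. h w) - pi * s\<^sup>2 * h z = (LINT w:ball z s|lborel. h w - h z)"
      using i ic by simp
    moreover have "\<bar>LINT w:ball z s|lborel. h w - h z\<bar> \<le> pi * s\<^sup>2 * e'"
    proof -
      have "set_integrable lborel (ball z s) (\<lambda>w. h w - h z)" using i ic by (intro set_integral_diff)
      have "\<bar>LINT w:ball z s|lborel. h w - h z\<bar> \<le> (\<integral>w. \<bar>indicator (ball z s) w *\<^sub>R (h w - h z)\<bar> \<partial>lborel)"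
        unfolding set_lebesgue_integral_def by (rule integral_abs_bound)
      also have "\<dots> \<le> (\<integral>w. indicator (ball z s) w *\<^sub>R e' \<partial>lborel)"
      proof (rule integral_mono)
        show "integrable lborel (\<lambda>w. \<bar>indicator (ball z s) w *\<^sub>R (h w - h z)\<bar>)"
          using \<open>set_integrable lborel (ball z s) (\<lambda>w. h w - h z)\<close> unfolding set_integrable_def by (rule integrable_abs)
        show "integrable lborel (\<lambda>w. indicator (ball z s) w *\<^sub>R e')" using ic(1)[of e'] by (simp add: set_integrable_def)
        show "\<bar>indicator (ball z s) w *\<^sub>R (h w - h z)\<bar> \<le> indicator (ball z s) w *\<^sub>R e'" for w
          using d(2)[of w] s by (auto simp: indicator_def dist_commute)
      qed
      also have "\<dots> = pi * s\<^sup>2 * e'" using ic(2)[of e'] by (simp add: set_lebesgue_integral_def)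
      finally show ?thesis .
    qed
    ultimately have 1: "\<bar>(LINT w:ball z s|lborel. h w) - pi * s\<^sup>2 * h z\<bar> \<le> pi * s\<^sup>2 * e'" by simp
    have 2: "r\<^sup>2 * (LINT w:ball z s|lborel. h w) = s\<^sup>2 * (LINT w:ball z r|lborel. h w)"
      by (rule weakly_harmonic_area_means[OF h(1)]) (use s r in auto)
    have "s\<^sup>2 * \<bar>(LINT w:ball z r|lborel. h w) - pi * r\<^sup>2 * h z\<bar> = \<bar>s\<^sup>2 * ((LINT w:ball z r|lborel. h w) - pi * r\<^sup>2 * h z)\<bar>"
      by (simp add: abs_mult)
    also have "s\<^sup>2 * ((LINT w:ball z r|lborel. h w) - pi * r\<^sup>2 * h z) = r\<^sup>2 * ((LINT w:ball z s|lborel. h w) - pi * s\<^sup>2 * h z)"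
      using 2 by (simp add: algebra_simps)
    also have "\<bar>\<dots>\<bar> \<le> r\<^sup>2 * (pi * s\<^sup>2 * e')" using 1 r by (simp add: abs_mult mult_left_mono)
    also have "\<dots> = s\<^sup>2 * e" using r by (simp add: e'_def)
    finally show ?thesis using s by simp
  qed
  then have "\<bar>(LINT w:ball z r|lborel. h w) - pi * r\<^sup>2 * h z\<bar> \<le> 0" by (rule field_le_epsilon) simp
  then show ?thesis by simp
qed

text \<open>The disc of radius \<open>r\<close> about \<open>y\<close> lies in the disc of radius
  \<open>2 * r\<close> about \<open>x\<close>, and for nonnegative \<open>h\<close> the integrals
  compare. The factor 4 is the ratio of the areas.\<close>

lemma area_harmonic_harnack:
  assumes h: "area_harmonic_on h \<Omega>" and r: "0 < r" "cball x (4 * r) \<subseteq> \<Omega>"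
    and nonneg: "\<And>y. y \<in> cball x (4 * r) \<Longrightarrow> 0 \<le> h y" and y: "dist x y < r"
  shows "h y \<le> 4 * h x"
proof -
  have sub: "ball y r \<subseteq> ball x (2 * r)" "cball y (2 * r) \<subseteq> cball x (4 * r)"
    by (rule ball_mono_dist; use y r in simp)+
  have i: "set_integrable lborel (ball x (2 * r)) h" "set_integrable lborel (ball y r) h"
    using area_harmonic_integrable[OF h, of x "2 * r"] area_harmonic_integrable[OF h, of y r] sub r by (auto simp: subset_iff)
  have "pi * r\<^sup>2 * h y = (LINT w:ball y r|lborel. h w)"
    using area_harmonic_mean[OF h r(1), of y] sub r by auto
  also have "\<dots> \<le> (LINT w:ball x (2 * r)|lborel. h w)"
    unfolding set_lebesgue_integral_def
  proof (rule integral_mono)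
    show "integrable lborel (\<lambda>w. indicator (ball y r) w *\<^sub>R h w)" "integrable lborel (\<lambda>w. indicator (ball x (2 * r)) w *\<^sub>R h w)"
      using i by (simp_all add: set_integrable_def)
    show "indicator (ball y r) w *\<^sub>R h w \<le> indicator (ball x (2 * r)) w *\<^sub>R h w" for w
      using sub(1) nonneg[of w] r by (auto simp: indicator_def subset_iff)
  qed
  also have "\<dots> = pi * (2 * r)\<^sup>2 * h x"
    using area_harmonic_mean[OF h, of "2 * r" x] r by auto
  also have "\<dots> = pi * r\<^sup>2 * (4 * h x)" by (simp add: power2_eq_square)
  finally show ?thesis using r by simp
qed

text \<open>Harnack's inequality is applied to the nonnegative function \<open>h x - h\<close>,
  whose value at \<open>x\<close> is 0.\<close>

lemma area_harmonic_max:
  assumes h: "area_harmonic_on h \<Omega>" and r: "0 < r" "cball x (4 * r) \<subseteq> \<Omega>"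
    and max: "\<And>y. y \<in> cball x (4 * r) \<Longrightarrow> h y \<le> h x" and y: "dist x y < r"
  shows "h y = h x"
proof -
  have "h x - h y \<le> 4 * (h x - h x)"
    by (rule area_harmonic_harnack[OF area_harmonic_reflect[OF h] r]) (use max y in auto)
  moreover have "h y \<le> h x" using y r by (intro max) auto
  ultimately show ?thesis by simp
qed

text \<open>The two means differ by an integral over the symmetric difference of two discs of radius
  r. Both discs contain the disc of radius r - \<delta> about \<open>z\<close>, so this area is at
  most 2 pi (r^2 - (r - \<delta>)^2) \<le> 4 pi r \<delta>. When \<delta> \<ge> r the trivial bound
  2 M is already small enough.\<close>

lemma area_harmonic_lipschitz:
  assumes h: "area_harmonic_on h \<Omega>" and r: "0 < r" "cball x (3 * r) \<subseteq> \<Omega>"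
    and M: "\<And>y. y \<in> cball x (3 * r) \<Longrightarrow> \<bar>h y\<bar> \<le> M" and z: "dist x z < r" "dist x z' < r"
  shows "\<bar>h z - h z'\<bar> \<le> 4 * M / r * dist z z'"
proof -
  define \<delta> where "\<delta> = dist z z'"
  have zx: "z \<in> cball x (3 * r)" "z' \<in> cball x (3 * r)" using z r by auto
  have M0: "M \<ge> 0" using M[OF zx(1)] by simp
  show ?thesis
  proof (cases "\<delta> < r")
    case False
    have "\<bar>h z - h z'\<bar> \<le> 2 * M" using M[OF zx(1)] M[OF zx(2)] by linarith
    also have "\<dots> \<le> 4 * M * 1" using M0 by simp
    also have "\<dots> \<le> 4 * M * (\<delta> / r)" using False r M0 by (intro mult_left_mono) auto
    finally show ?thesis by (simp add: \<delta>_def)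
  next
    case True
    have sub: "cball z (2 * r) \<subseteq> cball x (3 * r)" "cball z' (2 * r) \<subseteq> cball x (3 * r)"
      by (rule ball_mono_dist; use z in simp)+
    have subI: "ball z (r - \<delta>) \<subseteq> ball z r" "ball z (r - \<delta>) \<subseteq> ball z' r"
      by (rule ball_mono_dist; simp add: \<delta>_def dist_commute)+
    have i: "integrable lborel (\<lambda>w. indicator (ball z r) w *\<^sub>R h w)" "integrable lborel (\<lambda>w. indicator (ball z' r) w *\<^sub>R h w)"
      using area_harmonic_integrable[OF h, of z r] area_harmonic_integrable[OF h, of z' r] sub r
      by (auto simp: subset_iff set_integrable_def)
    have "pi * r\<^sup>2 * h z - pi * r\<^sup>2 * h z' = (\<integral>w. indicator (ball z r) w *\<^sub>R h w - indicator (ball z' r) w *\<^sub>R h w \<partial>lborel)"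
      using area_harmonic_mean[OF h r(1), of z] area_harmonic_mean[OF h r(1), of z'] sub r i
      by (simp add: set_lebesgue_integral_def)
    also have "\<bar>\<dots>\<bar> \<le> (\<integral>w. \<bar>indicator (ball z r) w *\<^sub>R h w - indicator (ball z' r) w *\<^sub>R h w\<bar> \<partial>lborel)"
      by (rule integral_abs_bound)
    also have "\<dots> \<le> (\<integral>w. M * (indicator (ball z r) w + indicator (ball z' r) w - 2 * indicator (ball z (r - \<delta>)) w) \<partial>lborel)"
    proof (rule integral_mono)
      show "integrable lborel (\<lambda>w. \<bar>indicator (ball z r) w *\<^sub>R h w - indicator (ball z' r) w *\<^sub>R h w\<bar>)"
        by (intro integrable_abs Bochner_Integration.integrable_diff i)
      show "integrable lborel (\<lambda>w. M * (indicator (ball z r) w + indicator (ball z' r) w - 2 * indicator (ball z (r - \<delta>)) w))"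
        by (intro integrable_mult_right Bochner_Integration.integrable_diff Bochner_Integration.integrable_add integrable_indicator_ball)
      fix w :: complex
      have "w \<in> ball z r \<Longrightarrow> \<bar>h w\<bar> \<le> M" "w \<in> ball z' r \<Longrightarrow> \<bar>h w\<bar> \<le> M"
        using sub r by (auto intro!: M simp: subset_iff)
      then show "\<bar>indicator (ball z r) w *\<^sub>R h w - indicator (ball z' r) w *\<^sub>R h w\<bar>
        \<le> M * (indicator (ball z r) w + indicator (ball z' r) w - 2 * indicator (ball z (r - \<delta>)) w)"
        using subI by (auto simp: indicator_def simp del: mem_ball)
    qed
    also have "\<dots> = M * (pi * r\<^sup>2 + pi * r\<^sup>2 - 2 * (pi * (r - \<delta>)\<^sup>2))"
      using True r by (simp add: integrable_indicator_ball measure_ball_complex)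
    also have "\<dots> \<le> M * (pi * r * (4 * \<delta>))"
    proof (rule mult_left_mono[OF _ M0])
      have "pi * r\<^sup>2 + pi * r\<^sup>2 - 2 * (pi * (r - \<delta>)\<^sup>2) = pi * r * (4 * \<delta>) - 2 * pi * \<delta>\<^sup>2"
        by (simp add: power2_eq_square algebra_simps)
      then show "pi * r\<^sup>2 + pi * r\<^sup>2 - 2 * (pi * (r - \<delta>)\<^sup>2) \<le> pi * r * (4 * \<delta>)" by simp
    qed
    finally have "pi * r\<^sup>2 * \<bar>h z - h z'\<bar> \<le> M * (pi * r * (4 * \<delta>))"
      by (simp add: right_diff_distrib[symmetric] abs_mult)
    then have "pi * r * (r * \<bar>h z - h z'\<bar>) \<le> pi * r * (4 * M * \<delta>)" by (simp add: power2_eq_square mult_ac)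
    then have "r * \<bar>h z - h z'\<bar> \<le> 4 * M * \<delta>" using r by simp
    then show ?thesis using r by (simp add: \<delta>_def field_simps)
  qed
qed

text \<open>The Lipschitz estimate is used twice: in \<open>w\<close>, where \<open>m\<close>
  vanishes at \<open>w0\<close>, and then in \<open>z\<close> with the resulting small bound in
  place of \<open>M\<close>. This produces the product of the two distances and the constant 16 = 4
  * 4.\<close>

lemma separately_area_harmonic_mixed_bound:
  assumes r: "0 < r"
    and h1: "\<And>w. w \<in> ball w0 (4 * r) \<Longrightarrow> area_harmonic_on (\<lambda>z. m z w) (ball z0 (4 * r))"
    and h2: "\<And>z. z \<in> ball z0 (4 * r) \<Longrightarrow> area_harmonic_on (\<lambda>w. m z w) (ball w0 (4 * r))"
    and M: "\<And>z w. z \<in> ball z0 (4 * r) \<Longrightarrow> w \<in> ball w0 (4 * r) \<Longrightarrow> \<bar>m z w\<bar> \<le> M"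
    and 0: "\<And>z. z \<in> ball z0 (4 * r) \<Longrightarrow> m z w0 = 0" "\<And>w. w \<in> ball w0 (4 * r) \<Longrightarrow> m z0 w = 0"
    and zw: "dist z0 z < r" "dist w0 w < r"
  shows "\<bar>m z w\<bar> \<le> 16 * M / r\<^sup>2 * (dist z0 z * dist w0 w)"
proof -
  have sub: "cball x (3 * r) \<subseteq> ball x (4 * r)" for x :: complex using r by auto
  have 1: "\<bar>m z w\<bar> \<le> 4 * M / r * dist w0 w" if "z \<in> ball z0 (4 * r)" for z
  proof -
    have "\<bar>m z w - m z w0\<bar> \<le> 4 * M / r * dist w w0"
      by (rule area_harmonic_lipschitz[OF h2[OF that] r sub]) (use M[OF that] sub zw r in \<open>auto simp: subset_iff\<close>)
    then show ?thesis using 0(1)[OF that] by (simp add: dist_commute)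
  qed
  have w: "w \<in> ball w0 (4 * r)" using zw r by auto
  have "\<bar>m z w - m z0 w\<bar> \<le> 4 * (4 * M / r * dist w0 w) / r * dist z z0"
    by (rule area_harmonic_lipschitz[OF h1[OF w] r sub]) (use 1 sub zw r in \<open>auto simp: subset_iff\<close>)
  then show ?thesis using 0(2)[OF w] by (simp add: dist_commute power2_eq_square mult_ac)
qed

text \<open>The second difference is an increment of the function
  \<open>\<lambda>z. h (z + \<zeta>) - h z\<close> over a step of length |\<zeta>|. This function is
  itself of order |\<zeta>| by the Lipschitz estimate, and a second application of that estimate
  gives the square.\<close>

lemma area_harmonic_second_difference:
  assumes h: "area_harmonic_on h (ball x (8 * r))" and r: "0 < r"
    and M: "\<And>y. y \<in> ball x (8 * r) \<Longrightarrow> \<bar>h y\<bar> \<le> M" and \<zeta>: "norm \<zeta> < r"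
  shows "\<bar>h (x + \<zeta>) + h (x - \<zeta>) - 2 * h x\<bar> \<le> 16 * M / r\<^sup>2 * (norm \<zeta>)\<^sup>2"
proof -
  have d: "area_harmonic_on (\<lambda>z. h (z + \<zeta>) - h z + 0) (ball x (4 * r))"
  proof (rule area_harmonic_diff)
    show "area_harmonic_on (\<lambda>z. h (z + \<zeta>)) (ball x (4 * r))"
      by (rule area_harmonic_subset[OF area_harmonic_translate[OF h]])
        (rule ball_mono_dist, use \<zeta> r in \<open>simp add: dist_norm\<close>)
    show "area_harmonic_on h (ball x (4 * r))"
      by (rule area_harmonic_subset[OF h]) (use r in auto)
  qed
  have b: "\<bar>h (z + \<zeta>) - h z + 0\<bar> \<le> 4 * M / r * norm \<zeta>" if z: "z \<in> cball x (3 * r)" for z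
  proof -
    have "cball z (3 * r) \<subseteq> ball x (8 * r)" by (rule ball_mono_dist) (use z r in auto)
    then have "\<bar>h (z + \<zeta>) - h z\<bar> \<le> 4 * M / r * dist (z + \<zeta>) z"
      by (intro area_harmonic_lipschitz[OF h r, of z]) (use \<zeta> r M in \<open>auto simp: dist_norm subset_iff\<close>)
    then show ?thesis by (simp add: dist_norm)
  qed
  have "\<bar>(h (x + \<zeta>) - h x + 0) - (h (x - \<zeta> + \<zeta>) - h (x - \<zeta>) + 0)\<bar> \<le> 4 * (4 * M / r * norm \<zeta>) / r * dist x (x - \<zeta>)"
    by (rule area_harmonic_lipschitz[OF d r, of x]) (use b \<zeta> r in \<open>auto simp: dist_norm\<close>)
  then show ?thesis by (simp add: dist_norm power2_eq_square mult_ac algebra_simps)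
qed

section \<open>Weak harmonicity, vanishing Laplacian and removable points\<close>

lemma weakly_harmonic_of_laplacian:
  assumes g: "C_k_on 2 g \<Omega>" "open \<Omega>" "cball z R \<subseteq> \<Omega>" "\<And>w. w \<in> cball z R \<Longrightarrow> flat_laplacian g w = 0"
  shows "weakly_harmonic_at g z R"
  unfolding weakly_harmonic_at_def
proof (intro conjI allI impI)
  show "set_integrable lborel (cball z R) g"
    by (rule set_integrable_continuous_cball) (use C2_continuous(1)[OF g(1)] g(3) continuous_on_subset in blast)
  fix F assume "radial_test R F"
  then obtain R1 where F: "D_k_on 2 F UNIV" "0 < R1" "R1 < R" "\<And>t. R1\<^sup>2 \<le> t \<Longrightarrow> F t = 0"
    by (auto simp: radial_test_def)
  have "(LINT w:cball z R|lborel. g w * flat_laplacian (\<lambda>w. F ((norm (w - z))\<^sup>2)) w) = (LINT w:cball z R|lborel. F ((norm (w - z))\<^sup>2) * flat_laplacian g w)"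
    by (rule green_identity[OF g(1-3) F(2,3) C_k_on_radial[OF F(1)]])
      (use F in \<open>auto simp: dist_norm norm_minus_commute intro: power_mono\<close>)
  also have "\<dots> = (LINT w:cball z R|lborel. 0)"
    by (rule set_lebesgue_integral_cong) (use g(4) in auto)
  finally show "(LINT w:cball z R|lborel. g w * flat_laplacian (\<lambda>w. F ((norm (w - z))\<^sup>2)) w) = 0"
    by (simp add: set_lebesgue_integral_def)
qed

text \<open>The disc of radius \<open>2 * r\<close> gives the disc of radius \<open>r\<close> the
  strict margin that \<open>weakly_harmonic_mean\<close> asks for. This is the origin of the factor
  2 in \<open>area_harmonic_on\<close>.\<close>

lemma area_harmonic_of_laplacian:
  assumes g: "C_k_on 2 g \<Omega>" "open \<Omega>" "\<And>w. w \<in> \<Omega> \<Longrightarrow> flat_laplacian g w = 0"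
  shows "area_harmonic_on g \<Omega>"
  unfolding area_harmonic_on_def
proof (intro conjI allI impI)
  show c: "continuous_on \<Omega> g" using C2_continuous(1)[OF g(1)] .
  fix z r assume r: "0 < (r::real)" "cball z (2 * r) \<subseteq> \<Omega>"
  then have "z \<in> \<Omega>" by auto
  then have "isCont g z" using c g(2) by (simp add: continuous_on_eq_continuous_at)
  then show "(LINT w:ball z r|lborel. g w) = pi * r\<^sup>2 * g z"
    using r g(3) by (intro weakly_harmonic_mean[OF weakly_harmonic_of_laplacian[OF g(1,2) r(2)]]) auto
qed

text \<open>If the Laplacian had the value L \<noteq> 0 at \<open>z\<close>, its product with L
  would stay above L^2 / 2 on a small disc. Green's identity with a nonnegative bump would then give
  integral zero to a nonnegative function that is positive on a nonempty open set.\<close>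

lemma laplacian_of_weakly_harmonic:
  assumes g: "C_k_on 2 g \<Omega>" "open \<Omega>" "z \<in> \<Omega>"
    and w: "\<And>R. 0 < R \<Longrightarrow> cball z R \<subseteq> \<Omega> \<Longrightarrow> weakly_harmonic_at g z R"
  shows "flat_laplacian g z = 0"
proof (rule ccontr)
  define L where "L = flat_laplacian g z"
  assume "flat_laplacian g z \<noteq> 0"
  then have L: "L \<noteq> 0" by (simp add: L_def)
  have "isCont (flat_laplacian g) z"
    using C2_continuous(4)[OF g(1)] g by (simp add: continuous_on_eq_continuous_at)
  then obtain d where d: "d > 0" "\<And>w. dist w z < d \<Longrightarrow> \<bar>flat_laplacian g w - L\<bar> < \<bar>L\<bar> / 2"
    using L unfolding continuous_at_eps_delta L_def by (metis dist_real_def half_gt_zero zero_less_abs_iff)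
  obtain d' where d': "d' > 0" "cball z d' \<subseteq> \<Omega>" using g open_contains_cball by blast
  define R where "R = min (d / 2) d'"
  have R: "R > 0" "cball z R \<subseteq> \<Omega>" "\<And>w. w \<in> cball z R \<Longrightarrow> dist w z < d"
    using d d' by (auto simp: R_def dist_commute subset_iff)
  have pos: "L * flat_laplacian g w \<ge> L\<^sup>2 / 2" if "w \<in> cball z R" for w
  proof -
    have "L * (L - flat_laplacian g w) \<le> \<bar>L\<bar> * (\<bar>L\<bar> / 2)"
    proof -
      have "L * (L - flat_laplacian g w) \<le> \<bar>L\<bar> * \<bar>L - flat_laplacian g w\<bar>"
        using abs_ge_self[of "L * (L - flat_laplacian g w)"] by (simp add: abs_mult)
      also have "\<dots> \<le> \<bar>L\<bar> * (\<bar>L\<bar> / 2)"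
        using d(2)[OF R(3)[OF that]] by (intro mult_left_mono) (auto simp: abs_minus_commute)
      finally show ?thesis .
    qed
    then show ?thesis by (simp add: power2_eq_square algebra_simps)
  qed
  define R1 where "R1 = R / 2"
  have R1: "0 < R1" "R1 < R" using R by (auto simp: R1_def)
  \<comment> \<open>A bump with parameter \<open>n\<close> is positive once its argument exceeds
    \<open>1 / n\<close>. This \<open>n\<close> makes it positive at
    \<open>3/4 * R1\<^sup>2\<close>, the squared distance of the point exhibited in \<open>S\<close>
    below.\<close>
  obtain n where n: "2 < real n * R1\<^sup>2"
    using reals_Archimedean3[of "R1\<^sup>2"] R1 by auto
  define F where "F = bump (R1\<^sup>2) n"
  define \<psi> where "\<psi> = (\<lambda>w. F ((norm (w - z))\<^sup>2))"
  have F: "radial_test R F"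
    unfolding radial_test_def F_def using D_k_on_bump bump_zero(2) R1 by blast
  have \<psi>: "C_k_on 2 \<psi> UNIV" unfolding \<psi>_def F_def by (rule C_k_on_radial[OF D_k_on_bump]) auto
  have supp: "\<psi> w = 0" if "R1 \<le> dist z w" for w
    using that R1 unfolding \<psi>_def F_def by (intro bump_zero(2) power_mono) (auto simp: dist_norm norm_minus_commute)
  have c\<psi>: "continuous_on S \<psi>" for S using C_k_on_continuous[OF \<psi>] by (rule continuous_on_subset) auto
  have \<psi>0: "\<psi> w \<ge> 0" for w by (simp add: \<psi>_def F_def bump_bounds)
  have cL: "continuous_on (cball z R) (flat_laplacian g)"
    using C2_continuous(4)[OF g(1)] R(2) continuous_on_subset by blast
  have "0 = (LINT w:cball z R|lborel. g w * flat_laplacian \<psi> w)"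
    using w[OF R(1,2)] F unfolding weakly_harmonic_at_def \<psi>_def by metis
  also have "\<dots> = (LINT w:cball z R|lborel. \<psi> w * flat_laplacian g w)"
    by (rule green_identity[OF g(1,2) R(2) R1 \<psi> supp])
  finally have zero: "(\<integral>w. L * (indicator (cball z R) w *\<^sub>R (\<psi> w * flat_laplacian g w)) \<partial>lborel) = 0"
    by (simp add: set_lebesgue_integral_def)
  have int: "integrable lborel (\<lambda>w. L * (indicator (cball z R) w *\<^sub>R (\<psi> w * flat_laplacian g w)))"
    using set_integrable_continuous_cball[of z R "\<lambda>w. \<psi> w * flat_laplacian g w"] c\<psi> cL
    by (intro integrable_mult_right) (auto simp: set_integrable_def intro!: continuous_intros)
  have nn: "0 \<le> L * (indicator (cball z R) w *\<^sub>R (\<psi> w * flat_laplacian g w))" for w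
  proof -
    have "0 \<le> \<psi> w * (L * flat_laplacian g w)" if "w \<in> cball z R"
    proof -
      have "0 \<le> L * flat_laplacian g w" using pos[OF that] zero_le_power2[of L] by linarith
      then show ?thesis using \<psi>0[of w] by (rule mult_nonneg_nonneg[rotated])
    qed
    then show ?thesis by (auto simp: indicator_def mult_ac simp del: mem_cball)
  qed
  have ae: "AE w in lborel. L * (indicator (cball z R) w *\<^sub>R (\<psi> w * flat_laplacian g w)) = 0"
    using integral_nonneg_eq_0_iff_AE[OF int] nn zero by simp
  define S where "S = {w. \<psi> w > 0} \<inter> ball z R"
  have "open {w. \<psi> w > 0}" using c\<psi>[of UNIV] by (intro open_Collect_less) auto
  then have oS: "open S" by (auto simp: S_def)
  have "z + of_real (sqrt (3/4) * R1) \<in> S"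
  proof -
    have "(sqrt (3/4) * R1)\<^sup>2 = 3/4 * R1\<^sup>2" by (simp add: power_mult_distrib)
    moreover have "0 < R1\<^sup>2" using R1 by simp
    ultimately have "\<psi> (z + of_real (sqrt (3/4) * R1)) > 0"
      unfolding \<psi>_def F_def using n by (intro bump_pos) (auto simp: norm_mult power_mult_distrib)
    moreover have "sqrt (3/4) * R1 < R"
    proof -
      have "sqrt (3/4) * R1 < 1 * R1"
        using R1 real_sqrt_less_mono[of "3/4" 1] by (intro mult_strict_right_mono) simp_all
      then show ?thesis using R1 by linarith
    qed
    ultimately show ?thesis using R1 by (auto simp: S_def dist_norm norm_mult)
  qed
  then have "\<not> negligible S" using open_not_negligible[OF oS] by auto
  moreover have "AE w in lborel. w \<notin> S"
    using ae
  proof eventually_elim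
    case (elim w)
    show ?case
    proof
      assume "w \<in> S"
      then have "\<psi> w > 0" "w \<in> cball z R" by (auto simp: S_def)
      moreover have "L\<^sup>2 / 2 > 0" using L by simp
      moreover have "L * flat_laplacian g w > 0" using pos[of w] calculation by linarith
      ultimately have "\<psi> w * (L * flat_laplacian g w) > 0" by (metis mult_pos_pos)
      then show False using elim \<open>w \<in> cball z R\<close> by auto
    qed
  qed
  then have "S \<in> null_sets lborel" using oS by (subst AE_iff_null_sets) auto
  then have "negligible S" unfolding negligible_iff_null_sets by (rule null_sets_completionI)
  ultimately show False by simp
qed

lemma continuous_on_area_integral:
  fixes h :: "complex \<Rightarrow> real"
  assumes h: "set_integrable lborel (cball a R) h" and s: "\<And>z. z \<in> S \<Longrightarrow> cball z s \<subseteq> cball a R" "0 \<le> s"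
  shows "continuous_on S (\<lambda>z. LINT w:ball z s|lborel. h w)"
proof (rule continuous_on_sequentiallyI)
  fix u x assume u: "\<forall>n. u n \<in> S" "x \<in> S" "u \<longlonglongrightarrow> (x::complex)"
  define k where "k = (\<lambda>w. indicator (cball a R) w *\<^sub>R h w)"
  have k: "integrable lborel k" using h by (simp add: set_integrable_def k_def)
  have km: "k \<in> borel_measurable borel" using borel_measurable_integrable[OF k] by simp
  have eq: "(LINT w:ball z s|lborel. h w) = (\<integral>w. indicator (ball z s) w *\<^sub>R k w \<partial>lborel)" if "z \<in> S" for z
    unfolding set_lebesgue_integral_def k_def
    by (rule Bochner_Integration.integral_cong) (use s(1)[OF that] in \<open>auto simp: indicator_def subset_iff\<close>)
  have "(\<lambda>n. \<integral>w. indicator (ball (u n) s) w *\<^sub>R k w \<partial>lborel) \<longlonglongrightarrow> (\<integral>w. indicator (ball x s) w *\<^sub>R k w \<partial>lborel)"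
  proof (rule integral_dominated_convergence[where w="\<lambda>w. \<bar>k w\<bar>"])
    show "integrable lborel (\<lambda>w. \<bar>k w\<bar>)" using k by (rule integrable_abs)
    have "sphere x s \<in> null_sets lborel"
      using negligible_sphere[of x s] by (auto simp: negligible_iff_null_sets null_sets_completion_iff)
    then have "AE w in lborel. w \<notin> sphere x s" by (rule AE_not_in)
    then show "AE w in lborel. (\<lambda>n. indicator (ball (u n) s) w *\<^sub>R k w) \<longlonglongrightarrow> indicator (ball x s) w *\<^sub>R k w"
    proof eventually_elim
      case (elim w)
      have l: "(\<lambda>n. dist (u n) w) \<longlonglongrightarrow> dist x w" by (intro tendsto_intros u)
      have "\<forall>\<^sub>F n in sequentially. indicator (ball (u n) s) w = (indicator (ball x s) w :: real)"
      proof (cases "dist x w < s")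
        case True
        from order_tendstoD(2)[OF l True] show ?thesis by eventually_elim (use True in \<open>auto simp: indicator_def\<close>)
      next
        case False
        then have "s < dist x w" using elim by auto
        from order_tendstoD(1)[OF l this] show ?thesis by eventually_elim (use False in \<open>auto simp: indicator_def\<close>)
      qed
      then have "\<forall>\<^sub>F n in sequentially. indicator (ball x s) w *\<^sub>R k w = indicator (ball (u n) s) w *\<^sub>R k w"
        by eventually_elim simp
      then show ?case by (rule Lim_transform_eventually[OF tendsto_const])
    qed
    show "(\<lambda>w. indicator (ball x s) w *\<^sub>R k w) \<in> borel_measurable lborel" "(\<lambda>w. indicator (ball (u n) s) w *\<^sub>R k w) \<in> borel_measurable lborel" for n
      by (rule borel_measurable_indicator_scaleR[OF _ km], simp)+
    show "AE w in lborel. norm (indicator (ball (u n) s) w *\<^sub>R k w) \<le> \<bar>k w\<bar>" for n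
      by (intro AE_I2) (auto simp: indicator_def)
  qed
  then show "(\<lambda>n. LINT w:ball (u n) s|lborel. h w) \<longlonglongrightarrow> (LINT w:ball x s|lborel. h w)"
    using eq u by simp
qed

text \<open>The discs tested may contain \<open>p\<close>, so \<open>h\<close> has no singular mass
  there and only its value at \<open>p\<close> can be wrong. Averaging over discs of the fixed
  radius \<open>r\<close> reproduces \<open>h\<close> wherever it is continuous, and the averages
  depend continuously on the centre even at \<open>p\<close>.\<close>

lemma weyl_removable:
  assumes r: "0 < r" and w: "\<And>z R. 0 < R \<Longrightarrow> cball z R \<subseteq> ball a (4 * r) \<Longrightarrow> weakly_harmonic_at h z R"
    and c: "continuous_on (ball a (4 * r) - {p}) h"
  obtains h' where "area_harmonic_on h' (ball a r)" "\<And>z. z \<in> ball a r \<Longrightarrow> z \<noteq> p \<Longrightarrow> h' z = h z"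
proof
  define h' where "h' = (\<lambda>z. (LINT w:ball z r|lborel. h w) / (pi * r\<^sup>2))"
  have hi: "set_integrable lborel (cball a (3 * r)) h"
    using w[of "3 * r" a] r by (simp add: weakly_harmonic_at_def subset_iff)
  have wz: "weakly_harmonic_at h z (2 * r)" if "z \<in> ball a r" for z
    by (rule w) (use r that in simp, rule ball_mono_dist, use that r in simp)
  have ic: "isCont h z" if "z \<in> ball a r" "z \<noteq> p" for z
  proof -
    have "open (ball a (4 * r) - {p})" "z \<in> ball a (4 * r) - {p}" using that r by auto
    then show ?thesis using c by (simp add: continuous_on_eq_continuous_at)
  qed
  have mean: "(LINT w:ball z s|lborel. h w) = pi * s\<^sup>2 * h z" if "z \<in> ball a r" "z \<noteq> p" "0 < s" "s < 2 * r" for z s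
    by (rule weakly_harmonic_mean[OF wz ic]) (use that in auto)
  show eq: "h' z = h z" if "z \<in> ball a r" "z \<noteq> p" for z
    using mean[OF that, of r] r by (simp add: h'_def)
  have cA: "continuous_on (ball a r) (\<lambda>z. LINT w:ball z s|lborel. h w)" if "0 < s" "s < 2 * r" for s
    by (rule continuous_on_area_integral[OF hi]) (rule ball_mono_dist, use that in auto)
  have ch: "continuous_on (ball a r) h'" unfolding h'_def
    using cA[of r] r by (intro continuous_intros) auto
  show "area_harmonic_on h' (ball a r)"
    unfolding area_harmonic_on_def
  proof (intro conjI allI impI)
    fix z s assume s: "0 < (s::real)" "cball z (2 * s) \<subseteq> ball a r"
    have "2 * s \<le> 2 * r"
    proof -
      have "2 * s < dist a z + 2 * s + 1" using zero_le_dist[of a z] s by linarith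
      have "z + of_real (2 * s) \<in> ball a r" "z - of_real (2 * s) \<in> ball a r" using s by (auto simp: subset_iff dist_norm norm_mult)
      then have "dist (z + of_real (2 * s)) (z - of_real (2 * s)) < r + r"
        using dist_triangle[of "z + of_real (2 * s)" "z - of_real (2 * s)" a] by (simp add: dist_commute)
      then show ?thesis using s by (simp add: dist_norm norm_mult)
    qed
    then have s2: "s < 2 * r" using s r by simp
    have z: "z \<in> ball a r" using s by (auto simp: subset_iff)
    have "AE w in lborel. w \<noteq> p" by (simp add: AE_lborel_singleton)
    have "(LINT w:ball z s|lborel. h' w) = (LINT w:ball z s|lborel. h w)"
      unfolding set_lebesgue_integral_def
    proof (rule integral_cong_AE)
      have sub: "cball z s \<subseteq> ball a r" using s by (auto simp: subset_iff)
      have "set_integrable lborel (ball z s) h'"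
        by (rule set_integrable_ball_subset_cball[OF set_integrable_continuous_cball[OF continuous_on_subset[OF ch sub]]]) simp
      then show "(\<lambda>w. indicator (ball z s) w *\<^sub>R h' w) \<in> borel_measurable lborel"
        unfolding set_integrable_def by (rule borel_measurable_integrable)
      have "set_integrable lborel (ball z s) h"
      proof (rule set_integrable_subset[OF hi])
        have "ball z s \<subseteq> cball z s" "ball a r \<subseteq> cball a (3 * r)" using r by auto
        then show "ball z s \<subseteq> cball a (3 * r)" using sub by blast
      qed simp
      then show "(\<lambda>w. indicator (ball z s) w *\<^sub>R h w) \<in> borel_measurable lborel"
        unfolding set_integrable_def by (rule borel_measurable_integrable)
      show "AE w in lborel. indicator (ball z s) w *\<^sub>R h' w = indicator (ball z s) w *\<^sub>R h w"
        using \<open>AE w in lborel. w \<noteq> p\<close>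
        by eventually_elim (use sub eq in \<open>auto simp: indicator_def subset_iff\<close>)
    qed
    also have "\<dots> = pi * s\<^sup>2 * h' z"
    proof (cases "z = p")
      case False then show ?thesis using mean[OF z False s(1) s2] eq[OF z] by simp
    next
      \<comment> \<open>At the exceptional point the mean value equation is inherited: both sides
        are continuous in the centre and agree at all other nearby points.\<close>
      case True
      let ?A = "\<lambda>z. LINT w:ball z s|lborel. h w"
      have "isCont ?A z" "isCont h' z"
        using cA[OF s(1) s2] ch z by (simp_all add: continuous_on_eq_continuous_at)
      then have 1: "(?A \<longlongrightarrow> ?A z) (at z)" "((\<lambda>z. pi * s\<^sup>2 * h' z) \<longlongrightarrow> pi * s\<^sup>2 * h' z) (at z)"
        by (auto simp: isCont_def intro!: tendsto_intros)
      have "\<forall>\<^sub>F y in at z. ?A y = pi * s\<^sup>2 * h' y"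
      proof -
        have "\<forall>\<^sub>F y in at z. y \<in> ball a r - {z}" using z by (intro eventually_at_in_open) auto
        then show ?thesis by eventually_elim (use mean eq s s2 True in auto)
      qed
      from Lim_transform_eventually[OF 1(1) this] show ?thesis
        using 1(2) by (rule tendsto_unique[OF at_neq_bot])
    qed
    finally show "(LINT w:ball z s|lborel. h' w) = pi * s\<^sup>2 * h' z" .
  qed (rule ch)
qed

section \<open>Green functions in charts\<close>

locale charted_surface =
  fixes X :: "'a topology" and \<A> :: "'a chart set"
  assumes riemann_surface: "riemann_surface X \<A>"
begin

lemma chart:
  assumes "c \<in> \<A>"
  shows "openin X (chart_dom c)" "open (chart_img c)" "inj_on (snd c) (chart_dom c)" "chart_dom c \<subseteq> topspace X"
    "homeomorphic_map (subtopology X (chart_dom c)) (top_of_set (chart_img c)) (snd c)"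
proof -
  have *: "complex_chart X c" using riemann_surface assms by (auto simp: riemann_surface_def)
  then show "openin X (chart_dom c)" "open (chart_img c)"
    "homeomorphic_map (subtopology X (chart_dom c)) (top_of_set (chart_img c)) (snd c)"
    by (auto simp: complex_chart_def)
  then show "chart_dom c \<subseteq> topspace X" by (auto dest: openin_subset)
  then show "inj_on (snd c) (chart_dom c)"
    using homeomorphic_imp_injective_map[of "subtopology X (chart_dom c)" "top_of_set (chart_img c)" "snd c"] *
    by (auto simp: complex_chart_def Int_absorb1)
qed

lemma chart_inv:
  assumes "c \<in> \<A>"
  shows "x \<in> chart_dom c \<Longrightarrow> chart_inv c (snd c x) = x"
    "z \<in> chart_img c \<Longrightarrow> chart_inv c z \<in> chart_dom c" "z \<in> chart_img c \<Longrightarrow> snd c (chart_inv c z) = z"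
  using chart(3)[OF assms] by (auto simp: inv_into_f_f)

lemma chart_inv_topspace: "c \<in> \<A> \<Longrightarrow> z \<in> chart_img c \<Longrightarrow> chart_inv c z \<in> topspace X"
  using chart_inv(2) chart(4) by blast

lemma chart_inv_inj: "c \<in> \<A> \<Longrightarrow> z \<in> chart_img c \<Longrightarrow> w \<in> chart_img c \<Longrightarrow> chart_inv c z = chart_inv c w \<Longrightarrow> z = w"
  by (metis chart_inv(3))

lemma ex_chart: "p \<in> topspace X \<Longrightarrow> \<exists>c\<in>\<A>. p \<in> chart_dom c"
  using riemann_surface by (auto simp: riemann_surface_def)

lemma chart_at: "p \<in> topspace X \<Longrightarrow> chart_at \<A> p \<in> \<A>" "p \<in> topspace X \<Longrightarrow> p \<in> chart_dom (chart_at \<A> p)"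
  using someI_ex[of "\<lambda>c. c \<in> \<A> \<and> p \<in> chart_dom c"] ex_chart unfolding chart_at_def by blast+

lemma chart_continuous: "c \<in> \<A> \<Longrightarrow> continuous_map (subtopology X (chart_dom c)) euclidean (snd c)"
  using chart(5) by (meson homeomorphic_imp_continuous_map continuous_map_into_fulltopology)

lemma chart_inv_continuous:
  assumes c: "c \<in> \<A>" shows "continuous_map (top_of_set (chart_img c)) X (chart_inv c)"
proof -
  obtain g where "homeomorphic_maps (subtopology X (chart_dom c)) (top_of_set (chart_img c)) (snd c) g"
    using chart(5)[OF c] homeomorphic_map_maps by blast
  then have g: "continuous_map (top_of_set (chart_img c)) (subtopology X (chart_dom c)) g"
    "\<And>z. z \<in> chart_img c \<Longrightarrow> snd c (g z) = z"
    by (auto simp: homeomorphic_maps_def)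
  have "g z = chart_inv c z" if "z \<in> chart_img c" for z
  proof -
    have "g z \<in> chart_dom c" using continuous_map_image_subset_topspace[OF g(1)] that by auto
    then show ?thesis using chart_inv(1)[OF c] g(2)[OF that] by metis
  qed
  moreover have "continuous_map (top_of_set (chart_img c)) X g"
    using g(1) by (rule continuous_map_into_fulltopology)
  ultimately show ?thesis by (elim continuous_map_eq) auto
qed

lemma open_chart_image:
  assumes c: "c \<in> \<A>" and U: "openin X U"
  shows "open (snd c ` (chart_dom c \<inter> U))"
proof -
  have "openin (subtopology X (chart_dom c)) (chart_dom c \<inter> U)" using U by (simp add: openin_subtopology_Int2)
  then have "openin (top_of_set (chart_img c)) (snd c ` (chart_dom c \<inter> U))"
    using homeomorphic_imp_open_map[OF chart(5)[OF c]] by (simp add: open_map_def)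
  then show ?thesis using chart(2)[OF c] by (simp add: openin_open_eq)
qed

lemma openin_chart_vimage:
  assumes c: "c \<in> \<A>" and W: "open W"
  shows "openin X {x \<in> chart_dom c. snd c x \<in> W}"
proof -
  have "openin (subtopology X (chart_dom c)) {x \<in> topspace (subtopology X (chart_dom c)). snd c x \<in> W}"
    by (rule openin_continuous_map_preimage[OF chart_continuous[OF c]]) (use W in simp)
  moreover have "{x \<in> topspace (subtopology X (chart_dom c)). snd c x \<in> W} = {x \<in> chart_dom c. snd c x \<in> W}"
    using chart(4)[OF c] by auto
  ultimately show ?thesis using chart(1)[OF c] by (metis openin_trans_full)
qed

lemma chart_inv_image_eq: "c \<in> \<A> \<Longrightarrow> W \<subseteq> chart_img c \<Longrightarrow> chart_inv c ` W = {x \<in> chart_dom c. snd c x \<in> W}"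
proof (intro equalityI subsetI)
  fix x assume *: "c \<in> \<A>" "W \<subseteq> chart_img c" "x \<in> {x \<in> chart_dom c. snd c x \<in> W}"
  then have "chart_inv c (snd c x) = x" using chart_inv(1) by blast
  then show "x \<in> chart_inv c ` W" using * by (metis (no_types, lifting) imageI mem_Collect_eq)
next
  fix x assume c: "c \<in> \<A>" and W: "W \<subseteq> chart_img c" and "x \<in> chart_inv c ` W"
  then obtain z where "z \<in> W" "x = chart_inv c z" by blast
  then show "x \<in> {x \<in> chart_dom c. snd c x \<in> W}" using chart_inv(2,3)[OF c, of z] W by auto
qed

lemma openin_chart_inv_image: "c \<in> \<A> \<Longrightarrow> open W \<Longrightarrow> W \<subseteq> chart_img c \<Longrightarrow> openin X (chart_inv c ` W)"
  using openin_chart_vimage chart_inv_image_eq by simp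

lemma closedin_chart_inv_image:
  assumes "c \<in> \<A>" "compact K" "K \<subseteq> chart_img c" shows "compactin X (chart_inv c ` K)" "closedin X (chart_inv c ` K)"
proof -
  have "compactin (top_of_set (chart_img c)) K" using assms by (simp add: compactin_subtopology)
  then show "compactin X (chart_inv c ` K)" by (rule image_compactin[OF _ chart_inv_continuous[OF assms(1)]])
  then show "closedin X (chart_inv c ` K)"
    using riemann_surface by (auto simp: riemann_surface_def intro: compactin_imp_closedin)
qed

lemma transition:
  assumes c: "c \<in> \<A>" and d: "d \<in> \<A>"
  defines "S \<equiv> snd c ` (chart_dom c \<inter> chart_dom d)"
  shows "open S" "transition c d holomorphic_on S"
    "x \<in> chart_dom c \<Longrightarrow> transition c d (snd c x) = snd d x"
proof -
  show "open S" unfolding S_def by (rule open_chart_image[OF c chart(1)[OF d]])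
  show "transition c d holomorphic_on S" using riemann_surface c d by (auto simp: riemann_surface_def S_def)
  show "x \<in> chart_dom c \<Longrightarrow> transition c d (snd c x) = snd d x"
    using chart_inv(1)[OF c] by (simp add: transition_def)
qed

lemma chart_ball:
  assumes "c \<in> \<A>" "p \<in> chart_dom c" "openin X U" "p \<in> U"
  obtains r where "0 < r" "cball (snd c p) r \<subseteq> chart_img c" "chart_inv c ` cball (snd c p) r \<subseteq> U"
proof -
  have "open (snd c ` (chart_dom c \<inter> U))" "snd c p \<in> snd c ` (chart_dom c \<inter> U)"
    using open_chart_image[OF assms(1,3)] assms by auto
  then obtain r where r: "0 < r" "cball (snd c p) r \<subseteq> snd c ` (chart_dom c \<inter> U)"
    using open_contains_cball by blast
  moreover have "chart_inv c ` snd c ` (chart_dom c \<inter> U) \<subseteq> U" using chart_inv(1)[OF assms(1)] by auto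
  ultimately show ?thesis by (intro that[of r]) blast+
qed

definition chart_extend :: "'a chart \<Rightarrow> (complex \<Rightarrow> real) \<Rightarrow> 'a \<Rightarrow> real" where
  "chart_extend c \<psi> x = (if x \<in> chart_dom c then \<psi> (snd c x) else 0)"

text \<open>The image of the closed ball is compact, hence closed since the surface is Hausdorff. So
  a point outside the chart domain has a neighbourhood on which the extension is 0, while near a
  point inside the extension is \<psi> after a transition map. Local statements about
  \<open>chart_extend\<close> are settled by these two cases.\<close>

lemma chart_extend_local:
  assumes c: "c \<in> \<A>" and d: "d \<in> \<A>" and K: "cball a R \<subseteq> chart_img c" and \<psi>: "\<And>z. z \<notin> cball a R \<Longrightarrow> \<psi> z = 0"
    and x: "x \<in> chart_dom d"
  obtains T where "x \<in> chart_dom c" "open T" "snd d x \<in> T" "T \<subseteq> chart_img d" "transition d c holomorphic_on T"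
      "\<And>z. z \<in> T \<Longrightarrow> chart_extend c \<psi> (chart_inv d z) = (\<psi> \<circ> transition d c) z"
  | T where "x \<notin> chart_dom c" "open T" "snd d x \<in> T" "T \<subseteq> chart_img d" "\<And>z. z \<in> T \<Longrightarrow> chart_extend c \<psi> (chart_inv d z) = 0"
proof (cases "x \<in> chart_dom c")
  case True
  let ?T = "snd d ` (chart_dom d \<inter> chart_dom c)"
  show ?thesis
  proof (rule that(1)[OF True, of ?T])
    fix z assume "z \<in> ?T"
    then show "chart_extend c \<psi> (chart_inv d z) = (\<psi> \<circ> transition d c) z"
      using chart_inv(1)[OF d] by (auto simp: chart_extend_def transition_def)
  qed (use transition[OF d c] x True in auto)
next
  case False
  let ?U = "topspace X - chart_inv c ` cball a R"
  have U: "openin X ?U" using closedin_chart_inv_image[OF c compact_cball K] by auto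
  let ?T = "snd d ` (chart_dom d \<inter> ?U)"
  show ?thesis
  proof (rule that(2)[OF False, of ?T])
    show "open ?T" by (rule open_chart_image[OF d U])
    have "x \<in> ?U" using False x chart(4)[OF d] chart_inv(2)[OF c] K by blast
    then show "snd d x \<in> ?T" using x by auto
    fix z assume "z \<in> ?T"
    then obtain y where y: "y \<in> chart_dom d" "y \<in> ?U" "z = snd d y" by auto
    have "chart_extend c \<psi> y = 0"
    proof (cases "y \<in> chart_dom c")
      case True
      then have "snd c y \<notin> cball a R" using y(2) chart_inv(1)[OF c True] by (metis DiffD2 imageI)
      then show ?thesis using \<psi> by (simp add: chart_extend_def)
    qed (simp add: chart_extend_def)
    then show "chart_extend c \<psi> (chart_inv d z) = 0" using chart_inv(1)[OF d y(1)] y(3) by simp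
  qed auto
qed

lemma chart_extend_smooth:
  assumes c: "c \<in> \<A>" and K: "cball a R \<subseteq> chart_img c" and \<psi>: "\<And>z. z \<notin> cball a R \<Longrightarrow> \<psi> z = 0"
    and s: "C_k_on k \<psi> UNIV"
  shows "surface_C_k_on \<A> k (topspace X) (chart_extend c \<psi>)"
  unfolding surface_C_k_on_def
proof (intro ballI C_k_on_local)
  fix d z assume d: "d \<in> \<A>" and "z \<in> snd d ` (chart_dom d \<inter> topspace X)"
  then obtain x where x: "x \<in> chart_dom d" "z = snd d x" by auto
  show "\<exists>T. open T \<and> z \<in> T \<and> C_k_on k (chart_extend c \<psi> \<circ> chart_inv d) T"
  proof (rule chart_extend_local[OF c d K \<psi> x(1)])
    fix T assume inside: "x \<in> chart_dom c" "open T" "snd d x \<in> T" "T \<subseteq> chart_img d" "transition d c holomorphic_on T"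
      "\<And>z. z \<in> T \<Longrightarrow> chart_extend c \<psi> (chart_inv d z) = (\<psi> \<circ> transition d c) z"
    have "C_k_on k (\<psi> \<circ> transition d c) T"
      by (rule C_k_on_compose_holomorphic[OF inside(5,2) open_UNIV _ s]) auto
    then have "C_k_on k (chart_extend c \<psi> \<circ> chart_inv d) T"
      by (rule C_k_on_cong_imp[OF inside(2), rotated]) (use inside(6) in simp)
    then show ?thesis using inside x by blast
  next
    fix T assume outside: "x \<notin> chart_dom c" "open T" "snd d x \<in> T" "T \<subseteq> chart_img d" "\<And>z. z \<in> T \<Longrightarrow> chart_extend c \<psi> (chart_inv d z) = 0"
    have "C_k_on k (chart_extend c \<psi> \<circ> chart_inv d) T"
      by (rule C_k_on_cong_imp[OF outside(2) _ C_k_on_const[of k 0]]) (use outside(5) in simp)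
    then show ?thesis using outside x by blast
  qed
qed

end

locale hyperbolic_surface = charted_surface X \<A> for X :: "'a topology" and \<A> +
  fixes \<rho> :: "'a chart \<Rightarrow> complex \<Rightarrow> real"
  assumes hyperbolic: "hyperbolic_metric \<A> \<rho>"
begin

lemma density_pos: "c \<in> \<A> \<Longrightarrow> z \<in> chart_img c \<Longrightarrow> 0 < \<rho> c z"
  using hyperbolic unfolding hyperbolic_metric_def conformal_metric_def by blast

lemma density_smooth: "c \<in> \<A> \<Longrightarrow> C_k_on k (\<rho> c) (chart_img c)"
  using hyperbolic unfolding hyperbolic_metric_def conformal_metric_def by blast

lemma density_transition:
  assumes "c \<in> \<A>" "d \<in> \<A>" "x \<in> chart_dom c" "x \<in> chart_dom d"
  shows "\<rho> c (snd c x) = \<rho> d (snd d x) * norm (deriv (transition c d) (snd c x))"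
proof -
  have "snd c x \<in> snd c ` (chart_dom c \<inter> chart_dom d)" using assms by auto
  then have "\<rho> c (snd c x) = \<rho> d (transition c d (snd c x)) * norm (deriv (transition c d) (snd c x))"
    using hyperbolic assms(1,2) unfolding hyperbolic_metric_def conformal_metric_def by blast
  then show ?thesis using transition(3)[OF assms(1-3)] by simp
qed

text \<open>This is Liouville's equation, a rewriting of curvature -1. In each chart it supplies an
  explicit function whose flat Laplacian is the area density, with which the constant term of the
  Green equation is absorbed.\<close>

lemma ln_density:
  assumes "c \<in> \<A>"
  shows "C_k_on k (\<lambda>z. ln (\<rho> c z)) (chart_img c)" "z \<in> chart_img c \<Longrightarrow> flat_laplacian (\<lambda>z. ln (\<rho> c z)) z = (\<rho> c z)\<^sup>2"
proof -
  show "C_k_on k (\<lambda>z. ln (\<rho> c z)) (chart_img c)"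
    by (rule C_k_on_compose_real[OF chart(2)[OF assms] _ D_k_on_ln density_smooth[OF assms]])
      (use density_pos[OF assms] in auto)
  assume z: "z \<in> chart_img c"
  then have "gaussian_curvature \<rho> c z = -1" using hyperbolic assms by (auto simp: hyperbolic_metric_def)
  then show "flat_laplacian (\<lambda>z. ln (\<rho> c z)) z = (\<rho> c z)\<^sup>2"
    using density_pos[OF assms z] by (simp add: gaussian_curvature_def)
qed

lemma density_continuous: "c \<in> \<A> \<Longrightarrow> continuous_on (chart_img c) (\<rho> c)"
  using density_smooth C_k_on_continuous by blast

text \<open>\<open>laplace_beltrami\<close> evaluates in an arbitrary chart \<open>d\<close>.
  Passing to \<open>c\<close> multiplies the flat Laplacian and the squared density by the same
  squared modulus of the derivative of the transition map, which is nonzero because the densities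
  are positive.\<close>

lemma laplace_beltrami_chart_extend:
  assumes c: "c \<in> \<A>" and K: "cball a R \<subseteq> chart_img c" and \<psi>: "\<And>z. z \<notin> cball a R \<Longrightarrow> \<psi> z = 0"
    and s: "C_k_on 2 \<psi> UNIV" and x: "x \<in> topspace X"
  shows "laplace_beltrami \<A> \<rho> (chart_extend c \<psi>) x
    = (if x \<in> chart_dom c then - flat_laplacian \<psi> (snd c x) / (\<rho> c (snd c x))\<^sup>2 else 0)"
proof -
  define d where "d = chart_at \<A> x"
  have d: "d \<in> \<A>" "x \<in> chart_dom d" using chart_at[OF x] by (auto simp: d_def)
  have lb: "laplace_beltrami \<A> \<rho> (chart_extend c \<psi>) x = - flat_laplacian (chart_extend c \<psi> \<circ> chart_inv d) (snd d x) / (\<rho> d (snd d x))\<^sup>2"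
    by (simp add: laplace_beltrami_def Let_def d_def)
  show ?thesis
  proof (rule chart_extend_local[OF c d(1) K \<psi> d(2)])
    fix T assume inside: "x \<in> chart_dom c" "open T" "snd d x \<in> T" "T \<subseteq> chart_img d" "transition d c holomorphic_on T"
      "\<And>z. z \<in> T \<Longrightarrow> chart_extend c \<psi> (chart_inv d z) = (\<psi> \<circ> transition d c) z"
    have "flat_laplacian (chart_extend c \<psi> \<circ> chart_inv d) (snd d x) = flat_laplacian (\<psi> \<circ> transition d c) (snd d x)"
      by (rule flat_laplacian_cong[OF inside(2,3)]) (use inside(6) in simp)
    also have "\<dots> = flat_laplacian \<psi> (transition d c (snd d x)) * (norm (deriv (transition d c) (snd d x)))\<^sup>2"
      by (rule flat_laplacian_compose_holomorphic[OF inside(5,2,3) open_UNIV _ s]) auto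
    also have "transition d c (snd d x) = snd c x" using transition(3)[OF d(1) c d(2)] .
    finally have L: "flat_laplacian (chart_extend c \<psi> \<circ> chart_inv d) (snd d x) = flat_laplacian \<psi> (snd c x) * (norm (deriv (transition d c) (snd d x)))\<^sup>2" .
    note \<rho> = density_transition[OF d(1) c d(2) inside(1)]
    have "norm (deriv (transition d c) (snd d x)) \<noteq> 0"
      using density_pos[OF d(1), of "snd d x"] d(2) unfolding \<rho> by auto
    then show ?thesis
      unfolding lb L \<rho> using inside(1) by (simp add: power_mult_distrib)
  next
    fix T assume outside: "x \<notin> chart_dom c" "open T" "snd d x \<in> T" "T \<subseteq> chart_img d" "\<And>z. z \<in> T \<Longrightarrow> chart_extend c \<psi> (chart_inv d z) = 0"
    have "flat_laplacian (chart_extend c \<psi> \<circ> chart_inv d) (snd d x) = flat_laplacian (\<lambda>_. 0) (snd d x)"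
      by (rule flat_laplacian_cong[OF outside(2,3)]) (use outside(5) in simp)
    also have "\<dots> = 0" by (simp add: flat_laplacian_def partial_x_def partial_y_def)
    finally show ?thesis using outside(1) by (simp add: lb)
  qed
qed

end

locale green_surface = hyperbolic_surface X \<A> \<rho> for X :: "'a topology" and \<A> \<rho> +
  fixes \<mu> :: "'a measure" and G :: "'a \<Rightarrow> 'a \<Rightarrow> real"
  assumes area: "area_measure X \<A> \<rho> \<mu>" and green: "green_function X \<A> \<rho> \<mu> G" and compact_X: "compact_space X"
begin

section \<open>Integration over the surface in a chart\<close>

lemma space_area: "space \<mu> = topspace X" "openin X U \<Longrightarrow> U \<in> sets \<mu>"
  using area by (auto simp: area_measure_def intro: sigma_sets.Basic)

lemma emeasure_chart:
  "c \<in> \<A> \<Longrightarrow> E \<in> sets \<mu> \<Longrightarrow> E \<subseteq> chart_dom c \<Longrightarrow> emeasure \<mu> E = (\<integral>\<^sup>+z\<in>snd c ` E. ennreal ((\<rho> c z)\<^sup>2) \<partial>lborel)"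
  using area unfolding area_measure_def by blast

lemma chart_density_borel:
  assumes "c \<in> \<A>"
  shows "\<rho> c \<in> borel_measurable (restrict_space lborel (chart_img c))"
    "(\<lambda>z. ennreal ((\<rho> c z)\<^sup>2)) \<in> borel_measurable (restrict_space lborel (chart_img c))"
proof -
  have "sets (restrict_space lborel (chart_img c)) = sets (restrict_space borel (chart_img c))"
    by (simp add: sets_restrict_space)
  then show "\<rho> c \<in> borel_measurable (restrict_space lborel (chart_img c))"
    using borel_measurable_continuous_on_restrict[OF density_continuous[OF assms]]
      measurable_cong_sets[of "restrict_space lborel (chart_img c)" "restrict_space borel (chart_img c)" borel borel] by blast
  then show "(\<lambda>z. ennreal ((\<rho> c z)\<^sup>2)) \<in> borel_measurable (restrict_space lborel (chart_img c))" by measurable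
qed

lemma chart_inv_measurable:
  assumes c: "c \<in> \<A>"
  shows "chart_inv c \<in> measurable (restrict_space lborel (chart_img c)) (restrict_space \<mu> (chart_dom c))"
proof (rule measurable_restrict_space2)
  show "chart_inv c \<in> space (restrict_space lborel (chart_img c)) \<rightarrow> chart_dom c"
    using chart_inv(2)[OF c] by (auto simp: space_restrict_space)
  show "chart_inv c \<in> measurable (restrict_space lborel (chart_img c)) \<mu>"
  proof (rule measurable_sigma_sets)
    show "sets \<mu> = sigma_sets (topspace X) {U. openin X U}" using area by (simp add: area_measure_def)
    show "{U. openin X U} \<subseteq> Pow (topspace X)" by (auto dest: openin_subset)
    show "chart_inv c \<in> space (restrict_space lborel (chart_img c)) \<rightarrow> topspace X"
      using chart_inv_topspace[OF c] by (auto simp: space_restrict_space)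
    fix U assume "U \<in> {U. openin X U}"
    then have U: "openin X U" by simp
    have "chart_inv c -` U \<inter> space (restrict_space lborel (chart_img c)) = snd c ` (chart_dom c \<inter> U)"
      using chart_inv[OF c] by (force simp: space_restrict_space)
    then show "chart_inv c -` U \<inter> space (restrict_space lborel (chart_img c)) \<in> sets (restrict_space lborel (chart_img c))"
      using open_chart_image[OF c U] chart(2)[OF c] by (auto simp: sets_restrict_space_iff)
  qed
qed

lemma chart_measurable: "c \<in> \<A> \<Longrightarrow> snd c \<in> borel_measurable (restrict_space \<mu> (chart_dom c))"
proof (rule borel_measurableI)
  fix S :: "complex set" assume c: "c \<in> \<A>" and "open S"
  have "snd c -` S \<inter> space (restrict_space \<mu> (chart_dom c)) = {x \<in> chart_dom c. snd c x \<in> S}"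
    using chart(4)[OF c] by (auto simp: space_restrict_space space_area)
  moreover have "\<dots> \<in> sets \<mu>" by (rule space_area(2)[OF openin_chart_vimage[OF c \<open>open S\<close>]])
  ultimately show "snd c -` S \<inter> space (restrict_space \<mu> (chart_dom c)) \<in> sets (restrict_space \<mu> (chart_dom c))"
    using space_area(2)[OF chart(1)[OF c]] chart(4)[OF c] by (subst sets_restrict_space_iff) (auto simp: space_area Int_absorb2)
qed

text \<open>\<open>area_measure\<close> prescribes numbers for the sets inside a chart domain. As an
  identity of measures it becomes a change of variables for integrals, which
  \<open>chart_integral\<close> exploits.\<close>

lemma area_in_chart:
  assumes c: "c \<in> \<A>"
  shows "restrict_space \<mu> (chart_dom c)
    = distr (density (restrict_space lborel (chart_img c)) (\<lambda>z. ennreal ((\<rho> c z)\<^sup>2))) (restrict_space \<mu> (chart_dom c)) (chart_inv c)"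
    (is "?M = ?N")
proof (rule measure_eqI)
  fix A assume A: "A \<in> sets ?M"
  have dom: "chart_dom c \<inter> space \<mu> \<in> sets \<mu>" using space_area chart[OF c] by (simp add: Int_absorb2)
  have A': "A \<in> sets \<mu>" "A \<subseteq> chart_dom c" using A dom by (auto simp: sets_restrict_space_iff)
  have m: "chart_inv c \<in> measurable (density (restrict_space lborel (chart_img c)) (\<lambda>z. ennreal ((\<rho> c z)\<^sup>2))) ?M"
    using chart_inv_measurable[OF c] by simp
  have pre: "chart_inv c -` A \<inter> chart_img c = snd c ` A"
    using chart_inv[OF c] A'(2) by (force simp: subset_iff)
  have pre_m: "snd c ` A \<in> sets (restrict_space lborel (chart_img c))"
    using measurable_sets[OF chart_inv_measurable[OF c] A] pre by (simp add: space_restrict_space)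
  have "emeasure ?N A = emeasure (density (restrict_space lborel (chart_img c)) (\<lambda>z. ennreal ((\<rho> c z)\<^sup>2))) (snd c ` A)"
    by (subst emeasure_distr[OF m A]) (simp add: space_restrict_space pre)
  also have "\<dots> = (\<integral>\<^sup>+z\<in>snd c ` A. ennreal ((\<rho> c z)\<^sup>2) \<partial>restrict_space lborel (chart_img c))"
    by (rule emeasure_density[OF chart_density_borel(2)[OF c] pre_m])
  also have "\<dots> = (\<integral>\<^sup>+z\<in>snd c ` A. ennreal ((\<rho> c z)\<^sup>2) \<partial>lborel)"
  proof -
    have "(\<integral>\<^sup>+z\<in>snd c ` A. ennreal ((\<rho> c z)\<^sup>2) \<partial>restrict_space lborel (chart_img c)) = (\<integral>\<^sup>+z\<in>chart_img c. (ennreal ((\<rho> c z)\<^sup>2) * indicator (snd c ` A) z) \<partial>lborel)"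
      using chart(2)[OF c] by (subst nn_integral_restrict_space) auto
    also have "\<dots> = (\<integral>\<^sup>+z\<in>snd c ` A. ennreal ((\<rho> c z)\<^sup>2) \<partial>lborel)"
      by (rule nn_integral_cong) (use A'(2) in \<open>auto simp: indicator_def\<close>)
    finally show ?thesis .
  qed
  also have "\<dots> = emeasure \<mu> A" using emeasure_chart[OF c A'] by simp
  also have "\<dots> = emeasure ?M A" using emeasure_restrict_space[OF dom A'(2)] by simp
  finally show "emeasure ?M A = emeasure ?N A" by simp
qed simp

lemma chart_integral:
  fixes f :: "'a \<Rightarrow> real"
  assumes c: "c \<in> \<A>" and f: "f \<in> borel_measurable \<mu>"
  shows "integrable \<mu> f \<Longrightarrow> set_integrable lborel (chart_img c) (\<lambda>z. (\<rho> c z)\<^sup>2 * f (chart_inv c z))"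
    "(\<And>x. x \<in> topspace X \<Longrightarrow> x \<notin> chart_dom c \<Longrightarrow> f x = 0) \<Longrightarrow>
      (\<integral>x. f x \<partial>\<mu>) = (LINT z:chart_img c|lborel. (\<rho> c z)\<^sup>2 * f (chart_inv c z))"
proof -
  let ?R = "restrict_space lborel (chart_img c)" and ?M = "restrict_space \<mu> (chart_dom c)"
  let ?D = "density ?R (\<lambda>z. ennreal ((\<rho> c z)\<^sup>2))"
  have dom: "chart_dom c \<inter> space \<mu> \<in> sets \<mu>" using space_area chart[OF c] by (simp add: Int_absorb2)
  have img: "chart_img c \<inter> space lborel \<in> sets lborel" using chart(2)[OF c] by simp
  have fM: "f \<in> borel_measurable ?M" using f by (rule measurable_restrict_space1)
  have m: "chart_inv c \<in> measurable ?D ?M" using chart_inv_measurable[OF c] by simp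
  have fc: "(\<lambda>z. f (chart_inv c z)) \<in> borel_measurable ?R"
    using measurable_compose[OF chart_inv_measurable[OF c] fM] .
  have \<rho>: "(\<lambda>z. (\<rho> c z)\<^sup>2) \<in> borel_measurable ?R"
    using chart_density_borel(1)[OF c] by measurable
  show "set_integrable lborel (chart_img c) (\<lambda>z. (\<rho> c z)\<^sup>2 * f (chart_inv c z))" if "integrable \<mu> f"
  proof -
    have "integrable \<mu> (\<lambda>x. indicator (chart_dom c) x *\<^sub>R f x)"
    proof (rule Bochner_Integration.integrable_bound[OF that])
      show "(\<lambda>x. indicator (chart_dom c) x *\<^sub>R f x) \<in> borel_measurable \<mu>"
        using f space_area(2)[OF chart(1)[OF c]] by (intro borel_measurable_scaleR borel_measurable_indicator)
    qed (auto simp: indicator_def)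
    then have "integrable ?M f" using integrable_restrict_space[OF dom] by blast
    then have "integrable (distr ?D ?M (chart_inv c)) f" using area_in_chart[OF c] by simp
    then have "integrable ?D (\<lambda>z. f (chart_inv c z))" using integrable_distr_eq[OF m fM] by simp
    then have "integrable ?R (\<lambda>z. (\<rho> c z)\<^sup>2 *\<^sub>R f (chart_inv c z))"
      by (subst (asm) integrable_density[OF fc \<rho>]) auto
    from iffD1[OF integrable_restrict_space[OF img] this] show ?thesis by (simp add: set_integrable_def)
  qed
  show "(\<integral>x. f x \<partial>\<mu>) = (LINT z:chart_img c|lborel. (\<rho> c z)\<^sup>2 * f (chart_inv c z))"
    if z: "\<And>x. x \<in> topspace X \<Longrightarrow> x \<notin> chart_dom c \<Longrightarrow> f x = 0"
  proof -
    have "(\<integral>x. f x \<partial>\<mu>) = (\<integral>x. indicator (chart_dom c) x *\<^sub>R f x \<partial>\<mu>)"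
      by (rule Bochner_Integration.integral_cong) (use z in \<open>auto simp: indicator_def space_area\<close>)
    also have "\<dots> = (\<integral>x. f x \<partial>?M)" by (rule integral_restrict_space[OF dom, symmetric])
    also have "\<dots> = (\<integral>x. f x \<partial>distr ?D ?M (chart_inv c))" using area_in_chart[OF c] by simp
    also have "\<dots> = (\<integral>z. f (chart_inv c z) \<partial>?D)" by (rule integral_distr[OF m fM])
    also have "\<dots> = (\<integral>z. (\<rho> c z)\<^sup>2 *\<^sub>R f (chart_inv c z) \<partial>?R)"
      by (rule integral_density[OF fc \<rho>]) auto
    also have "\<dots> = (LINT z:chart_img c|lborel. (\<rho> c z)\<^sup>2 * f (chart_inv c z))"
      unfolding set_lebesgue_integral_def by (subst integral_restrict_space[OF img]) simp
    finally show ?thesis .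
  qed
qed
end

lemma set_integrable_mult_continuous:
  fixes v w :: "complex \<Rightarrow> real"
  assumes v: "set_integrable lborel (cball a R) v" and w: "continuous_on (cball a R) w"
  shows "set_integrable lborel (cball a R) (\<lambda>z. v z * w z)"
proof -
  have "compact (w ` cball a R)" by (rule compact_continuous_image[OF w]) simp
  then obtain B where B: "\<And>z. z \<in> cball a R \<Longrightarrow> \<bar>w z\<bar> \<le> B"
    by (metis bounded_iff compact_imp_bounded imageI real_norm_def)
  have eq: "indicator (cball a R) z *\<^sub>R (v z * w z) = (indicator (cball a R) z *\<^sub>R v z) * (indicator (cball a R) z *\<^sub>R w z)" for z
    by (simp add: indicator_def)
  show ?thesis unfolding set_integrable_def
  proof (rule Bochner_Integration.integrable_bound)
    show "integrable lborel (\<lambda>z. B * (indicator (cball a R) z *\<^sub>R v z))"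
      using v unfolding set_integrable_def by (rule integrable_mult_right)
    show "(\<lambda>z. indicator (cball a R) z *\<^sub>R (v z * w z)) \<in> borel_measurable lborel"
      unfolding eq using v[unfolded set_integrable_def] borel_integrable_compact[OF compact_cball w]
      by (intro borel_measurable_times borel_measurable_integrable)
    have "norm (indicator (cball a R) z *\<^sub>R (v z * w z)) \<le> norm (B * (indicator (cball a R) z *\<^sub>R v z))" for z
    proof (cases "z \<in> cball a R")
      case True
      have "\<bar>v z\<bar> * \<bar>w z\<bar> \<le> \<bar>v z\<bar> * \<bar>B\<bar>" using B[OF True] by (intro mult_left_mono) auto
      then show ?thesis using True by (simp add: abs_mult mult.commute)
    qed simp
    then show "AE z in lborel. norm (indicator (cball a R) z *\<^sub>R (v z * w z)) \<le> norm (B * (indicator (cball a R) z *\<^sub>R v z))" by simp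
  qed
qed

section \<open>Harnack chains on compact connected spaces\<close>

lemma compact_space_finite_cover:
  assumes "compact_space X" "\<And>x. x \<in> topspace X \<Longrightarrow> openin X (N x) \<and> x \<in> N x"
  obtains F where "finite F" "F \<subseteq> topspace X" "topspace X \<subseteq> (\<Union>x\<in>F. N x)"
proof -
  have "\<forall>U\<in>N ` topspace X. openin X U" "topspace X \<subseteq> \<Union>(N ` topspace X)" using assms(2) by auto
  then obtain \<F> where "finite \<F>" "\<F> \<subseteq> N ` topspace X" "topspace X \<subseteq> \<Union>\<F>"
    using assms(1) unfolding compact_space_alt by meson
  then show ?thesis using that by (metis finite_subset_image)
qed

text \<open>The set where \<open>P\<close> holds and its complement are both open, since near each
  point \<open>P\<close> holds everywhere or nowhere. Local statements about harmonic functions are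
  spread over the surface in this way.\<close>

lemma connected_space_induct:
  assumes "connected_space X" "x0 \<in> topspace X" "P x0"
    and loc: "\<And>x. x \<in> topspace X \<Longrightarrow> \<exists>N. openin X N \<and> x \<in> N \<and> (\<forall>y\<in>N. \<forall>y'\<in>N. P y \<longrightarrow> P y')"
    and x: "x \<in> topspace X"
  shows "P x"
proof -
  obtain N where N: "\<And>x. x \<in> topspace X \<Longrightarrow> openin X (N x) \<and> x \<in> N x \<and> (\<forall>y\<in>N x. \<forall>y'\<in>N x. P y \<longrightarrow> P y')"
    using loc by metis
  have o: "openin X {x \<in> topspace X. Q x}" if "\<And>x y. x \<in> topspace X \<Longrightarrow> Q x \<Longrightarrow> y \<in> N x \<Longrightarrow> Q y" for Q
  proof (subst openin_subopen, intro ballI)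
    fix x assume "x \<in> {x \<in> topspace X. Q x}"
    then show "\<exists>T. openin X T \<and> x \<in> T \<and> T \<subseteq> {x \<in> topspace X. Q x}"
      using N[of x] that[of x] openin_subset[of X "N x"] by (intro exI[of _ "N x"]) blast
  qed
  have "openin X {x \<in> topspace X. P x}" by (rule o) (use N in blast)
  moreover have "openin X {x \<in> topspace X. \<not> P x}" by (rule o) (use N in blast)
  moreover have "topspace X - {x \<in> topspace X. P x} = {x \<in> topspace X. \<not> P x}" by auto
  ultimately have "{x \<in> topspace X. P x} = {} \<or> {x \<in> topspace X. P x} = topspace X"
    using assms(1) unfolding connected_space_clopen_in closedin_def by (metis (no_types, lifting) mem_Collect_eq subsetI)
  then show ?thesis using assms(2,3) x by blast
qed

text \<open>Local Harnack inequalities are chained. Connectedness links every point to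
  \<open>x0\<close>, and compactness leaves finitely many links, so the constants serve all members
  of the family at once. The additive \<open>C\<close> in the hypothesis admits functions that are
  only within bounded distance of harmonic ones.\<close>

lemma harnack_oscillation:
  fixes \<K> :: "('a \<Rightarrow> real) set"
  assumes X: "compact_space X" "connected_space X" "topspace X \<noteq> {}"
    and loc: "\<And>x. x \<in> topspace X \<Longrightarrow> \<exists>N C. openin X N \<and> x \<in> N \<and> 0 \<le> C \<and>
      (\<forall>k\<in>\<K>. \<forall>M. (\<forall>y\<in>topspace X. k y \<le> M) \<longrightarrow> (\<forall>y\<in>N. \<forall>y'\<in>N. M - k y \<le> 4 * (M - k y') + C))"
    and bdd: "\<And>k. k \<in> \<K> \<Longrightarrow> \<exists>M. \<forall>y\<in>topspace X. k y \<le> M"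
  shows "\<exists>C. \<forall>k\<in>\<K>. \<forall>y\<in>topspace X. \<forall>y'\<in>topspace X. \<bar>k y - k y'\<bar> \<le> C"
proof -
  \<comment> \<open>\<open>rel C x y\<close> bounds the deficit \<open>M - k y\<close> by the
    deficit at \<open>x\<close>, with one constant as factor and as summand so that relations
    compose. It ranges over all upper bounds \<open>M\<close>, since a supremum need not be
    attained.\<close>
  define rel where "rel = (\<lambda>C x y. \<forall>k\<in>\<K>. \<forall>M. (\<forall>y\<in>topspace X. k y \<le> M) \<longrightarrow> M - k y \<le> C * (M - k x) + C)"
  have trans: "rel (C' * C + C') x z"
    if "rel C x y" "rel C' y z" "0 \<le> C'" "0 \<le> C" "x \<in> topspace X" for C C' x y z
    unfolding rel_def
  proof (intro ballI allI impI)
    fix k M assume *: "k \<in> \<K>" "\<forall>y\<in>topspace X. k y \<le> M"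
    have "M - k z \<le> C' * (M - k y) + C'" using that(2) * by (auto simp: rel_def)
    also have "\<dots> \<le> C' * (C * (M - k x) + C) + C'" using that * by (intro add_right_mono mult_left_mono) (auto simp: rel_def)
    finally have "M - k z \<le> C' * C * (M - k x) + C' * C + C'" by (simp add: algebra_simps)
    moreover have "0 \<le> C' * (M - k x)" using that * by simp
    ultimately show "M - k z \<le> (C' * C + C') * (M - k x) + (C' * C + C')" by (simp add: algebra_simps)
  qed
  have "\<exists>N. \<forall>x\<in>topspace X. \<exists>C. openin X (N x) \<and> x \<in> N x \<and> 0 \<le> C \<and>
      (\<forall>k\<in>\<K>. \<forall>M. (\<forall>y\<in>topspace X. k y \<le> M) \<longrightarrow> (\<forall>y\<in>N x. \<forall>y'\<in>N x. M - k y \<le> 4 * (M - k y') + C))"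
    using loc by (intro bchoice) blast
  then obtain N where "\<forall>x\<in>topspace X. \<exists>C. openin X (N x) \<and> x \<in> N x \<and> 0 \<le> C \<and>
      (\<forall>k\<in>\<K>. \<forall>M. (\<forall>y\<in>topspace X. k y \<le> M) \<longrightarrow> (\<forall>y\<in>N x. \<forall>y'\<in>N x. M - k y \<le> 4 * (M - k y') + C))" by blast
  from bchoice[OF this] obtain C where NC: "\<And>x. x \<in> topspace X \<Longrightarrow> openin X (N x)" "\<And>x. x \<in> topspace X \<Longrightarrow> x \<in> N x"
      "\<And>x. x \<in> topspace X \<Longrightarrow> 0 \<le> C x"
      "\<And>x k M y y'. x \<in> topspace X \<Longrightarrow> k \<in> \<K> \<Longrightarrow> \<forall>y\<in>topspace X. k y \<le> M \<Longrightarrow> y \<in> N x \<Longrightarrow> y' \<in> N x \<Longrightarrow> M - k y \<le> 4 * (M - k y') + C x"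
    by blast
  have NX: "y \<in> topspace X" if "x \<in> topspace X" "y \<in> N x" for x y
    using NC(1)[OF that(1)] openin_subset that(2) by blast
  have locrel: "rel (4 + C x) y y'" if "x \<in> topspace X" "y \<in> N x" "y' \<in> N x" for x y y'
    unfolding rel_def
  proof (intro ballI allI impI)
    fix k M assume *: "k \<in> \<K>" "\<forall>y\<in>topspace X. k y \<le> M"
    have "M - k y' \<le> 4 * (M - k y) + C x" using NC(4)[OF that(1) * that(3,2)] .
    moreover have "0 \<le> C x * (M - k y)" using * NX[OF that(1,2)] NC(3)[OF that(1)] by simp
    ultimately show "M - k y' \<le> (4 + C x) * (M - k y) + (4 + C x)" by (simp add: algebra_simps)
  qed
  obtain x0 where x0: "x0 \<in> topspace X" using X(3) by blast
  have all: "\<exists>C\<ge>0. rel C x0 y \<and> rel C y x0" if y: "y \<in> topspace X" for y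
  proof (rule connected_space_induct[OF X(2) x0 _ _ y])
    have "rel (4 + C x0) x0 x0" using locrel[OF x0 NC(2)[OF x0] NC(2)[OF x0]] .
    then show "\<exists>C\<ge>0. rel C x0 x0 \<and> rel C x0 x0" using NC(3)[OF x0] by (intro exI[of _ "4 + C x0"]) auto
    fix x assume x: "x \<in> topspace X"
    have "\<exists>C\<ge>0. rel C x0 y' \<and> rel C y' x0" if yy: "y \<in> N x" "y' \<in> N x" and C': "0 \<le> C'" "rel C' x0 y" "rel C' y x0" for y y' C'
    proof -
      define D where "D = 4 + C x"
      have D: "0 \<le> D" "rel D y y'" "rel D y' y" using locrel[OF x] yy NC(3)[OF x] by (auto simp: D_def)
      have "rel (D * C' + D) x0 y'" by (rule trans[OF C'(2) D(2,1) C'(1) x0])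
      moreover have "rel (C' * D + C') y' x0" by (rule trans[OF D(3) C'(3,1) D(1) NX[OF x yy(2)]])
      moreover have mono: "rel B x y" if "rel A x y" "A \<le> B" "x \<in> topspace X" for A B x y
        unfolding rel_def
      proof (intro ballI allI impI)
        fix k M assume *: "k \<in> \<K>" "\<forall>y\<in>topspace X. k y \<le> M"
        have "M - k y \<le> A * (M - k x) + A" using that(1) * by (auto simp: rel_def)
        also have "\<dots> \<le> B * (M - k x) + B" using that * by (intro add_mono mult_right_mono) auto
        finally show "M - k y \<le> B * (M - k x) + B" .
      qed
      ultimately have "rel (D * C' + D + C') x0 y'" "rel (D * C' + D + C') y' x0"
        using C' D NX[OF x yy(2)] x0 by (auto intro: mono simp: mult.commute)
      then show ?thesis using C' D by (intro exI[of _ "D * C' + D + C'"]) auto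
    qed
    then show "\<exists>N. openin X N \<and> x \<in> N \<and> (\<forall>y\<in>N. \<forall>y'\<in>N. (\<exists>C\<ge>0. rel C x0 y \<and> rel C y x0) \<longrightarrow> (\<exists>C\<ge>0. rel C x0 y' \<and> rel C y' x0))"
      using NC(1,2)[OF x] by (intro exI[of _ "N x"]) blast
  qed
  obtain F where F: "finite F" "F \<subseteq> topspace X" "topspace X \<subseteq> (\<Union>x\<in>F. N x)"
    using compact_space_finite_cover[OF X(1), of N] NC(1,2) by blast
  have "\<forall>x\<in>topspace X. \<exists>C\<ge>0. rel C x0 x \<and> rel C x x0" using all by blast
  from bchoice[OF this] obtain A where A: "\<And>x. x \<in> topspace X \<Longrightarrow> 0 \<le> A x \<and> rel (A x) x0 x \<and> rel (A x) x x0" by blast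
  define B where "B = (\<Sum>x\<in>F. (4 + C x) * A x + A x * (4 + C x) + (4 + C x) + A x)"
  have pos: "0 \<le> (4 + C x) * A x + A x * (4 + C x) + (4 + C x) + A x" if "x \<in> F" for x
    using A[of x] NC(3)[of x] F(2) that by (auto intro!: add_nonneg_nonneg mult_nonneg_nonneg)
  have uni: "M - k y \<le> B * (M - k x0) + B \<and> M - k x0 \<le> B * (M - k y) + B"
    if y: "y \<in> topspace X" and k: "k \<in> \<K>" "\<forall>y\<in>topspace X. k y \<le> M" for y k M
  proof -
    obtain x where x: "x \<in> F" "y \<in> N x" using F y by blast
    then have xt: "x \<in> topspace X" using F by blast
    have l: "rel (4 + C x) x y" "rel (4 + C x) y x" using locrel[OF xt] x(2) NC(2)[OF xt] by auto
    have c: "0 \<le> 4 + C x" "0 \<le> A x" using NC(3)[OF xt] A[OF xt] by auto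
    have 1: "rel ((4 + C x) * A x + (4 + C x)) x0 y" using trans[OF _ l(1) c x0] A[OF xt] by blast
    have 2: "rel (A x * (4 + C x) + A x) y x0" using trans[OF l(2) _ c(2,1) y] A[OF xt] by blast
    have le: "(4 + C x) * A x + A x * (4 + C x) + (4 + C x) + A x \<le> B"
      unfolding B_def by (rule member_le_sum[OF x(1) _ F(1)]) (use pos in auto)
    have "0 \<le> (4 + C x) * A x" "0 \<le> A x * (4 + C x)" using c by auto
    then have le': "(4 + C x) * A x + (4 + C x) \<le> B" "A x * (4 + C x) + A x \<le> B" using le c by linarith+
    have nn: "0 \<le> M - k x0" "0 \<le> M - k y" using k y x0 by auto
    have "M - k y \<le> ((4 + C x) * A x + (4 + C x)) * (M - k x0) + ((4 + C x) * A x + (4 + C x))"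
      using 1 k by (auto simp: rel_def)
    also have "\<dots> \<le> B * (M - k x0) + B" using le' nn by (intro add_mono mult_right_mono)
    finally have "M - k y \<le> B * (M - k x0) + B" .
    moreover have "M - k x0 \<le> (A x * (4 + C x) + A x) * (M - k y) + (A x * (4 + C x) + A x)"
      using 2 k by (auto simp: rel_def)
    moreover have "\<dots> \<le> B * (M - k y) + B" using le' nn by (intro add_mono mult_right_mono)
    ultimately show ?thesis by linarith
  qed
  have B0: "0 \<le> B" unfolding B_def by (rule sum_nonneg) (rule pos)
  show ?thesis
  proof (intro exI[of _ "B * (2 * B) + B"] ballI)
    fix k y y' assume k: "k \<in> \<K>" and y: "y \<in> topspace X" "y' \<in> topspace X"
    \<comment> \<open>With \<open>M\<close> the supremum there is a point \<open>y1\<close> of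
      deficit less than 1. From it the deficit at \<open>x0\<close> is at most \<open>2 * B\<close>,
      and from \<open>x0\<close> the deficit anywhere is at most
      \<open>B * (2 * B) + B\<close>.\<close>
    define M where "M = Sup (k ` topspace X)"
    have ba: "bdd_above (k ` topspace X)" using bdd[OF k] by (auto simp: bdd_above_def)
    then have M: "\<forall>y\<in>topspace X. k y \<le> M" by (auto simp: M_def intro: cSup_upper)
    have "k ` topspace X \<noteq> {}" using x0 by blast
    from less_cSup_iff[OF this ba, of "M - 1"] obtain y1 where y1: "y1 \<in> topspace X" "M - 1 < k y1"
      by (auto simp: M_def simp del: image_is_empty)
    have "M - k x0 \<le> B * (M - k y1) + B" using uni[OF y1(1) k M] by blast
    also have "\<dots> \<le> B * 1 + B" using y1 B0 by (intro add_right_mono mult_left_mono) auto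
    finally have x: "M - k x0 \<le> 2 * B" by simp
    have "0 \<le> M - k z \<and> M - k z \<le> B * (2 * B) + B" if z: "z \<in> topspace X" for z
    proof -
      have "M - k z \<le> B * (M - k x0) + B" using uni[OF z k M] by blast
      also have "\<dots> \<le> B * (2 * B) + B" using x B0 by (intro add_right_mono mult_left_mono)
      finally show ?thesis using M z by auto
    qed
    from this[OF y(1)] this[OF y(2)] show "\<bar>k y - k y'\<bar> \<le> B * (2 * B) + B" by linarith
  qed
qed

section \<open>The equation of the Green function in a chart\<close>

context green_surface begin

definition inv_area :: real where "inv_area = 1 / measure \<mu> (space \<mu>)"

lemma green_props:
  assumes "r \<in> topspace X"
  shows "surface_C_k_on \<A> 2 (topspace X - {r}) (\<lambda>s. G s r)" "integrable \<mu> (\<lambda>s. G s r)"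
    "s \<in> topspace X \<Longrightarrow> G s r = G r s"
    "(\<And>k. surface_C_k_on \<A> k (topspace X) f) \<Longrightarrow>
       (\<integral>s. G s r * laplace_beltrami \<A> \<rho> f s \<partial>\<mu>) = f r - (\<integral>s. f s \<partial>\<mu>) * inv_area"
  using green assms unfolding green_function_def inv_area_def by auto

lemma green_chart_C2:
  assumes c: "c \<in> \<A>" and r: "r \<in> topspace X"
  shows "C_k_on 2 (\<lambda>z. G (chart_inv c z) r) {z \<in> chart_img c. chart_inv c z \<noteq> r}" "open {z \<in> chart_img c. chart_inv c z \<noteq> r}"
proof -
  have eq: "{z \<in> chart_img c. chart_inv c z \<noteq> r} = snd c ` (chart_dom c \<inter> (topspace X - {r}))"
    using chart(4)[OF c] chart_inv[OF c] by (auto simp: image_iff)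
  have "C_k_on 2 ((\<lambda>s. G s r) \<circ> chart_inv c) (snd c ` (chart_dom c \<inter> (topspace X - {r})))"
    using green_props(1)[OF r] c by (auto simp: surface_C_k_on_def)
  then show "C_k_on 2 (\<lambda>z. G (chart_inv c z) r) {z \<in> chart_img c. chart_inv c z \<noteq> r}"
    unfolding eq by (simp add: o_def)
  have "closedin X {r}" using riemann_surface r by (auto simp: riemann_surface_def closedin_Hausdorff_singleton)
  then have "openin X (topspace X - {r})" by auto
  then show "open {z \<in> chart_img c. chart_inv c z \<noteq> r}" unfolding eq by (rule open_chart_image[OF c])
qed

lemma chart_extend_measurable:
  assumes c: "c \<in> \<A>" and \<phi>: "continuous_on (chart_img c) \<phi>"
  shows "chart_extend c \<phi> \<in> borel_measurable \<mu>"
proof -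
  have "snd c \<in> measurable (restrict_space \<mu> (chart_dom c)) (restrict_space borel (chart_img c))"
    by (rule measurable_restrict_space2[OF _ chart_measurable[OF c]]) (auto simp: space_restrict_space)
  from measurable_compose[OF this borel_measurable_continuous_on_restrict[OF \<phi>]]
  have "(\<lambda>x. \<phi> (snd c x)) \<in> borel_measurable (restrict_space \<mu> (chart_dom c))" .
  moreover have "{x \<in> space \<mu>. x \<in> chart_dom c} = chart_dom c"
    using chart(4)[OF c] by (auto simp: space_area)
  moreover have "chart_dom c \<in> sets \<mu>" by (rule space_area(2)[OF chart(1)[OF c]])
  ultimately show ?thesis unfolding chart_extend_def
    by (subst measurable_If_restrict_space_iff) (auto simp: cong: measurable_cong_simp)
qed

text \<open>Integrability with respect to area is integrability of \<open>G\<close> times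
  \<open>\<rho>\<^sup>2\<close> in the chart, and the reciprocal of \<open>\<rho>\<^sup>2\<close> is
  bounded on a closed disc.\<close>

lemma green_set_integrable:
  assumes c: "c \<in> \<A>" and r: "r \<in> topspace X" and K: "cball a R \<subseteq> chart_img c"
  shows "set_integrable lborel (cball a R) (\<lambda>z. G (chart_inv c z) r)"
proof -
  let ?u = "\<lambda>z. G (chart_inv c z) r"
  have "set_integrable lborel (chart_img c) (\<lambda>z. (\<rho> c z)\<^sup>2 * ?u z)"
    using chart_integral(1)[OF c _ green_props(2)[OF r]] green_props(2)[OF r] by auto
  then have i: "set_integrable lborel (cball a R) (\<lambda>z. (\<rho> c z)\<^sup>2 * ?u z)"
    by (rule set_integrable_subset) (use K in auto)
  have cont: "continuous_on (cball a R) (\<lambda>z. 1 / (\<rho> c z)\<^sup>2)"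
    using density_pos[OF c] K by (intro continuous_intros continuous_on_subset[OF density_continuous[OF c]]) (auto, fastforce)
  have "set_integrable lborel (cball a R) (\<lambda>z. (\<rho> c z)\<^sup>2 * ?u z * (1 / (\<rho> c z)\<^sup>2))"
    by (rule set_integrable_mult_continuous[OF i cont])
  moreover have "indicator (cball a R) z *\<^sub>R ((\<rho> c z)\<^sup>2 * ?u z * (1 / (\<rho> c z)\<^sup>2)) = indicator (cball a R) z *\<^sub>R ?u z" for z
    using density_pos[OF c, of z] K by (cases "z \<in> cball a R") (auto simp: subset_iff)
  ultimately show ?thesis unfolding set_integrable_def by (simp only:)
qed

text \<open>The radial function is extended by zero to a test function on the surface. Its mean,
  which the constant term of the Green equation brings in, equals by \<open>ln_density\<close> the
  integral of \<psi> against the Laplacian of \<open>ln \<rho>\<close>, and Green's identity moves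
  that Laplacian to \<psi>. Hence the combination with \<open>ln \<rho>\<close> has as
  distributional Laplacian minus the unit mass at \<open>r\<close>.\<close>

lemma weak_green_equation:
  assumes c: "c \<in> \<A>" and r: "r \<in> topspace X" and K: "cball a R \<subseteq> chart_img c" and F: "radial_test R F"
  defines "\<psi> \<equiv> \<lambda>z. F ((norm (z - a))\<^sup>2)"
  shows "set_integrable lborel (cball a R) (\<lambda>z. G (chart_inv c z) r - inv_area * ln (\<rho> c z))"
    "(LINT z:cball a R|lborel. (G (chart_inv c z) r - inv_area * ln (\<rho> c z)) * flat_laplacian \<psi> z) = - chart_extend c \<psi> r"
    "C_k_on k \<psi> UNIV" "\<exists>R1>0. R1 < R \<and> (\<forall>z. R1 \<le> dist a z \<longrightarrow> \<psi> z = 0)"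
proof -
  let ?u = "\<lambda>z. G (chart_inv c z) r"
  obtain R1 where R1: "\<And>k. D_k_on k F UNIV" "0 < R1" "R1 < R" "\<And>t. R1\<^sup>2 \<le> t \<Longrightarrow> F t = 0"
    using F by (auto simp: radial_test_def)
  show s: "C_k_on k \<psi> UNIV" for k unfolding \<psi>_def by (rule C_k_on_radial[OF R1(1)]) auto
  have supp: "\<psi> z = 0" if "R1 \<le> dist a z" for z
    unfolding \<psi>_def by (rule R1(4)) (use that R1(2) in \<open>auto simp: dist_norm norm_minus_commute intro: power_mono\<close>)
  then show "\<exists>R1>0. R1 < R \<and> (\<forall>z. R1 \<le> dist a z \<longrightarrow> \<psi> z = 0)" using R1 by blast
  have supp': "\<psi> z = 0" if "z \<notin> cball a R" for z using supp that R1 by auto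
  have \<Delta>0: "flat_laplacian \<psi> z = 0" if "z \<notin> cball a R" for z
  proof -
    have "flat_laplacian \<psi> z = flat_laplacian (\<lambda>_. 0) z"
      by (rule flat_laplacian_cong[of "- cball a R"]) (use that supp' in auto)
    then show ?thesis by (simp add: flat_laplacian_def partial_x_def partial_y_def)
  qed
  have ui: "set_integrable lborel (cball a R) ?u" by (rule green_set_integrable[OF c r K])
  have lc: "continuous_on (cball a R) (\<lambda>z. ln (\<rho> c z))"
    using C_k_on_continuous[OF ln_density(1)[OF c]] K continuous_on_subset by blast
  have li: "set_integrable lborel (cball a R) (\<lambda>z. ln (\<rho> c z))" by (rule set_integrable_continuous_cball[OF lc])
  have li': "set_integrable lborel (cball a R) (\<lambda>z. inv_area * ln (\<rho> c z))"
    by (rule set_integrable_mult_right) (rule li)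
  then show "set_integrable lborel (cball a R) (\<lambda>z. ?u z - inv_area * ln (\<rho> c z))" using ui by (intro set_integral_diff(1))
  let ?f = "chart_extend c \<psi>"
  have smooth: "surface_C_k_on \<A> k (topspace X) ?f" for k by (rule chart_extend_smooth[OF c K supp' s])
  have cL: "continuous_on S (flat_laplacian \<psi>)" "continuous_on S \<psi>" for S
    using C2_continuous[OF s] by (auto intro: continuous_on_subset)
  let ?k = "\<lambda>z. - flat_laplacian \<psi> z / (\<rho> c z)\<^sup>2"
  have ck: "continuous_on (chart_img c) ?k"
    using density_pos[OF c] by (intro continuous_intros cL density_continuous[OF c]) force
  have lb: "laplace_beltrami \<A> \<rho> ?f x = chart_extend c ?k x" if "x \<in> topspace X" for x
    using laplace_beltrami_chart_extend[OF c K supp' s that] by (simp add: chart_extend_def)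
  have "(\<integral>s. G s r * laplace_beltrami \<A> \<rho> ?f s \<partial>\<mu>) = (\<integral>s. G s r * chart_extend c ?k s \<partial>\<mu>)"
    by (rule Bochner_Integration.integral_cong) (auto simp: lb space_area)
  also have "\<dots> = (LINT z:chart_img c|lborel. (\<rho> c z)\<^sup>2 * (?u z * chart_extend c ?k (chart_inv c z)))"
  proof (rule chart_integral(2)[OF c])
    show "(\<lambda>s. G s r * chart_extend c ?k s) \<in> borel_measurable \<mu>"
      by (intro borel_measurable_times chart_extend_measurable[OF c ck] borel_measurable_integrable[OF green_props(2)[OF r]])
  qed (simp add: chart_extend_def)
  also have "\<dots> = (LINT z:chart_img c|lborel. - (?u z * flat_laplacian \<psi> z))"
  proof (rule set_lebesgue_integral_cong)
    show "\<forall>z. z \<in> chart_img c \<longrightarrow> (\<rho> c z)\<^sup>2 * (?u z * chart_extend c ?k (chart_inv c z)) = - (?u z * flat_laplacian \<psi> z)"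
    proof (intro allI impI)
      fix z assume z: "z \<in> chart_img c"
      then show "(\<rho> c z)\<^sup>2 * (?u z * chart_extend c ?k (chart_inv c z)) = - (?u z * flat_laplacian \<psi> z)"
        using density_pos[OF c z] chart_inv(2,3)[OF c z] by (simp add: chart_extend_def)
    qed
  qed (use chart(2)[OF c] in simp)
  also have "\<dots> = (LINT z:cball a R|lborel. - (?u z * flat_laplacian \<psi> z))"
    unfolding set_lebesgue_integral_def
    by (rule Bochner_Integration.integral_cong) (use K \<Delta>0 in \<open>auto simp: indicator_def subset_iff\<close>)
  finally have 1: "(\<integral>s. G s r * laplace_beltrami \<A> \<rho> ?f s \<partial>\<mu>) = - (LINT z:cball a R|lborel. ?u z * flat_laplacian \<psi> z)"
    by (simp add: set_lebesgue_integral_def)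
  have "(\<integral>s. ?f s \<partial>\<mu>) = (LINT z:chart_img c|lborel. (\<rho> c z)\<^sup>2 * ?f (chart_inv c z))"
    by (rule chart_integral(2)[OF c chart_extend_measurable[OF c cL(2)]]) (simp add: chart_extend_def)
  also have "\<dots> = (LINT z:cball a R|lborel. \<psi> z * flat_laplacian (\<lambda>z. ln (\<rho> c z)) z)"
    unfolding set_lebesgue_integral_def
  proof (rule Bochner_Integration.integral_cong[OF refl])
    fix z
    show "indicator (chart_img c) z *\<^sub>R ((\<rho> c z)\<^sup>2 * ?f (chart_inv c z)) = indicator (cball a R) z *\<^sub>R (\<psi> z * flat_laplacian (\<lambda>z. ln (\<rho> c z)) z)"
    proof (cases "z \<in> chart_img c")
      case True
      then have "?f (chart_inv c z) = \<psi> z" using chart_inv(2,3)[OF c True] by (simp add: chart_extend_def)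
      then show ?thesis using True ln_density(2)[OF c True] supp'[of z] by (auto simp: indicator_def)
    qed (use K in \<open>auto simp: indicator_def subset_iff\<close>)
  qed
  also have "\<dots> = (LINT z:cball a R|lborel. ln (\<rho> c z) * flat_laplacian \<psi> z)"
    using green_identity[OF ln_density(1)[OF c] chart(2)[OF c] K R1(2,3) s supp] by simp
  finally have 2: "(\<integral>s. ?f s \<partial>\<mu>) = (LINT z:cball a R|lborel. ln (\<rho> c z) * flat_laplacian \<psi> z)" .
  note i1 = set_integrable_mult_continuous[OF _ cL(1)]
  have "(LINT z:cball a R|lborel. (?u z - inv_area * ln (\<rho> c z)) * flat_laplacian \<psi> z)
      = (LINT z:cball a R|lborel. ?u z * flat_laplacian \<psi> z - inv_area * (ln (\<rho> c z) * flat_laplacian \<psi> z))"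
    by (simp add: algebra_simps)
  also have "\<dots> = (LINT z:cball a R|lborel. ?u z * flat_laplacian \<psi> z) - inv_area * (LINT z:cball a R|lborel. ln (\<rho> c z) * flat_laplacian \<psi> z)"
    using i1[OF ui] i1[OF li] by (cases "inv_area = 0") (auto simp: set_integral_diff(2))
  finally show "(LINT z:cball a R|lborel. (?u z - inv_area * ln (\<rho> c z)) * flat_laplacian \<psi> z) = - ?f r"
    using green_props(4)[OF r smooth] 1 2 by (simp add: mult.commute)
qed

text \<open>Off the pole both terms have the flat Laplacian
  \<open>inv_area * (\<rho> c z)\<^sup>2\<close>, so that their difference is harmonic in the
  chart.\<close>

definition green_reg :: "'a chart \<Rightarrow> 'a \<Rightarrow> complex \<Rightarrow> real" where
  "green_reg c r z = G (chart_inv c z) r - inv_area * ln (\<rho> c z)"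

lemma weakly_harmonic_green_reg:
  assumes c: "c \<in> \<A>" and r: "r \<in> topspace X" and K: "cball a R \<subseteq> chart_img c" and R: "0 < R"
    and nr: "r \<notin> chart_inv c ` cball a R"
  shows "weakly_harmonic_at (green_reg c r) a R"
  unfolding weakly_harmonic_at_def
proof (intro conjI allI impI)
  have "radial_test R (\<lambda>_. 0)" unfolding radial_test_def using R D_k_on_const by (auto intro!: exI[of _ "R/2"])
  then show "set_integrable lborel (cball a R) (green_reg c r)"
    using weak_green_equation(1)[OF c r K] by (simp add: green_reg_def[abs_def])
  fix F assume F: "radial_test R F"
  obtain R1 where R1: "R1 < R" "\<And>z. R1 \<le> dist a z \<Longrightarrow> F ((norm (z - a))\<^sup>2) = 0"
    using weak_green_equation(4)[OF c r K F] by blast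
  have "chart_extend c (\<lambda>z. F ((norm (z - a))\<^sup>2)) r = 0"
  proof (cases "r \<in> chart_dom c")
    case True
    then have "snd c r \<notin> cball a R" using nr chart_inv(1)[OF c True] by (metis imageI)
    then show ?thesis using R1 by (auto simp: chart_extend_def)
  qed (simp add: chart_extend_def)
  then show "(LINT z:cball a R|lborel. green_reg c r z * flat_laplacian (\<lambda>z. F ((norm (z - a))\<^sup>2)) z) = 0"
    using weak_green_equation(2)[OF c r K F] by (simp add: green_reg_def)
qed

text \<open>The added logarithm has the unit mass at the pole as its Laplacian and cancels the
  right-hand side of \<open>weak_green_equation\<close>. The disc may therefore contain the
  pole.\<close>

lemma weakly_harmonic_green_pole:
  assumes c: "c \<in> \<A>" and r: "r \<in> chart_dom c" and K: "cball a R \<subseteq> chart_img c" and R: "0 < R"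
  shows "weakly_harmonic_at (\<lambda>z. green_reg c r z + ln (norm (z - snd c r)) / (2 * pi)) a R"
  unfolding weakly_harmonic_at_def
proof (intro conjI allI impI)
  have rX: "r \<in> topspace X" using chart(4)[OF c] r by blast
  have "radial_test R (\<lambda>_. 0)" unfolding radial_test_def using R D_k_on_const by (auto intro!: exI[of _ "R/2"])
  then have gi: "set_integrable lborel (cball a R) (green_reg c r)"
    using weak_green_equation(1)[OF c rX K] by (simp add: green_reg_def[abs_def])
  have li: "set_integrable lborel (cball a R) (\<lambda>z. ln (norm (z - snd c r)) / (2 * pi))"
    using set_integrable_ln_norm by (subst set_integrable_mult_divide_iff) auto
  show "set_integrable lborel (cball a R) (\<lambda>z. green_reg c r z + ln (norm (z - snd c r)) / (2 * pi))"
    by (rule set_integral_add(1)[OF gi li])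
  fix F assume F: "radial_test R F"
  define \<psi> where "\<psi> = (\<lambda>z. F ((norm (z - a))\<^sup>2))"
  have \<psi>: "C_k_on 2 \<psi> UNIV" using weak_green_equation(3)[OF c rX K F] by (simp add: \<psi>_def)
  obtain R1 where R1: "0 < R1" "R1 < R" "\<And>z. R1 \<le> dist a z \<Longrightarrow> \<psi> z = 0"
    using weak_green_equation(4)[OF c rX K F] by (auto simp: \<psi>_def)
  note m = set_integrable_mult_continuous[OF _ continuous_on_subset[OF C2_continuous(4)[OF \<psi>] subset_UNIV]]
  have "(LINT z:cball a R|lborel. (green_reg c r z + ln (norm (z - snd c r)) / (2 * pi)) * flat_laplacian \<psi> z)
      = (LINT z:cball a R|lborel. green_reg c r z * flat_laplacian \<psi> z + (ln (norm (z - snd c r)) * flat_laplacian \<psi> z) / (2 * pi))"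
    by (simp add: algebra_simps)
  also have "\<dots> = (LINT z:cball a R|lborel. green_reg c r z * flat_laplacian \<psi> z) + (LINT z:cball a R|lborel. ln (norm (z - snd c r)) * flat_laplacian \<psi> z) / (2 * pi)"
    using m[OF gi] m[OF set_integrable_ln_norm] by (subst set_integral_add(2)) (auto simp: set_integrable_mult_divide_iff)
  also have "(LINT z:cball a R|lborel. ln (norm (z - snd c r)) * flat_laplacian \<psi> z) = 2 * pi * \<psi> (snd c r)"
    by (rule laplacian_ln_norm[OF R1(1,2) \<psi> R1(3)])
  also have "(LINT z:cball a R|lborel. green_reg c r z * flat_laplacian \<psi> z) = - \<psi> (snd c r)"
    using weak_green_equation(2)[OF c rX K F] r by (simp add: green_reg_def \<psi>_def chart_extend_def)
  finally show "(LINT z:cball a R|lborel. (green_reg c r z + ln (norm (z - snd c r)) / (2 * pi)) * flat_laplacian (\<lambda>z. F ((norm (z - a))\<^sup>2)) z) = 0"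
    by (simp add: \<psi>_def)
qed
end

section \<open>Regular parts and bounds uniform in the pole\<close>

context green_surface begin

lemma green_reg_C2:
  assumes c: "c \<in> \<A>" and r: "r \<in> topspace X"
  shows "C_k_on 2 (green_reg c r) {z \<in> chart_img c. chart_inv c z \<noteq> r}"
  unfolding green_reg_def[abs_def]
  by (intro C_k_on_diff C_k_on_cmult green_chart_C2[OF c r] C_k_on_subset[OF ln_density(1)[OF c]]) auto

text \<open>Twice continuous differentiability off the pole is part of the definition of a Green
  function, so the weak statement can be turned into a pointwise one.\<close>

lemma green_reg_laplacian:
  assumes c: "c \<in> \<A>" and r: "r \<in> topspace X" and z: "z \<in> chart_img c" "chart_inv c z \<noteq> r"
  shows "flat_laplacian (green_reg c r) z = 0" "flat_laplacian (\<lambda>z. G (chart_inv c z) r) z = inv_area * (\<rho> c z)\<^sup>2"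
proof -
  let ?\<Omega> = "{z \<in> chart_img c. chart_inv c z \<noteq> r}"
  have z': "z \<in> ?\<Omega>" using z by simp
  show 0: "flat_laplacian (green_reg c r) z = 0"
  proof (rule laplacian_of_weakly_harmonic[OF green_reg_C2[OF c r] green_chart_C2(2)[OF c r] z'])
    fix R :: real assume "0 < R" "cball z R \<subseteq> ?\<Omega>"
    then show "weakly_harmonic_at (green_reg c r) z R"
      by (intro weakly_harmonic_green_reg[OF c r]) auto
  qed
  have "flat_laplacian (\<lambda>w. G (chart_inv c w) r + (- inv_area) * ln (\<rho> c w)) z = flat_laplacian (\<lambda>z. G (chart_inv c z) r) z + (- inv_area) * flat_laplacian (\<lambda>w. ln (\<rho> c w)) z"
    by (rule flat_laplacian_add_cmult[OF green_chart_C2(1)[OF c r] _ green_chart_C2(2)[OF c r] z'])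
      (rule C_k_on_subset[OF ln_density(1)[OF c]], auto)
  then show "flat_laplacian (\<lambda>z. G (chart_inv c z) r) z = inv_area * (\<rho> c z)\<^sup>2"
    using 0 ln_density(2)[OF c z(1)] by (simp add: green_reg_def[abs_def])
qed

lemma green_reg_area_harmonic:
  assumes c: "c \<in> \<A>" and r: "r \<in> topspace X" and \<Omega>: "open \<Omega>" "\<Omega> \<subseteq> chart_img c" "\<And>z. z \<in> \<Omega> \<Longrightarrow> chart_inv c z \<noteq> r"
  shows "area_harmonic_on (green_reg c r) \<Omega>"
  using \<Omega> green_reg_laplacian(1)[OF c r]
  by (intro area_harmonic_of_laplacian C_k_on_subset[OF green_reg_C2[OF c r]]) auto

definition green_log :: "'a chart \<Rightarrow> complex \<Rightarrow> complex \<Rightarrow> real" where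
  "green_log c w z = G (chart_inv c z) (chart_inv c w) + ln (norm (z - w)) / (2 * pi)"

text \<open>The diagonal value is the regular part of the Green function in the coordinate of
  \<open>c\<close>. No density is subtracted, which keeps the function symmetric in \<open>w\<close>
  and \<open>z\<close>.\<close>

definition green_ext :: "'a chart \<Rightarrow> complex \<Rightarrow> complex \<Rightarrow> real" where
  "green_ext c w z = (if z = w then Lim (at w) (green_log c w) else green_log c w z)"

lemma green_ext_sym:
  assumes "c \<in> \<A>" "w \<in> chart_img c" "z \<in> chart_img c"
  shows "green_ext c w z = green_ext c z w"
  using green_props(3)[OF chart_inv_topspace[OF assms(1,2)] chart_inv_topspace[OF assms(1,3)]]
  by (auto simp: green_ext_def green_log_def norm_minus_commute)

text \<open>\<open>weyl_removable\<close> yields a continuous harmonic function that agrees with the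
  weakly harmonic one off the pole. Its value at \<open>w\<close> proves that the limit in
  \<open>green_ext\<close> exists. The disc of radius \<open>4 * R\<close> is the room that
  \<open>weyl_removable\<close> takes.\<close>

lemma green_ext_area_harmonic:
  assumes c: "c \<in> \<A>" and w: "w \<in> chart_img c" and R: "0 < R" "ball a (4 * R) \<subseteq> chart_img c"
  shows "area_harmonic_on (\<lambda>z. green_ext c w z - inv_area * ln (\<rho> c z)) (ball a R)"
    "w \<in> ball a R \<Longrightarrow> (green_log c w \<longlongrightarrow> green_ext c w w) (at w)"
proof -
  define r where "r = chart_inv c w"
  have r: "r \<in> chart_dom c" "snd c r = w" "r \<in> topspace X"
    using chart_inv(2,3)[OF c w] chart(4)[OF c] by (auto simp: r_def)
  let ?h = "\<lambda>z. green_reg c r z + ln (norm (z - snd c r)) / (2 * pi)"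
  have hl: "?h z = green_log c w z - inv_area * ln (\<rho> c z)" for z
    by (simp add: green_reg_def green_log_def r(2)) (simp add: r_def)
  have ne: "chart_inv c z \<noteq> r" if "z \<in> chart_img c" "z \<noteq> w" for z
    using chart_inv_inj[OF c that(1) w] that(2) by (auto simp: r_def)
  have wk: "weakly_harmonic_at ?h z S" if "0 < S" "cball z S \<subseteq> ball a (4 * R)" for z S
    using that R(2) by (intro weakly_harmonic_green_pole[OF c r(1)]) auto
  have ct: "continuous_on (ball a (4 * R) - {w}) ?h"
  proof -
    have "continuous_on (ball a (4 * R) - {w}) (green_reg c r)"
      by (rule continuous_on_subset[OF C_k_on_continuous[OF green_reg_C2[OF c r(3)]]]) (use ne R(2) in blast)
    then show ?thesis by (intro continuous_intros) (auto simp: r(2))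
  qed
  obtain h' where h': "area_harmonic_on h' (ball a R)" "\<And>z. z \<in> ball a R \<Longrightarrow> z \<noteq> w \<Longrightarrow> h' z = ?h z"
    using weyl_removable[OF R(1) wk ct] by blast
  have sub: "ball a R \<subseteq> chart_img c" using R by auto
  have lim: "(green_log c w \<longlongrightarrow> h' w + inv_area * ln (\<rho> c w)) (at w)" if "w \<in> ball a R"
  proof -
    have "isCont h' w" using h'(1) that by (simp add: area_harmonic_on_def continuous_on_eq_continuous_at)
    moreover have "isCont (\<lambda>z. ln (\<rho> c z)) w"
      using iffD1[OF continuous_on_eq_continuous_at[OF chart(2)[OF c]] C_k_on_continuous[OF ln_density(1)[OF c]]] w by blast
    ultimately have l: "((\<lambda>z. h' z + inv_area * ln (\<rho> c z)) \<longlongrightarrow> h' w + inv_area * ln (\<rho> c w)) (at w)"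
      unfolding isCont_def by (intro tendsto_add tendsto_mult tendsto_const)
    have "\<forall>\<^sub>F z in at w. z \<in> ball a R - {w}" using that by (intro eventually_at_in_open) auto
    then have "\<forall>\<^sub>F z in at w. h' z + inv_area * ln (\<rho> c z) = green_log c w z"
      by eventually_elim (use h'(2) hl in auto)
    from Lim_transform_eventually[OF l this] show ?thesis .
  qed
  have ext: "green_ext c w w = h' w + inv_area * ln (\<rho> c w)" if "w \<in> ball a R"
    using tendsto_Lim[OF _ lim[OF that]] by (simp add: green_ext_def)
  show "w \<in> ball a R \<Longrightarrow> (green_log c w \<longlongrightarrow> green_ext c w w) (at w)" using lim ext by simp
  show "area_harmonic_on (\<lambda>z. green_ext c w z - inv_area * ln (\<rho> c z)) (ball a R)"
  proof (rule area_harmonic_cong[OF _ h'(1)])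
    fix z assume z: "z \<in> ball a R"
    show "h' z = green_ext c w z - inv_area * ln (\<rho> c z)"
    proof (cases "z = w")
      case True then show ?thesis using ext z by simp
    next
      case False then show ?thesis using h'(2)[OF z False] hl by (simp add: green_ext_def)
    qed
  qed
qed

text \<open>
  \<open>green_osc c z0 \<delta> w\<close> is \<open>G(\<cdot>, r)\<close>, with the singularity at the point \<open>r\<close> with coordinate \<open>w\<close>
  removed.
\<close>

definition green_osc :: "'a chart \<Rightarrow> complex \<Rightarrow> real \<Rightarrow> complex \<Rightarrow> 'a \<Rightarrow> real" where
  "green_osc c z0 \<delta> w x = (if x \<in> chart_inv c ` ball z0 (4 * \<delta>) then green_ext c w (snd c x) else G x (chart_inv c w))"

text \<open>Inside the switching disc of radius 4 \<delta> the function differs from a harmonic one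
  by a bounded density term. For other points the neighbourhood avoids the disc of radius 3
  \<delta>, and \<open>green_reg\<close> is used. Between the two radii this leaves an extra
  logarithm of a number between 2 \<delta> and 5 \<delta>, because the pole stays within \<delta> of
  \<open>z0\<close>. So the discrepancy \<open>B\<close> is the same for all poles.\<close>

lemma green_osc_local:
  assumes c: "c \<in> \<A>" and \<delta>: "0 < \<delta>" "ball z0 (16 * \<delta>) \<subseteq> chart_img c" and x: "x \<in> topspace X"
  shows "\<exists>d s B. d \<in> \<A> \<and> x \<in> chart_dom d \<and> 0 < s \<and> cball (snd d x) (8 * s) \<subseteq> chart_img d \<and>
    (\<forall>w\<in>cball z0 \<delta>. \<exists>h. area_harmonic_on h (ball (snd d x) (8 * s)) \<and>
       (\<forall>z\<in>ball (snd d x) (8 * s). \<bar>green_osc c z0 \<delta> w (chart_inv d z) - h z\<bar> \<le> B))"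
proof -
  have lnb: "\<exists>B. \<forall>z\<in>cball a R. \<bar>inv_area * ln (\<rho> d z)\<bar> \<le> B" if "d \<in> \<A>" "cball a R \<subseteq> chart_img d" for d a R
  proof -
    have "continuous_on (cball a R) (\<lambda>z. inv_area * ln (\<rho> d z))"
      by (intro continuous_on_mult[OF continuous_on_const]
        continuous_on_subset[OF C_k_on_continuous[OF ln_density(1)[OF that(1)]] that(2)])
    from compact_imp_bounded[OF compact_continuous_image[OF this compact_cball]]
    show ?thesis by (auto simp: bounded_iff)
  qed
  have img: "w \<in> chart_img c" if "w \<in> cball z0 \<delta>" for w using that \<delta> by (auto simp: subset_iff)
  show ?thesis
  proof (cases "x \<in> chart_inv c ` ball z0 (4 * \<delta>)")
    case True
    then obtain a where a: "a \<in> ball z0 (4 * \<delta>)" "x = chart_inv c a" by blast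
    have aimg: "a \<in> chart_img c" using a \<delta> by (auto simp: subset_iff)
    have xa: "x \<in> chart_dom c" "snd c x = a" using chart_inv(2,3)[OF c aimg] a by auto
    define s where "s = (4 * \<delta> - dist z0 a) / 16"
    have "16 * s = 4 * \<delta> - dist z0 a" by (simp add: s_def)
    then have s: "s > 0" "dist z0 a + 16 * s = 4 * \<delta>" using a by auto
    have sub: "cball a (8 * s) \<subseteq> ball z0 (4 * \<delta>)" by (rule ball_mono_dist) (use s in linarith)
    then have subc: "cball a (8 * s) \<subseteq> chart_img c" using \<delta> by (auto simp: subset_iff)
    obtain B where B: "\<And>z. z \<in> cball a (8 * s) \<Longrightarrow> \<bar>inv_area * ln (\<rho> c z)\<bar> \<le> B" using lnb[OF c subc] by blast
    have "\<exists>h. area_harmonic_on h (ball a (8 * s)) \<and> (\<forall>z\<in>ball a (8 * s). \<bar>green_osc c z0 \<delta> w (chart_inv c z) - h z\<bar> \<le> B)"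
      if w: "w \<in> cball z0 \<delta>" for w
    proof (intro exI conjI ballI)
      show "area_harmonic_on (\<lambda>z. green_ext c w z - inv_area * ln (\<rho> c z)) (ball a (8 * s))"
        by (rule area_harmonic_subset[OF green_ext_area_harmonic(1)[OF c img[OF w], of "4 * \<delta>" z0]])
          (use \<delta> sub in \<open>auto simp: subset_iff\<close>)
      fix z assume z: "z \<in> ball a (8 * s)"
      then have "z \<in> ball z0 (4 * \<delta>)" "z \<in> chart_img c" using sub subc by (auto simp: subset_iff)
      then have "green_osc c z0 \<delta> w (chart_inv c z) = green_ext c w z"
        using chart_inv(3)[OF c] by (simp add: green_osc_def)
      then show "\<bar>green_osc c z0 \<delta> w (chart_inv c z) - (green_ext c w z - inv_area * ln (\<rho> c z))\<bar> \<le> B"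
        using B[of z] z by auto
    qed
    then show ?thesis using c xa s subc by blast
  next
    case False
    let ?U = "topspace X - chart_inv c ` cball z0 (3 * \<delta>)"
    have K: "cball z0 (3 * \<delta>) \<subseteq> chart_img c" using \<delta> by (auto simp: subset_iff)
    have U: "openin X ?U" using closedin_chart_inv_image(2)[OF c compact_cball K] by auto
    have "x \<in> ?U" using False x \<delta> by auto
    obtain d where d: "d \<in> \<A>" "x \<in> chart_dom d" using ex_chart[OF x] by blast
    obtain R where R: "0 < R" "cball (snd d x) R \<subseteq> chart_img d" "chart_inv d ` cball (snd d x) R \<subseteq> ?U"
      using chart_ball[OF d U \<open>x \<in> ?U\<close>] by blast
    define s where "s = R / 8"
    have s: "0 < s" "8 * s = R" using R by (auto simp: s_def)
    obtain B where B: "\<And>z. z \<in> cball (snd d x) R \<Longrightarrow> \<bar>inv_area * ln (\<rho> d z)\<bar> \<le> B" using lnb[OF d(1) R(2)] by blast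
    define B' where "B' = (\<bar>ln (2 * \<delta>)\<bar> + \<bar>ln (5 * \<delta>)\<bar>) / (2 * pi)"
    have B': "0 \<le> B'" by (simp add: B'_def)
    have "\<exists>h. area_harmonic_on h (ball (snd d x) R) \<and> (\<forall>z\<in>ball (snd d x) R. \<bar>green_osc c z0 \<delta> w (chart_inv d z) - h z\<bar> \<le> B + B')"
      if w: "w \<in> cball z0 \<delta>" for w
    proof (intro exI conjI ballI)
      let ?r = "chart_inv c w"
      have r: "?r \<in> topspace X" using chart_inv_topspace[OF c img[OF w]] .
      have r': "?r \<in> chart_inv c ` cball z0 (3 * \<delta>)" using w \<delta> by auto
      show "area_harmonic_on (green_reg d ?r) (ball (snd d x) R)"
      proof (rule green_reg_area_harmonic[OF d(1) r open_ball])
        show "ball (snd d x) R \<subseteq> chart_img d" using R(2) by (auto simp: subset_iff)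
        fix z assume "z \<in> ball (snd d x) R"
        then have "chart_inv d z \<in> ?U" using R(3) by (auto simp: image_subset_iff)
        then have nK: "chart_inv d z \<notin> chart_inv c ` cball z0 (3 * \<delta>)" unfolding Diff_iff by (rule conjunct2)
        show "chart_inv d z \<noteq> ?r"
        proof
          assume e: "chart_inv d z = ?r"
          show False using nK r' unfolding e by (rule notE)
        qed
      qed
      fix z assume z: "z \<in> ball (snd d x) R"
      define y where "y = chart_inv d z"
      have y: "y \<in> ?U" using R(3) z by (auto simp: y_def subset_iff)
      have "\<bar>green_osc c z0 \<delta> w y - G y ?r\<bar> \<le> B'"
      proof (cases "y \<in> chart_inv c ` ball z0 (4 * \<delta>)")
        case True
        then obtain v where v: "v \<in> ball z0 (4 * \<delta>)" "y = chart_inv c v" by blast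
        have vi: "v \<in> chart_img c" using v \<delta> by (auto simp: subset_iff)
        have v3: "v \<notin> cball z0 (3 * \<delta>)" using y v by auto
        have n: "2 * \<delta> \<le> norm (v - w)" "norm (v - w) \<le> 5 * \<delta>"
          using dist_triangle[of z0 v w] dist_triangle[of v w z0] v(1) v3 w by (auto simp: dist_norm norm_minus_commute)
        have "ln (2 * \<delta>) \<le> ln (norm (v - w))" "ln (norm (v - w)) \<le> ln (5 * \<delta>)"
          by (rule ln_mono; use n \<delta> in linarith)+
        then have "\<bar>ln (norm (v - w))\<bar> \<le> \<bar>ln (2 * \<delta>)\<bar> + \<bar>ln (5 * \<delta>)\<bar>" by linarith
        then have "\<bar>ln (norm (v - w)) / (2 * pi)\<bar> \<le> B'" unfolding B'_def by (simp add: abs_divide divide_right_mono)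
        moreover have "v \<noteq> w" using n \<delta> by auto
        ultimately show ?thesis
          using True v(2) chart_inv(3)[OF c vi] by (simp add: green_osc_def green_ext_def green_log_def)
      next
        case False then show ?thesis using B' by (simp add: green_osc_def)
      qed
      moreover have "G y ?r - green_reg d ?r z = inv_area * ln (\<rho> d z)" by (simp add: green_reg_def y_def)
      moreover have "\<bar>inv_area * ln (\<rho> d z)\<bar> \<le> B" using B z by auto
      ultimately show "\<bar>green_osc c z0 \<delta> w (chart_inv d z) - green_reg d ?r z\<bar> \<le> B + B'"
        unfolding y_def[symmetric] by linarith
    qed
    then show ?thesis using d s R unfolding s(2)[symmetric] by blast
  qed
qed

text \<open>The point is one constant for all poles \<open>w\<close>, which regularity in each
  variable separately does not give. \<open>green_osc_local\<close> turns Harnack's inequality for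
  discs into the hypothesis of \<open>harnack_oscillation\<close>. Only differences of values are
  bounded, and mixed second differences contain nothing else.\<close>

lemma green_oscillation:
  assumes c: "c \<in> \<A>" and \<delta>: "0 < \<delta>" "ball z0 (16 * \<delta>) \<subseteq> chart_img c"
  shows "\<exists>C. \<forall>w\<in>cball z0 \<delta>. \<forall>x\<in>topspace X. \<forall>y\<in>topspace X. \<bar>green_osc c z0 \<delta> w x - green_osc c z0 \<delta> w y\<bar> \<le> C"
proof -
  have X: "connected_space X" "topspace X \<noteq> {}" using riemann_surface by (auto simp: riemann_surface_def)
  have "\<exists>C. \<forall>k\<in>green_osc c z0 \<delta> ` cball z0 \<delta>. \<forall>y\<in>topspace X. \<forall>y'\<in>topspace X. \<bar>k y - k y'\<bar> \<le> C"
  proof (rule harnack_oscillation[OF compact_X X])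
    fix x assume x: "x \<in> topspace X"
    obtain d s B where d: "d \<in> \<A>" "x \<in> chart_dom d" "0 < s" "cball (snd d x) (8 * s) \<subseteq> chart_img d"
      and h: "\<And>w. w \<in> cball z0 \<delta> \<Longrightarrow> \<exists>h. area_harmonic_on h (ball (snd d x) (8 * s)) \<and>
         (\<forall>z\<in>ball (snd d x) (8 * s). \<bar>green_osc c z0 \<delta> w (chart_inv d z) - h z\<bar> \<le> B)"
      using green_osc_local[OF c \<delta> x] by blast
    let ?a = "snd d x"
    have sub: "ball ?a (s / 2) \<subseteq> ball ?a (8 * s)" using d(3) by auto
    have subi: "ball ?a (8 * s) \<subseteq> chart_img d" using d(4) by (auto simp: subset_iff)
    show "\<exists>N C. openin X N \<and> x \<in> N \<and> 0 \<le> C \<and> (\<forall>k\<in>green_osc c z0 \<delta> ` cball z0 \<delta>. \<forall>M. (\<forall>y\<in>topspace X. k y \<le> M) \<longrightarrow> (\<forall>y\<in>N. \<forall>y'\<in>N. M - k y \<le> 4 * (M - k y') + C))"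
    proof (intro exI[of _ "chart_inv d ` ball ?a (s / 2)"] exI[of _ "8 * \<bar>B\<bar>"] conjI ballI allI impI)
      show "openin X (chart_inv d ` ball ?a (s / 2))"
        by (rule openin_chart_inv_image[OF d(1) open_ball]) (use sub subi in blast)
      show "x \<in> chart_inv d ` ball ?a (s / 2)"
        using chart_inv(1)[OF d(1,2)] d(3) by (metis centre_in_ball half_gt_zero imageI)
      fix k M y y' assume "k \<in> green_osc c z0 \<delta> ` cball z0 \<delta>" and M: "\<forall>y\<in>topspace X. k y \<le> M"
        and "y \<in> chart_inv d ` ball ?a (s / 2)" "y' \<in> chart_inv d ` ball ?a (s / 2)"
      then obtain w z z' where w: "w \<in> cball z0 \<delta>" "k = green_osc c z0 \<delta> w"
        and z: "z \<in> ball ?a (s / 2)" "y = chart_inv d z" "z' \<in> ball ?a (s / 2)" "y' = chart_inv d z'" by blast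
      obtain h where ah: "area_harmonic_on h (ball ?a (8 * s))"
        and kh: "\<And>z. z \<in> ball ?a (8 * s) \<Longrightarrow> \<bar>k (chart_inv d z) - h z\<bar> \<le> B"
        using h[OF w(1)] w(2) by blast
      have Mh: "h v \<le> M + B" if v: "v \<in> ball ?a (8 * s)" for v
        using kh[OF v] M chart_inv_topspace[OF d(1), of v] subi v by (fastforce simp: abs_le_iff)
      have sub4: "cball z' (4 * s) \<subseteq> ball ?a (8 * s)" by (rule ball_mono_dist) (use z(3) d(3) in simp)
      have dz: "dist z' z < s" using dist_triangle[of z' z ?a] z by (auto simp: dist_commute)
      \<comment> \<open>Replacing \<open>k\<close> by the harmonic \<open>h\<close> raises the upper
        bound to \<open>M + B\<close> and shifts the values at both points by at most
        \<open>B\<close>. With the factor 4 the errors add up to eight times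
        \<open>B\<close>.\<close>
      have "(M + B) - h z \<le> 4 * ((M + B) - h z')"
        by (rule area_harmonic_harnack[OF area_harmonic_reflect[OF ah] d(3) sub4 _ dz]) (use Mh sub4 in auto)
      moreover have "\<bar>k y - h z\<bar> \<le> B" "\<bar>k y' - h z'\<bar> \<le> B" using kh z sub by auto
      then have "h z - B \<le> k y" "k y' \<le> h z' + B" by (simp_all add: abs_le_iff algebra_simps)
      moreover have "B \<le> \<bar>B\<bar>" by simp
      ultimately show "M - k y \<le> 4 * (M - k y') + 8 * \<bar>B\<bar>" by argo
    qed simp
  next
    fix k assume "k \<in> green_osc c z0 \<delta> ` cball z0 \<delta>"
    then obtain w where w: "w \<in> cball z0 \<delta>" "k = green_osc c z0 \<delta> w" by blast
    have "\<exists>N M. openin X N \<and> x \<in> N \<and> (\<forall>y\<in>N. k y \<le> M)" if x: "x \<in> topspace X" for x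
    proof -
      obtain d s B h where d: "d \<in> \<A>" "x \<in> chart_dom d" "0 < s" "cball (snd d x) (8 * s) \<subseteq> chart_img d"
        and h: "area_harmonic_on h (ball (snd d x) (8 * s))" "\<And>z. z \<in> ball (snd d x) (8 * s) \<Longrightarrow> \<bar>k (chart_inv d z) - h z\<bar> \<le> B"
        using green_osc_local[OF c \<delta> x] w by blast
      let ?a = "snd d x"
      have sub: "cball ?a s \<subseteq> ball ?a (8 * s)" using d(3) by auto
      have "continuous_on (cball ?a s) h" using h(1) sub by (auto simp: area_harmonic_on_def intro: continuous_on_subset)
      from compact_imp_bounded[OF compact_continuous_image[OF this compact_cball]]
      obtain B' where "\<forall>y\<in>h ` cball ?a s. norm y \<le> B'" unfolding bounded_iff by blast
      then have B': "\<bar>h z\<bar> \<le> B'" if "z \<in> cball ?a s" for z using that by auto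
      show ?thesis
      proof (intro exI[of _ "chart_inv d ` ball ?a s"] exI[of _ "B' + B"] conjI ballI)
        show "openin X (chart_inv d ` ball ?a s)"
        proof (rule openin_chart_inv_image[OF d(1) open_ball])
          have "ball ?a s \<subseteq> cball ?a (8 * s)" using d(3) by auto
          then show "ball ?a s \<subseteq> chart_img d" using d(4) by (rule order_trans)
        qed
        show "x \<in> chart_inv d ` ball ?a s"
          using chart_inv(1)[OF d(1,2)] d(3) by (metis centre_in_ball imageI)
        fix y assume "y \<in> chart_inv d ` ball ?a s"
        then obtain z where z: "z \<in> ball ?a s" "y = chart_inv d z" by blast
        have "z \<in> ball ?a (8 * s)" "z \<in> cball ?a s" using z(1) d(3) by auto
        from h(2)[OF this(1)] B'[OF this(2)] show "k y \<le> B' + B" unfolding z(2) by linarith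
      qed
    qed
    then have "\<forall>x\<in>topspace X. \<exists>N. \<exists>M. openin X N \<and> x \<in> N \<and> (\<forall>y\<in>N. k y \<le> M)" by blast
    from bchoice[OF this] obtain N where "\<forall>x\<in>topspace X. \<exists>M. openin X (N x) \<and> x \<in> N x \<and> (\<forall>y\<in>N x. k y \<le> M)" by blast
    from bchoice[OF this] obtain M where NM: "\<forall>x\<in>topspace X. openin X (N x) \<and> x \<in> N x \<and> (\<forall>y\<in>N x. k y \<le> M x)" by blast
    obtain F where F: "finite F" "F \<subseteq> topspace X" "topspace X \<subseteq> (\<Union>x\<in>F. N x)"
      using compact_space_finite_cover[OF compact_X, of N] NM by blast
    have "k y \<le> (\<Sum>x\<in>F. \<bar>M x\<bar>)" if yX: "y \<in> topspace X" for y
    proof -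
      obtain x where x: "x \<in> F" "y \<in> N x" using F(3) yX by blast
      then have "k y \<le> \<bar>M x\<bar>" using NM F(2) by fastforce
      also have "\<dots> \<le> (\<Sum>x\<in>F. \<bar>M x\<bar>)" by (rule member_le_sum[OF x(1) _ F(1)]) auto
      finally show ?thesis .
    qed
    then show "\<exists>M. \<forall>y\<in>topspace X. k y \<le> M" by blast
  qed
  then show ?thesis by blast
qed

text \<open>In the mixed difference the density terms cancel, so it is harmonic in each variable. It
  vanishes when \<open>z = z0\<close> or \<open>w = w0\<close>, and it is a difference of two
  oscillations, hence bounded by \<open>2 * C\<close> uniformly in both variables. These are the
  hypotheses of \<open>separately_area_harmonic_mixed_bound\<close>.\<close>

lemma green_mixed_bound:
  assumes c: "c \<in> \<A>" "z0 \<in> chart_img c" and d: "d \<in> \<A>" "w0 \<in> chart_img d" and ne: "chart_inv c z0 \<noteq> chart_inv d w0"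
  shows "\<exists>r>0. \<exists>C. \<forall>z w. dist z0 z < r \<longrightarrow> dist w0 w < r \<longrightarrow>
    \<bar>G (chart_inv c z) (chart_inv d w) - G (chart_inv c z0) (chart_inv d w) - G (chart_inv c z) (chart_inv d w0) + G (chart_inv c z0) (chart_inv d w0)\<bar> \<le> C * (dist z0 z * dist w0 w)"
proof -
  define p q where "p = chart_inv c z0" and "q = chart_inv d w0"
  have pq: "p \<in> topspace X" "q \<in> topspace X" "p \<noteq> q" "p \<in> chart_dom c" "q \<in> chart_dom d" "snd c p = z0" "snd d q = w0"
    using ne chart_inv_topspace chart_inv(2,3) c d by (auto simp: p_def q_def)
  have "Hausdorff_space X" using riemann_surface by (simp add: riemann_surface_def)
  then obtain U V where UV: "openin X U" "openin X V" "p \<in> U" "q \<in> V" "disjnt U V"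
    using pq unfolding Hausdorff_space_def by metis
  obtain r1 where r1: "0 < r1" "cball z0 r1 \<subseteq> chart_img c" "chart_inv c ` cball z0 r1 \<subseteq> U"
    using chart_ball[OF c(1) pq(4) UV(1,3)] pq(6) by metis
  obtain r2 where r2: "0 < r2" "cball w0 r2 \<subseteq> chart_img d" "chart_inv d ` cball w0 r2 \<subseteq> V"
    using chart_ball[OF d(1) pq(5) UV(2,4)] pq(7) by metis
  define \<delta> where "\<delta> = min r1 r2 / 16"
  have \<delta>: "0 < \<delta>" "16 * \<delta> \<le> r1" "16 * \<delta> \<le> r2" using r1 r2 by (auto simp: \<delta>_def)
  have sub2: "ball w0 (16 * \<delta>) \<subseteq> chart_img d" "ball w0 (16 * \<delta>) \<subseteq> cball w0 r2" using \<delta> r2(2) by (auto simp: subset_iff)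
  have sub1: "ball z0 (16 * \<delta>) \<subseteq> chart_img c" "ball z0 (16 * \<delta>) \<subseteq> cball z0 r1" using \<delta> r1(2) by (auto simp: subset_iff)
  have disj: "chart_inv c z \<noteq> chart_inv d w" if "z \<in> ball z0 (16 * \<delta>)" "w \<in> ball w0 (16 * \<delta>)" for z w
    using that r1(3) r2(3) sub1(2) sub2(2) UV(5) unfolding disjnt_iff by (metis image_subset_iff subsetD)
  obtain C where C: "\<And>w x y. w \<in> cball w0 \<delta> \<Longrightarrow> x \<in> topspace X \<Longrightarrow> y \<in> topspace X \<Longrightarrow> \<bar>green_osc d w0 \<delta> w x - green_osc d w0 \<delta> w y\<bar> \<le> C"
    using green_oscillation[OF d(1) \<delta>(1) sub2(1)] by blast
  have osc: "green_osc d w0 \<delta> w (chart_inv c z) = G (chart_inv c z) (chart_inv d w)" if "z \<in> ball z0 (16 * \<delta>)" for z w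
  proof -
    have "chart_inv c z \<notin> chart_inv d ` ball w0 (4 * \<delta>)" using disj[OF that] \<delta>(1) by (force simp: subset_iff)
    then show ?thesis by (simp add: green_osc_def)
  qed
  define m where "m = (\<lambda>z w. G (chart_inv c z) (chart_inv d w) - G (chart_inv c z0) (chart_inv d w) - G (chart_inv c z) (chart_inv d w0) + G (chart_inv c z0) (chart_inv d w0))"
  define r where "r = \<delta> / 4"
  have r: "0 < r" "4 * r = \<delta>" using \<delta> by (auto simp: r_def)
  have zi: "z \<in> ball z0 (16 * \<delta>)" "z \<in> chart_img c" if "z \<in> ball z0 (4 * r)" for z using that r \<delta> sub1 by (auto simp: subset_iff)
  have wi: "w \<in> ball w0 (16 * \<delta>)" "w \<in> chart_img d" "w \<in> cball w0 \<delta>" if "w \<in> ball w0 (4 * r)" for w using that r \<delta> sub2 by (auto simp: subset_iff)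
  have z0: "z0 \<in> ball z0 (4 * r)" and w0: "w0 \<in> ball w0 (4 * r)" using r by auto
  have symG: "G (chart_inv c z) (chart_inv d w) = G (chart_inv d w) (chart_inv c z)" if "z \<in> ball z0 (4 * r)" "w \<in> ball w0 (4 * r)" for z w
    using green_props(3)[OF chart_inv_topspace[OF d(1) wi(2)[OF that(2)]] chart_inv_topspace[OF c(1) zi(2)[OF that(1)]]] .
  have h1: "area_harmonic_on (\<lambda>z. m z w) (ball z0 (4 * r))" if w: "w \<in> ball w0 (4 * r)" for w
  proof -
    have a: "area_harmonic_on (green_reg c (chart_inv d v)) (ball z0 (4 * r))" if v: "v \<in> ball w0 (4 * r)" for v
      by (rule green_reg_area_harmonic[OF c(1) chart_inv_topspace[OF d(1) wi(2)[OF v]] open_ball]) (use zi(2) disj zi(1) wi(1)[OF v] in auto)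
    show ?thesis
      by (rule area_harmonic_cong[OF _ area_harmonic_diff[OF a[OF w] a[OF w0], of "G (chart_inv c z0) (chart_inv d w0) - G (chart_inv c z0) (chart_inv d w)"]])
        (simp add: m_def green_reg_def)
  qed
  have h2: "area_harmonic_on (\<lambda>w. m z w) (ball w0 (4 * r))" if z: "z \<in> ball z0 (4 * r)" for z
  proof -
    have a: "area_harmonic_on (green_reg d (chart_inv c v)) (ball w0 (4 * r))" if v: "v \<in> ball z0 (4 * r)" for v
      by (rule green_reg_area_harmonic[OF d(1) chart_inv_topspace[OF c(1) zi(2)[OF v]] open_ball]) (use wi(2) disj wi(1) zi(1)[OF v] in \<open>auto, metis\<close>)
    show ?thesis
      by (rule area_harmonic_cong[OF _ area_harmonic_diff[OF a[OF z] a[OF z0], of "G (chart_inv c z0) (chart_inv d w0) - G (chart_inv c z) (chart_inv d w0)"]])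
        (use symG[OF z] symG[OF z0] in \<open>simp add: m_def green_reg_def\<close>)
  qed
  have M: "\<bar>m z w\<bar> \<le> 2 * C" if "z \<in> ball z0 (4 * r)" "w \<in> ball w0 (4 * r)" for z w
  proof -
    have t: "chart_inv c z \<in> topspace X" "chart_inv c z0 \<in> topspace X" using zi(2) that z0 chart_inv_topspace[OF c(1)] by blast+
    show ?thesis
      using C[OF wi(3)[OF that(2)] t] C[OF wi(3)[OF w0] t] unfolding m_def osc[OF zi(1)[OF that(1)]] osc[OF zi(1)[OF z0]] by linarith
  qed
  have "\<bar>m z w\<bar> \<le> 16 * (2 * C) / r\<^sup>2 * (dist z0 z * dist w0 w)" if "dist z0 z < r" "dist w0 w < r" for z w
    by (rule separately_area_harmonic_mixed_bound[where m=m, OF r(1) h1 h2 M _ _ that]) (simp_all add: m_def)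
  then show ?thesis unfolding m_def using r(1) by blast
qed

text \<open>The same argument works at a point of the diagonal once the pole is removed. Setting
  \<open>w = z\<close> later determines the regular part along the diagonal up to a quadratic
  error.\<close>

lemma green_ext_mixed_bound:
  assumes c: "c \<in> \<A>" "z0 \<in> chart_img c"
  shows "\<exists>r>0. \<exists>C. \<forall>z w. dist z0 z < r \<longrightarrow> dist z0 w < r \<longrightarrow>
    \<bar>green_ext c w z - green_ext c w z0 - green_ext c z0 z + green_ext c z0 z0\<bar> \<le> C * (dist z0 z * dist z0 w)"
proof -
  obtain R where R: "0 < R" "cball z0 R \<subseteq> chart_img c" using chart(2)[OF c(1)] c(2) open_contains_cball by blast
  define \<delta> where "\<delta> = R / 16"
  have \<delta>: "0 < \<delta>" "16 * \<delta> = R" using R by (auto simp: \<delta>_def)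
  have sub: "ball z0 (16 * \<delta>) \<subseteq> chart_img c" using R \<delta> by (auto simp: subset_iff)
  obtain C where C: "\<And>w x y. w \<in> cball z0 \<delta> \<Longrightarrow> x \<in> topspace X \<Longrightarrow> y \<in> topspace X \<Longrightarrow> \<bar>green_osc c z0 \<delta> w x - green_osc c z0 \<delta> w y\<bar> \<le> C"
    using green_oscillation[OF c(1) \<delta>(1) sub] by blast
  define m where "m = (\<lambda>z w. green_ext c w z - green_ext c w z0 - green_ext c z0 z + green_ext c z0 z0)"
  define r where "r = \<delta> / 4"
  have r: "0 < r" "4 * r = \<delta>" using \<delta> by (auto simp: r_def)
  have zi: "z \<in> chart_img c" "z \<in> cball z0 \<delta>" "z \<in> ball z0 (4 * \<delta>)" if "z \<in> ball z0 (4 * r)" for z using that r \<delta> sub by (auto simp: subset_iff)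
  have z0: "z0 \<in> ball z0 (4 * r)" using r by auto
  have sub': "ball z0 (4 * \<delta>) \<subseteq> chart_img c" using sub \<delta> by (auto simp: subset_iff)
  have osc: "green_osc c z0 \<delta> w (chart_inv c z) = green_ext c w z" if "z \<in> ball z0 (4 * r)" for z w
    using zi[OF that] chart_inv(3)[OF c(1)] by (simp add: green_osc_def)
  have sym: "m z w = m w z" if "z \<in> ball z0 (4 * r)" "w \<in> ball z0 (4 * r)" for z w
    using green_ext_sym[OF c(1)] zi(1)[OF that(1)] zi(1)[OF that(2)] c(2) by (simp add: m_def)
  have h1: "area_harmonic_on (\<lambda>z. m z w) (ball z0 (4 * r))" if w: "w \<in> ball z0 (4 * r)" for w
  proof -
    have a: "area_harmonic_on (\<lambda>z. green_ext c v z - inv_area * ln (\<rho> c z)) (ball z0 (4 * r))" if v: "v \<in> ball z0 (4 * r)" for v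
      unfolding r(2) by (rule green_ext_area_harmonic(1)[OF c(1) zi(1)[OF v] \<delta>(1) sub'])
    show ?thesis
      by (rule area_harmonic_cong[OF _ area_harmonic_diff[OF a[OF w] a[OF z0], of "green_ext c z0 z0 - green_ext c w z0"]])
        (simp add: m_def)
  qed
  have h2: "area_harmonic_on (\<lambda>w. m z w) (ball z0 (4 * r))" if z: "z \<in> ball z0 (4 * r)" for z
    by (rule area_harmonic_cong[OF sym h1[OF z]]) (use z in auto)
  have M: "\<bar>m z w\<bar> \<le> 2 * C" if "z \<in> ball z0 (4 * r)" "w \<in> ball z0 (4 * r)" for z w
  proof -
    have t: "chart_inv c z \<in> topspace X" "chart_inv c z0 \<in> topspace X" using zi(1) that z0 chart_inv_topspace[OF c(1)] by blast+
    show ?thesis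
      using C[OF zi(2)[OF that(2)] t] C[OF zi(2)[OF z0] t] unfolding m_def osc[OF that(1)] osc[OF z0] by linarith
  qed
  have "\<bar>m z w\<bar> \<le> 16 * (2 * C) / r\<^sup>2 * (dist z0 z * dist z0 w)" if "dist z0 z < r" "dist z0 w < r" for z w
    by (rule separately_area_harmonic_mixed_bound[where m=m, OF r(1) h1 h2 M _ _ that])
      (use green_ext_sym[OF c(1)] zi(1) c(2) in \<open>simp_all add: m_def\<close>)
  then show ?thesis unfolding m_def using r(1) by blast
qed
end

section \<open>The hyperelliptic involution\<close>

lemma riemann_sphere:
  "topspace riemann_sphere = UNIV" "Hausdorff_space riemann_sphere"
  "d \<in> riemann_sphere_atlas \<Longrightarrow> openin riemann_sphere (chart_dom d)"
  "d \<in> riemann_sphere_atlas \<Longrightarrow> inj_on (snd d) (chart_dom d)"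
  "\<exists>d\<in>riemann_sphere_atlas. y \<in> chart_dom d"
proof -
  show top: "topspace riemann_sphere = UNIV" by (auto simp: riemann_sphere_def) (metis not_Some_eq rangeI)
  show H: "Hausdorff_space riemann_sphere"
    by (simp add: riemann_sphere_def Hausdorff_space_Alexandroff_compactification locally_compact_space_euclidean)
  have "openin riemann_sphere (range Some)"
    unfolding riemann_sphere_def by (subst openin_Alexandroff_compactification_image_Some) simp
  moreover have "closedin riemann_sphere {Some 0}" using H top by (simp add: closedin_Hausdorff_singleton)
  then have "openin riemann_sphere (UNIV - {Some 0})" using top by (metis openin_closedin_eq openin_diff openin_topspace)
  ultimately show "d \<in> riemann_sphere_atlas \<Longrightarrow> openin riemann_sphere (chart_dom d)"
    by (auto simp: riemann_sphere_atlas_def)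
  have "inj_on (\<lambda>w. case w of None \<Rightarrow> 0 | Some z \<Rightarrow> inverse z) (UNIV - {Some (0::complex)})"
    by (auto simp: inj_on_def split: option.splits)
  then show "d \<in> riemann_sphere_atlas \<Longrightarrow> inj_on (snd d) (chart_dom d)"
    by (auto simp: riemann_sphere_atlas_def inj_on_def)
  show "\<exists>d\<in>riemann_sphere_atlas. y \<in> chart_dom d"
    by (cases y) (auto simp: riemann_sphere_atlas_def)
qed

section \<open>Fibres of the covering and the local form of the sheet exchange\<close>

locale hyperelliptic = charted_surface X \<A> for X :: "'a topology" and \<A> +
  fixes \<pi> :: "'a \<Rightarrow> complex option"
  assumes hyperelliptic: "hyperelliptic_surface X \<A> \<pi>"
begin

abbreviation \<tau> :: "'a \<Rightarrow> 'a" where "\<tau> \<equiv> hyperelliptic_involution X \<pi>"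

lemma compact_hyperelliptic: "compact_space X" and connected_X: "connected_space X" and Hausdorff_X: "Hausdorff_space X"
  using hyperelliptic riemann_surface by (auto simp: hyperelliptic_surface_def riemann_surface_def)

lemma \<pi>_continuous: "continuous_map X riemann_sphere \<pi>"
  using hyperelliptic by (auto simp: hyperelliptic_surface_def two_sheeted_branched_covering_def holomorphic_between_def)

definition coord_dom :: "'a chart \<Rightarrow> complex option chart \<Rightarrow> 'a set" where
  "coord_dom c d = {x \<in> chart_dom c. \<pi> x \<in> chart_dom d}"

definition coord :: "'a chart \<Rightarrow> complex option chart \<Rightarrow> complex \<Rightarrow> complex" where
  "coord c d = snd d \<circ> \<pi> \<circ> chart_inv c"

lemma coord:
  assumes c: "c \<in> \<A>" and d: "d \<in> riemann_sphere_atlas"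
  shows "openin X (coord_dom c d)" "open (snd c ` coord_dom c d)" "coord c d holomorphic_on snd c ` coord_dom c d"
    "x \<in> chart_dom c \<Longrightarrow> coord c d (snd c x) = snd d (\<pi> x)"
proof -
  have "openin X {x \<in> topspace X. \<pi> x \<in> chart_dom d}"
    by (rule openin_continuous_map_preimage[OF \<pi>_continuous riemann_sphere(3)[OF d]])
  then have "openin X (chart_dom c \<inter> {x \<in> topspace X. \<pi> x \<in> chart_dom d})" using chart(1)[OF c] by blast
  moreover have "chart_dom c \<inter> {x \<in> topspace X. \<pi> x \<in> chart_dom d} = coord_dom c d"
    using chart(4)[OF c] by (auto simp: coord_dom_def)
  ultimately show o: "openin X (coord_dom c d)" by simp
  have "chart_dom c \<inter> coord_dom c d = coord_dom c d" by (auto simp: coord_dom_def)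
  then show "open (snd c ` coord_dom c d)" using open_chart_image[OF c o] by simp
  show "coord c d holomorphic_on snd c ` coord_dom c d"
    using hyperelliptic c d unfolding coord_def coord_dom_def
    by (auto simp: hyperelliptic_surface_def two_sheeted_branched_covering_def holomorphic_between_def)
  show "x \<in> chart_dom c \<Longrightarrow> coord c d (snd c x) = snd d (\<pi> x)" using chart_inv(1)[OF c] by (simp add: coord_def)
qed

lemma \<pi>_eq_iff:
  "d \<in> riemann_sphere_atlas \<Longrightarrow> \<pi> x \<in> chart_dom d \<Longrightarrow> \<pi> y \<in> chart_dom d \<Longrightarrow> snd d (\<pi> x) = snd d (\<pi> y) \<longleftrightarrow> \<pi> x = \<pi> y"
  using inj_on_eq_iff[OF riemann_sphere(4)] by blast

text \<open>Some finite set off which all fibres are pairs, chosen once. It contains every value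
  whose fibre is not a pair, but possibly ordinary values too.\<close>

definition branch_set :: "complex option set" where
  "branch_set = (SOME S. finite S \<and> (\<forall>y. y \<notin> S \<longrightarrow> (\<exists>a\<in>topspace X. \<exists>b\<in>topspace X. a \<noteq> b \<and> {x \<in> topspace X. \<pi> x = y} = {a, b})))"

lemma branch_set: "finite branch_set"
  "y \<notin> branch_set \<Longrightarrow> \<exists>a\<in>topspace X. \<exists>b\<in>topspace X. a \<noteq> b \<and> {x \<in> topspace X. \<pi> x = y} = {a, b}"
proof -
  have "two_sheeted_branched_covering X \<A> riemann_sphere riemann_sphere_atlas \<pi>"
    using hyperelliptic by (simp add: hyperelliptic_surface_def)
  then obtain S where S: "finite S" "\<forall>y\<in>topspace riemann_sphere - S. \<exists>W U V. openin riemann_sphere W \<and> y \<in> W \<and>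
          openin X U \<and> openin X V \<and> U \<inter> V = {} \<and> {x \<in> topspace X. \<pi> x \<in> W} = U \<union> V \<and>
          homeomorphic_map (subtopology X U) (subtopology riemann_sphere W) \<pi> \<and>
          homeomorphic_map (subtopology X V) (subtopology riemann_sphere W) \<pi>"
    unfolding two_sheeted_branched_covering_def by (elim exE conjE) (rule that)
  have "\<exists>a\<in>topspace X. \<exists>b\<in>topspace X. a \<noteq> b \<and> {x \<in> topspace X. \<pi> x = y} = {a, b}" if yS: "y \<notin> S" for y
  proof -
    have "y \<in> topspace riemann_sphere - S" using yS by (simp add: riemann_sphere(1))
    from bspec[OF S(2) this] obtain W U V where *: "y \<in> W" "openin X U" "openin X V" "U \<inter> V = {}" "{x \<in> topspace X. \<pi> x \<in> W} = U \<union> V"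
      "homeomorphic_map (subtopology X U) (subtopology riemann_sphere W) \<pi>"
      "homeomorphic_map (subtopology X V) (subtopology riemann_sphere W) \<pi>" by (elim exE conjE) (rule that)
    have UV: "U \<subseteq> topspace X" "V \<subseteq> topspace X" using *(2,3) openin_subset by auto
    have im: "\<pi> ` U = W" "\<pi> ` V = W" "inj_on \<pi> U" "inj_on \<pi> V"
      using homeomorphic_imp_surjective_map[OF *(6)] homeomorphic_imp_surjective_map[OF *(7)]
        homeomorphic_imp_injective_map[OF *(6)] homeomorphic_imp_injective_map[OF *(7)] UV
      by (simp_all add: riemann_sphere(1) Int_absorb1)
    obtain a b where ab: "a \<in> U" "b \<in> V" "\<pi> a = y" "\<pi> b = y" using im *(1) by (metis imageE)
    have "{x \<in> topspace X. \<pi> x = y} = {a, b}"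
    proof (intro equalityI subsetI)
      fix x assume "x \<in> {x \<in> topspace X. \<pi> x = y}"
      then have "x \<in> U \<union> V" "\<pi> x = y" using * by blast+
      then show "x \<in> {a, b}" using im(3,4) ab by (metis Un_iff inj_onD insertCI)
    qed (use ab UV in auto)
    moreover have "a \<noteq> b" using ab *(4) by blast
    ultimately show ?thesis using ab UV by blast
  qed
  then have "\<exists>S. finite S \<and> (\<forall>y. y \<notin> S \<longrightarrow> (\<exists>a\<in>topspace X. \<exists>b\<in>topspace X. a \<noteq> b \<and> {x \<in> topspace X. \<pi> x = y} = {a, b}))"
    using S(1) by blast
  from someI_ex[OF this] show "finite branch_set"
    "y \<notin> branch_set \<Longrightarrow> \<exists>a\<in>topspace X. \<exists>b\<in>topspace X. a \<noteq> b \<and> {x \<in> topspace X. \<pi> x = y} = {a, b}"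
    unfolding branch_set_def by blast+
qed

lemma unbranched_fibre:
  assumes "y \<notin> branch_set"
  obtains a b where "a \<in> topspace X" "b \<in> topspace X" "a \<noteq> b" "\<pi> a = y" "\<pi> b = y"
    "\<And>x. x \<in> topspace X \<Longrightarrow> \<pi> x = y \<Longrightarrow> x = a \<or> x = b"
proof -
  from branch_set(2)[OF assms] obtain a b where ab: "a \<in> topspace X" "b \<in> topspace X" "a \<noteq> b" "{x \<in> topspace X. \<pi> x = y} = {a, b}"
    by (elim bexE conjE) (rule that)
  have eq: "x \<in> topspace X \<and> \<pi> x = y \<longleftrightarrow> x = a \<or> x = b" for x
    using eqset_imp_iff[OF ab(4), of x] by simp
  show ?thesis by (rule that[of a b]) (use ab(1-3) eq in blast)+
qed

text \<open>Local constancy spreads through coordinate discs by the identity theorem, and by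
  connectedness \<pi> would be constant. But the sphere is infinite and every value outside the
  finite set \<open>branch_set\<close> is attained.\<close>

lemma \<pi>_not_locally_constant:
  assumes p: "p \<in> topspace X" and U: "openin X U" "p \<in> U"
  shows "\<exists>x\<in>U. \<pi> x \<noteq> \<pi> p"
proof (rule ccontr)
  define Z where "Z = (\<lambda>p. \<exists>U. openin X U \<and> p \<in> U \<and> (\<forall>x\<in>U. \<pi> x = \<pi> p))"
  assume "\<not> (\<exists>x\<in>U. \<pi> x \<noteq> \<pi> p)"
  then have Zp: "Z p" using U unfolding Z_def by blast
  have Z: "Z q" if q: "q \<in> topspace X" for q
  proof (rule connected_space_induct[where P=Z, OF connected_X p Zp _ q])
    fix x assume x: "x \<in> topspace X"
    obtain c where c: "c \<in> \<A>" "x \<in> chart_dom c" using ex_chart[OF x] by blast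
    obtain d where d: "d \<in> riemann_sphere_atlas" "\<pi> x \<in> chart_dom d" using riemann_sphere(5) by blast
    have "x \<in> coord_dom c d" using c d by (simp add: coord_dom_def)
    then obtain r where r: "0 < r" "cball (snd c x) r \<subseteq> chart_img c" "chart_inv c ` cball (snd c x) r \<subseteq> coord_dom c d"
      using chart_ball[OF c coord(1)[OF c(1) d(1)]] by blast
    define B where "B = ball (snd c x) r"
    have B: "B \<subseteq> chart_img c" "chart_inv c ` B \<subseteq> coord_dom c d" using r by (auto simp: B_def)
    define N where "N = chart_inv c ` B"
    have N: "openin X N" "x \<in> N" "N \<subseteq> coord_dom c d"
    proof -
      show "openin X N" unfolding N_def by (rule openin_chart_inv_image[OF c(1) _ B(1)]) (simp add: B_def)
      have "snd c x \<in> B" using r(1) by (simp add: B_def)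
      then have "chart_inv c (snd c x) \<in> chart_inv c ` B" by (rule imageI)
      then show "x \<in> N" using chart_inv(1)[OF c] by (simp add: N_def)
      show "N \<subseteq> coord_dom c d" using B(2) by (simp add: N_def)
    qed
    have hol: "coord c d holomorphic_on B"
    proof (rule holomorphic_on_subset[OF coord(3)[OF c(1) d(1)]])
      show "B \<subseteq> snd c ` coord_dom c d"
      proof
        fix z assume "z \<in> B"
        then have "chart_inv c z \<in> coord_dom c d" "snd c (chart_inv c z) = z" using B chart_inv(3)[OF c(1)] by auto
        then show "z \<in> snd c ` coord_dom c d" by (metis imageI)
      qed
    qed
    have "Z y'" if y: "y \<in> N" "y' \<in> N" "Z y" for y y'
    proof -
      obtain V where V: "openin X V" "y \<in> V" "\<And>v. v \<in> V \<Longrightarrow> \<pi> v = \<pi> y" using y(3) unfolding Z_def by blast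
      have yd: "y \<in> chart_dom c" "y \<in> coord_dom c d" using y(1) N(3) by (auto simp: coord_dom_def)
      have yB: "snd c y \<in> B" using y(1) chart_inv(3)[OF c(1)] B(1) by (auto simp: N_def)
      have oV: "open (snd c ` (chart_dom c \<inter> V) \<inter> B)" using open_chart_image[OF c(1) V(1)] by (auto simp: B_def)
      have const: "coord c d z = snd d (\<pi> y)" if "z \<in> B" for z
      proof (rule analytic_continuation_open[of "snd c ` (chart_dom c \<inter> V) \<inter> B" B "coord c d" "\<lambda>_. snd d (\<pi> y)", OF oV _ _ _ _ hol _ _ that])
        show "snd c ` (chart_dom c \<inter> V) \<inter> B \<noteq> {}" using yB yd V(2) by blast
        fix z assume "z \<in> snd c ` (chart_dom c \<inter> V) \<inter> B"
        then obtain v where v: "v \<in> chart_dom c" "v \<in> V" "z = snd c v" by blast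
        then show "coord c d z = snd d (\<pi> y)" using coord(4)[OF c(1) d(1) v(1)] V(3)[OF v(2)] by simp
      qed (auto simp: B_def)
      have "\<pi> v = \<pi> y" if v: "v \<in> N" for v
      proof -
        have vB: "snd c v \<in> B" "v \<in> coord_dom c d" using v chart_inv(3)[OF c(1)] B(1) N(3) by (auto simp: N_def)
        then have "snd d (\<pi> v) = snd d (\<pi> y)" using const[OF vB(1)] coord(4)[OF c(1) d(1), of v] by (simp add: coord_dom_def)
        then show ?thesis using \<pi>_eq_iff[OF d(1)] vB(2) yd(2) by (auto simp: coord_dom_def)
      qed
      then show ?thesis unfolding Z_def using N(1) y(2) by metis
    qed
    then show "\<exists>N. openin X N \<and> x \<in> N \<and> (\<forall>y\<in>N. \<forall>y'\<in>N. Z y \<longrightarrow> Z y')" using N by blast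
  qed
  have const: "\<pi> q = \<pi> p" if q: "q \<in> topspace X" for q
  proof (rule connected_space_induct[where P="\<lambda>q. \<pi> q = \<pi> p", OF connected_X p refl _ q])
    fix x assume "x \<in> topspace X"
    from Z[OF this, unfolded Z_def] obtain U where U: "openin X U" "x \<in> U" "\<forall>y\<in>U. \<pi> y = \<pi> x"
      by (elim exE conjE) (rule that)
    show "\<exists>N. openin X N \<and> x \<in> N \<and> (\<forall>y\<in>N. \<forall>y'\<in>N. \<pi> y = \<pi> p \<longrightarrow> \<pi> y' = \<pi> p)"
    proof (intro exI[of _ U] conjI ballI impI U(1,2))
      fix y y' assume "y \<in> U" "y' \<in> U" "\<pi> y = \<pi> p"
      then show "\<pi> y' = \<pi> p" using bspec[OF U(3), of y] bspec[OF U(3), of y'] by (simp only:)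
    qed
  qed
  have "infinite (range (Some :: complex \<Rightarrow> complex option))"
    using infinite_UNIV_char_0 by (subst finite_image_iff) auto
  then have "infinite (UNIV :: complex option set)" by (rule infinite_super[OF subset_UNIV])
  moreover have "finite (insert (\<pi> p) branch_set)" using branch_set(1) by simp
  ultimately obtain y where "y \<notin> insert (\<pi> p) branch_set" by (meson UNIV_I finite_subset subsetI)
  then have y: "y \<notin> branch_set" "y \<noteq> \<pi> p" by simp_all
  obtain a b where "a \<in> topspace X" "\<pi> a = y" by (rule unbranched_fibre[OF y(1)])
  then show False using const[of a] y(2) by simp
qed

lemma open_coord_image:
  assumes c: "c \<in> \<A>" and d: "d \<in> riemann_sphere_atlas" and U: "openin X U" "U \<subseteq> coord_dom c d"
  shows "open ((snd d \<circ> \<pi>) ` U)"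
proof -
  have Ud: "chart_dom c \<inter> U = U" using U by (auto simp: coord_dom_def)
  have oS: "open (snd c ` U)" using open_chart_image[OF c U(1)] by (simp add: Ud)
  have sub: "snd c ` U \<subseteq> snd c ` coord_dom c d" using U by blast
  have "open (coord c d ` snd c ` U)"
  proof (rule open_mapping_thm2[OF holomorphic_on_subset[OF coord(3)[OF c d] sub] oS oS])
    fix V assume V: "open V" "V \<subseteq> snd c ` U" "V \<noteq> {}"
    show "\<not> coord c d constant_on V"
    proof
      assume "coord c d constant_on V"
      then obtain k where k: "\<And>z. z \<in> V \<Longrightarrow> coord c d z = k" by (auto simp: constant_on_def)
      obtain z where z: "z \<in> V" using V by blast
      have Vi: "V \<subseteq> chart_img c" using V Ud by blast
      define N where "N = chart_inv c ` V"
      have N: "openin X N" unfolding N_def by (rule openin_chart_inv_image[OF c V(1) Vi])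
      have NU: "x \<in> U \<and> snd c x \<in> V" if xN: "x \<in> N" for x
      proof -
        obtain v where v: "v \<in> V" "x = chart_inv c v" using xN unfolding N_def by blast
        then obtain u where u: "u \<in> U" "v = snd c u" using V(2) by blast
        then have "x = u" using chart_inv(1)[OF c, of u] Ud v(2) by blast
        then show ?thesis using u v by simp
      qed
      have Nk: "snd d (\<pi> x) = k \<and> \<pi> x \<in> chart_dom d" if "x \<in> N" for x
        using NU[OF that] coord(4)[OF c d, of x] k[of "snd c x"] U(2) by (auto simp: coord_dom_def)
      have eq: "\<pi> x = \<pi> y" if "x \<in> N" "y \<in> N" for x y
        using Nk[OF that(1)] Nk[OF that(2)] \<pi>_eq_iff[OF d, of x y] by simp
      have "chart_inv c z \<in> N" using z by (simp add: N_def)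
      then show False using \<pi>_not_locally_constant[OF _ N] eq openin_subset[OF N] by blast
    qed
  qed auto
  moreover have "coord c d ` snd c ` U = (snd d \<circ> \<pi>) ` U"
    unfolding image_image by (rule image_cong[OF refl]) (use coord(4)[OF c d] U in \<open>auto simp: coord_dom_def\<close>)
  ultimately show ?thesis by simp
qed

text \<open>The covering property controls fibres only off a finite set. If three points had the
  same value, disjoint neighbourhoods of them would have open images with a common value. Their
  intersection would be infinite and contain an unbranched value with three preimages.\<close>

lemma fibre_le_2:
  assumes "p \<in> topspace X" "q \<in> topspace X" "r \<in> topspace X" "\<pi> p = \<pi> q" "\<pi> r = \<pi> q" "p \<noteq> q" "r \<noteq> q"
  shows "p = r"
proof (rule ccontr)
  assume pr: "p \<noteq> r"
  obtain d where d: "d \<in> riemann_sphere_atlas" "\<pi> q \<in> chart_dom d" using riemann_sphere(5) by blast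
  note H = Hausdorff_X[unfolded Hausdorff_space_def, rule_format]
  obtain U1 U2 where U12: "openin X U1" "openin X U2" "p \<in> U1" "q \<in> U2" "disjnt U1 U2" using H[of p q] assms by auto
  obtain V1 V3 where V13: "openin X V1" "openin X V3" "p \<in> V1" "r \<in> V3" "disjnt V1 V3" using H[of p r] assms pr by auto
  obtain W3 W2 where W32: "openin X W3" "openin X W2" "r \<in> W3" "q \<in> W2" "disjnt W3 W2" using H[of r q] assms by auto
  obtain c1 c2 c3 where c: "c1 \<in> \<A>" "p \<in> chart_dom c1" "c2 \<in> \<A>" "q \<in> chart_dom c2" "c3 \<in> \<A>" "r \<in> chart_dom c3"
    using ex_chart assms by metis
  define A1 where "A1 = U1 \<inter> V1 \<inter> coord_dom c1 d"
  define A2 where "A2 = U2 \<inter> W2 \<inter> coord_dom c2 d"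
  define A3 where "A3 = V3 \<inter> W3 \<inter> coord_dom c3 d"
  have oA: "openin X A1" "openin X A2" "openin X A3"
    unfolding A1_def A2_def A3_def
    using U12 V13 W32 coord(1)[OF c(1) d(1)] coord(1)[OF c(3) d(1)] coord(1)[OF c(5) d(1)]
    by (auto intro!: openin_Int)
  have mA: "p \<in> A1" "q \<in> A2" "r \<in> A3"
    unfolding A1_def A2_def A3_def using U12 V13 W32 c d assms by (auto simp: coord_dom_def)
  have dA: "A1 \<inter> A2 = {}" "A1 \<inter> A3 = {}" "A2 \<inter> A3 = {}"
    unfolding A1_def A2_def A3_def using U12 V13 W32 by (auto simp: disjnt_iff)
  let ?f = "snd d \<circ> \<pi>"
  have "open (?f ` A1)" "open (?f ` A2)" "open (?f ` A3)"
    by (rule open_coord_image[OF _ d(1) oA(1)] open_coord_image[OF _ d(1) oA(2)] open_coord_image[OF _ d(1) oA(3)];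
        use c in \<open>auto simp: A1_def A2_def A3_def\<close>)+
  then have o: "open (?f ` A1 \<inter> ?f ` A2 \<inter> ?f ` A3)" by blast
  have "?f q \<in> ?f ` A1 \<inter> ?f ` A2 \<inter> ?f ` A3"
    using mA assms(4,5) by (metis IntI comp_apply imageI)
  then have "infinite (?f ` A1 \<inter> ?f ` A2 \<inter> ?f ` A3)" using finite_imp_not_open[OF _ o] by blast
  moreover have "finite (snd d ` branch_set)" using branch_set(1) by simp
  ultimately obtain w where w: "w \<in> ?f ` A1 \<inter> ?f ` A2 \<inter> ?f ` A3" "w \<notin> snd d ` branch_set"
    by (meson finite_subset subsetI)
  then obtain x1 x2 x3 where x: "x1 \<in> A1" "x2 \<in> A2" "x3 \<in> A3" "snd d (\<pi> x1) = w" "snd d (\<pi> x2) = w" "snd d (\<pi> x3) = w"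
    by auto
  have dom: "\<pi> x1 \<in> chart_dom d" "\<pi> x2 \<in> chart_dom d" "\<pi> x3 \<in> chart_dom d"
    using x by (auto simp: A1_def A2_def A3_def coord_dom_def)
  then have eq: "\<pi> x2 = \<pi> x1" "\<pi> x3 = \<pi> x1" using x \<pi>_eq_iff[OF d(1)] by metis+
  have "\<pi> x1 \<notin> branch_set" using w(2) x(4) by blast
  then obtain a b where ab: "\<And>x. x \<in> topspace X \<Longrightarrow> \<pi> x = \<pi> x1 \<Longrightarrow> x = a \<or> x = b" by (rule unbranched_fibre) blast
  have "x1 \<in> topspace X" "x2 \<in> topspace X" "x3 \<in> topspace X" using x oA openin_subset by blast+
  from ab[OF this(1) refl] ab[OF this(2) eq(1)] ab[OF this(3) eq(2)]
  have "x1 = a \<or> x1 = b" "x2 = a \<or> x2 = b" "x3 = a \<or> x3 = b" .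
  moreover have "x1 \<noteq> x2" "x1 \<noteq> x3" "x2 \<noteq> x3" using x dA by blast+
  ultimately show False by metis
qed

lemma \<tau>_other: "p \<in> topspace X \<Longrightarrow> q \<in> topspace X \<Longrightarrow> q \<noteq> p \<Longrightarrow> \<pi> q = \<pi> p \<Longrightarrow> \<tau> p = q"
  unfolding hyperelliptic_involution_def
  by (auto intro!: the_equality dest: fibre_le_2)

lemma \<tau>_single: "(\<And>q. q \<in> topspace X \<Longrightarrow> \<pi> q = \<pi> p \<Longrightarrow> q = p) \<Longrightarrow> \<tau> p = p"
  unfolding hyperelliptic_involution_def by auto

lemma \<tau>: 
  assumes p: "p \<in> topspace X" shows "\<tau> p \<in> topspace X" "\<pi> (\<tau> p) = \<pi> p" "\<tau> (\<tau> p) = p"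
proof -
  have "\<tau> p \<in> topspace X \<and> \<pi> (\<tau> p) = \<pi> p \<and> \<tau> (\<tau> p) = p"
  proof (cases "\<exists>q\<in>topspace X. q \<noteq> p \<and> \<pi> q = \<pi> p")
    case True
    then obtain q where q: "q \<in> topspace X" "q \<noteq> p" "\<pi> q = \<pi> p" by blast
    then show ?thesis using \<tau>_other[OF p q] \<tau>_other[OF q(1) p] by auto
  next
    case False
    then have "\<tau> p = p" by (intro \<tau>_single) blast
    then show ?thesis using p by simp
  qed
  then show "\<tau> p \<in> topspace X" "\<pi> (\<tau> p) = \<pi> p" "\<tau> (\<tau> p) = p" by auto
qed

lemma \<tau>_fixed: "p \<in> topspace X \<Longrightarrow> \<tau> p = p \<Longrightarrow> q \<in> topspace X \<Longrightarrow> \<pi> q = \<pi> p \<Longrightarrow> q = p"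
  using \<tau>_other by metis

lemma \<tau>_inj: "p \<in> topspace X \<Longrightarrow> q \<in> topspace X \<Longrightarrow> \<tau> p = \<tau> q \<Longrightarrow> p = q"
  using \<tau>(3) by metis

text \<open>Where the two sheets are apart, \<open>\<tau>\<close> is \<pi> near \<open>p\<close>
  followed by the local inverse of \<pi> near \<open>\<tau> p\<close>, both read in one coordinate
  of the sphere.\<close>

lemma \<tau>_local_free:
  assumes p: "p \<in> topspace X" and c: "c \<in> \<A>" "p \<in> chart_dom c" and c': "c' \<in> \<A>" "\<tau> p \<in> chart_dom c'" and free: "\<tau> p \<noteq> p"
  shows "\<exists>r>0. \<exists>f. ball (snd c p) r \<subseteq> chart_img c \<and> f holomorphic_on ball (snd c p) r \<and> f ` ball (snd c p) r \<subseteq> chart_img c' \<and>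
    (\<forall>z\<in>ball (snd c p) r. \<tau> (chart_inv c z) = chart_inv c' (f z))"
proof -
  define q where "q = \<tau> p"
  have q: "q \<in> topspace X" "\<pi> q = \<pi> p" "q \<noteq> p" "q \<in> chart_dom c'" using \<tau>[OF p] free c' by (auto simp: q_def)
  obtain d where d: "d \<in> riemann_sphere_atlas" "\<pi> p \<in> chart_dom d" using riemann_sphere(5) by blast
  obtain U0 V0 where UV0: "openin X U0" "openin X V0" "p \<in> U0" "q \<in> V0" "disjnt U0 V0"
    using Hausdorff_X p q unfolding Hausdorff_space_def by metis
  define U where "U = U0 \<inter> coord_dom c d"
  define V where "V = V0 \<inter> coord_dom c' d"
  have U: "openin X U" "p \<in> U" "U \<subseteq> coord_dom c d" "chart_dom c \<inter> U = U"
    unfolding U_def using UV0 coord(1)[OF c(1) d(1)] c d by (auto simp: coord_dom_def)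
  have V: "openin X V" "q \<in> V" "V \<subseteq> coord_dom c' d" "chart_dom c' \<inter> V = V"
    unfolding V_def using UV0 coord(1)[OF c'(1) d(1)] c' d q by (auto simp: coord_dom_def)
  have disj: "x \<noteq> y" if "x \<in> U" "y \<in> V" for x y using that UV0(5) by (auto simp: U_def V_def disjnt_iff)
  have UX: "U \<subseteq> topspace X" "V \<subseteq> topspace X" using U(1) V(1) openin_subset by auto
  define W where "W = (snd d \<circ> \<pi>) ` U \<inter> (snd d \<circ> \<pi>) ` V"
  have W: "open W" "snd d (\<pi> p) \<in> W"
    unfolding W_def using open_coord_image[OF c(1) d(1) U(1,3)] open_coord_image[OF c'(1) d(1) V(1,3)] U(2) V(2) q(2)
    by (auto, metis comp_apply imageI)
  define A where "A = snd c ` U"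
  define B where "B = {w \<in> snd c' ` V. coord c' d w \<in> W}"
  have oA: "open A" using open_chart_image[OF c(1) U(1)] U(4) by (simp add: A_def)
  have oV: "open (snd c' ` V)" using open_chart_image[OF c'(1) V(1)] V(4) by simp
  have holA: "coord c d holomorphic_on A" unfolding A_def
    by (rule holomorphic_on_subset[OF coord(3)[OF c(1) d(1)]]) (use U(3) in blast)
  have holV: "coord c' d holomorphic_on snd c' ` V"
    by (rule holomorphic_on_subset[OF coord(3)[OF c'(1) d(1)]]) (use V(3) in blast)
  have oB: "open B"
  proof -
    have "open (snd c' ` V \<inter> coord c' d -` W)"
      by (rule continuous_open_preimage[OF holomorphic_on_imp_continuous_on[OF holV] oV W(1)])
    moreover have "snd c' ` V \<inter> coord c' d -` W = B" by (auto simp: B_def)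
    ultimately show ?thesis by simp
  qed
  have holB: "coord c' d holomorphic_on B" by (rule holomorphic_on_subset[OF holV]) (auto simp: B_def)
  have invV: "chart_inv c' w \<in> V \<and> snd c' (chart_inv c' w) = w" if "w \<in> snd c' ` V" for w
    using that chart_inv(1)[OF c'(1)] V(4) by (metis (no_types, lifting) Int_iff imageE)
  have invU: "chart_inv c z \<in> U \<and> snd c (chart_inv c z) = z" if "z \<in> A" for z
    using that chart_inv(1)[OF c(1)] U(4) unfolding A_def by (metis (no_types, lifting) Int_iff imageE)
  have cV: "coord c' d w = snd d (\<pi> (chart_inv c' w))" for w by (simp add: coord_def)
  have cU: "coord c d w = snd d (\<pi> (chart_inv c w))" for w by (simp add: coord_def)
  have domU: "\<pi> x \<in> chart_dom d" if "x \<in> U \<or> x \<in> V" for x using that U(3) V(3) by (auto simp: coord_dom_def)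
  \<comment> \<open>\<pi> is injective near \<open>\<tau> p\<close> over the values that it also
    takes near \<open>p\<close>: two preimages in \<open>V\<close> and one in \<open>U\<close> would
    make three points in a fibre.\<close>
  have inj: "inj_on (coord c' d) B"
  proof (rule inj_onI)
    fix w1 w2 assume w: "w1 \<in> B" "w2 \<in> B" "coord c' d w1 = coord c' d w2"
    let ?x1 = "chart_inv c' w1" and ?x2 = "chart_inv c' w2"
    have x: "?x1 \<in> V" "?x2 \<in> V" using w invV by (auto simp: B_def)
    obtain u where u: "u \<in> U" "snd d (\<pi> u) = coord c' d w1" using w(1) by (auto simp: B_def W_def)
    have "\<pi> u = \<pi> ?x1" "\<pi> u = \<pi> ?x2"
      using u w(3) \<pi>_eq_iff[OF d(1)] domU x unfolding cV by metis+
    then have "?x1 = ?x2"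
      using fibre_le_2[of ?x1 u ?x2] x u UX disj by (metis subsetD)
    then show "w1 = w2" using invV w by (metis (no_types, lifting) B_def mem_Collect_eq)
  qed
  obtain g where g: "g holomorphic_on coord c' d ` B" "\<And>z. z \<in> B \<Longrightarrow> g (coord c' d z) = z"
    using holomorphic_has_inverse[OF holB oB inj] by metis
  have imB: "coord c' d ` B = W"
  proof (intro equalityI subsetI)
    fix w assume "w \<in> W"
    then obtain v where v: "v \<in> V" "w = snd d (\<pi> v)" by (auto simp: W_def)
    have "coord c' d (snd c' v) = w" using coord(4)[OF c'(1) d(1), of v] v V(4) by blast
    then show "w \<in> coord c' d ` B" using v \<open>w \<in> W\<close> by (auto simp: B_def intro!: image_eqI[of _ _ "snd c' v"])
  qed (auto simp: B_def)
  have "open (A \<inter> coord c d -` W)"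
    by (rule continuous_open_preimage[OF holomorphic_on_imp_continuous_on[OF holA] oA W(1)])
  moreover have "snd c p \<in> A \<inter> coord c d -` W"
    using U(2) W(2) coord(4)[OF c(1) d(1) c(2)] by (auto simp: A_def)
  ultimately obtain r where r: "r > 0" "ball (snd c p) r \<subseteq> A \<inter> coord c d -` W" using open_contains_ball by blast
  have gB: "g w \<in> B" if "w \<in> W" for w using that imB g(2) by (metis imageE)
  show ?thesis
  proof (intro exI[of _ r] exI[of _ "g \<circ> coord c d"] conjI ballI)
    show "ball (snd c p) r \<subseteq> chart_img c" using r(2) U(4) unfolding A_def by blast
    show "g \<circ> coord c d holomorphic_on ball (snd c p) r"
      by (rule holomorphic_on_compose_gen[OF holomorphic_on_subset[OF holA] g(1)]) (use r(2) imB in auto)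
    show "(g \<circ> coord c d) ` ball (snd c p) r \<subseteq> chart_img c'"
    proof (rule image_subsetI)
      fix z assume "z \<in> ball (snd c p) r"
      then have "(g \<circ> coord c d) z \<in> B" using gB r(2) by auto
      moreover have "B \<subseteq> snd c' ` V" by (auto simp: B_def)
      moreover have "snd c' ` V \<subseteq> chart_img c'" using V(4) by blast
      ultimately show "(g \<circ> coord c d) z \<in> chart_img c'" by blast
    qed
    fix z assume z: "z \<in> ball (snd c p) r"
    let ?x = "chart_inv c z" and ?w = "g (coord c d z)"
    have zA: "z \<in> A" "coord c d z \<in> W" using z r(2) by auto
    have x: "?x \<in> U" using invU[OF zA(1)] by blast
    have w: "?w \<in> B" using gB[OF zA(2)] .
    then have y: "chart_inv c' ?w \<in> V" using invV by (auto simp: B_def)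
    have "coord c' d ?w = coord c d z" using zA(2) g(2) imB by (metis imageE)
    then have "\<pi> (chart_inv c' ?w) = \<pi> ?x" using \<pi>_eq_iff[OF d(1)] domU x y unfolding cV cU by metis
    then show "\<tau> ?x = chart_inv c' ((g \<circ> coord c d) z)"
      using \<tau>_other[of ?x "chart_inv c' ?w"] disj[OF x y] x y UX by auto
  qed (rule r(1))
qed

text \<open>At a fixed point the sheets meet and there is no local inverse of \<pi>. Instead,
  \<open>\<tau>\<close> moves all other nearby points and is holomorphic there by
  \<open>\<tau>_local_free\<close>; it is continuous at the fixed point, and an isolated singularity
  with continuity is removable.\<close>

lemma \<tau>_local_fixed:
  assumes p: "p \<in> topspace X" and c: "c \<in> \<A>" "p \<in> chart_dom c" and c': "c' \<in> \<A>" "p \<in> chart_dom c'" and fixed: "\<tau> p = p"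
  shows "\<exists>r>0. \<exists>f. ball (snd c p) r \<subseteq> chart_img c \<and> f holomorphic_on ball (snd c p) r \<and> f ` ball (snd c p) r \<subseteq> chart_img c' \<and>
    (\<forall>z\<in>ball (snd c p) r. \<tau> (chart_inv c z) = chart_inv c' (f z)) \<and>
    (\<forall>z\<in>ball (snd c p) r. z \<noteq> snd c p \<longrightarrow> \<tau> (chart_inv c z) \<noteq> chart_inv c z)"
proof -
  \<comment> \<open>\<open>p\<close> is alone in its fibre, and \<pi> maps closed sets to closed
    sets by compactness. So the points over a small neighbourhood of \<open>\<pi> p\<close> all lie
    in \<open>N\<close>, and \<open>\<tau>\<close> permutes them.\<close>
  have nbhd: "\<exists>N'. openin X N' \<and> p \<in> N' \<and> \<tau> ` N' \<subseteq> N" if N: "openin X N" "p \<in> N" for N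
  proof -
    have "compactin X (topspace X - N)"
      using compact_hyperelliptic N(1) by (intro closedin_compact_space) auto
    then have "compactin riemann_sphere (\<pi> ` (topspace X - N))" by (rule image_compactin[OF _ \<pi>_continuous])
    then have cl: "closedin riemann_sphere (\<pi> ` (topspace X - N))" by (rule compactin_imp_closedin[OF riemann_sphere(2)])
    define N' where "N' = {x \<in> topspace X. \<pi> x \<in> topspace riemann_sphere - \<pi> ` (topspace X - N)}"
    have "openin X N'" unfolding N'_def
      by (rule openin_continuous_map_preimage[OF \<pi>_continuous]) (use cl in auto)
    moreover have "p \<in> N'"
    proof -
      have "\<pi> p \<notin> \<pi> ` (topspace X - N)"
      proof
        assume "\<pi> p \<in> \<pi> ` (topspace X - N)"
        then obtain x where x: "\<pi> p = \<pi> x" "x \<in> topspace X - N" by (rule imageE)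
        then have "x = p" using \<tau>_fixed[OF p fixed, of x] by simp
        then show False using x(2) N(2) by simp
      qed
      then show ?thesis using p by (simp add: N'_def riemann_sphere(1))
    qed
    moreover have "\<tau> ` N' \<subseteq> N"
    proof
      fix y assume "y \<in> \<tau> ` N'"
      then obtain x where x: "x \<in> N'" "y = \<tau> x" by blast
      then have "y \<in> topspace X" "\<pi> y = \<pi> x" using \<tau>[of x] by (auto simp: N'_def)
      moreover have "\<pi> x \<notin> \<pi> ` (topspace X - N)" using x(1) by (simp add: N'_def)
      ultimately show "y \<in> N" using imageI[of y "topspace X - N" \<pi>] by auto
    qed
    ultimately show ?thesis by blast
  qed
  define f where "f = (\<lambda>z. snd c' (\<tau> (chart_inv c z)))"
  obtain N1 where N1: "openin X N1" "p \<in> N1" "\<tau> ` N1 \<subseteq> chart_dom c'" using nbhd[OF chart(1)[OF c'(1)] c'(2)] by blast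
  \<comment> \<open>Removing all other members of \<open>branch_set\<close> leaves only unbranched
    values around \<open>\<pi> p\<close>, over which \<open>\<tau>\<close> has no fixed
    point.\<close>
  have "closedin riemann_sphere (branch_set - {\<pi> p})"
    using branch_set(1) by (intro closedin_Hausdorff_finite[OF riemann_sphere(2)]) (auto simp: riemann_sphere(1))
  then have "openin riemann_sphere (topspace riemann_sphere - (branch_set - {\<pi> p}))" by blast
  from openin_continuous_map_preimage[OF \<pi>_continuous this]
  have N2: "openin X (N1 \<inter> {x \<in> topspace X. \<pi> x \<in> topspace riemann_sphere - (branch_set - {\<pi> p})})" (is "openin X ?N")
    using N1(1) by blast
  have "p \<in> ?N" using N1(2) p by (auto simp: riemann_sphere(1))
  obtain r where r: "0 < r" "cball (snd c p) r \<subseteq> chart_img c" "chart_inv c ` cball (snd c p) r \<subseteq> ?N"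
    using chart_ball[OF c N2 \<open>p \<in> ?N\<close>] by blast
  let ?B = "ball (snd c p) r"
  have inN: "chart_inv c z \<in> ?N" if "z \<in> ?B" for z using r(3) that by (auto simp: image_subset_iff)
  have img: "z \<in> chart_img c" if "z \<in> ?B" for z using r(2) that by auto
  have cp: "chart_inv c (snd c p) = p" using chart_inv(1)[OF c] .
  have dom': "\<tau> (chart_inv c z) \<in> chart_dom c'" if "z \<in> ?B" for z using inN[OF that] N1(3) by auto
  have free: "\<tau> (chart_inv c z) \<noteq> chart_inv c z" if z: "z \<in> ?B" "z \<noteq> snd c p" for z
  proof
    let ?x = "chart_inv c z"
    assume fx: "\<tau> ?x = ?x"
    have xX: "?x \<in> topspace X" using inN[OF z(1)] by blast
    have "?x \<noteq> p" using chart_inv(3)[OF c(1) img[OF z(1)]] z(2) by auto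
    then have "\<pi> ?x \<noteq> \<pi> p" using \<tau>_fixed[OF p fixed xX] by blast
    then have "\<pi> ?x \<notin> branch_set" using inN[OF z(1)] by auto
    then obtain a b where "a \<in> topspace X" "b \<in> topspace X" "a \<noteq> b" "\<pi> a = \<pi> ?x" "\<pi> b = \<pi> ?x"
      by (rule unbranched_fibre)
    then have "a = ?x" "b = ?x" using \<tau>_fixed[OF xX fx] by simp_all
    then show False using \<open>a \<noteq> b\<close> by simp
  qed
  have eq: "\<tau> (chart_inv c z) = chart_inv c' (f z)" if "z \<in> ?B" for z
    using chart_inv(1)[OF c'(1) dom'[OF that]] by (simp add: f_def)
  have fp: "f (snd c p) = snd c' p" by (simp add: f_def cp fixed)
  have contp: "isCont f (snd c p)"
    unfolding continuous_at_eps_delta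
  proof (intro allI impI)
    fix e :: real assume e: "e > 0"
    have "openin X {x \<in> chart_dom c'. snd c' x \<in> ball (snd c' p) e}" by (rule openin_chart_vimage[OF c'(1) open_ball])
    moreover have "p \<in> {x \<in> chart_dom c'. snd c' x \<in> ball (snd c' p) e}" using c' e by simp
    ultimately obtain M where M: "openin X M" "p \<in> M" "\<tau> ` M \<subseteq> {x \<in> chart_dom c'. snd c' x \<in> ball (snd c' p) e}"
      using nbhd by blast
    obtain s where s: "0 < s" "cball (snd c p) s \<subseteq> chart_img c" "chart_inv c ` cball (snd c p) s \<subseteq> M"
      using chart_ball[OF c M(1,2)] by blast
    show "\<exists>d>0. \<forall>x'. dist x' (snd c p) < d \<longrightarrow> dist (f x') (f (snd c p)) < e"
    proof (intro exI[of _ s] conjI allI impI s(1))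
      fix z assume "dist z (snd c p) < s"
      then have "chart_inv c z \<in> M" using s(3) by (auto simp: dist_commute image_subset_iff)
      then have "snd c' (\<tau> (chart_inv c z)) \<in> ball (snd c' p) e" using M(3) by blast
      then show "dist (f z) (f (snd c p)) < e" unfolding fp by (simp add: f_def dist_commute)
    qed
  qed
  have local: "f field_differentiable at z" if z: "z \<in> ?B - {snd c p}" for z
  proof -
    let ?x = "chart_inv c z"
    have zB: "z \<in> ?B" "z \<noteq> snd c p" using z by auto
    have x: "?x \<in> topspace X" "?x \<in> chart_dom c" "snd c ?x = z"
      using inN[OF zB(1)] chart_inv(2,3)[OF c(1) img[OF zB(1)]] by auto
    from \<tau>_local_free[OF x(1) c(1) x(2) c'(1) dom'[OF zB(1)] free[OF zB], unfolded x(3)]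
    obtain s g where s: "s > 0" "ball z s \<subseteq> chart_img c" "g holomorphic_on ball z s" "g ` ball z s \<subseteq> chart_img c'"
      "\<forall>w\<in>ball z s. \<tau> (chart_inv c w) = chart_inv c' (g w)"
      by (elim exE conjE) (rule that)
    have "g w = f w" if w: "w \<in> ball z s" for w
    proof -
      have "g w \<in> chart_img c'" using s(4) w by blast
      then show ?thesis using chart_inv(3)[OF c'(1), of "g w"] bspec[OF s(5) w] by (simp add: f_def)
    qed
    then have "f holomorphic_on ball z s" using s(3) holomorphic_cong[of "ball z s" "ball z s" g f] by simp
    then show ?thesis using s(1) by (simp add: holomorphic_on_imp_differentiable_at)
  qed
  have "f holomorphic_on ?B"
  proof (rule no_isolated_singularity[of ?B f "{snd c p}"])
    show "f holomorphic_on ?B - {snd c p}"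
      using local by (auto simp: holomorphic_on_def intro: field_differentiable_at_within)
    have "isCont f z" if "z \<in> ?B" for z
      using that contp local[of z] by (cases "z = snd c p") (auto intro: field_differentiable_imp_continuous_at)
    then show "continuous_on ?B f" by (simp add: continuous_at_imp_continuous_on)
  qed auto
  moreover have "?B \<subseteq> chart_img c" using img by blast
  moreover have "f ` ?B \<subseteq> chart_img c'" using dom' by (auto simp: f_def)
  ultimately show ?thesis using r(1) eq free by (intro exI[of _ r] exI[of _ f] conjI ballI impI)
qed

lemma \<tau>_local:
  assumes p: "p \<in> topspace X" and c: "c \<in> \<A>" "p \<in> chart_dom c" and c': "c' \<in> \<A>" "\<tau> p \<in> chart_dom c'"
  shows "\<exists>r>0. \<exists>f. ball (snd c p) r \<subseteq> chart_img c \<and> f holomorphic_on ball (snd c p) r \<and> f ` ball (snd c p) r \<subseteq> chart_img c' \<and>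
    (\<forall>z\<in>ball (snd c p) r. \<tau> (chart_inv c z) = chart_inv c' (f z)) \<and> (\<forall>z\<in>ball (snd c p) r. deriv f z \<noteq> 0) \<and> inj_on f (ball (snd c p) r)"
proof -
  have "\<exists>r>0. \<exists>f. ball (snd c p) r \<subseteq> chart_img c \<and> f holomorphic_on ball (snd c p) r \<and> f ` ball (snd c p) r \<subseteq> chart_img c' \<and>
    (\<forall>z\<in>ball (snd c p) r. \<tau> (chart_inv c z) = chart_inv c' (f z))"
  proof (cases "\<tau> p = p")
    case True
    then have "p \<in> chart_dom c'" using c'(2) by simp
    from \<tau>_local_fixed[OF p c c'(1) this True] show ?thesis by (elim exE conjE) (intro exI conjI)
  next
    case False
    show ?thesis by (rule \<tau>_local_free[OF p c c' False])
  qed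
  then obtain r f where rf: "r > 0" "ball (snd c p) r \<subseteq> chart_img c" "f holomorphic_on ball (snd c p) r" "f ` ball (snd c p) r \<subseteq> chart_img c'"
    "\<forall>z\<in>ball (snd c p) r. \<tau> (chart_inv c z) = chart_inv c' (f z)"
    by (elim exE conjE) (rule that)
  have inj: "inj_on f (ball (snd c p) r)"
  proof (rule inj_onI)
    fix z w assume zw: "z \<in> ball (snd c p) r" "w \<in> ball (snd c p) r" "f z = f w"
    then have "chart_inv c z = chart_inv c w"
      using bspec[OF rf(5) zw(1)] bspec[OF rf(5) zw(2)] zw(3) chart_inv_topspace[OF c(1)] subsetD[OF rf(2)] zw(1,2)
      by - (rule \<tau>_inj, simp_all)
    then show "z = w" using chart_inv_inj[OF c(1)] rf(2) zw by blast
  qed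
  then have "deriv f z \<noteq> 0" if "z \<in> ball (snd c p) r" for z
    using holomorphic_injective_imp_regular[OF rf(3) open_ball inj that] by simp
  then show ?thesis using rf inj by (intro exI[of _ r] exI[of _ f] conjI ballI) auto
qed

text \<open>Since \<open>f\<close> is an involution, its derivative squares to 1. If it were 1, then
  \<open>h z = z + f z\<close> would be locally injective, while \<open>h (f z) = h z\<close>. This
  would make \<open>f\<close> the identity near the point, but the fixed point is isolated.\<close>

lemma \<tau>_derivative_fixed:
  assumes p: "p \<in> topspace X" and c: "c \<in> \<A>" "p \<in> chart_dom c" and fixed: "\<tau> p = p"
  shows "\<exists>r>0. \<exists>f. ball (snd c p) r \<subseteq> chart_img c \<and> f holomorphic_on ball (snd c p) r \<and> f ` ball (snd c p) r \<subseteq> chart_img c \<and>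
    (\<forall>z\<in>ball (snd c p) r. \<tau> (chart_inv c z) = chart_inv c (f z)) \<and> f (snd c p) = snd c p \<and> deriv f (snd c p) = -1"
proof -
  define z0 where "z0 = snd c p"
  obtain r f where rf: "r > 0" "ball z0 r \<subseteq> chart_img c" "f holomorphic_on ball z0 r" "f ` ball z0 r \<subseteq> chart_img c"
    and rf5: "\<forall>z\<in>ball z0 r. \<tau> (chart_inv c z) = chart_inv c (f z)"
    and rf6: "\<forall>z\<in>ball z0 r. z \<noteq> z0 \<longrightarrow> \<tau> (chart_inv c z) \<noteq> chart_inv c z"
    using \<tau>_local_fixed[OF p c c fixed, folded z0_def] by (elim exE conjE) (rule that)
  have z0: "z0 \<in> ball z0 r" "chart_inv c z0 = p" "z0 \<in> chart_img c" using rf(1) chart_inv(1)[OF c] c(2) by (auto simp: z0_def)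
  have fz0: "f z0 = z0"
  proof -
    have "f z0 \<in> chart_img c" using rf(4) z0(1) by blast
    moreover have "chart_inv c (f z0) = chart_inv c z0" using bspec[OF rf5 z0(1)] fixed z0(2) by simp
    ultimately show ?thesis using chart_inv_inj[OF c(1) _ z0(3)] by blast
  qed
  have fd: "f field_differentiable at z0" using rf(3) z0(1) by (simp add: holomorphic_on_imp_differentiable_at)
  then have fD: "(f has_field_derivative deriv f z0) (at z0)" by (simp add: field_differentiable_derivI)
  have ff: "f (f z) = z" if z: "z \<in> ball z0 r" "f z \<in> ball z0 r" for z
  proof -
    have zi: "z \<in> chart_img c" "f z \<in> chart_img c" "f (f z) \<in> chart_img c" using rf(2,4) z by auto
    have "chart_inv c (f (f z)) = \<tau> (\<tau> (chart_inv c z))" using bspec[OF rf5 z(1)] bspec[OF rf5 z(2)] by simp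
    also have "\<dots> = chart_inv c z" by (rule \<tau>(3)[OF chart_inv_topspace[OF c(1) zi(1)]])
    finally show ?thesis using chart_inv_inj[OF c(1) zi(3,1)] by blast
  qed
  have "open (ball z0 r \<inter> f -` ball z0 r)"
    by (rule continuous_open_preimage[OF holomorphic_on_imp_continuous_on[OF rf(3)] open_ball open_ball])
  moreover have "z0 \<in> ball z0 r \<inter> f -` ball z0 r" using z0(1) fz0 by simp
  ultimately obtain s where s: "s > 0" "ball z0 s \<subseteq> ball z0 r \<inter> f -` ball z0 r" by (rule openE)
  have "((f \<circ> f) has_field_derivative deriv f z0 * deriv f z0) (at z0)"
    by (rule DERIV_chain) (use fD fz0 in auto)
  moreover have "((f \<circ> f) has_field_derivative 1) (at z0)"
  proof (rule has_field_derivative_transform_within_open[OF DERIV_ident open_ball])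
    show "z0 \<in> ball z0 s" using s by simp
    fix z assume "z \<in> ball z0 s"
    then have "z \<in> ball z0 r" "f z \<in> ball z0 r" using s(2) by auto
    from ff[OF this] show "z = (f \<circ> f) z" by simp
  qed
  ultimately have "deriv f z0 * deriv f z0 = 1" using DERIV_unique by blast
  then have pm: "deriv f z0 = 1 \<or> deriv f z0 = -1" by (simp add: square_eq_1_iff)
  have "deriv f z0 \<noteq> 1"
  proof
    assume 1: "deriv f z0 = 1"
    define h where "h = (\<lambda>z. z + f z)"
    have hol: "h holomorphic_on ball z0 r" unfolding h_def by (intro holomorphic_intros rf(3))
    have "(h has_field_derivative 1 + 1) (at z0)" unfolding h_def using DERIV_add[OF DERIV_ident fD] 1 by simp
    then have "deriv h z0 \<noteq> 0" using DERIV_imp_deriv by fastforce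
    then obtain e where e: "e > 0" "inj_on h (ball z0 e)"
      using has_complex_derivative_locally_injective[OF hol z0(1) open_ball] by metis
    have "open (ball z0 s \<inter> f -` ball z0 e)"
      by (rule continuous_open_preimage[OF continuous_on_subset[OF holomorphic_on_imp_continuous_on[OF rf(3)]] open_ball open_ball])
        (use s in auto)
    moreover have "z0 \<in> ball z0 s \<inter> f -` ball z0 e" using s(1) e(1) fz0 by simp
    ultimately obtain e' where e': "e' > 0" "ball z0 e' \<subseteq> ball z0 s \<inter> f -` ball z0 e" by (rule openE)
    define z where "z = z0 + of_real (min e e' / 2)"
    have z: "z \<in> ball z0 e" "z \<in> ball z0 e'" "z \<noteq> z0" using e(1) e'(1) by (auto simp: z_def dist_norm)
    then have zs: "z \<in> ball z0 s" "f z \<in> ball z0 e" using e'(2) by auto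
    then have zr: "z \<in> ball z0 r" "f z \<in> ball z0 r" using s(2) by auto
    have "h (f z) = h z" using ff[OF zr] by (simp add: h_def)
    then have "f z = z" using inj_onD[OF e(2)] zs(2) z(1) by blast
    then show False using bspec[OF rf5 zr(1)] bspec[OF rf6 zr(1)] z(3) by simp
  qed
  then have "deriv f z0 = -1" using pm by blast
  then show ?thesis using rf rf5 fz0 unfolding z0_def by (intro exI[of _ r] exI[of _ f] conjI)
qed
end

section \<open>Invariance of the metric and of the Green function\<close>

lemma second_derivative_at_max:
  fixes g g1 g2 :: "complex \<Rightarrow> real"
  assumes \<Omega>: "open \<Omega>" "z \<in> \<Omega>" and e: "norm e = 1"
    and g: "\<And>z. z \<in> \<Omega> \<Longrightarrow> ((\<lambda>s. g (z + of_real s * e)) has_real_derivative g1 z) (at 0)"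
    and g1: "\<And>z. z \<in> \<Omega> \<Longrightarrow> ((\<lambda>s. g1 (z + of_real s * e)) has_real_derivative g2 z) (at 0)"
    and c: "continuous_on \<Omega> g2" and max: "\<And>w. w \<in> \<Omega> \<Longrightarrow> g w \<le> g z"
  shows "g2 z \<le> 0"
proof (rule ccontr)
  assume "\<not> g2 z \<le> 0"
  then have pos: "g2 z > 0" by simp
  have "isCont g2 z" using c \<Omega> by (simp add: continuous_on_eq_continuous_at)
  then obtain d1 where d1: "d1 > 0" "\<And>w. dist w z < d1 \<Longrightarrow> \<bar>g2 w - g2 z\<bar> < g2 z"
    using pos unfolding continuous_at_eps_delta by (metis dist_real_def)
  obtain d2 where d2: "d2 > 0" "ball z d2 \<subseteq> \<Omega>" using \<Omega> open_contains_ball by blast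
  define t where "t = min d1 d2 / 2"
  have t: "t > 0" "t < d1" "t < d2" using d1 d2 by (auto simp: t_def)
  have di: "dist (z + of_real s * e) z = \<bar>s\<bar>" for s :: real using e by (simp add: dist_norm norm_mult)
  have in\<Omega>: "z + of_real s * e \<in> \<Omega>" if "\<bar>s\<bar> \<le> t" for s
  proof -
    have "z + of_real s * e \<in> ball z d2" using di[of s] that t by (simp add: dist_commute)
    then show ?thesis using d2 by blast
  qed
  have p: "g2 (z + of_real s * e) > 0" if "\<bar>s\<bar> \<le> t" for s
    using d1(2)[of "z + of_real s * e"] di[of s] that t by auto
  obtain \<alpha> \<beta> where ab: "\<bar>\<alpha>\<bar> \<le> t" "\<bar>\<beta>\<bar> \<le> t"
    "g (z + of_real t * e) + g (z - of_real t * e) - 2 * g z = t\<^sup>2 * (g2 (z + of_real \<alpha> * e) + g2 (z + of_real \<beta> * e)) / 2"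
    by (rule second_difference[of t z e \<Omega> g g1 g2, OF t(1) in\<Omega> g g1])
  have "g (z + of_real t * e) \<le> g z" "g (z - of_real t * e) \<le> g z"
    using max[OF in\<Omega>[of t]] max[OF in\<Omega>[of "- t"]] t(1) by auto
  moreover have "t\<^sup>2 * (g2 (z + of_real \<alpha> * e) + g2 (z + of_real \<beta> * e)) > 0"
    using p[OF ab(1)] p[OF ab(2)] t(1) by (intro mult_pos_pos) auto
  ultimately show False using ab(3) by linarith
qed

lemma flat_laplacian_at_max:
  assumes u: "C_k_on 2 u S" "open S" "z \<in> S" and max: "\<And>w. w \<in> S \<Longrightarrow> u w \<le> u z"
  shows "flat_laplacian u z \<le> 0"
proof -
  have "partial_x (partial_x u) z \<le> 0"
    by (rule second_derivative_at_max[OF u(2,3) _ C2_partials(1,3)[OF u(1,2)] C2_continuous(2)[OF u(1)] max]) auto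
  moreover have "partial_y (partial_y u) z \<le> 0"
    by (rule second_derivative_at_max[OF u(2,3) _ C2_partials(2,4)[OF u(1,2)] C2_continuous(3)[OF u(1)] max]) auto
  ultimately show ?thesis by (simp add: flat_laplacian_def)
qed

text \<open>Among the maximum points one farthest from \<open>a\<close> is chosen. If it were
  interior, \<open>v\<close> would be constant near it, and a small move radially outwards would
  reach a farther maximum point.\<close>

lemma area_harmonic_annulus_max:
  assumes r: "0 < \<delta>" "\<delta> < R" and c: "continuous_on (cball a R - ball a \<delta>) v" and h: "area_harmonic_on v (ball a R - cball a \<delta>)"
    and b: "\<And>z. dist a z = R \<or> dist a z = \<delta> \<Longrightarrow> v z \<le> m" and z: "z \<in> cball a R - ball a \<delta>"
  shows "v z \<le> m"
proof (rule ccontr)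
  let ?A = "cball a R - ball a \<delta>" and ?I = "ball a R - cball a \<delta>"
  assume "\<not> v z \<le> m"
  have cA: "compact ?A" by (intro compact_diff compact_cball open_ball)
  have ne: "?A \<noteq> {}" using z by (metis empty_iff)
  obtain xm where xm: "xm \<in> ?A" "\<forall>y\<in>?A. v y \<le> v xm"
    using continuous_attains_sup[OF cA ne c] by (elim bexE) (rule that)
  note xm = xm(1) bspec[OF xm(2)]
  have M: "m < v xm" using xm(2)[OF z] \<open>\<not> v z \<le> m\<close> by linarith
  define S where "S = {y \<in> ?A. v y = v xm}"
  have "closed S" unfolding S_def by (rule continuous_closed_preimage_constant[OF c compact_imp_closed[OF cA]])
  moreover have "bounded S" by (rule bounded_subset[OF compact_imp_bounded[OF cA]]) (auto simp: S_def)
  ultimately have "compact S" by (simp add: compact_eq_bounded_closed)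
  moreover have "S \<noteq> {}" using xm by (auto simp: S_def)
  moreover have "continuous_on S (dist a)" by (intro continuous_intros)
  ultimately have "\<exists>x\<in>S. \<forall>y\<in>S. dist a y \<le> dist a x" by (rule continuous_attains_sup)
  then obtain x where x: "x \<in> S" "\<forall>y\<in>S. dist a y \<le> dist a x" by (elim bexE) (rule that)
  note x = x(1) bspec[OF x(2)]
  have xA: "x \<in> ?A" "v x = v xm" using x by (auto simp: S_def)
  have "x \<in> ?I"
  proof -
    have "dist a x \<noteq> R" "dist a x \<noteq> \<delta>" using b[of x] M xA(2) by auto
    then show ?thesis using xA(1) by auto
  qed
  then obtain e where e: "e > 0" "ball x e \<subseteq> ?I"
    by (meson openE open_Diff open_ball closed_cball)
  define s where "s = e / 8"
  have s: "s > 0" using e by (simp add: s_def)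
  have sub: "cball x (4 * s) \<subseteq> ball x e" using e by (auto simp: s_def)
  define n where "n = dist a x"
  have n: "n > 0" using \<open>x \<in> ?I\<close> r by (auto simp: n_def)
  define y where "y = x + of_real (s / 2 / n) * (x - a)"
  have dy: "dist x y = s / 2" using n s by (simp add: y_def dist_norm norm_mult norm_divide n_def norm_minus_commute)
  have "y - a = of_real (1 + s / 2 / n) * (x - a)" by (simp add: y_def algebra_simps)
  then have "norm (y - a) = (1 + s / 2 / n) * n"
    using n s by (simp add: norm_mult n_def dist_norm norm_minus_commute del: of_real_add)
  then have day: "dist a y = n + s / 2" using n by (simp add: dist_norm norm_minus_commute distrib_right)
  have "v y = v x"
  proof (rule area_harmonic_max[OF h s])
    show "cball x (4 * s) \<subseteq> ?I" using sub e by blast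
    show "v y \<le> v x" if "y \<in> cball x (4 * s)" for y
    proof -
      have "y \<in> ?I" using that sub e by blast
      then have "y \<in> ?A" by auto
      then show ?thesis using xm(2) xA(2) by simp
    qed
    show "dist x y < s" using dy s by simp
  qed
  moreover have "y \<in> ?A"
  proof -
    have "y \<in> ball x e" using dy s e by (simp add: s_def)
    then have "y \<in> ?I" using e by blast
    then show ?thesis by auto
  qed
  ultimately have "y \<in> S" using xA(2) by (simp add: S_def)
  then show False using x(2)[of y] day s by (simp add: n_def)
qed

lemma area_harmonic_ln_norm: "area_harmonic_on (\<lambda>z. ln (norm (z - a))) (- {a})"
proof (rule area_harmonic_of_laplacian)
  have hol: "(\<lambda>z. z - a) holomorphic_on - {a}" by (intro holomorphic_intros)
  have o: "open (- {a})" "open (- {0::complex})" by auto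
  have im: "(\<lambda>z. z - a) ` (- {a}) \<subseteq> - {0}" by auto
  show "C_k_on 2 (\<lambda>z. ln (norm (z - a))) (- {a})"
    using C_k_on_compose_holomorphic[OF hol o im ln_norm_C_k] by (simp add: o_def)
  show "flat_laplacian (\<lambda>z. ln (norm (z - a))) w = 0" if "w \<in> - {a}" for w
    using flat_laplacian_compose_holomorphic[OF hol o(1) that o(2) im ln_norm_C_k] flat_laplacian_ln_norm[of "w - a"] that
    by (simp add: o_def)
qed auto

text \<open>
  A bounded harmonic function does not see a puncture: compare with multiples of
  \<open>ln |z - a|\<close>, which tends to \<open>-\<infinity>\<close> there.
\<close>

lemma area_harmonic_punctured_max:
  assumes R: "0 < R" and c: "continuous_on (cball a R - {a}) h" and h: "area_harmonic_on h (ball a R - {a})"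
    and b: "\<And>z. dist a z = R \<Longrightarrow> h z \<le> m" and B: "\<And>z. z \<in> cball a R - {a} \<Longrightarrow> h z \<le> B" and z: "z \<in> cball a R - {a}"
  shows "h z \<le> m"
proof (rule field_le_epsilon)
  fix e :: real assume e: "e > 0"
  define L where "L = ln R - ln (norm (z - a))"
  have nz: "0 < norm (z - a)" "norm (z - a) \<le> R" using z by (auto simp: dist_norm norm_minus_commute)
  then have L: "0 \<le> L" using ln_mono[of "norm (z - a)" R] by (simp add: L_def)
  \<comment> \<open>Chosen for the given point \<open>z\<close>: the comparison term costs at most
    \<open>e\<close> there.\<close>
  define \<epsilon> where "\<epsilon> = e / (L + 1)"
  have \<epsilon>: "\<epsilon> > 0" "\<epsilon> * L \<le> e" using e L by (auto simp: \<epsilon>_def divide_le_eq algebra_simps)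
  define v where "v = (\<lambda>z. h z + \<epsilon> * (ln (norm (z - a)) - ln R))"
  \<comment> \<open>On the inner circle the logarithmic term has to lower the bound \<open>B\<close>
    to \<open>m\<close>, which dictates the exponential factor. The other entry of the minimum
    places \<open>z\<close> in the annulus.\<close>
  define \<delta> where "\<delta> = min (norm (z - a) / 2) (R * exp ((m - B) / \<epsilon>))"
  have \<delta>: "0 < \<delta>" "\<delta> < norm (z - a)" "\<delta> < R"
  proof -
    have "\<delta> \<le> norm (z - a) / 2" unfolding \<delta>_def by (rule min.cobounded1)
    then show "\<delta> < norm (z - a)" "\<delta> < R" using nz by linarith+
    show "0 < \<delta>" using nz R by (simp add: \<delta>_def)
  qed
  have sub: "cball a R - ball a \<delta> \<subseteq> cball a R - {a}" "ball a R - cball a \<delta> \<subseteq> ball a R - {a}" using \<delta> by auto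
  have ln\<delta>: "B + \<epsilon> * (ln \<delta> - ln R) \<le> m"
  proof -
    have "ln \<delta> \<le> ln (R * exp ((m - B) / \<epsilon>))" by (rule ln_mono) (use \<delta>(1) in \<open>auto simp: \<delta>_def\<close>)
    also have "\<dots> = ln R + (m - B) / \<epsilon>" using R by (simp add: ln_mult)
    finally have "\<epsilon> * (ln \<delta> - ln R) \<le> \<epsilon> * ((m - B) / \<epsilon>)" using \<epsilon> by (intro mult_left_mono) auto
    then show ?thesis using \<epsilon> by simp
  qed
  have "v z \<le> m"
  proof (rule area_harmonic_annulus_max[OF \<delta>(1,3)])
    show "continuous_on (cball a R - ball a \<delta>) v"
    proof -
      have "continuous_on (cball a R - ball a \<delta>) h" by (rule continuous_on_subset[OF c sub(1)])
      moreover have "continuous_on (cball a R - ball a \<delta>) (\<lambda>z. ln (norm (z - a)))"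
        using sub(1) by (intro continuous_intros) auto
      ultimately show ?thesis unfolding v_def by (intro continuous_on_add continuous_on_mult continuous_on_diff continuous_on_const)
    qed
    have "area_harmonic_on (\<lambda>z. 1 * h z + \<epsilon> * ln (norm (z - a)) + - \<epsilon> * ln R) (ball a R - cball a \<delta>)"
    proof (rule area_harmonic_lincomb)
      show "area_harmonic_on h (ball a R - cball a \<delta>)" by (rule area_harmonic_subset[OF h sub(2)])
      show "area_harmonic_on (\<lambda>z. ln (norm (z - a))) (ball a R - cball a \<delta>)"
        by (rule area_harmonic_subset[OF area_harmonic_ln_norm]) (use \<delta> in auto)
    qed
    then show "area_harmonic_on v (ball a R - cball a \<delta>)"
      by (simp add: v_def algebra_simps)
    show "v w \<le> m" if "dist a w = R \<or> dist a w = \<delta>" for w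
      using that
    proof
      assume "dist a w = R"
      then show ?thesis using b[of w] by (simp add: v_def dist_norm norm_minus_commute)
    next
      assume w: "dist a w = \<delta>"
      then have "h w \<le> B" using \<delta> by (intro B) auto
      then show ?thesis using ln\<delta> w by (simp add: v_def dist_norm norm_minus_commute)
    qed
    show "z \<in> cball a R - ball a \<delta>" using z \<delta> by (auto simp: dist_norm norm_minus_commute)
  qed
  then show "h z \<le> m + e" using \<epsilon>(2) by (simp add: v_def L_def algebra_simps)
qed

lemma (in charted_surface) continuous_map_of_charts:
  fixes f :: "'a \<Rightarrow> real"
  assumes "\<And>p. p \<in> topspace X \<Longrightarrow> \<exists>c\<in>\<A>. p \<in> chart_dom c \<and> isCont (\<lambda>z. f (chart_inv c z)) (snd c p)"
  shows "continuous_map X euclidean f"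
  unfolding continuous_map_def
proof (intro conjI allI impI)
  fix U :: "real set" assume "openin euclidean U"
  then have U: "open U" by simp
  show "openin X {x \<in> topspace X. f x \<in> U}"
  proof (subst openin_subopen, intro ballI)
    fix p assume "p \<in> {x \<in> topspace X. f x \<in> U}"
    then have p: "p \<in> topspace X" "f p \<in> U" by auto
    obtain c where c: "c \<in> \<A>" "p \<in> chart_dom c" "isCont (\<lambda>z. f (chart_inv c z)) (snd c p)" using assms[OF p(1)] by blast
    have fp: "f (chart_inv c (snd c p)) \<in> U" using chart_inv(1)[OF c(1,2)] p(2) by simp
    obtain d where d: "d > 0" "\<And>z. dist z (snd c p) < d \<Longrightarrow> f (chart_inv c z) \<in> U"
    proof -
      obtain e where e: "e > 0" "ball (f (chart_inv c (snd c p))) e \<subseteq> U" using U fp open_contains_ball by blast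
      obtain d where "d > 0" "\<And>z. dist z (snd c p) < d \<Longrightarrow> dist (f (chart_inv c z)) (f (chart_inv c (snd c p))) < e"
        using c(3) e(1) unfolding continuous_at_eps_delta by blast
      then show ?thesis using e(2) by (intro that[of d]) (auto simp: dist_commute subset_iff)
    qed
    have N: "openin X {x \<in> chart_dom c. snd c x \<in> ball (snd c p) d}" by (rule openin_chart_vimage[OF c(1) open_ball])
    show "\<exists>T. openin X T \<and> p \<in> T \<and> T \<subseteq> {x \<in> topspace X. f x \<in> U}"
    proof (intro exI[of _ "{x \<in> chart_dom c. snd c x \<in> ball (snd c p) d}"] conjI N)
      show "p \<in> {x \<in> chart_dom c. snd c x \<in> ball (snd c p) d}" using c(2) d(1) by simp
      show "{x \<in> chart_dom c. snd c x \<in> ball (snd c p) d} \<subseteq> {x \<in> topspace X. f x \<in> U}"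
      proof
        fix x assume x: "x \<in> {x \<in> chart_dom c. snd c x \<in> ball (snd c p) d}"
        then have "f (chart_inv c (snd c x)) \<in> U" by (intro d(2)) (simp add: dist_commute)
        then show "x \<in> {x \<in> topspace X. f x \<in> U}" using x chart_inv(1)[OF c(1)] chart(4)[OF c(1)] by auto
      qed
    qed
  qed
qed auto

lemma (in charted_surface) chart_transition_point:
  assumes "c \<in> \<A>" "d \<in> \<A>" "x \<in> chart_dom c" "x \<in> chart_dom d"
  shows "(transition c d has_field_derivative deriv (transition c d) (snd c x)) (at (snd c x))"
    "\<exists>e>0. \<forall>z\<in>ball (snd c x) e. z \<in> chart_img c \<and> chart_inv c z \<in> chart_dom d \<and> transition c d z = snd d (chart_inv c z)"
proof -
  let ?S = "snd c ` (chart_dom c \<inter> chart_dom d)"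
  have x: "snd c x \<in> ?S" using assms by blast
  note t = transition[OF assms(1,2)]
  show "(transition c d has_field_derivative deriv (transition c d) (snd c x)) (at (snd c x))"
    by (rule holomorphic_derivI[OF t(2,1) x])
  obtain e where e: "e > 0" "ball (snd c x) e \<subseteq> ?S" using t(1) x openE by blast
  have "z \<in> chart_img c \<and> chart_inv c z \<in> chart_dom d \<and> transition c d z = snd d (chart_inv c z)" if zB: "z \<in> ball (snd c x) e" for z
  proof -
    have "z \<in> ?S" using zB e(2) by (rule subsetD[rotated])
    then obtain y where y: "y \<in> chart_dom c" "y \<in> chart_dom d" "z = snd c y" by (elim imageE IntE) (rule that)
    then show ?thesis using chart_inv(1)[OF assms(1) y(1)] by (simp add: transition_def)
  qed
  then show "\<exists>e>0. \<forall>z\<in>ball (snd c x) e. z \<in> chart_img c \<and> chart_inv c z \<in> chart_dom d \<and> transition c d z = snd d (chart_inv c z)"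
    using e(1) by blast
qed

section \<open>The involution is an isometry\<close>

locale hyperelliptic_green = green_surface X \<A> \<rho> \<mu> G + hyperelliptic X \<A> \<pi>
  for X :: "'a topology" and \<A> \<rho> \<mu> G \<pi>
begin

definition \<tau>_chart :: "'a chart \<Rightarrow> 'a chart \<Rightarrow> complex \<Rightarrow> complex" where
  "\<tau>_chart c c' z = snd c' (\<tau> (chart_inv c z))"

lemma \<tau>_chart:
  assumes p: "p \<in> topspace X" and c: "c \<in> \<A>" "p \<in> chart_dom c" and c': "c' \<in> \<A>" "\<tau> p \<in> chart_dom c'"
  obtains r where "r > 0" "ball (snd c p) r \<subseteq> chart_img c" "\<tau>_chart c c' holomorphic_on ball (snd c p) r"
    "\<And>z. z \<in> ball (snd c p) r \<Longrightarrow> \<tau> (chart_inv c z) \<in> chart_dom c'"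
    "\<And>z. z \<in> ball (snd c p) r \<Longrightarrow> deriv (\<tau>_chart c c') z \<noteq> 0"
    "inj_on (\<tau>_chart c c') (ball (snd c p) r)" "\<tau>_chart c c' (snd c p) = snd c' (\<tau> p)"
proof -
  let ?B = "\<lambda>r. ball (snd c p) r"
  from \<tau>_local[OF assms] obtain r f where rf: "r > 0" "?B r \<subseteq> chart_img c" "f holomorphic_on ?B r" "f ` ?B r \<subseteq> chart_img c'"
    "\<forall>z\<in>?B r. \<tau> (chart_inv c z) = chart_inv c' (f z)" "\<forall>z\<in>?B r. deriv f z \<noteq> 0" "inj_on f (?B r)"
    by (elim exE conjE) (rule that)
  have eq: "\<tau>_chart c c' z = f z" "\<tau> (chart_inv c z) \<in> chart_dom c'" if z: "z \<in> ?B r" for z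
  proof -
    have "f z \<in> chart_img c'" using rf(4) z by blast
    then show "\<tau>_chart c c' z = f z" "\<tau> (chart_inv c z) \<in> chart_dom c'"
      using bspec[OF rf(5) z] chart_inv(2,3)[OF c'(1), of "f z"] by (simp_all add: \<tau>_chart_def)
  qed
  show ?thesis
  proof (rule that[of r])
    show "\<tau>_chart c c' holomorphic_on ?B r" using rf(3) holomorphic_cong[OF refl eq(1), of "?B r"] by simp
    show "inj_on (\<tau>_chart c c') (?B r)" using rf(7) inj_on_cong[of "?B r" "\<tau>_chart c c'" f] eq(1) by simp
    show "deriv (\<tau>_chart c c') z \<noteq> 0" if z: "z \<in> ?B r" for z
    proof -
      have "\<forall>\<^sub>F w in nhds z. w \<in> ?B r" using z by (intro eventually_nhds_in_open) auto
      then have "\<forall>\<^sub>F w in nhds z. \<tau>_chart c c' w = f w" by eventually_elim (rule eq(1))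
      then have "deriv (\<tau>_chart c c') z = deriv f z" by (rule deriv_cong_ev) simp
      then show ?thesis using bspec[OF rf(6) z] by simp
    qed
    show "\<tau>_chart c c' (snd c p) = snd c' (\<tau> p)" using chart_inv(1)[OF c] by (simp add: \<tau>_chart_def)
  qed (use rf(1,2) eq(2) in auto)
qed

lemma \<tau>_chart_derivative:
  assumes p: "p \<in> topspace X" and c: "c \<in> \<A>" "p \<in> chart_dom c" and c': "c' \<in> \<A>" "\<tau> p \<in> chart_dom c'"
  shows "(\<tau>_chart c c' has_field_derivative deriv (\<tau>_chart c c') (snd c p)) (at (snd c p))"
  using holomorphic_derivI[of "\<tau>_chart c c'"] by (rule \<tau>_chart[OF assms]) (auto intro: holomorphic_derivI)

text \<open>The norm of the differential of \<open>\<tau>\<close> at \<open>p\<close> with respect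
  to the metric, read in a chart \<open>c\<close> at \<open>p\<close> and a chart \<open>c'\<close>
  at \<open>\<tau> p\<close>.\<close>

definition dilatation :: "'a chart \<Rightarrow> 'a chart \<Rightarrow> 'a \<Rightarrow> real" where
  "dilatation c c' p = \<rho> c' (snd c' (\<tau> p)) * norm (deriv (\<tau>_chart c c') (snd c p)) / \<rho> c (snd c p)"

text \<open>A change of charts multiplies derivative and densities by derivatives of transition
  maps, and these cancel. The dilatation is thus a function on the compact surface, where it attains
  a maximum.\<close>

lemma dilatation_chart_indep:
  assumes p: "p \<in> topspace X" and c: "c \<in> \<A>" "p \<in> chart_dom c" and c': "c' \<in> \<A>" "\<tau> p \<in> chart_dom c'"
    and d: "d \<in> \<A>" "p \<in> chart_dom d" and d': "d' \<in> \<A>" "\<tau> p \<in> chart_dom d'"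
  shows "dilatation d d' p = dilatation c c' p"
proof -
  note T = \<tau>_chart_derivative[OF p c c'] and T' = \<tau>_chart_derivative[OF p d d']
  note t1 = chart_transition_point[OF d(1) c(1) d(2) c(2)] and t2 = chart_transition_point[OF c'(1) d'(1) c'(2) d'(2)]
  have pts: "transition d c (snd d p) = snd c p" "\<tau>_chart c c' (snd c p) = snd c' (\<tau> p)"
    using transition(3)[OF d(1) c(1) d(2)] chart_inv(1)[OF c] by (simp_all add: \<tau>_chart_def)
  have "((transition c' d' \<circ> (\<tau>_chart c c' \<circ> transition d c)) has_field_derivative
      deriv (transition c' d') (snd c' (\<tau> p)) * (deriv (\<tau>_chart c c') (snd c p) * deriv (transition d c) (snd d p))) (at (snd d p))"
    by (intro DERIV_chain) (use T t1(1) t2(1) pts in simp_all)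
  moreover have "\<forall>\<^sub>F z in nhds (snd d p). (transition c' d' \<circ> (\<tau>_chart c c' \<circ> transition d c)) z = \<tau>_chart d d' z"
  proof -
    obtain e where e: "e > 0" "\<forall>z\<in>ball (snd d p) e. z \<in> chart_img d \<and> chart_inv d z \<in> chart_dom c \<and> transition d c z = snd c (chart_inv d z)"
      using t1(2) by blast
    obtain r where r: "r > 0" "\<And>z. z \<in> ball (snd c p) r \<Longrightarrow> \<tau> (chart_inv c z) \<in> chart_dom c'" by (rule \<tau>_chart[OF p c c']) blast
    have "isCont (transition d c) (snd d p)" using t1(1) by (rule DERIV_isCont)
    then have "(transition d c \<longlongrightarrow> snd c p) (nhds (snd d p))"
      using pts(1) by (simp add: isCont_def tendsto_nhds_iff)
    then have "\<forall>\<^sub>F z in nhds (snd d p). transition d c z \<in> ball (snd c p) r"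
      using r(1) by (intro topological_tendstoD) auto
    moreover have "\<forall>\<^sub>F z in nhds (snd d p). z \<in> ball (snd d p) e" using e(1) by (intro eventually_nhds_in_open) auto
    ultimately show ?thesis
    proof eventually_elim
      case (elim z)
      have z: "chart_inv d z \<in> chart_dom c" "transition d c z = snd c (chart_inv d z)" using bspec[OF e(2) elim(2)] by auto
      have ci: "chart_inv c (transition d c z) = chart_inv d z" using chart_inv(1)[OF c(1) z(1)] z(2) by simp
      have "\<tau> (chart_inv d z) \<in> chart_dom c'" using r(2)[OF elim(1)] unfolding ci .
      then have "chart_inv c' (snd c' (\<tau> (chart_inv d z))) = \<tau> (chart_inv d z)" by (rule chart_inv(1)[OF c'(1)])
      moreover have "\<tau>_chart c c' (transition d c z) = snd c' (\<tau> (chart_inv d z))" unfolding \<tau>_chart_def ci ..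
      ultimately show ?case by (simp add: \<tau>_chart_def[of d d'] transition_def[of c' d'])
    qed
  qed
  ultimately have "(\<tau>_chart d d' has_field_derivative
      deriv (transition c' d') (snd c' (\<tau> p)) * (deriv (\<tau>_chart c c') (snd c p) * deriv (transition d c) (snd d p))) (at (snd d p))"
    using DERIV_cong_ev[OF refl _ refl] by blast
  then have D: "deriv (\<tau>_chart d d') (snd d p) =
      deriv (transition c' d') (snd c' (\<tau> p)) * (deriv (\<tau>_chart c c') (snd c p) * deriv (transition d c) (snd d p))"
    by (rule DERIV_imp_deriv)
  have r1: "\<rho> d (snd d p) = \<rho> c (snd c p) * norm (deriv (transition d c) (snd d p))"
    by (rule density_transition[OF d(1) c(1) d(2) c(2)])
  have r2: "\<rho> c' (snd c' (\<tau> p)) = \<rho> d' (snd d' (\<tau> p)) * norm (deriv (transition c' d') (snd c' (\<tau> p)))"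
    by (rule density_transition[OF c'(1) d'(1) c'(2) d'(2)])
  have "\<rho> d (snd d p) \<noteq> 0" using density_pos[OF d(1), of "snd d p"] d(2) by auto
  then have "norm (deriv (transition d c) (snd d p)) \<noteq> 0" unfolding r1 by auto
  then show ?thesis unfolding dilatation_def D r1 r2 by (simp add: norm_mult)
qed

lemma dilatation_inverse:
  assumes p: "p \<in> topspace X" and c: "c \<in> \<A>" "p \<in> chart_dom c" and c': "c' \<in> \<A>" "\<tau> p \<in> chart_dom c'"
  shows "dilatation c' c (\<tau> p) * dilatation c c' p = 1"
proof -
  have q: "\<tau> p \<in> topspace X" "\<tau> (\<tau> p) = p" using \<tau>[OF p] by auto
  have cq: "\<tau> (\<tau> p) \<in> chart_dom c" using q(2) c(2) by simp
  note T = \<tau>_chart_derivative[OF p c c'] and T' = \<tau>_chart_derivative[OF q(1) c' c(1) cq]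
  have pt: "\<tau>_chart c c' (snd c p) = snd c' (\<tau> p)" using chart_inv(1)[OF c] by (simp add: \<tau>_chart_def)
  have "((\<tau>_chart c' c \<circ> \<tau>_chart c c') has_field_derivative deriv (\<tau>_chart c' c) (snd c' (\<tau> p)) * deriv (\<tau>_chart c c') (snd c p)) (at (snd c p))"
    by (rule DERIV_chain) (use T T' pt in simp_all)
  moreover have "\<forall>\<^sub>F z in nhds (snd c p). (\<tau>_chart c' c \<circ> \<tau>_chart c c') z = z"
  proof -
    obtain r where r: "r > 0" "ball (snd c p) r \<subseteq> chart_img c" "\<And>z. z \<in> ball (snd c p) r \<Longrightarrow> \<tau> (chart_inv c z) \<in> chart_dom c'"
      by (rule \<tau>_chart[OF p c c']) blast
    have "\<forall>\<^sub>F z in nhds (snd c p). z \<in> ball (snd c p) r" using r(1) by (intro eventually_nhds_in_open) auto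
    then show ?thesis
    proof eventually_elim
      case (elim z)
      then have z: "z \<in> chart_img c" "\<tau> (chart_inv c z) \<in> chart_dom c'" using r by auto
      have "chart_inv c' (\<tau>_chart c c' z) = \<tau> (chart_inv c z)" using chart_inv(1)[OF c'(1) z(2)] by (simp add: \<tau>_chart_def)
      then have "\<tau>_chart c' c (\<tau>_chart c c' z) = snd c (\<tau> (\<tau> (chart_inv c z)))" by (simp add: \<tau>_chart_def[of c' c])
      also have "\<dots> = z" using \<tau>(3)[OF chart_inv_topspace[OF c(1) z(1)]] chart_inv(3)[OF c(1) z(1)] by simp
      finally show ?case by simp
    qed
  qed
  ultimately have "((\<lambda>z. z) has_field_derivative deriv (\<tau>_chart c' c) (snd c' (\<tau> p)) * deriv (\<tau>_chart c c') (snd c p)) (at (snd c p))"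
    using DERIV_cong_ev[OF refl _ refl, of "\<tau>_chart c' c \<circ> \<tau>_chart c c'" "\<lambda>z. z"] by blast
  then have "deriv (\<tau>_chart c' c) (snd c' (\<tau> p)) * deriv (\<tau>_chart c c') (snd c p) = 1"
    using DERIV_unique DERIV_ident by blast
  then have n: "norm (deriv (\<tau>_chart c' c) (snd c' (\<tau> p))) * norm (deriv (\<tau>_chart c c') (snd c p)) = 1"
    by (metis norm_mult norm_one)
  have "\<rho> c (snd c p) > 0" "\<rho> c' (snd c' (\<tau> p)) > 0" using density_pos c c' by auto
  then have "dilatation c' c (\<tau> p) * dilatation c c' p = norm (deriv (\<tau>_chart c' c) (snd c' (\<tau> p))) * norm (deriv (\<tau>_chart c c') (snd c p))"
    by (simp add: dilatation_def q(2))
  then show ?thesis using n by simp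
qed

text \<open>The Ahlfors--Schwarz argument: at a maximum of \<open>ln |d\<tau>|\<close> its Laplacian \<open>\<rho>\<^sup>2 (|d\<tau>|\<^sup>2 - 1)\<close> is nonpositive.\<close>

lemma dilatation_eq_1:
  assumes p: "p \<in> topspace X" and c: "c \<in> \<A>" "p \<in> chart_dom c" and c': "c' \<in> \<A>" "\<tau> p \<in> chart_dom c'"
  shows "dilatation c c' p = 1"
proof -
  define W where "W = (\<lambda>p. dilatation (chart_at \<A> p) (chart_at \<A> (\<tau> p)) p)"
  have W: "W p = dilatation c c' p"
    if "p \<in> topspace X" "c \<in> \<A>" "p \<in> chart_dom c" "c' \<in> \<A>" "\<tau> p \<in> chart_dom c'" for p c c'
    unfolding W_def by (rule dilatation_chart_indep[OF that]) (use chart_at[OF that(1)] chart_at[OF \<tau>(1)[OF that(1)]] in auto)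
  have local: "\<exists>r>0. ball (snd c p) r \<subseteq> chart_img c \<and> C_k_on 2 (\<lambda>z. ln (W (chart_inv c z))) (ball (snd c p) r) \<and>
      (\<forall>z\<in>ball (snd c p) r. 0 < W (chart_inv c z)) \<and>
      flat_laplacian (\<lambda>z. ln (W (chart_inv c z))) (snd c p) = (\<rho> c (snd c p))\<^sup>2 * ((W p)\<^sup>2 - 1)"
    if p: "p \<in> topspace X" and c: "c \<in> \<A>" "p \<in> chart_dom c" for p c
  proof -
    obtain c' where c': "c' \<in> \<A>" "\<tau> p \<in> chart_dom c'" using ex_chart[OF \<tau>(1)[OF p]] by blast
    obtain r where r: "r > 0" "ball (snd c p) r \<subseteq> chart_img c" "\<tau>_chart c c' holomorphic_on ball (snd c p) r"
      "\<And>z. z \<in> ball (snd c p) r \<Longrightarrow> \<tau> (chart_inv c z) \<in> chart_dom c'"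
      "\<And>z. z \<in> ball (snd c p) r \<Longrightarrow> deriv (\<tau>_chart c c') z \<noteq> 0" by (rule \<tau>_chart[OF p c c']) blast
    let ?B = "ball (snd c p) r" and ?T = "\<tau>_chart c c'"
    have T: "?T ` ?B \<subseteq> chart_img c'" using r(4) by (auto simp: \<tau>_chart_def)
    have dh: "deriv ?T holomorphic_on ?B" using r(3) by (intro holomorphic_deriv) auto
    have dn: "deriv ?T ` ?B \<subseteq> - {0}" using r(5) by auto
    have o0: "open (- {0::complex})" by auto
    have Wz: "W (chart_inv c z) = \<rho> c' (?T z) * norm (deriv ?T z) / \<rho> c z" if "z \<in> ?B" for z
    proof -
      have z: "z \<in> chart_img c" using r(2) that by blast
      have "W (chart_inv c z) = dilatation c c' (chart_inv c z)"
        by (rule W[OF chart_inv_topspace[OF c(1) z] c(1) chart_inv(2)[OF c(1) z] c'(1) r(4)[OF that]])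
      then show ?thesis using chart_inv(3)[OF c(1) z] by (simp add: dilatation_def \<tau>_chart_def)
    qed
    have pos: "0 < \<rho> c' (?T z)" "0 < \<rho> c z" "0 < norm (deriv ?T z)" if "z \<in> ?B" for z
    proof -
      have "?T z \<in> chart_img c'" "z \<in> chart_img c" using T r(2) that by blast+
      then show "0 < \<rho> c' (?T z)" "0 < \<rho> c z" using density_pos c(1) c'(1) by blast+
      show "0 < norm (deriv ?T z)" using r(5)[OF that] by simp
    qed
    \<comment> \<open>\<open>ln W\<close> is \<open>u1 + u2 - u3\<close>. Liouville's equation gives
      the Laplacians of \<open>u1\<close> and \<open>u3\<close>, and \<open>u2\<close> is harmonic
      as the logarithm of the modulus of a holomorphic function without zeros.\<close>
    define u1 where "u1 = (\<lambda>w. ln (\<rho> c' w)) \<circ> ?T"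
    define u2 where "u2 = (\<lambda>w::complex. ln (norm w)) \<circ> deriv ?T"
    define u3 where "u3 = (\<lambda>z. ln (\<rho> c z))"
    have C1: "C_k_on 2 u1 ?B" unfolding u1_def
      by (rule C_k_on_compose_holomorphic[OF r(3) open_ball chart(2)[OF c'(1)] T ln_density(1)[OF c'(1)]])
    have C2: "C_k_on 2 u2 ?B" unfolding u2_def
      by (rule C_k_on_compose_holomorphic[OF dh open_ball _ dn ln_norm_C_k]) auto
    have C3: "C_k_on 2 u3 ?B" unfolding u3_def by (rule C_k_on_subset[OF ln_density(1)[OF c(1)] r(2)])
    have C12: "C_k_on 2 (\<lambda>z. u1 z + 1 * u2 z) ?B" using C_k_on_add[OF open_ball C1 C2] by simp
    have eq: "u1 z + 1 * u2 z + (-1) * u3 z = ln (W (chart_inv c z))" if "z \<in> ?B" for z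
      using pos[OF that] unfolding Wz[OF that] by (simp add: u1_def u2_def u3_def ln_div ln_mult)
    have z0: "snd c p \<in> ?B" using r(1) by simp
    have "C_k_on 2 (\<lambda>z. (u1 z + 1 * u2 z) - u3 z) ?B" by (rule C_k_on_diff[OF open_ball C12 C3])
    then have C: "C_k_on 2 (\<lambda>z. ln (W (chart_inv c z))) ?B"
      by (rule C_k_on_cong_imp[OF open_ball, rotated]) (use eq in auto)
    have "flat_laplacian (\<lambda>z. ln (W (chart_inv c z))) (snd c p) = flat_laplacian (\<lambda>z. u1 z + 1 * u2 z + (-1) * u3 z) (snd c p)"
      by (rule flat_laplacian_cong[OF open_ball z0]) (use eq in simp)
    also have "\<dots> = flat_laplacian u1 (snd c p) + flat_laplacian u2 (snd c p) - flat_laplacian u3 (snd c p)"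
      using flat_laplacian_add_cmult[OF C12 C3 open_ball z0, of "-1"] flat_laplacian_add_cmult[OF C1 C2 open_ball z0, of 1] by simp
    also have "flat_laplacian u1 (snd c p) = (\<rho> c' (?T (snd c p)))\<^sup>2 * (norm (deriv ?T (snd c p)))\<^sup>2"
    proof -
      have Ti: "?T (snd c p) \<in> chart_img c'" using T z0 by blast
      show ?thesis unfolding u1_def
        using flat_laplacian_compose_holomorphic[OF r(3) open_ball z0 chart(2)[OF c'(1)] T ln_density(1)[OF c'(1)]]
          ln_density(2)[OF c'(1) Ti] by simp
    qed
    also have "flat_laplacian u2 (snd c p) = 0"
      unfolding u2_def
      using flat_laplacian_compose_holomorphic[OF dh open_ball z0 o0 dn ln_norm_C_k] flat_laplacian_ln_norm[OF r(5)[OF z0]] by simp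
    also have "flat_laplacian u3 (snd c p) = (\<rho> c (snd c p))\<^sup>2"
      unfolding u3_def using ln_density(2)[OF c(1), of "snd c p"] r(2) z0 by blast
    also have "(\<rho> c' (?T (snd c p)))\<^sup>2 * (norm (deriv ?T (snd c p)))\<^sup>2 + 0 - (\<rho> c (snd c p))\<^sup>2 = (\<rho> c (snd c p))\<^sup>2 * ((W p)\<^sup>2 - 1)"
      using Wz[OF z0] pos[OF z0] chart_inv(1)[OF c] by (simp add: field_simps power2_eq_square)
    finally have "flat_laplacian (\<lambda>z. ln (W (chart_inv c z))) (snd c p) = (\<rho> c (snd c p))\<^sup>2 * ((W p)\<^sup>2 - 1)" .
    moreover have "\<forall>z\<in>?B. 0 < W (chart_inv c z)" using Wz pos by simp
    ultimately show ?thesis using r(1,2) C by blast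
  qed
  have cW: "continuous_map X euclidean W"
  proof (rule continuous_map_of_charts)
    fix p assume p: "p \<in> topspace X"
    obtain c where c: "c \<in> \<A>" "p \<in> chart_dom c" using ex_chart[OF p] by blast
    obtain r where r: "r > 0" "C_k_on 2 (\<lambda>z. ln (W (chart_inv c z))) (ball (snd c p) r)" "\<forall>z\<in>ball (snd c p) r. 0 < W (chart_inv c z)"
      using local[OF p c] by blast
    have "continuous_on (ball (snd c p) r) (\<lambda>z. exp (ln (W (chart_inv c z))))"
      by (intro continuous_on_exp C_k_on_continuous[OF r(2)])
    then have "continuous_on (ball (snd c p) r) (\<lambda>z. W (chart_inv c z))"
      by (rule continuous_on_eq) (use r(3) in simp)
    then have "isCont (\<lambda>z. W (chart_inv c z)) (snd c p)" using r(1) by (simp add: continuous_on_eq_continuous_at)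
    then show "\<exists>c\<in>\<A>. p \<in> chart_dom c \<and> isCont (\<lambda>z. W (chart_inv c z)) (snd c p)" using c by blast
  qed
  have "compactin euclidean (W ` topspace X)"
    using compact_X by (intro image_compactin[OF _ cW]) (simp add: compact_space_def)
  then have "compact (W ` topspace X)" by simp
  moreover have "W ` topspace X \<noteq> {}" using p by blast
  ultimately obtain q where q: "q \<in> topspace X" "\<And>x. x \<in> topspace X \<Longrightarrow> W x \<le> W q"
    using compact_attains_sup[of "W ` topspace X"] by blast
  have Wq: "W q \<le> 1"
  proof -
    obtain c where c: "c \<in> \<A>" "q \<in> chart_dom c" using ex_chart[OF q(1)] by blast
    obtain r where r: "r > 0" "ball (snd c q) r \<subseteq> chart_img c" "C_k_on 2 (\<lambda>z. ln (W (chart_inv c z))) (ball (snd c q) r)"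
      "\<forall>z\<in>ball (snd c q) r. 0 < W (chart_inv c z)" "flat_laplacian (\<lambda>z. ln (W (chart_inv c z))) (snd c q) = (\<rho> c (snd c q))\<^sup>2 * ((W q)\<^sup>2 - 1)"
      using local[OF q(1) c] by blast
    have ciq: "chart_inv c (snd c q) = q" by (rule chart_inv(1)[OF c])
    have z0: "snd c q \<in> ball (snd c q) r" using r(1) by simp
    have "flat_laplacian (\<lambda>z. ln (W (chart_inv c z))) (snd c q) \<le> 0"
    proof (rule flat_laplacian_at_max[OF r(3) open_ball z0])
      fix w assume w: "w \<in> ball (snd c q) r"
      then have "W (chart_inv c w) \<le> W q" using r(2) chart_inv_topspace[OF c(1)] by (intro q(2)) blast
      then show "ln (W (chart_inv c w)) \<le> ln (W (chart_inv c (snd c q)))"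
        unfolding ciq using bspec[OF r(4) w] by (intro ln_mono) auto
    qed
    then have "(\<rho> c (snd c q))\<^sup>2 * ((W q)\<^sup>2 - 1) \<le> 0" using r(5) by simp
    moreover have "(\<rho> c (snd c q))\<^sup>2 > 0" using density_pos[OF c(1), of "snd c q"] c(2) by auto
    ultimately have "(W q)\<^sup>2 \<le> 1" by (simp add: mult_le_0_iff)
    then show ?thesis by (simp add: power2_le_iff_abs_le abs_le_iff power_le_one_iff abs_square_le_1)
  qed
  then have le1: "W x \<le> 1" if "x \<in> topspace X" for x using q(2)[OF that] by linarith
  have "W (\<tau> p) = dilatation c' c (\<tau> p)"
    by (rule W) (use \<tau>[OF p] c c' in auto)
  \<comment> \<open>As \<open>\<tau>\<close> is an involution, the dilatations at \<open>p\<close>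
    and \<open>\<tau> p\<close> are reciprocal. Neither exceeds 1, so both equal 1.\<close>
  then have 1: "W (\<tau> p) * W p = 1" using dilatation_inverse[OF p c c'] W[OF p c c'] by simp
  have "W p > 0" using local[OF p c] chart_inv(1)[OF c] by (metis centre_in_ball)
  then have "1 \<le> W p" using mult_right_mono[OF le1[OF \<tau>(1)[OF p]], of "W p"] 1 by simp
  then show ?thesis using le1[OF p] W[OF p c c'] by linarith
qed

lemma density_\<tau>:
  assumes p: "p \<in> topspace X" and c: "c \<in> \<A>" "p \<in> chart_dom c" and c': "c' \<in> \<A>" "\<tau> p \<in> chart_dom c'"
  shows "\<rho> c (snd c p) = \<rho> c' (snd c' (\<tau> p)) * norm (deriv (\<tau>_chart c c') (snd c p))"
  using dilatation_eq_1[OF assms] density_pos[OF c(1), of "snd c p"] c(2) by (simp add: dilatation_def)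

end

lemma area_harmonic_strong_max:
  assumes h: "area_harmonic_on h \<Omega>" and \<Omega>: "open \<Omega>" "connected \<Omega>" and M: "\<And>z. z \<in> \<Omega> \<Longrightarrow> h z \<le> M"
    and a: "a \<in> \<Omega>" "h a = M" and z: "z \<in> \<Omega>"
  shows "h z = M"
proof -
  have "open {z \<in> \<Omega>. h z = M}"
    unfolding open_contains_ball
  proof (intro ballI)
    fix x assume "x \<in> {z \<in> \<Omega>. h z = M}"
    then have x: "x \<in> \<Omega>" "h x = M" by auto
    obtain e where e: "e > 0" "cball x e \<subseteq> \<Omega>" using \<Omega>(1) x(1) open_contains_cball by blast
    have "y \<in> {z \<in> \<Omega>. h z = M}" if y: "y \<in> ball x (e / 4)" for y
    proof -
      have "h y = h x"
        by (rule area_harmonic_max[OF h, of "e / 4"]) (use e M x y in auto)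
      moreover have "y \<in> cball x e" using y e(1) by simp
      ultimately show ?thesis using e(2) x(2) by auto
    qed
    then show "\<exists>e>0. ball x e \<subseteq> {z \<in> \<Omega>. h z = M}" using e(1) by (intro exI[of _ "e / 4"]) auto
  qed
  then have 1: "openin (top_of_set \<Omega>) {z \<in> \<Omega>. h z = M}" by (intro open_subset) auto
  have 2: "closedin (top_of_set \<Omega>) {z \<in> \<Omega>. h z = M}"
    using h unfolding area_harmonic_on_def by (intro continuous_closedin_preimage_constant) auto
  have "{z \<in> \<Omega>. h z = M} = {} \<or> {z \<in> \<Omega>. h z = M} = \<Omega>"
    using \<Omega>(2) 1 2 unfolding connected_clopen by blast
  then show ?thesis using a z by blast
qed

section \<open>Invariance of the Green function\<close>

context hyperelliptic_green
begin

definition green_defect :: "'a \<Rightarrow> 'a \<Rightarrow> real" where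
  "green_defect r s = G (\<tau> s) (\<tau> r) - G s r"

text \<open>Off the poles both terms have the same flat Laplacian
  \<open>inv_area * \<rho>\<^sup>2\<close> in the chart \<open>c\<close>: the factor that
  composition with \<open>\<tau>\<close> produces is absorbed by \<open>density_\<tau>\<close>. Both
  poles sit at \<open>r\<close>, by injectivity of \<open>\<tau>\<close>.\<close>

lemma green_defect_harmonic:
  assumes r: "r \<in> topspace X" and c: "c \<in> \<A>" and \<Omega>: "open \<Omega>" "\<Omega> \<subseteq> chart_img c" "\<And>z. z \<in> \<Omega> \<Longrightarrow> chart_inv c z \<noteq> r"
  shows "area_harmonic_on (\<lambda>z. green_defect r (chart_inv c z)) \<Omega>"
proof -
  have loc: "\<exists>e>0. ball z e \<subseteq> \<Omega> \<and> C_k_on 2 (\<lambda>w. green_defect r (chart_inv c w)) (ball z e) \<and>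
      flat_laplacian (\<lambda>w. green_defect r (chart_inv c w)) z = 0" if z: "z \<in> \<Omega>" for z
  proof -
    define p where "p = chart_inv c z"
    have zi: "z \<in> chart_img c" using \<Omega>(2) z by blast
    have p: "p \<in> topspace X" "p \<in> chart_dom c" "snd c p = z"
      using chart_inv_topspace[OF c zi] chart_inv(2,3)[OF c zi] by (auto simp: p_def)
    obtain c' where c': "c' \<in> \<A>" "\<tau> p \<in> chart_dom c'" using ex_chart[OF \<tau>(1)[OF p(1)]] by blast
    obtain e1 where e1: "e1 > 0" "\<tau>_chart c c' holomorphic_on ball z e1"
      "\<And>w. w \<in> ball z e1 \<Longrightarrow> \<tau> (chart_inv c w) \<in> chart_dom c'"
      by (rule \<tau>_chart[OF p(1) c p(2) c']) (auto simp: p(3))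
    obtain e2 where e2: "e2 > 0" "ball z e2 \<subseteq> \<Omega>" using \<Omega>(1) z openE by blast
    define B where "B = ball z (min e1 e2)"
    have B: "open B" "z \<in> B" "B \<subseteq> ball z e1" "B \<subseteq> \<Omega>" using e1(1) e2 by (auto simp: B_def)
    let ?T = "\<tau>_chart c c'" and ?V = "{v \<in> chart_img c'. chart_inv c' v \<noteq> \<tau> r}"
    have \<tau>r: "\<tau> r \<in> topspace X" using \<tau>(1)[OF r] .
    have inv: "chart_inv c' (?T w) = \<tau> (chart_inv c w)" if "w \<in> B" for w
      using chart_inv(1)[OF c'(1) e1(3)] B(3) that by (auto simp: \<tau>_chart_def)
    have TB: "?T ` B \<subseteq> ?V"
    proof (rule image_subsetI)
      fix w assume w: "w \<in> B"
      have "w \<in> ball z e1" using w B(3) by blast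
      then have "?T w \<in> chart_img c'" using e1(3) by (auto simp: \<tau>_chart_def)
      moreover have "\<tau> (chart_inv c w) \<noteq> \<tau> r"
      proof
        assume eq: "\<tau> (chart_inv c w) = \<tau> r"
        have w': "w \<in> \<Omega>" using w B(4) by blast
        then have "w \<in> chart_img c" using \<Omega>(2) by blast
        then have "chart_inv c w = r" using \<tau>_inj[OF chart_inv_topspace[OF c] r eq] by blast
        then show False using \<Omega>(3)[OF w'] by simp
      qed
      ultimately show "?T w \<in> ?V" using inv[OF w] by simp
    qed
    have hol: "?T holomorphic_on B" by (rule holomorphic_on_subset[OF e1(2) B(3)])
    note C' = green_chart_C2[OF c'(1) \<tau>r]
    have C1: "C_k_on 2 ((\<lambda>v. G (chart_inv c' v) (\<tau> r)) \<circ> ?T) B"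
      by (rule C_k_on_compose_holomorphic[OF hol B(1) C'(2) TB C'(1)])
    have C2: "C_k_on 2 (\<lambda>v. G (chart_inv c v) r) B"
      by (rule C_k_on_subset[OF green_chart_C2(1)[OF c r]]) (use B(4) \<Omega> in auto)
    have eq: "((\<lambda>v. G (chart_inv c' v) (\<tau> r)) \<circ> ?T) w + (-1) * G (chart_inv c w) r = green_defect r (chart_inv c w)" if "w \<in> B" for w
      using inv[OF that] by (simp add: green_defect_def)
    have "C_k_on 2 (\<lambda>w. ((\<lambda>v. G (chart_inv c' v) (\<tau> r)) \<circ> ?T) w - G (chart_inv c w) r) B"
      by (rule C_k_on_diff[OF B(1) C1 C2])
    then have C: "C_k_on 2 (\<lambda>w. green_defect r (chart_inv c w)) B"
      by (rule C_k_on_cong_imp[OF B(1), rotated]) (use eq in auto)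
    have "flat_laplacian (\<lambda>w. green_defect r (chart_inv c w)) z
        = flat_laplacian (\<lambda>w. ((\<lambda>v. G (chart_inv c' v) (\<tau> r)) \<circ> ?T) w + (-1) * G (chart_inv c w) r) z"
      by (rule flat_laplacian_cong[OF B(1,2)]) (use eq in simp)
    also have "\<dots> = flat_laplacian ((\<lambda>v. G (chart_inv c' v) (\<tau> r)) \<circ> ?T) z - flat_laplacian (\<lambda>v. G (chart_inv c v) r) z"
      using flat_laplacian_add_cmult[OF C1 C2 B(1,2), of "-1"] by simp
    also have "flat_laplacian ((\<lambda>v. G (chart_inv c' v) (\<tau> r)) \<circ> ?T) z = inv_area * (\<rho> c' (?T z))\<^sup>2 * (norm (deriv ?T z))\<^sup>2"
    proof -
      have "?T z \<in> ?V" using TB B(2) by blast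
      then have "flat_laplacian (\<lambda>v. G (chart_inv c' v) (\<tau> r)) (?T z) = inv_area * (\<rho> c' (?T z))\<^sup>2"
        by (intro green_reg_laplacian(2)[OF c'(1) \<tau>r]) auto
      then show ?thesis using flat_laplacian_compose_holomorphic[OF hol B(1,2) C'(2) TB C'(1)] by simp
    qed
    also have "flat_laplacian (\<lambda>v. G (chart_inv c v) r) z = inv_area * (\<rho> c z)\<^sup>2"
      by (rule green_reg_laplacian(2)[OF c r zi \<Omega>(3)[OF z]])
    also have "\<rho> c z = \<rho> c' (?T z) * norm (deriv ?T z)"
      using density_\<tau>[OF p(1) c p(2) c'] p(3) by (simp add: \<tau>_chart_def p_def)
    finally have "flat_laplacian (\<lambda>w. green_defect r (chart_inv c w)) z = 0"
      by (simp add: power_mult_distrib)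
    then show ?thesis using C B(4) e1(1) e2(1) unfolding B_def by (intro exI[of _ "min e1 e2"]) auto
  qed
  show ?thesis
  proof (rule area_harmonic_of_laplacian[OF _ \<Omega>(1)])
    show "C_k_on 2 (\<lambda>z. green_defect r (chart_inv c z)) \<Omega>"
    proof (rule C_k_on_local)
      fix z assume "z \<in> \<Omega>"
      then obtain e where "e > 0" "C_k_on 2 (\<lambda>w. green_defect r (chart_inv c w)) (ball z e)" using loc by blast
      then show "\<exists>T. open T \<and> z \<in> T \<and> C_k_on 2 (\<lambda>w. green_defect r (chart_inv c w)) T" by (intro exI[of _ "ball z e"]) auto
    qed
  qed (use loc in blast)
qed

lemma green_log_limit:
  assumes c: "c \<in> \<A>" and w: "w \<in> chart_img c"
  shows "(green_log c w \<longlongrightarrow> green_ext c w w) (at w)"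
proof -
  obtain e where e: "e > 0" "ball w e \<subseteq> chart_img c" using chart(2)[OF c] w openE by blast
  show ?thesis by (rule green_ext_area_harmonic(2)[OF c w, of "e / 4" w]) (use e in auto)
qed

text \<open>The two logarithmic poles combine to ln |T z - T z0| - ln |z - z0|, which tends to the
  logarithm of |T'(z0)|. So the defect has a finite limit at \<open>r\<close>, and its explicit
  value gives the transformation law of the regular part.\<close>

lemma green_defect_limit:
  assumes r: "r \<in> topspace X" and c: "c \<in> \<A>" "r \<in> chart_dom c" and c': "c' \<in> \<A>" "\<tau> r \<in> chart_dom c'"
  defines "z0 \<equiv> snd c r" and "T \<equiv> \<tau>_chart c c'"
  shows "((\<lambda>z. green_defect r (chart_inv c z)) \<longlongrightarrow>
    green_ext c' (T z0) (T z0) - green_ext c z0 z0 - ln (norm (deriv T z0)) / (2 * pi)) (at z0)"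
proof -
  obtain e where e: "e > 0" "ball z0 e \<subseteq> chart_img c" "\<And>w. w \<in> ball z0 e \<Longrightarrow> \<tau> (chart_inv c w) \<in> chart_dom c'"
    "\<And>w. w \<in> ball z0 e \<Longrightarrow> deriv T w \<noteq> 0" "inj_on T (ball z0 e)" "T z0 = snd c' (\<tau> r)"
    unfolding z0_def T_def by (rule \<tau>_chart[OF r c c']) blast
  have z0: "z0 \<in> chart_img c" "z0 \<in> ball z0 e" "chart_inv c z0 = r" using c e(1) chart_inv(1)[OF c] by (auto simp: z0_def)
  have T0: "T z0 \<in> chart_img c'" using e(6) c' by auto
  have inv: "chart_inv c' (T w) = \<tau> (chart_inv c w)" if "w \<in> ball z0 e" for w
    using chart_inv(1)[OF c'(1) e(3)[OF that]] by (simp add: T_def \<tau>_chart_def)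
  have D: "(T has_field_derivative deriv T z0) (at z0)" unfolding T_def z0_def by (rule \<tau>_chart_derivative[OF r c c'])
  have ev: "\<forall>\<^sub>F z in at z0. z \<in> ball z0 e \<and> z \<noteq> z0" using e(1) eventually_at_ball[of e z0 UNIV] by (auto simp: eventually_at_filter elim: eventually_mono)
  have "\<forall>\<^sub>F z in at z0. T z \<noteq> T z0"
    using ev by eventually_elim (use e(5) z0(2) in \<open>auto dest: inj_onD\<close>)
  then have Tlim: "filterlim T (at (T z0)) (at z0)"
    using DERIV_isCont[OF D] by (simp add: filterlim_at isCont_def)
  have l1: "((\<lambda>z. green_log c' (T z0) (T z)) \<longlongrightarrow> green_ext c' (T z0) (T z0)) (at z0)"
    by (rule filterlim_compose[OF green_log_limit[OF c'(1) T0] Tlim])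
  have l2: "(green_log c z0 \<longlongrightarrow> green_ext c z0 z0) (at z0)" by (rule green_log_limit[OF c(1) z0(1)])
  have "((\<lambda>z. norm ((T z - T z0) / (z - z0))) \<longlongrightarrow> norm (deriv T z0)) (at z0)"
    using D by (intro tendsto_norm) (simp add: has_field_derivative_iff)
  then have l3: "((\<lambda>z. ln (norm ((T z - T z0) / (z - z0)))) \<longlongrightarrow> ln (norm (deriv T z0))) (at z0)"
    using e(4)[OF z0(2)] by (intro tendsto_ln) auto
  have "((\<lambda>z. green_log c' (T z0) (T z) - green_log c z0 z - ln (norm ((T z - T z0) / (z - z0))) / (2 * pi)) \<longlongrightarrow>
    green_ext c' (T z0) (T z0) - green_ext c z0 z0 - ln (norm (deriv T z0)) / (2 * pi)) (at z0)"
    by (rule tendsto_diff[OF tendsto_diff[OF l1 l2] tendsto_divide[OF l3 tendsto_const]]) simp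
  moreover have "\<forall>\<^sub>F z in at z0. green_log c' (T z0) (T z) - green_log c z0 z - ln (norm ((T z - T z0) / (z - z0))) / (2 * pi)
      = green_defect r (chart_inv c z)"
    using ev
  proof eventually_elim
    case (elim z)
    then have "T z \<noteq> T z0" using e(5) z0(2) by (auto dest: inj_onD)
    then have "ln (norm ((T z - T z0) / (z - z0))) = ln (norm (T z - T z0)) - ln (norm (z - z0))"
      using elim by (simp add: norm_divide ln_div)
    then show ?case using inv[of z] inv[of z0] elim z0 by (simp add: green_log_def green_defect_def diff_divide_distrib)
  qed
  ultimately show ?thesis by (rule Lim_transform_eventually)
qed

text \<open>The defect is extended to \<open>r\<close> by its limit, and its maximum over the
  compact surface spreads over each neighbourhood. Off \<open>r\<close> this is the strong maximum
  principle. At \<open>r\<close> only continuity is at hand, so a maximum there is first carried to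
  a surrounding circle by \<open>area_harmonic_punctured_max\<close>.\<close>

lemma green_defect_constant:
  assumes r: "r \<in> topspace X"
  shows "\<exists>m. \<forall>s\<in>topspace X - {r}. green_defect r s = m"
proof -
  obtain c where c: "c \<in> \<A>" "r \<in> chart_dom c" using ex_chart[OF r] by blast
  obtain c' where c': "c' \<in> \<A>" "\<tau> r \<in> chart_dom c'" using ex_chart[OF \<tau>(1)[OF r]] by blast
  define z0 where "z0 = snd c r"
  obtain L where L: "((\<lambda>z. green_defect r (chart_inv c z)) \<longlongrightarrow> L) (at z0)"
    using green_defect_limit[OF r c c'] unfolding z0_def by blast
  define D where "D = (\<lambda>s. if s = r then L else green_defect r s)"
  have z0: "z0 \<in> chart_img c" "chart_inv c z0 = r" using c chart_inv(1)[OF c] by (auto simp: z0_def)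
  obtain R where R: "0 < R" "cball z0 (2 * R) \<subseteq> chart_img c"
  proof -
    obtain e where "e > 0" "cball z0 e \<subseteq> chart_img c" using chart(2)[OF c(1)] z0(1) open_contains_cball by blast
    then show ?thesis by (intro that[of "e / 2"]) auto
  qed
  have punct: "chart_inv c z \<noteq> r" if "z \<in> cball z0 (2 * R)" "z \<noteq> z0" for z
    using chart_inv_inj[OF c(1) subsetD[OF R(2) that(1)] z0(1)] that(2) z0(2) by auto
  have harm: "area_harmonic_on (\<lambda>z. D (chart_inv d z)) \<Omega>"
    if d: "d \<in> \<A>" and \<Omega>: "open \<Omega>" "\<Omega> \<subseteq> chart_img d" "\<And>z. z \<in> \<Omega> \<Longrightarrow> chart_inv d z \<noteq> r" for d \<Omega>
    by (rule area_harmonic_cong[OF _ green_defect_harmonic[OF r that]]) (use \<Omega>(3) in \<open>simp add: D_def\<close>)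
  have contr: "isCont (\<lambda>z. D (chart_inv c z)) z0"
  proof -
    have "\<forall>\<^sub>F z in at z0. z \<in> ball z0 R" using R(1) by (intro eventually_at_in_open') auto
    then have "\<forall>\<^sub>F z in at z0. green_defect r (chart_inv c z) = D (chart_inv c z)"
      using eventually_neq_at_within[of z0 z0 UNIV]
      by eventually_elim (use punct R in \<open>auto simp: D_def\<close>)
    then have "((\<lambda>z. D (chart_inv c z)) \<longlongrightarrow> L) (at z0)" by (rule Lim_transform_eventually[OF L])
    then show ?thesis by (simp add: isCont_def D_def z0(2))
  qed
  have good: "\<exists>d\<in>\<A>. x \<in> chart_dom d \<and> (\<exists>e>0. ball (snd d x) e \<subseteq> chart_img d \<and> (\<forall>z\<in>ball (snd d x) e. chart_inv d z \<noteq> r))"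
    if x: "x \<in> topspace X" "x \<noteq> r" for x
  proof -
    obtain d where d: "d \<in> \<A>" "x \<in> chart_dom d" using ex_chart[OF x(1)] by blast
    have U: "x \<in> {z \<in> topspace X. z \<noteq> r}" "openin X {z \<in> topspace X. z \<noteq> r}"
    proof -
      have "closedin X {r}" using Hausdorff_X r by (simp add: closedin_Hausdorff_singleton)
      then have "openin X (topspace X - {r})" by (rule openin_diff[OF openin_topspace])
      moreover have "topspace X - {r} = {z \<in> topspace X. z \<noteq> r}" by auto
      ultimately show "openin X {z \<in> topspace X. z \<noteq> r}" by simp
    qed (use x in simp)
    obtain e where e: "0 < e" "cball (snd d x) e \<subseteq> chart_img d" "chart_inv d ` cball (snd d x) e \<subseteq> {z \<in> topspace X. z \<noteq> r}"
      by (rule chart_ball[OF d U(2,1)])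
    have "chart_inv d z \<noteq> r" if "z \<in> ball (snd d x) e" for z
      using subsetD[OF e(3) imageI[of z]] that by simp
    then show ?thesis using d e(1,2) ball_subset_cball[of "snd d x" e] by (intro bexI[of _ d] conjI exI[of _ e]) auto
  qed
  have cont: "continuous_map X euclidean D"
  proof (rule continuous_map_of_charts)
    fix x assume x: "x \<in> topspace X"
    show "\<exists>c\<in>\<A>. x \<in> chart_dom c \<and> isCont (\<lambda>z. D (chart_inv c z)) (snd c x)"
    proof (cases "x = r")
      case True then show ?thesis using c contr unfolding z0_def by blast
    next
      case False
      obtain d e where d: "d \<in> \<A>" "x \<in> chart_dom d" and e: "e > 0" "ball (snd d x) e \<subseteq> chart_img d" "\<forall>z\<in>ball (snd d x) e. chart_inv d z \<noteq> r"
        using good[OF x False] by (elim bexE exE conjE) (rule that)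
      have "area_harmonic_on (\<lambda>z. D (chart_inv d z)) (ball (snd d x) e)" by (rule harm[OF d(1)]) (use e in auto)
      then have "isCont (\<lambda>z. D (chart_inv d z)) (snd d x)"
        using e(1) by (simp add: area_harmonic_on_def continuous_on_eq_continuous_at)
      then show ?thesis using d by blast
    qed
  qed
  have "compactin euclidean (D ` topspace X)"
    using compact_X by (intro image_compactin[OF _ cont]) (simp add: compact_space_def)
  then have "compact (D ` topspace X)" by simp
  moreover have "D ` topspace X \<noteq> {}" using r by blast
  ultimately obtain q where q: "q \<in> topspace X" "\<And>x. x \<in> topspace X \<Longrightarrow> D x \<le> D q"
    using compact_attains_sup[of "D ` topspace X"] by blast
  have Dr: "D x = D q" if x: "x \<in> topspace X" for x
  proof (rule connected_space_induct[OF connected_X q(1) refl _ x])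
    fix x assume x: "x \<in> topspace X"
    show "\<exists>N. openin X N \<and> x \<in> N \<and> (\<forall>y\<in>N. \<forall>y'\<in>N. D y = D q \<longrightarrow> D y' = D q)"
    proof (cases "x = r")
      case False
      obtain d e where d: "d \<in> \<A>" "x \<in> chart_dom d" and e: "e > 0" "ball (snd d x) e \<subseteq> chart_img d" "\<forall>z\<in>ball (snd d x) e. chart_inv d z \<noteq> r"
        using good[OF x False] by (elim bexE exE conjE) (rule that)
      have h: "area_harmonic_on (\<lambda>z. D (chart_inv d z)) (ball (snd d x) e)" by (rule harm[OF d(1)]) (use e in auto)
      have "D (chart_inv d z') = D q" if "z \<in> ball (snd d x) e" "z' \<in> ball (snd d x) e" "D (chart_inv d z) = D q" for z z'
        by (rule area_harmonic_strong_max[OF h open_ball connected_ball _ that(1,3,2)])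
          (use q(2) chart_inv_topspace[OF d(1)] e(2) in blast)
      moreover have "x \<in> chart_inv d ` ball (snd d x) e" using chart_inv(1)[OF d] e(1) by (metis centre_in_ball image_eqI)
      moreover have "\<forall>y\<in>chart_inv d ` ball (snd d x) e. \<forall>y'\<in>chart_inv d ` ball (snd d x) e. D y = D q \<longrightarrow> D y' = D q"
        unfolding ball_simps(9) by (intro ballI impI) (rule calculation(1))
      ultimately show ?thesis using openin_chart_inv_image[OF d(1) open_ball e(2)]
        by (intro exI[of _ "chart_inv d ` ball (snd d x) e"] conjI)
    next
      case True
      let ?P = "ball z0 (2 * R) - {z0}"
      have le: "D (chart_inv c z) \<le> D q" if "z \<in> cball z0 (2 * R)" for z
        using q(2) chart_inv_topspace[OF c(1)] R(2) that by blast
      have h: "area_harmonic_on (\<lambda>z. D (chart_inv c z)) ?P"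
      proof (rule harm[OF c(1)])
        show "open ?P" by auto
        show "?P \<subseteq> chart_img c" using order_trans[OF ball_subset_cball R(2)] by blast
        show "chart_inv c z \<noteq> r" if "z \<in> ?P" for z using punct that by auto
      qed
      have P: "open ?P" "connected ?P" using connected_punctured_ball[of z0 "2 * R"] by auto
      have circle: "\<exists>z\<in>?P. D (chart_inv c z) = D q" if "D r = D q"
      proof (rule ccontr)
        assume none: "\<not> ?thesis"
        have cP: "continuous_on ?P (\<lambda>z. D (chart_inv c z))" using h by (simp add: area_harmonic_on_def)
        have sub: "cball z0 R - {z0} \<subseteq> ?P" "ball z0 R - {z0} \<subseteq> ?P" using R(1) by auto
        have sp: "sphere z0 R \<subseteq> ?P" using R(1) by auto
        have "\<exists>z\<in>sphere z0 R. \<forall>y\<in>sphere z0 R. D (chart_inv c y) \<le> D (chart_inv c z)"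
          by (rule continuous_attains_sup[OF compact_sphere _ continuous_on_subset[OF cP sp]]) (use R(1) in simp)
        then obtain z1 where z1: "z1 \<in> sphere z0 R" "\<forall>y\<in>sphere z0 R. D (chart_inv c y) \<le> D (chart_inv c z1)"
          by (elim bexE) (rule that)
        have bound: "D (chart_inv c z) \<le> D (chart_inv c z1)" if z: "z \<in> cball z0 R - {z0}" for z
        proof (rule area_harmonic_punctured_max[OF R(1) continuous_on_subset[OF cP sub(1)] area_harmonic_subset[OF h sub(2)] _ _ z])
          show "D (chart_inv c z) \<le> D q" if "z \<in> cball z0 R - {z0}" for z using le[of z] that R(1) by auto
        qed (use z1(2) in auto)
        have "D r \<le> D (chart_inv c z1)"
        proof (rule tendsto_upperbound)
          show "((\<lambda>z. D (chart_inv c z)) \<longlongrightarrow> D r) (at z0)" using contr by (simp add: isCont_def z0(2))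
          have "\<forall>\<^sub>F z in at z0. z \<in> ball z0 R" using R(1) by (intro eventually_at_in_open') auto
          then show "\<forall>\<^sub>F z in at z0. D (chart_inv c z) \<le> D (chart_inv c z1)"
            using eventually_neq_at_within[of z0 z0 UNIV]
            by eventually_elim (use bound in auto)
        qed simp
        then have "D (chart_inv c z1) = D q" using le[of z1] z1(1) R(1) \<open>D r = D q\<close> by simp
        then show False using none sp z1(1) by blast
      qed
      \<comment> \<open>Once the maximum is attained in the punctured disc it fills that disc, and
        continuity carries it to the centre.\<close>
      have step: "D (chart_inv c z') = D q" if z: "z \<in> ball z0 (2 * R)" "z' \<in> ball z0 (2 * R)" "D (chart_inv c z) = D q" for z z'
      proof -
        have "\<exists>z\<in>?P. D (chart_inv c z) = D q"
        proof (cases "z = z0")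
          case True then show ?thesis using circle z(3) z0(2) by simp
        next
          case False then show ?thesis using z by blast
        qed
        then obtain a where a: "a \<in> ?P" "D (chart_inv c a) = D q" by (elim bexE) (rule that)
        have all: "D (chart_inv c w) = D q" if w: "w \<in> ?P" for w
          by (rule area_harmonic_strong_max[OF h P _ a w]) (use le in auto)
        have "D r = D q"
        proof (rule tendsto_unique)
          show "((\<lambda>z. D (chart_inv c z)) \<longlongrightarrow> D r) (at z0)" using contr by (simp add: isCont_def z0(2))
          have "\<forall>\<^sub>F z in at z0. z \<in> ball z0 (2 * R)" using R(1) by (intro eventually_at_in_open') auto
          then have "\<forall>\<^sub>F z in at z0. D q = D (chart_inv c z)"
            using eventually_neq_at_within[of z0 z0 UNIV]
            by eventually_elim (use all in auto)
          then show "((\<lambda>z. D (chart_inv c z)) \<longlongrightarrow> D q) (at z0)" by (rule Lim_transform_eventually[OF tendsto_const])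
        qed simp
        then show ?thesis using all[of z'] z(2) z0(2) by (cases "z' = z0") auto
      qed
      have sub: "ball z0 (2 * R) \<subseteq> chart_img c" by (rule order_trans[OF ball_subset_cball R(2)])
      have "x \<in> chart_inv c ` ball z0 (2 * R)" using z0(2) True R(1) by (intro image_eqI[of _ _ z0]) auto
      moreover have "\<forall>y\<in>chart_inv c ` ball z0 (2 * R). \<forall>y'\<in>chart_inv c ` ball z0 (2 * R). D y = D q \<longrightarrow> D y' = D q"
        unfolding ball_simps(9) by (intro ballI impI) (rule step)
      ultimately show ?thesis using openin_chart_inv_image[OF c(1) open_ball sub]
        by (intro exI[of _ "chart_inv c ` ball z0 (2 * R)"] conjI)
    qed
  qed
  have "green_defect r s = D q" if s: "s \<in> topspace X - {r}" for s
  proof -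
    have "D s = D q" using s by (intro Dr) auto
    then show ?thesis using s by (simp add: D_def)
  qed
  then show ?thesis by blast
qed

lemma green_\<tau>:
  assumes s: "s \<in> topspace X" and r: "r \<in> topspace X" and ne: "s \<noteq> r"
  shows "G (\<tau> s) (\<tau> r) = G s r"
proof -
  have neg: "green_defect (\<tau> r) (\<tau> s) = - green_defect r s" if "s \<in> topspace X" "r \<in> topspace X" for s r
    using \<tau>(3) that by (simp add: green_defect_def)
  have sym: "green_defect r s = green_defect s r" if "s \<in> topspace X" "r \<in> topspace X" for s r
    using green_props(3)[OF that(2,1)] green_props(3)[OF \<tau>(1)[OF that(2)] \<tau>(1)[OF that(1)]] by (simp add: green_defect_def)
  obtain m where m: "\<And>s. s \<in> topspace X - {r} \<Longrightarrow> green_defect r s = m" using green_defect_constant[OF r] by blast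
  obtain m' where m': "\<And>s. s \<in> topspace X - {\<tau> r} \<Longrightarrow> green_defect (\<tau> r) s = m'" using green_defect_constant[OF \<tau>(1)[OF r]] by blast
  have "\<tau> s \<noteq> \<tau> r" using \<tau>_inj[OF s r] ne by blast
  then have "m' = - m" using m'[of "\<tau> s"] m[of s] neg[OF s r] \<tau>(1)[OF s] s ne by simp
  moreover have "m' = m"
  \<comment> \<open>The constants belonging to \<open>r\<close> and \<open>\<tau> r\<close> are
    compared at the pair of these two points, where symmetry of the defect applies. If the points
    coincide, so do the constants.\<close>
  proof (cases "\<tau> r = r")
    case True then show ?thesis using m[of s] m'[of s] s ne by simp
  next
    case False
    then show ?thesis using m[of "\<tau> r"] m'[of r] sym[OF r \<tau>(1)[OF r]] r \<tau>(1)[OF r] by simp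
  qed
  ultimately have "green_defect r s = 0" using m[of s] s ne by simp
  then show ?thesis by (simp add: green_defect_def)
qed

text \<open>The defect is zero near the pole, hence so is its limit, and the two regular parts
  differ by ln |T'(z0)| / (2 pi). As \<open>\<tau>\<close> is an isometry, this is the difference of
  the logarithms of the densities.\<close>

lemma green_ext_\<tau>:
  assumes r: "r \<in> topspace X" and c: "c \<in> \<A>" "r \<in> chart_dom c" and c': "c' \<in> \<A>" "\<tau> r \<in> chart_dom c'"
  defines "z0 \<equiv> snd c r" and "T \<equiv> \<tau>_chart c c'"
  shows "green_ext c' (T z0) (T z0) + ln (\<rho> c' (T z0)) / (2 * pi) = green_ext c z0 z0 + ln (\<rho> c z0) / (2 * pi)"
proof -
  obtain e where e: "e > 0" "ball z0 e \<subseteq> chart_img c" "\<And>w. w \<in> ball z0 e \<Longrightarrow> deriv T w \<noteq> 0" "T z0 = snd c' (\<tau> r)"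
    unfolding z0_def T_def by (rule \<tau>_chart[OF r c c']) blast
  have z0: "z0 \<in> chart_img c" "z0 \<in> ball z0 e" "chart_inv c z0 = r" using c e(1) chart_inv(1)[OF c] by (auto simp: z0_def)
  have "((\<lambda>z. green_defect r (chart_inv c z)) \<longlongrightarrow> 0) (at z0)"
  proof (rule tendsto_eventually)
    have "\<forall>\<^sub>F z in at z0. z \<in> ball z0 e" using e(1) by (intro eventually_at_in_open') auto
    then show "\<forall>\<^sub>F z in at z0. green_defect r (chart_inv c z) = 0"
      using eventually_neq_at_within[of z0 z0 UNIV]
    proof eventually_elim
      case (elim z)
      then have z: "z \<in> chart_img c" using e(2) by blast
      have "chart_inv c z \<noteq> r" using chart_inv_inj[OF c(1) z z0(1)] z0(3) elim(2) by auto
      then show ?case using green_\<tau>[OF chart_inv_topspace[OF c(1) z] r] by (simp add: green_defect_def)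
    qed
  qed
  then have "green_ext c' (T z0) (T z0) - green_ext c z0 z0 - ln (norm (deriv T z0)) / (2 * pi) = 0"
    using tendsto_unique[OF _ green_defect_limit[OF r c c']] unfolding z0_def T_def by (metis at_neq_bot)
  moreover have "\<rho> c z0 = \<rho> c' (T z0) * norm (deriv T z0)" using density_\<tau>[OF r c c'] e(4) by (simp add: z0_def T_def)
  moreover have "\<rho> c' (T z0) > 0" using density_pos[OF c'(1)] e(4) c' by simp
  ultimately show ?thesis using e(3)[OF z0(2)] by (simp add: ln_mult add_divide_distrib)
qed

end

section \<open>The Robin function\<close>

text \<open>\<open>v\<close> stands for a curve speed, about whose measurability nothing is assumed,
  and enters only through monotonicity of the integral. The fundamental theorem is applied to
  \<open>E\<close>, the scaled derivative cut off at finitely many points, which is Borel.\<close>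

lemma length_ge_displacement:
  fixes f :: "real \<Rightarrow> complex"
  assumes f: "f piecewise_C1_differentiable_on {a..b}" and ab: "a \<le> b" and k: "0 \<le> k"
    and v: "\<And>t D. a < t \<Longrightarrow> t < b \<Longrightarrow> (f has_vector_derivative D) (at t) \<Longrightarrow> ennreal (k * norm D) \<le> v t"
  shows "ennreal (k * norm (f b - f a)) \<le> (\<integral>\<^sup>+t\<in>{a..b}. v t \<partial>lborel)"
proof -
  obtain S D where S: "finite S" and D: "\<And>t. t \<in> {a..b} - S \<Longrightarrow> (f has_vector_derivative D t) (at t)" "continuous_on ({a..b} - S) D"
    and fc: "continuous_on {a..b} f"
    using f unfolding piecewise_C1_differentiable_on_def C1_differentiable_on_def by blast
  define A where "A = {a..b} - (S \<union> {a, b})"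
  define E where "E = (\<lambda>t. indicator A t *\<^sub>R (k *\<^sub>R D t))"
  have fin: "finite (S \<union> {a, b})" using S by simp
  have A: "A \<in> sets borel" "A \<subseteq> {a..b} - S"
    unfolding A_def by (intro sets.Diff borel_closed closed_atLeastAtMost finite_imp_closed[OF fin]) auto
  have "continuous_on A (\<lambda>t. k *\<^sub>R D t)" by (intro continuous_on_scaleR continuous_on_const continuous_on_subset[OF D(2) A(2)])
  then have Em: "E \<in> borel_measurable borel" unfolding E_def by (rule borel_measurable_continuous_on_indicator[OF A(1)])
  have hi: "(E has_integral k *\<^sub>R f b - k *\<^sub>R f a) {a..b}"
  proof (rule fundamental_theorem_of_calculus_strong[of "S \<union> {a, b}"])
    show "continuous_on {a..b} (\<lambda>t. k *\<^sub>R f t)" by (intro continuous_on_scaleR continuous_on_const fc)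
    fix t assume t: "t \<in> {a..b} - (S \<union> {a, b})"
    then have "(f has_vector_derivative D t) (at t)" by (intro D(1)) auto
    then have "((\<lambda>t. k *\<^sub>R f t) has_vector_derivative k *\<^sub>R D t) (at t)" by (rule bounded_linear.has_vector_derivative[OF bounded_linear_scaleR_right])
    moreover have "E t = k *\<^sub>R D t" using t by (simp add: E_def A_def)
    ultimately show "((\<lambda>t. k *\<^sub>R f t) has_vector_derivative E t) (at t)" by simp
  qed (use S ab in auto)
  have le: "(\<integral>\<^sup>+t. ennreal (norm (E t)) \<partial>lborel) \<le> (\<integral>\<^sup>+t\<in>{a..b}. v t \<partial>lborel)"
  proof (rule nn_integral_mono)
    fix t
    show "ennreal (norm (E t)) \<le> v t * indicator {a..b} t"
    proof (cases "t \<in> A")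
      case True
      then have t: "a < t" "t < b" "t \<in> {a..b} - S" by (auto simp: A_def)
      have "ennreal (k * norm (D t)) \<le> v t" by (rule v[OF t(1,2) D(1)[OF t(3)]])
      then show ?thesis using True t k by (simp add: E_def)
    qed (simp add: E_def)
  qed
  show ?thesis
  \<comment> \<open>An infinite integral makes the claim trivial. Otherwise \<open>E\<close> is
    Lebesgue integrable, and its integral agrees with the gauge integral from the fundamental
    theorem.\<close>
  proof (cases "(\<integral>\<^sup>+t. ennreal (norm (E t)) \<partial>lborel) = \<infinity>")
    case True then show ?thesis using le by (simp add: top_unique)
  next
    case False
    then have int: "integrable lborel E" using Em by (intro integrableI_bounded) (auto simp: less_top)
    have "(\<lambda>t. if t \<in> {a..b} then E t else 0) = E" by (rule ext) (auto simp: E_def A_def indicator_def)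
    then have "(E has_integral (integral\<^sup>L lborel E)) {a..b}"
      using has_integral_integral_lborel[OF int] has_integral_restrict_UNIV[of "{a..b}" E] by simp
    then have eq: "integral\<^sup>L lborel E = k *\<^sub>R f b - k *\<^sub>R f a" using hi by (rule has_integral_unique)
    have "k * norm (f b - f a) = norm (k *\<^sub>R (f b - f a))" using k by simp
    also have "\<dots> = norm (integral\<^sup>L lborel E)" unfolding eq scaleR_diff_right ..
    also have "\<dots> \<le> (\<integral>t. norm (E t) \<partial>lborel)" by (rule integral_norm_bound)
    finally have "ennreal (k * norm (f b - f a)) \<le> ennreal (\<integral>t. norm (E t) \<partial>lborel)" by (rule ennreal_leI)
    also have "\<dots> = (\<integral>\<^sup>+t. ennreal (norm (E t)) \<partial>lborel)"
      using int by (intro nn_integral_eq_integral[symmetric]) auto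
    finally show ?thesis using le by simp
  qed
qed

section \<open>Riemannian distance near a point\<close>

context hyperbolic_surface
begin

text \<open>\<open>curve_speed\<close> takes an arbitrary chart at each time. The chain rule and the
  transformation rule of the density show that any chart gives the same value.\<close>

lemma curve_speed_chart:
  assumes c: "c \<in> \<A>" and T: "open T" "t \<in> T" "\<And>t. t \<in> T \<Longrightarrow> \<gamma> t = chart_inv c (f t) \<and> f t \<in> chart_img c"
    and D: "(f has_vector_derivative D) (at t)"
  shows "curve_speed \<A> \<rho> \<gamma> t = \<rho> c (f t) * norm D"
proof -
  define d where "d = chart_at \<A> (\<gamma> t)"
  have ft: "\<gamma> t = chart_inv c (f t)" "f t \<in> chart_img c" using T by auto
  have \<gamma>: "\<gamma> t \<in> topspace X" "\<gamma> t \<in> chart_dom c" "snd c (\<gamma> t) = f t"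
    unfolding ft(1) using chart_inv_topspace[OF c ft(2)] chart_inv(2,3)[OF c ft(2)] by auto
  have d: "d \<in> \<A>" "\<gamma> t \<in> chart_dom d" using chart_at[OF \<gamma>(1)] by (auto simp: d_def)
  have "(transition c d has_field_derivative deriv (transition c d) (f t)) (at (f t))"
    using chart_transition_point(1)[OF c d(1) \<gamma>(2) d(2)] \<gamma>(3) by simp
  from field_vector_diff_chain_at[OF D this]
  have "(snd d \<circ> \<gamma> has_vector_derivative D * deriv (transition c d) (f t)) (at t)"
    by (rule has_vector_derivative_transform_within_open[OF _ T(1,2)]) (use T(3) in \<open>simp add: transition_def\<close>)
  then have "vector_derivative (snd d \<circ> \<gamma>) (at t) = D * deriv (transition c d) (f t)" by (rule vector_derivative_at)
  moreover have "\<rho> c (f t) = \<rho> d (snd d (\<gamma> t)) * norm (deriv (transition c d) (f t))"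
    using density_transition[OF c d(1) \<gamma>(2) d(2)] \<gamma>(3) by simp
  ultimately show ?thesis by (simp add: curve_speed_def Let_def d_def[symmetric] norm_mult)
qed

lemma curve_length_segment:
  assumes c: "c \<in> \<A>" and \<delta>: "ball z0 \<delta> \<subseteq> chart_img c" "z \<in> ball z0 \<delta>" and K: "\<And>w. w \<in> ball z0 \<delta> \<Longrightarrow> \<rho> c w \<le> K"
  shows "\<exists>\<gamma>. piecewise_C1_curve X \<A> \<gamma> \<and> \<gamma> 0 = chart_inv c z \<and> \<gamma> 1 = chart_inv c z0 \<and>
    curve_length \<A> \<rho> \<gamma> \<le> ennreal (K * norm (z - z0))"
proof -
  define l where "l = (\<lambda>t::real. z + of_real t * (z0 - z))"
  define \<gamma> where "\<gamma> = chart_inv c \<circ> l"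
  have ld: "(l has_vector_derivative (z0 - z)) (at t)" for t
    unfolding l_def has_vector_derivative_def by (auto intro!: derivative_eq_intros simp: scaleR_conv_of_real)
  have lc: "continuous_on S l" for S unfolding l_def by (intro continuous_intros)
  have lb: "l t \<in> ball z0 \<delta>" if "t \<in> {0..1}" for t
  proof -
    have "l t - z0 = of_real (1 - t) * (z - z0)" by (simp add: l_def algebra_simps)
    then have "norm (l t - z0) = (1 - t) * norm (z - z0)" using that by (simp add: norm_mult del: of_real_diff)
    also have "\<dots> \<le> norm (z - z0)" using that by (intro mult_left_le_one_le) auto
    finally show ?thesis using \<delta>(2) by (simp add: dist_norm norm_minus_commute)
  qed
  have path: "pathin X \<gamma>"
    unfolding pathin_def \<gamma>_def
    by (rule continuous_map_compose[OF _ chart_inv_continuous[OF c]]) (use lc lb \<delta>(1) in auto)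
  have "piecewise_C1_curve X \<A> \<gamma>"
    unfolding piecewise_C1_curve_def
  proof (intro conjI path ballI allI impI)
    fix d a b assume d: "d \<in> \<A>" and ab: "0 \<le> a \<and> a \<le> b \<and> b \<le> 1 \<and> \<gamma> ` {a..b} \<subseteq> chart_dom d"
    let ?S = "snd c ` (chart_dom c \<inter> chart_dom d)"
    note t = transition[OF c d]
    have lS: "l t \<in> ?S" if t: "t \<in> {a..b}" for t
    proof -
      have li: "l t \<in> chart_img c" using lb[of t] t ab \<delta>(1) by auto
      have "\<gamma> t \<in> chart_dom d" using ab t by blast
      then show ?thesis using chart_inv(2,3)[OF c li] by (intro image_eqI[of _ _ "\<gamma> t"]) (auto simp: \<gamma>_def)
    qed
    have eq: "snd d \<circ> \<gamma> = transition c d \<circ> l" by (auto simp: \<gamma>_def transition_def)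
    have "(snd d \<circ> \<gamma>) C1_differentiable_on {a..b}"
      unfolding C1_differentiable_on_def eq
    proof (intro exI[of _ "\<lambda>t. (z0 - z) * deriv (transition c d) (l t)"] conjI ballI)
      fix t assume "t \<in> {a..b}"
      then show "(transition c d \<circ> l has_vector_derivative (z0 - z) * deriv (transition c d) (l t)) (at t)"
        using field_vector_diff_chain_at[OF ld holomorphic_derivI[OF t(2,1) lS]] by blast
    next
      have "continuous_on ?S (deriv (transition c d))" using holomorphic_deriv[OF t(2,1)] by (rule holomorphic_on_imp_continuous_on)
      then have "continuous_on {a..b} (\<lambda>t. deriv (transition c d) (l t))"
        by (rule continuous_on_compose2[OF _ lc]) (use lS in auto)
      then show "continuous_on {a..b} (\<lambda>t. (z0 - z) * deriv (transition c d) (l t))" by (intro continuous_on_mult continuous_on_const)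
    qed
    then show "(snd d \<circ> \<gamma>) piecewise_C1_differentiable_on {a..b}" by (rule C1_differentiable_imp_piecewise)
  qed
  moreover have "\<gamma> 0 = chart_inv c z" "\<gamma> 1 = chart_inv c z0" by (auto simp: \<gamma>_def l_def)
  moreover have "curve_length \<A> \<rho> \<gamma> \<le> ennreal (K * norm (z - z0))"
  proof -
    let ?T = "l -` ball z0 \<delta>"
    have oT: "open ?T" by (rule open_vimage[OF open_ball lc])
    have "curve_speed \<A> \<rho> \<gamma> t \<le> K * norm (z - z0)" if t: "t \<in> {0..1}" for t
    proof -
      have "curve_speed \<A> \<rho> \<gamma> t = \<rho> c (l t) * norm (z0 - z)"
        by (rule curve_speed_chart[OF c oT _ _ ld]) (use lb[OF t] \<delta>(1) in \<open>auto simp: \<gamma>_def\<close>)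
      then show ?thesis using mult_right_mono[OF K[OF lb[OF t]], of "norm (z - z0)"] by (simp add: norm_minus_commute)
    qed
    then have "curve_length \<A> \<rho> \<gamma> \<le> (\<integral>\<^sup>+t\<in>{0..1::real}. ennreal (K * norm (z - z0)) \<partial>lborel)"
      unfolding curve_length_def by (intro nn_integral_mono) (auto simp: indicator_def intro!: ennreal_leI)
    also have "\<dots> = ennreal (K * norm (z - z0))" by (simp add: nn_integral_cmult_indicator)
    finally show ?thesis .
  qed
  ultimately show ?thesis by blast
qed

text \<open>A competing curve may leave the chart, so only its final stretch is measured, after the
  last time outside the open disc of radius |z - z0| about \<open>z0\<close>. This stretch starts on
  the bounding circle and ends at the centre, so its displacement is |z - z0|.\<close>

lemma curve_length_lower:
  assumes c: "c \<in> \<A>" and \<delta>: "ball z0 \<delta> \<subseteq> chart_img c" "z \<in> ball z0 \<delta>" "z \<noteq> z0"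
    and k: "\<And>w. w \<in> ball z0 \<delta> \<Longrightarrow> k \<le> \<rho> c w" "0 \<le> k"
    and \<gamma>: "piecewise_C1_curve X \<A> \<gamma>" "\<gamma> 0 = chart_inv c z" "\<gamma> 1 = chart_inv c z0"
  shows "ennreal (k * norm (z - z0)) \<le> curve_length \<A> \<rho> \<gamma>"
proof -
  define \<eta> where "\<eta> = dist z0 z"
  have \<eta>: "0 < \<eta>" "\<eta> < \<delta>" using \<delta> by (auto simp: \<eta>_def)
  have "cball z0 \<eta> \<subseteq> ball z0 \<delta>" using \<eta>(2) by auto
  then have img: "cball z0 \<eta> \<subseteq> chart_img c" "ball z0 \<eta> \<subseteq> chart_img c"
    using \<delta>(1) ball_subset_cball[of z0 \<eta>] by blast+
  let ?U = "chart_inv c ` ball z0 \<eta>" and ?C = "chart_inv c ` cball z0 \<eta>"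
  have U: "openin X ?U" by (rule openin_chart_inv_image[OF c open_ball img(2)])
  have C: "closedin X ?C" by (rule closedin_chart_inv_image(2)[OF c compact_cball img(1)])
  have path: "continuous_map (top_of_set {0..1}) X \<gamma>" using \<gamma>(1) by (simp add: piecewise_C1_curve_def pathin_def)
  have pre: "closed {t \<in> {0..1}. \<gamma> t \<in> K}" if "closedin X K" for K
    using closedin_continuous_map_preimage[OF path that] by (simp add: closedin_closed_trans)
  have \<gamma>X: "\<gamma> t \<in> topspace X" if "t \<in> {0..1}" for t using continuous_map_image_subset_topspace[OF path] that by auto
  define T where "T = {t \<in> {0..1}. \<gamma> t \<in> topspace X - ?U}"
  have "closed T" unfolding T_def by (rule pre) (use U in blast)
  moreover have "bounded T" by (rule bounded_subset[OF bounded_closed_interval[of 0 1]]) (auto simp: T_def)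
  ultimately have "compact T" by (simp add: compact_eq_bounded_closed)
  moreover have "T \<noteq> {}"
  proof -
    have "\<gamma> 0 \<notin> ?U"
    proof
      assume "\<gamma> 0 \<in> ?U"
      then obtain w where w: "w \<in> ball z0 \<eta>" "chart_inv c z = chart_inv c w" using \<gamma>(2) by auto
      then have "z = w" using chart_inv_inj[OF c] \<delta>(1,2) img(2) by blast
      then show False using w(1) by (simp add: \<eta>_def)
    qed
    then have "0 \<in> T" using \<gamma>X[of 0] by (simp add: T_def)
    then show ?thesis by blast
  qed
  ultimately obtain t1 where t1: "t1 \<in> T" "\<And>t. t \<in> T \<Longrightarrow> t \<le> t1" using compact_attains_sup[of T] by blast
  have t01: "0 \<le> t1" "t1 \<le> 1" "\<gamma> t1 \<notin> ?U" using t1(1) by (auto simp: T_def)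
  have "\<gamma> 1 \<in> ?U" using \<gamma>(3) \<eta>(1) by auto
  then have lt: "t1 < 1" using t01 by (cases "t1 = 1") auto
  have inU: "\<gamma> t \<in> ?U" if t: "t1 < t" "t \<le> 1" for t
  proof (rule ccontr)
    assume "\<gamma> t \<notin> ?U"
    then have "t \<in> T" using \<gamma>X[of t] t t01 by (simp add: T_def)
    then show False using t1(2) t(1) by force
  qed
  have UC: "?U \<subseteq> ?C" by auto
  have "{t1<..1} \<subseteq> {t \<in> {0..1}. \<gamma> t \<in> ?C}" using inU UC t01(1) by auto
  \<comment> \<open>The point at time \<open>t1\<close> lies outside the open disc and, as a limit
    of later points, in the closed disc, hence on the circle.\<close>
  then have "closure {t1<..1} \<subseteq> {t \<in> {0..1}. \<gamma> t \<in> ?C}" by (rule closure_minimal[OF _ pre[OF C]])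
  moreover have "t1 \<in> closure {t1<..1}" using lt by simp
  ultimately have "t1 \<in> {t \<in> {0..1}. \<gamma> t \<in> ?C}" by (rule subsetD)
  then obtain w where w: "w \<in> cball z0 \<eta>" "\<gamma> t1 = chart_inv c w" by blast
  have wb: "w \<notin> ball z0 \<eta>" using t01(3) w(2) by blast
  define f where "f = snd c \<circ> \<gamma>"
  have dom: "\<gamma> t \<in> chart_dom c" "\<gamma> t = chart_inv c (f t)" "f t \<in> ball z0 \<eta>" if t: "t1 < t" "t \<le> 1" for t
  proof -
    obtain u where u: "u \<in> ball z0 \<eta>" "\<gamma> t = chart_inv c u" using inU[OF t] by blast
    have ui: "u \<in> chart_img c" using u(1) img(2) by blast
    show "\<gamma> t \<in> chart_dom c" "\<gamma> t = chart_inv c (f t)" "f t \<in> ball z0 \<eta>"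
      using chart_inv(2,3)[OF c ui] u by (auto simp: f_def)
  qed
  have wi: "w \<in> chart_img c" using w(1) img(1) by blast
  have "\<gamma> t1 \<in> chart_dom c" using chart_inv(2)[OF c wi] w(2) by simp
  then have "\<gamma> ` {t1..1} \<subseteq> chart_dom c" using dom(1) by (metis atLeastAtMost_iff image_subsetI order_le_less)
  then have pw: "f piecewise_C1_differentiable_on {t1..1}"
    using \<gamma>(1) c t01 unfolding piecewise_C1_curve_def f_def by blast
  have "z0 \<in> chart_img c" using img(2) \<eta>(1) by (rule subsetD[OF _ centre_in_ball[THEN iffD2]])
  then have "f 1 = z0" using \<gamma>(3) chart_inv(3)[OF c, of z0] by (simp add: f_def)
  moreover have "f t1 = w" using chart_inv(3)[OF c wi] w(2) by (simp add: f_def)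
  moreover have "dist z0 w = \<eta>" using w(1) wb by auto
  ultimately have "norm (f 1 - f t1) = norm (z - z0)" by (simp add: \<eta>_def dist_norm norm_minus_commute)
  then have "ennreal (k * norm (z - z0)) = ennreal (k * norm (f 1 - f t1))" by simp
  also have "\<dots> \<le> (\<integral>\<^sup>+t\<in>{t1..1}. ennreal (curve_speed \<A> \<rho> \<gamma> t) \<partial>lborel)"
  proof (rule length_ge_displacement[OF pw t01(2) k(2)])
    fix t D assume t: "t1 < t" "t < 1" and D: "(f has_vector_derivative D) (at t)"
    have "curve_speed \<A> \<rho> \<gamma> t = \<rho> c (f t) * norm D"
      by (rule curve_speed_chart[OF c open_greaterThanLessThan[of t1 1] _ _ D]) (use t dom img(2) in auto)
    moreover have "f t \<in> ball z0 \<delta>" using dom(3)[of t] t \<eta>(2) by auto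
    ultimately show "ennreal (k * norm D) \<le> ennreal (curve_speed \<A> \<rho> \<gamma> t)"
      using k(1) by (intro ennreal_leI) (simp add: mult_right_mono)
  qed
  also have "\<dots> \<le> curve_length \<A> \<rho> \<gamma>"
    unfolding curve_length_def by (intro nn_integral_mono) (use t01(1) in \<open>auto simp: indicator_def\<close>)
  finally show ?thesis .
qed

lemma riemannian_dist_asymptotic:
  assumes c: "c \<in> \<A>" "z0 \<in> chart_img c"
  shows "((\<lambda>z. riemannian_dist X \<A> \<rho> (chart_inv c z) (chart_inv c z0) / norm (z - z0)) \<longlongrightarrow> \<rho> c z0) (at z0)"
proof (rule tendstoI)
  fix e0 :: real assume e0: "0 < e0"
  have pos: "0 < \<rho> c z0" by (rule density_pos[OF c])
  \<comment> \<open>The bound by \<open>\<rho> c z0\<close> keeps the lower density estimate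
    nonnegative, as \<open>curve_length_lower\<close> requires.\<close>
  define e where "e = min (e0 / 2) (\<rho> c z0)"
  have e: "0 < e" "e < e0" "e \<le> \<rho> c z0" using e0 pos by (auto simp: e_def)
  have "isCont (\<rho> c) z0" using density_continuous[OF c(1)] continuous_on_eq_continuous_at[OF chart(2)[OF c(1)]] c(2) by blast
  then obtain d1 where d1: "d1 > 0" "\<And>w. dist w z0 < d1 \<Longrightarrow> dist (\<rho> c w) (\<rho> c z0) < e"
    using e(1) unfolding continuous_at_eps_delta by blast
  obtain d2 where d2: "d2 > 0" "ball z0 d2 \<subseteq> chart_img c" using chart(2)[OF c(1)] c(2) openE by blast
  define \<delta> where "\<delta> = min d1 d2"
  have \<delta>: "0 < \<delta>" "ball z0 \<delta> \<subseteq> chart_img c" using d1(1) d2 by (auto simp: \<delta>_def)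
  have b: "\<rho> c w \<le> \<rho> c z0 + e" "\<rho> c z0 - e \<le> \<rho> c w" if "w \<in> ball z0 \<delta>" for w
    using d1(2)[of w] that by (auto simp: \<delta>_def dist_commute dist_real_def)
  have "\<bar>riemannian_dist X \<A> \<rho> (chart_inv c z) (chart_inv c z0) / norm (z - z0) - \<rho> c z0\<bar> \<le> e" if z: "z \<in> ball z0 \<delta>" "z \<noteq> z0" for z
  proof -
    let ?\<Gamma> = "{\<gamma>. piecewise_C1_curve X \<A> \<gamma> \<and> \<gamma> 0 = chart_inv c z \<and> \<gamma> 1 = chart_inv c z0}"
    define I where "I = (INF \<gamma>\<in>?\<Gamma>. curve_length \<A> \<rho> \<gamma>)"
    have n: "0 < norm (z - z0)" using z(2) by simp
    obtain \<gamma> where "\<gamma> \<in> ?\<Gamma>" "curve_length \<A> \<rho> \<gamma> \<le> ennreal ((\<rho> c z0 + e) * norm (z - z0))"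
      using curve_length_segment[OF c(1) \<delta>(2) z(1) b(1)] by blast
    then have up: "I \<le> ennreal ((\<rho> c z0 + e) * norm (z - z0))" unfolding I_def by (intro INF_lower2[of \<gamma>])
    have lo: "ennreal ((\<rho> c z0 - e) * norm (z - z0)) \<le> I" unfolding I_def
      by (rule INF_greatest) (use curve_length_lower[OF c(1) \<delta>(2) z b(2)] e(3) in auto)
    have top: "I < top_class.top" using up by (rule order_le_less_trans) simp
    have "enn2real I \<le> (\<rho> c z0 + e) * norm (z - z0)"
      using enn2real_mono[OF up] e(1) pos by simp
    moreover have "(\<rho> c z0 - e) * norm (z - z0) \<le> enn2real I"
      using enn2real_mono[OF lo top] e(3) by simp
    ultimately have "\<bar>enn2real I / norm (z - z0) - \<rho> c z0\<bar> \<le> e"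
      using n by (simp add: abs_le_iff field_simps)
    then show ?thesis by (simp add: riemannian_dist_def I_def)
  qed
  note bound = this
  have "\<forall>\<^sub>F z in at z0. z \<in> ball z0 \<delta>" using \<delta>(1) by (intro eventually_at_in_open') auto
  then show "\<forall>\<^sub>F z in at z0. dist (riemannian_dist X \<A> \<rho> (chart_inv c z) (chart_inv c z0) / norm (z - z0)) (\<rho> c z0) < e0"
    using eventually_neq_at_within[of z0 z0 UNIV]
  proof eventually_elim
    case (elim z)
    then show ?case using bound[of z] e(2) by (simp add: dist_real_def)
  qed
qed

end

context hyperelliptic_green
begin

text \<open>By \<open>riemannian_dist_asymptotic\<close> the logarithm of the distance is ln |z -
  z0| plus the logarithm of the density plus a term tending to 0. The defining limit therefore
  becomes the regular part plus a density term.\<close>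

lemma robin_function_chart:
  assumes c: "c \<in> \<A>" and z0: "z0 \<in> chart_img c"
  shows "robin_function X \<A> \<rho> G (chart_inv c z0) = green_ext c z0 z0 + ln (\<rho> c z0) / (2 * pi)"
proof -
  define p where "p = chart_inv c z0"
  let ?F = "\<lambda>s. G s p + 1 / (2 * pi) * ln (riemannian_dist X \<A> \<rho> s p)"
  let ?L = "green_ext c z0 z0 + ln (\<rho> c z0) / (2 * pi)"
  let ?q = "\<lambda>z. riemannian_dist X \<A> \<rho> (chart_inv c z) p / norm (z - z0)"
  have q: "(?q \<longlongrightarrow> \<rho> c z0) (at z0)" unfolding p_def by (rule riemannian_dist_asymptotic[OF c z0])
  have pos: "0 < \<rho> c z0" by (rule density_pos[OF c z0])
  have "((\<lambda>z. green_log c z0 z + ln (?q z) / (2 * pi)) \<longlongrightarrow> ?L) (at z0)"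
    by (rule tendsto_add[OF green_log_limit[OF c z0] tendsto_divide[OF tendsto_ln[OF q] tendsto_const]]) (use pos in auto)
  moreover have "\<forall>\<^sub>F z in at z0. green_log c z0 z + ln (?q z) / (2 * pi) = ?F (chart_inv c z)"
    using order_tendstoD(1)[OF q pos] eventually_neq_at_within[of z0 z0 UNIV]
  proof eventually_elim
    case (elim z)
    then have "0 < riemannian_dist X \<A> \<rho> (chart_inv c z) p" by (simp add: zero_less_divide_iff)
    then show ?case using elim by (simp add: green_log_def p_def ln_div diff_divide_distrib)
  qed
  ultimately have lim: "((\<lambda>z. ?F (chart_inv c z)) \<longlongrightarrow> ?L) (at z0)" by (rule Lim_transform_eventually)
  have p: "p \<in> topspace X" "p \<in> chart_dom c" "snd c p = z0"
    using chart_inv_topspace[OF c z0] chart_inv(2,3)[OF c z0] by (auto simp: p_def)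
  have atin: "\<exists>d>0. \<forall>z. dist z z0 < d \<longrightarrow> z \<noteq> z0 \<longrightarrow> P (chart_inv c z) \<Longrightarrow> \<forall>\<^sub>F s in atin X p. P s" for P
  proof -
    assume "\<exists>d>0. \<forall>z. dist z z0 < d \<longrightarrow> z \<noteq> z0 \<longrightarrow> P (chart_inv c z)"
    then obtain d1 where d1: "d1 > 0" "\<And>z. dist z z0 < d1 \<Longrightarrow> z \<noteq> z0 \<Longrightarrow> P (chart_inv c z)" by blast
    obtain d2 where d2: "d2 > 0" "ball z0 d2 \<subseteq> chart_img c" using chart(2)[OF c] z0 openE by blast
    let ?U = "chart_inv c ` ball z0 (min d1 d2)"
    have sub: "ball z0 (min d1 d2) \<subseteq> chart_img c" using d2(2) by auto
    have "openin X ?U" by (rule openin_chart_inv_image[OF c open_ball sub])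
    moreover have "p \<in> ?U" using d1(1) d2(1) by (auto simp: p_def)
    moreover have "\<forall>x\<in>?U - {p}. P x"
    proof
      fix x assume x: "x \<in> ?U - {p}"
      then obtain z where z: "z \<in> ball z0 (min d1 d2)" "x = chart_inv c z" by blast
      have "z \<noteq> z0" using x z(2) by (auto simp: p_def)
      then show "P x" using d1(2)[of z] z by (simp add: dist_commute)
    qed
    ultimately show "\<forall>\<^sub>F s in atin X p. P s" unfolding eventually_atin by blast
  qed
  have "(?F \<longlongrightarrow> ?L) (atin X p)"
  proof (rule tendstoI)
    fix e :: real assume "0 < e"
    then have "\<forall>\<^sub>F z in at z0. dist (?F (chart_inv c z)) ?L < e" using lim by (rule tendstoD[rotated])
    then show "\<forall>\<^sub>F s in atin X p. dist (?F s) ?L < e"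
      by (intro atin) (auto simp: eventually_at)
  qed
  \<comment> \<open>A limit is determined only along a proper filter. The point is not isolated,
    since a chart would map it to an open singleton of the plane.\<close>
  moreover have "atin X p \<noteq> bot"
  proof
    assume "atin X p = bot"
    then have "eventually (\<lambda>_. False) (atin X p)" by simp
    then obtain U where U: "openin X U" "p \<in> U" "U - {p} = {}" using p(1) unfolding eventually_atin by blast
    then have "chart_dom c \<inter> U = {p}" using p(2) by blast
    then have "open {z0}" using open_chart_image[OF c U(1)] p(3) by simp
    then show False using not_open_singleton by blast
  qed
  ultimately have "Lim (atin X p) ?F = ?L" by (intro tendsto_Lim) auto
  then show ?thesis by (simp add: robin_function_def p_def)
qed

end

section \<open>Equilibria at the Weierstrass points\<close>

lemma area_harmonic_on_bounded_near:
  assumes h: "area_harmonic_on h \<Omega>" and z: "open \<Omega>" "z0 \<in> \<Omega>"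
  obtains r M where "0 < r" "ball z0 (8 * r) \<subseteq> \<Omega>" "\<And>y. y \<in> ball z0 (8 * r) \<Longrightarrow> \<bar>h y\<bar> \<le> M"
proof -
  obtain e where e: "0 < e" "cball z0 e \<subseteq> \<Omega>" using z open_contains_cball by blast
  have "continuous_on (cball z0 e) h" using h e(2) by (auto simp: area_harmonic_on_def intro: continuous_on_subset)
  then have "bounded (h ` cball z0 e)" by (intro compact_imp_bounded compact_continuous_image compact_cball)
  then obtain M where M: "\<forall>y\<in>cball z0 e. \<bar>h y\<bar> \<le> M" by (auto simp: bounded_iff)
  have sub: "ball z0 (8 * (e / 8)) \<subseteq> cball z0 e" by auto
  show ?thesis
  proof (rule that[of "e / 8" M])
    show "ball z0 (8 * (e / 8)) \<subseteq> \<Omega>" using sub e(2) by (rule order_trans)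
    show "\<bar>h y\<bar> \<le> M" if "y \<in> ball z0 (8 * (e / 8))" for y using bspec[OF M subsetD[OF sub that]] .
  qed (use e(1) in simp)
qed

lemma has_derivative_zeroI:
  fixes E :: "'a::real_normed_vector \<Rightarrow> real"
  assumes "\<forall>\<^sub>F z in at z0. \<bar>E z - E z0\<bar> \<le> q z * norm (z - z0)" and q: "(q \<longlongrightarrow> 0) (at z0)"
  shows "(E has_derivative (\<lambda>_. 0)) (at z0)"
  unfolding has_derivative_iff_norm
proof (intro conjI bounded_linear_zero)
  show "((\<lambda>y. norm (E y - E z0 - 0) / norm (y - z0)) \<longlongrightarrow> 0) (at z0)"
  proof (rule Lim_null_comparison[OF _ q])
    show "\<forall>\<^sub>F y in at z0. norm (norm (E y - E z0 - 0) / norm (y - z0)) \<le> q y"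
      using assms(1) eventually_neq_at_within[of z0 z0 UNIV]
      by eventually_elim (simp add: divide_le_eq)
  qed
qed

text \<open>
  A function invariant under a map with differential \<open>-1\<close> is even to first order. For a harmonic
  function this already gives a vanishing differential: the second difference is of second order.
\<close>

lemma has_derivative_zero_of_invariant:
  assumes h: "area_harmonic_on h \<Omega>" "open \<Omega>" "z0 \<in> \<Omega>" and \<psi>: "(\<psi> has_derivative \<psi>') (at z0)"
    and E: "\<forall>\<^sub>F z in nhds z0. \<bar>E z - h z - \<psi> z\<bar> \<le> C * (norm (z - z0))\<^sup>2"
    and f: "(f has_field_derivative -1) (at z0)" "f z0 = z0" and inv: "\<forall>\<^sub>F z in nhds z0. E (f z) = E z"
  shows "(E has_derivative (\<lambda>_. 0)) (at (z0::complex))"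
proof -
  obtain r M where r: "0 < r" "ball z0 (8 * r) \<subseteq> \<Omega>" and M: "\<And>y. y \<in> ball z0 (8 * r) \<Longrightarrow> \<bar>h y\<bar> \<le> M"
    by (rule area_harmonic_on_bounded_near[OF h]) blast
  define n where "n = (\<lambda>z. norm (z - z0))"
  \<comment> \<open>\<open>\<Psi>\<close> symmetrises the smooth part along \<open>f\<close>, so its
    differential at \<open>z0\<close> is 0. The function \<open>g\<close> below measures the
    deviation of \<open>f\<close> from the point reflection in \<open>z0\<close>; it tends to 0
    because the differential of \<open>f\<close> is -1.\<close>
  define \<Psi> where "\<Psi> = (\<lambda>z. \<psi> z + \<psi> (f z))"
  define g where "g = (\<lambda>z. norm (f z - (2 * z0 - z)) / n z)"
  have \<psi>'lin: "linear \<psi>'" using \<psi> by (rule has_derivative_linear)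
  have "(*) (- 1) = (\<lambda>h::complex. - h)" by (rule ext) simp
  then have fd: "(f has_derivative (\<lambda>h. - h)) (at z0)" using f(1) by (simp only: has_field_derivative_def)
  have "(\<Psi> has_derivative (\<lambda>h. \<psi>' h + \<psi>' (- h))) (at z0)"
    unfolding \<Psi>_def using has_derivative_compose[OF fd, of \<psi> \<psi>'] \<psi> f(2) by (intro has_derivative_add \<psi>) simp
  then have \<Psi>d: "(\<Psi> has_derivative (\<lambda>h. 0)) (at z0)" using linear_neg[OF \<psi>'lin] by simp
  have g0: "(g \<longlongrightarrow> 0) (at z0)"
  proof -
    have "((\<lambda>y. norm (f y - f z0 - (- (y - z0))) / norm (y - z0)) \<longlongrightarrow> 0) (at z0)"
      using fd unfolding has_derivative_iff_norm by blast
    moreover have "f y - f z0 - (- (y - z0)) = f y - (2 * z0 - y)" for y using f(2) by (simp add: algebra_simps)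
    ultimately show ?thesis unfolding g_def n_def by (simp only:)
  qed
  have n0: "(n \<longlongrightarrow> 0) (at z0)" unfolding n_def by (rule tendsto_eq_intros refl | simp)+
  have \<Psi>0: "((\<lambda>z. \<bar>\<Psi> z - \<Psi> z0\<bar> / n z) \<longlongrightarrow> 0) (at z0)"
    using \<Psi>d unfolding has_derivative_iff_norm n_def by simp
  have E0: "E z0 = h z0 + \<psi> z0" using eventually_nhds_x_imp_x[OF E] by simp
  have fl: "(f \<longlongrightarrow> z0) (nhds z0)" using DERIV_isCont[OF f(1)] f(2) by (simp add: isCont_def tendsto_nhds_iff)
  define q where "q = (\<lambda>z. (5 * C + 16 * M / r\<^sup>2) * n z + 4 * M / r * g z + \<bar>\<Psi> z - \<Psi> z0\<bar> / n z)"
  show ?thesis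
  proof (rule has_derivative_zeroI)
    have "(q \<longlongrightarrow> (5 * C + 16 * M / r\<^sup>2) * 0 + 4 * M / r * 0 + 0) (at z0)"
      unfolding q_def by (intro tendsto_add tendsto_mult tendsto_const n0 g0 \<Psi>0)
    then show "(q \<longlongrightarrow> 0) (at z0)" by simp
    have "\<forall>\<^sub>F z in nhds z0. z \<in> ball z0 r" using r(1) by (intro eventually_nhds_in_open) auto
    then have 1: "\<forall>\<^sub>F z in at z0. z \<in> ball z0 r" by (rule eventually_nhds_conv_at[THEN iffD1, THEN conjunct1])
    have 2: "\<forall>\<^sub>F z in at z0. f z \<in> ball z0 r"
      using topological_tendstoD[OF fl open_ball, of z0 r] r(1) by (simp add: eventually_nhds_conv_at)
    have 3: "\<forall>\<^sub>F z in at z0. \<bar>E z - h z - \<psi> z\<bar> \<le> C * (norm (z - z0))\<^sup>2" using E by (simp add: eventually_nhds_conv_at)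
    have 4: "\<forall>\<^sub>F z in at z0. \<bar>E (f z) - h (f z) - \<psi> (f z)\<bar> \<le> C * (norm (f z - z0))\<^sup>2"
      using filterlim_compose[OF _ fl, unfolded filterlim_def] eventually_compose_filterlim[OF E fl] by (simp add: eventually_nhds_conv_at)
    have 5: "\<forall>\<^sub>F z in at z0. E (f z) = E z" using inv by (simp add: eventually_nhds_conv_at)
    have 6: "\<forall>\<^sub>F z in at z0. g z < 1" by (rule order_tendstoD(2)[OF g0]) simp
    show "\<forall>\<^sub>F z in at z0. \<bar>E z - E z0\<bar> \<le> q z * norm (z - z0)"
      using 1 2 3 4 5 6 eventually_neq_at_within[of z0 z0 UNIV]
    proof eventually_elim
      case (elim z)
      have n: "0 < n z" using elim(7) by (simp add: n_def)
      define w where "w = 2 * z0 - z"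
      have C0: "0 \<le> C"
      proof -
        have "0 \<le> C * (norm (z - z0))\<^sup>2" using elim(3) by linarith
        then show ?thesis using elim(7) by (simp add: zero_le_mult_iff)
      qed
      have gz: "norm (f z - w) = g z * n z" using n by (simp add: g_def w_def)
      have nf: "norm (f z - z0) \<le> 2 * n z"
      proof -
        have "f z - z0 = (f z - w) + (z0 - z)" by (simp add: w_def)
        then have "norm (f z - z0) \<le> norm (f z - w) + norm (z0 - z)" using norm_triangle_ineq by metis
        also have "norm (f z - w) \<le> 1 * n z" unfolding gz using elim(6) n by (intro mult_right_mono) auto
        finally show ?thesis by (simp add: n_def norm_minus_commute)
      qed
      have R2: "\<bar>E z - h (f z) - \<psi> (f z)\<bar> \<le> 4 * C * (n z)\<^sup>2"
      proof -
        have "(norm (f z - z0))\<^sup>2 \<le> (2 * n z)\<^sup>2" using nf by (intro power_mono) auto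
        then have "C * (norm (f z - z0))\<^sup>2 \<le> C * (4 * (n z)\<^sup>2)" using C0 by (intro mult_left_mono) (auto simp: power_mult_distrib)
        then show ?thesis using elim(4,5) by simp
      qed
      have sd: "\<bar>h (z0 + (z - z0)) + h (z0 - (z - z0)) - 2 * h z0\<bar> \<le> 16 * M / r\<^sup>2 * (norm (z - z0))\<^sup>2"
        by (rule area_harmonic_second_difference[OF area_harmonic_subset[OF h(1) r(2)] r(1) M])
          (use elim(1) in \<open>auto simp: dist_norm norm_minus_commute\<close>)
      have "z0 - (z - z0) = w" by (simp add: w_def)
      then have sd: "\<bar>h z + h w - 2 * h z0\<bar> \<le> 16 * M / r\<^sup>2 * (n z)\<^sup>2" using sd by (simp add: n_def)
      have cb: "cball z0 (3 * r) \<subseteq> ball z0 (8 * r)" using r(1) by auto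
      have "\<bar>h (f z) - h w\<bar> \<le> 4 * M / r * dist (f z) w"
      proof (rule area_harmonic_lipschitz[OF h(1) r(1) order_trans[OF cb r(2)]])
        show "\<bar>h y\<bar> \<le> M" if "y \<in> cball z0 (3 * r)" for y using M[OF subsetD[OF cb that]] .
        show "dist z0 (f z) < r" using elim(2) by simp
        have zw: "z0 - w = z - z0" by (simp add: w_def)
        show "dist z0 w < r" unfolding dist_norm zw using elim(1) by (simp add: dist_norm norm_minus_commute)
      qed
      then have lip: "\<bar>h (f z) - h w\<bar> \<le> 4 * M / r * (g z * n z)" using gz by (simp add: dist_norm)
      have R1: "\<bar>E z - h z - \<psi> z\<bar> \<le> C * (n z)\<^sup>2" using elim(3) by (simp add: n_def)
      \<comment> \<open>Invariance lets the increment be written once at \<open>z\<close> and once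
        at \<open>f z\<close>. The summands are the two approximation errors, the second difference
        of \<open>h\<close>, the effect of replacing \<open>f z\<close> by the reflected point
        \<open>w\<close>, and the increment of \<open>\<Psi>\<close>. The coefficient 5 in
        \<open>q\<close> is 1 + 4, where 4 comes from |f z - z0| \<le> 2 |z - z0|.\<close>
      have "2 * (E z - E z0) = (E z - h z - \<psi> z) + (E z - h (f z) - \<psi> (f z)) + (h z + h w - 2 * h z0) + (h (f z) - h w) + (\<Psi> z - \<Psi> z0)"
        using E0 f(2) by (simp add: \<Psi>_def)
      then have "2 * \<bar>E z - E z0\<bar> \<le> C * (n z)\<^sup>2 + 4 * C * (n z)\<^sup>2 + 16 * M / r\<^sup>2 * (n z)\<^sup>2 + 4 * M / r * (g z * n z) + \<bar>\<Psi> z - \<Psi> z0\<bar>"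
        using R1 R2 sd lip by linarith
      also have "\<dots> = q z * n z" using n by (simp add: q_def power2_eq_square algebra_simps)
      finally have "2 * \<bar>E z - E z0\<bar> \<le> q z * norm (z - z0)" by (simp add: n_def)
      then show ?case by (rule order_trans[rotated]) simp
    qed
  qed
qed

lemma C_k_on_has_derivative:
  assumes "C_k_on (Suc k) u S" "open S" "z \<in> S"
  obtains u' where "(u has_derivative u') (at z)"
proof -
  have "u differentiable (at z within S)" using assms(1,3) unfolding C_k_on.simps differentiable_on_def by blast
  then have "u differentiable (at z)" unfolding at_within_open[OF assms(3,2)] .
  then show ?thesis unfolding differentiable_def by (elim exE) (rule that)
qed

context hyperelliptic_green
begin

text \<open>On the diagonal, \<open>green_ext_mixed_bound\<close> and symmetry give
  \<open>green_ext c z z\<close> as twice \<open>green_ext c z0 z\<close> minus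
  \<open>green_ext c z0 z0\<close>, up to a quadratic error. The Robin function is thus harmonic
  plus smooth plus quadratic, the form to which \<open>has_derivative_zero_of_invariant\<close>
  applies.\<close>

lemma robin_has_derivative:
  assumes p: "p \<in> topspace X" "\<tau> p = p" and c: "c \<in> \<A>" "p \<in> chart_dom c"
  shows "((\<lambda>z. robin_function X \<A> \<rho> G (chart_inv c z)) has_derivative (\<lambda>_. 0)) (at (snd c p))"
proof -
  let ?z0 = "snd c p"
  let ?E = "\<lambda>z. robin_function X \<A> \<rho> G (chart_inv c z)"
  have z0: "?z0 \<in> chart_img c" using c by blast
  have oc: "open (chart_img c)" by (rule chart(2)[OF c(1)])
  obtain e where e: "e > 0" "ball ?z0 e \<subseteq> chart_img c" using oc z0 openE by blast
  from \<tau>_derivative_fixed[OF p(1) c p(2)] obtain r f where rf: "r > 0" "ball ?z0 r \<subseteq> chart_img c" "f holomorphic_on ball ?z0 r"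
    "f ` ball ?z0 r \<subseteq> chart_img c" "\<forall>z\<in>ball ?z0 r. \<tau> (chart_inv c z) = chart_inv c (f z)" "f ?z0 = ?z0" "deriv f ?z0 = -1"
    by (elim exE conjE) (rule that)
  have near: "\<forall>\<^sub>F z in nhds ?z0. z \<in> ball ?z0 d" if "d > 0" for d
    using that by (intro eventually_nhds_in_open) auto
  have fd: "(f has_field_derivative -1) (at ?z0)"
    using holomorphic_derivI[OF rf(3) open_ball, of ?z0 UNIV] rf(1,7) by simp
  have rc: "?E z = green_ext c z z + ln (\<rho> c z) / (2 * pi)" if "z \<in> chart_img c" for z
    by (rule robin_function_chart[OF c(1) that])
  have inv: "?E (f z) = ?E z" if z: "z \<in> ball ?z0 r" for z
  proof -
    have zi: "z \<in> chart_img c" "f z \<in> chart_img c" using rf(2,4) z by blast+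
    note ci = chart_inv(2,3)[OF c(1) zi(1)] 
    have tz: "\<tau> (chart_inv c z) = chart_inv c (f z)" by (rule bspec[OF rf(5) z])
    have "\<tau> (chart_inv c z) \<in> chart_dom c" unfolding tz by (rule chart_inv(2)[OF c(1) zi(2)])
    from green_ext_\<tau>[OF chart_inv_topspace[OF c(1) zi(1)] c(1) ci(1) c(1) this]
    have "green_ext c (f z) (f z) + ln (\<rho> c (f z)) / (2 * pi) = green_ext c z z + ln (\<rho> c z) / (2 * pi)"
      using chart_inv(3)[OF c(1) zi(2)] by (simp add: \<tau>_chart_def ci(2) tz)
    then show ?thesis using rc zi by simp
  qed
  \<comment> \<open>Subtracting \<open>inv_area * ln \<rho>\<close> from each of the two copies
    makes \<open>h\<close> harmonic. \<open>\<psi>\<close> restores both and adds the density term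
    of the Robin function. The summand with factor 0 fits the shape of
    \<open>area_harmonic_lincomb\<close>.\<close>
  define h where "h = (\<lambda>w. 2 * (green_ext c ?z0 w - inv_area * ln (\<rho> c w)) + 0 * (green_ext c ?z0 w - inv_area * ln (\<rho> c w)) + - green_ext c ?z0 ?z0)"
  define \<psi> where "\<psi> = (\<lambda>w. (2 * inv_area + 1 / (2 * pi)) * ln (\<rho> c w))"
  have ah: "area_harmonic_on (\<lambda>w. green_ext c ?z0 w - inv_area * ln (\<rho> c w)) (ball ?z0 (e / 4))"
    by (rule green_ext_area_harmonic(1)[OF c(1) z0]) (use e in auto)
  obtain l where l: "((\<lambda>w. ln (\<rho> c w)) has_derivative l) (at ?z0)"
    by (rule C_k_on_has_derivative[OF ln_density(1)[OF c(1), of "Suc 0"] oc z0])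
  obtain d C where d: "d > 0" and C: "\<forall>z w. dist ?z0 z < d \<longrightarrow> dist ?z0 w < d \<longrightarrow>
    \<bar>green_ext c w z - green_ext c w ?z0 - green_ext c ?z0 z + green_ext c ?z0 ?z0\<bar> \<le> C * (dist ?z0 z * dist ?z0 w)"
    using green_ext_mixed_bound[OF c(1) z0] by blast
  show ?thesis
  proof (rule has_derivative_zero_of_invariant)
    show "area_harmonic_on h (ball ?z0 (e / 4))" unfolding h_def by (rule area_harmonic_lincomb[OF ah ah])
    show "?z0 \<in> ball ?z0 (e / 4)" using e by simp
    show "(\<psi> has_derivative (\<lambda>x. (2 * inv_area + 1 / (2 * pi)) * l x)) (at ?z0)"
      unfolding \<psi>_def by (rule has_derivative_mult_right[OF l])
    show "\<forall>\<^sub>F z in nhds ?z0. \<bar>?E z - h z - \<psi> z\<bar> \<le> C * (norm (z - ?z0))\<^sup>2"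
      using near[OF d] near[OF e(1)]
    proof eventually_elim
      case (elim z)
      have zi: "z \<in> chart_img c" using elim(2) e(2) by blast
      have dz: "dist ?z0 z < d" using elim(1) by simp
      have "\<bar>green_ext c z z - green_ext c z ?z0 - green_ext c ?z0 z + green_ext c ?z0 ?z0\<bar> \<le> C * (dist ?z0 z * dist ?z0 z)"
        using C dz by blast
      moreover have "?E z - h z - \<psi> z = green_ext c z z - green_ext c z ?z0 - green_ext c ?z0 z + green_ext c ?z0 ?z0"
        using rc[OF zi] green_ext_sym[OF c(1) zi z0] by (simp add: h_def \<psi>_def algebra_simps)
      ultimately show ?case by (simp add: dist_norm norm_minus_commute power2_eq_square)
    qed
    show "(f has_field_derivative -1) (at ?z0)" "f ?z0 = ?z0" by (rule fd) (rule rf(6))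
    show "\<forall>\<^sub>F z in nhds ?z0. ?E (f z) = ?E z" using near[OF rf(1)] by eventually_elim (rule inv)
  qed simp
qed

text \<open>Because \<open>q\<close> is fixed as well, \<open>G(., q)\<close> is an invariant
  function of one variable. It is exactly \<open>green_reg\<close> plus a smooth density term, so
  the error constant is 0.\<close>

lemma green_has_derivative:
  assumes p: "p \<in> topspace X" "\<tau> p = p" and c: "c \<in> \<A>" "p \<in> chart_dom c"
    and q: "q \<in> topspace X" "\<tau> q = q" "p \<noteq> q"
  shows "((\<lambda>z. G (chart_inv c z) q) has_derivative (\<lambda>_. 0)) (at (snd c p))"
proof -
  let ?z0 = "snd c p"
  let ?V = "{z \<in> chart_img c. chart_inv c z \<noteq> q}"
  have V: "open ?V" by (rule green_chart_C2(2)[OF c(1) q(1)])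
  have z0: "?z0 \<in> ?V" using c chart_inv(1)[OF c] q(3) by simp
  from \<tau>_derivative_fixed[OF p(1) c p(2)] obtain r f where rf: "r > 0" "ball ?z0 r \<subseteq> chart_img c" "f holomorphic_on ball ?z0 r"
    "\<forall>z\<in>ball ?z0 r. \<tau> (chart_inv c z) = chart_inv c (f z)" "f ?z0 = ?z0" "deriv f ?z0 = -1"
    by (elim exE conjE) (rule that)
  have fd: "(f has_field_derivative -1) (at ?z0)"
    using holomorphic_derivI[OF rf(3) open_ball, of ?z0 UNIV] rf(1,6) by simp
  obtain l where l: "((\<lambda>w. ln (\<rho> c w)) has_derivative l) (at ?z0)"
    by (rule C_k_on_has_derivative[OF ln_density(1)[OF c(1), of "Suc 0"] chart(2)[OF c(1)]]) (use c in auto)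
  have near: "\<forall>\<^sub>F z in nhds ?z0. z \<in> ball ?z0 r" "\<forall>\<^sub>F z in nhds ?z0. z \<in> ?V"
    by (rule eventually_nhds_in_open; use rf(1) in simp) (rule eventually_nhds_in_open[OF V z0])
  show ?thesis
  proof (rule has_derivative_zero_of_invariant[OF _ V z0 has_derivative_mult_right[OF l, of inv_area] _ fd rf(5)])
    show "area_harmonic_on (green_reg c q) ?V" by (rule green_reg_area_harmonic[OF c(1) q(1) V]) auto
    show "\<forall>\<^sub>F z in nhds ?z0. \<bar>G (chart_inv c z) q - green_reg c q z - inv_area * ln (\<rho> c z)\<bar> \<le> 0 * (norm (z - ?z0))\<^sup>2"
      by (simp add: green_reg_def)
    show "\<forall>\<^sub>F z in nhds ?z0. G (chart_inv c (f z)) q = G (chart_inv c z) q"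
      using near
    proof eventually_elim
      case (elim z)
      then have "z \<in> chart_img c" "chart_inv c z \<noteq> q" by auto
      then have "G (\<tau> (chart_inv c z)) (\<tau> q) = G (chart_inv c z) q" by (intro green_\<tau> chart_inv_topspace[OF c(1)] q(1))
      then show ?case using bspec[OF rf(4) elim(1)] q(2) by simp
    qed
  qed
qed

text \<open>Near the pair, G(z, w) is G(z, q) + G(p, w) - G(p, q) plus a mixed difference, which
  \<open>green_mixed_bound\<close> shows to be of second order. Joint differentiability thus reduces
  to the two statements in one variable.\<close>

lemma green_pair_has_derivative:
  fixes Z :: "complex ^ 'm::finite"
  assumes p: "p \<in> topspace X" "\<tau> p = p" and c: "c \<in> \<A>" "p \<in> chart_dom c"
    and q: "q \<in> topspace X" "\<tau> q = q" and d: "d \<in> \<A>" "q \<in> chart_dom d" and ne: "p \<noteq> q"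
    and Z: "Z $ j = snd c p" "Z $ k = snd d q"
  shows "((\<lambda>z. G (chart_inv c (z $ j)) (chart_inv d (z $ k))) has_derivative (\<lambda>_. 0)) (at Z)"
proof -
  have ci: "chart_inv c (Z $ j) = p" "chart_inv d (Z $ k) = q" using chart_inv(1)[OF c] chart_inv(1)[OF d] Z by simp_all
  have img: "Z $ j \<in> chart_img c" "Z $ k \<in> chart_img d" using c d Z by auto
  have "chart_inv c (Z $ j) \<noteq> chart_inv d (Z $ k)" using ne ci by simp
  from green_mixed_bound[OF c(1) img(1) d(1) img(2) this]
  obtain r C where r: "r > 0" and C: "\<forall>z w. dist (Z $ j) z < r \<longrightarrow> dist (Z $ k) w < r \<longrightarrow>
    \<bar>G (chart_inv c z) (chart_inv d w) - G p (chart_inv d w) - G (chart_inv c z) q + G p q\<bar> \<le> C * (dist (Z $ j) z * dist (Z $ k) w)"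
    unfolding ci by (elim exE conjE) (rule that)
  let ?m = "\<lambda>z::complex^'m. G (chart_inv c (z $ j)) (chart_inv d (z $ k)) - G p (chart_inv d (z $ k)) - G (chart_inv c (z $ j)) q + G p q"
  have m: "(?m has_derivative (\<lambda>_. 0)) (at Z)"
  proof (rule has_derivative_zeroI)
    have "((\<lambda>z. \<bar>C\<bar> * norm (z - Z)) \<longlongrightarrow> \<bar>C\<bar> * norm (Z - Z)) (at Z)" by (intro tendsto_intros)
    then show "((\<lambda>z. \<bar>C\<bar> * norm (z - Z)) \<longlongrightarrow> 0) (at Z)" by simp
    have "\<forall>\<^sub>F z in at Z. z \<in> ball Z r" using r by (intro eventually_at_in_open') auto
    then show "\<forall>\<^sub>F z in at Z. \<bar>?m z - ?m Z\<bar> \<le> \<bar>C\<bar> * norm (z - Z) * norm (z - Z)"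
    proof eventually_elim
      case (elim z)
      have dn: "dist (Z $ i) (z $ i) \<le> norm (z - Z)" for i
        using Finite_Cartesian_Product.norm_nth_le[of "z - Z" i] by (simp add: dist_norm norm_minus_commute)
      have "norm (z - Z) < r" using elim by (simp add: dist_norm norm_minus_commute)
      then have "dist (Z $ j) (z $ j) < r" "dist (Z $ k) (z $ k) < r" using dn[of j] dn[of k] by linarith+
      then have "\<bar>?m z\<bar> \<le> C * (dist (Z $ j) (z $ j) * dist (Z $ k) (z $ k))" using C by blast
      also have "\<dots> \<le> \<bar>C\<bar> * (norm (z - Z) * norm (z - Z))"
        by (intro mult_mono dn) auto
      finally show ?case using ci by (simp add: mult.assoc)
    qed
  qed
  have 1: "((\<lambda>z. G (chart_inv c (z $ j)) q) has_derivative (\<lambda>_. 0)) (at Z)"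
  proof -
    have "((\<lambda>z. G (chart_inv c z) q) has_derivative (\<lambda>_. 0)) (at (Z $ j))"
      unfolding Z(1) by (rule green_has_derivative[OF p c q ne])
    from has_derivative_compose[OF bounded_linear_imp_has_derivative[OF bounded_linear_vec_nth] this]
    show ?thesis by simp
  qed
  have 2: "((\<lambda>z. G p (chart_inv d (z $ k))) has_derivative (\<lambda>_. 0)) (at Z)"
  proof -
    have "((\<lambda>w. G (chart_inv d w) p) has_derivative (\<lambda>_. 0)) (at (Z $ k))"
      unfolding Z(2) by (rule green_has_derivative[OF q d p ne[symmetric]])
    then have "((\<lambda>w. G p (chart_inv d w)) has_derivative (\<lambda>_. 0)) (at (Z $ k))"
      by (rule has_derivative_transform_within_open[OF _ chart(2)[OF d(1)] img(2)])
        (rule green_props(3)[OF p(1) chart_inv_topspace[OF d(1)]])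
    from has_derivative_compose[OF bounded_linear_imp_has_derivative[OF bounded_linear_vec_nth] this]
    show ?thesis by simp
  qed
  have "((\<lambda>z. ?m z + G p (chart_inv d (z $ k)) + G (chart_inv c (z $ j)) q - G p q) has_derivative (\<lambda>_. 0 + 0 + 0 - 0)) (at Z)"
    by (intro has_derivative_add has_derivative_diff m 1 2 has_derivative_const)
  then show ?thesis by simp
qed

lemma equilibrium_at_fixed_points:
  fixes s :: "'m::finite \<Rightarrow> 'a"
  assumes s: "inj s" "\<And>j. s j \<in> topspace X" "\<And>j. \<tau> (s j) = s j"
  shows "vortex_equilibrium X \<A> G (robin_function X \<A> \<rho> G) \<Gamma> s"
  unfolding vortex_equilibrium_def
proof (intro conjI allI impI s(1))
  show "range s \<subseteq> topspace X" using s(2) by auto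
  fix c assume "\<forall>j. c j \<in> \<A> \<and> s j \<in> chart_dom (c j)"
  then have c: "c j \<in> \<A>" "s j \<in> chart_dom (c j)" for j by auto
  let ?Z = "\<chi> j. snd (c j) (s j)"
  have R: "((\<lambda>z. robin_function X \<A> \<rho> G (chart_inv (c j) (z $ j))) has_derivative (\<lambda>_. 0)) (at ?Z)" for j
  proof -
    have "((\<lambda>z. robin_function X \<A> \<rho> G (chart_inv (c j) z)) has_derivative (\<lambda>_. 0)) (at (?Z $ j))"
      using robin_has_derivative[OF s(2,3) c] by simp
    from has_derivative_compose[OF bounded_linear_imp_has_derivative[OF bounded_linear_vec_nth] this]
    show ?thesis by simp
  qed
  have P: "((\<lambda>z. G (chart_inv (c j) (z $ j)) (chart_inv (c k) (z $ k))) has_derivative (\<lambda>_. 0)) (at ?Z)" if "j \<noteq> k" for j k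
    by (rule green_pair_has_derivative[OF s(2,3) c s(2,3) c]) (use that s(1) in \<open>auto dest: injD\<close>)
  have "((\<lambda>z. vortex_hamiltonian G (robin_function X \<A> \<rho> G) \<Gamma> (\<lambda>j. chart_inv (c j) (z $ j))) has_derivative
     (\<lambda>_. (\<Sum>j\<in>UNIV. (\<Gamma> j)\<^sup>2 / 2 * 0) + (\<Sum>j\<in>UNIV. \<Sum>k\<in>UNIV - {j}. \<Gamma> j * \<Gamma> k / 2 * 0))) (at ?Z)"
    unfolding vortex_hamiltonian_def
    by (intro has_derivative_add has_derivative_sum has_derivative_mult_right R P) auto
  then show "((\<lambda>z. vortex_hamiltonian G (robin_function X \<A> \<rho> G) \<Gamma> (\<lambda>j. chart_inv (c j) (z $ j))) has_derivative (\<lambda>_. 0)) (at ?Z)"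
    by simp
qed

end

theorem corollary5:
  fixes X :: "'a topology" and \<A> :: "'a chart set" and \<pi> :: "'a \<Rightarrow> complex option"
    and \<rho> :: "'a chart \<Rightarrow> complex \<Rightarrow> real" and \<mu> :: "'a measure"
    and G :: "'a \<Rightarrow> 'a \<Rightarrow> real" and g :: nat
    and \<Gamma> :: "'m::finite \<Rightarrow> real" and s :: "'m \<Rightarrow> 'a"
  assumes "hyperelliptic_surface X \<A> \<pi>"
    and "has_genus X g" and "g \<ge> 2"
    and "hyperbolic_metric \<A> \<rho>"
    and "area_measure X \<A> \<rho> \<mu>"
    and "green_function X \<A> \<rho> \<mu> G"
    and "CARD('m) \<le> 2 * g + 2"
    and "inj s" and "range s \<subseteq> weierstrass_points X \<pi>"
  shows "vortex_equilibrium X \<A> G (robin_function X \<A> \<rho> G) \<Gamma> s"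
proof -
  interpret hyperelliptic_green X \<A> \<rho> \<mu> G \<pi>
    by unfold_locales (use assms in \<open>auto simp: hyperelliptic_surface_def\<close>)
  show ?thesis
    by (rule equilibrium_at_fixed_points) (use assms in \<open>auto simp: weierstrass_points_def\<close>)
qed

end
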